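(* Let $n\geq2$, let $(M^{n+2},g)$ be a time slice of any constructed soliton (as specified in the context: either a space-periodic soliton with rod structure period $\mathbf{e}_1,\dots,\mathbf{e}_n$, or one of the listed quotient solitons), and pick an angular coordinate $\phi^i$, $1\leq i\leq n$. Then the Wick rotation $\phi^i\to\sqrt{-1}\,t$ applied to the Weyl-Papapetrou form of the metric, $$g=e^{2\alpha}(d\rho^2+dz^2)+\sum_{j=1}^ne^{u_j}(d\phi^j)^2\;\longmapsto\;\mathbf{g}=-e^{u_i}dt^2+e^{2\alpha}(d\rho^2+dz^2)+\sum_{j\neq i}e^{u_j}(d\phi^j)^2,$$ transforms this manifold into a regular black hole solution $(\mathbf{M}^{n+2},\mathbf{g})$ of the $(n-1)$-axisymmetric static vacuum Einstein equations, with Kasner asymptotics.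
   Context: Constructed solitons. Fix $n\geq2$, $L>0$ and a finite sequence of rod structures (the period), of length $N$, with entries in the standard basis $\mathbf{e}_1,\dots,\mathbf{e}_n$ of $\mathbb{Z}^n$. Allowed periods: $\mathbf{e}_1,\dots,\mathbf{e}_n$ for any $n\geq2$; $\mathbf{e}_1,\mathbf{e}_2,\mathbf{e}_1,\mathbf{e}_2$ for $n=2$; $\mathbf{e}_1,\mathbf{e}_2,\mathbf{e}_1,\mathbf{e}_3$ for $n=3$; $\mathbf{e}_1,\mathbf{e}_2,\mathbf{e}_1,\mathbf{e}_3,\mathbf{e}_4$ for $n=4$. Divide the $z$-axis of $\mathbb{R}^3$ (cylindrical coordinates $(\rho,z,\varphi)$) into consecutive intervals (axis rods) of equal length $L/N$, assigned rod structures by repeating the period, so that the configuration is $L$-periodic in $z$. For an interval $I=[a,b]$ set $U_I=\log(r_a-(z-a))-\log(r_b-(z-b))$ with $r_a=\sqrt{\rho^2+(z-a)^2}$. Let $N_i$ be the number of occurrences of $\mathbf{e}_i$ in the period, and let $S_{i,m}$ be the set of rods with structure $\mathbf{e}_i$ lying in the $2m+1$ consecutive periods indexed by $-m,\dots,m$. Put $$u_i=\lim_{m\to\infty}\Big(\sum_{I\in S_{i,m}}U_I+\tfrac{2N_i}{N}\log m\Big)+k_i,\qquad i=1,\dots,n,$$ with constants $k_i\in\mathbb{R}$; each $u_i$ is harmonic off the axis, $L$-periodic in $z$, and $u_i\sim2\log\rho$ near the $\mathbf{e}_i$ rods. With $f=e^{\sum_iu_i}$, the function $\alpha(\rho,z)$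 is obtained by integrating $$\alpha_\rho=\tfrac{\rho}{8}\Big[(\log f)_\rho^2-(\log f)_z^2+\sum_i(u_{i,\rho}^2-u_{i,z}^2)-\tfrac4\rho(\log f)_\rho\Big],\quad \alpha_z=\tfrac\rho4\Big[(\log f)_\rho(\log f)_z+\sum_iu_{i,\rho}u_{i,z}-\tfrac2\rho(\log f)_z\Big].$$ The constants are chosen so that there are no conical singularities: $\lim_{\rho\to0}(\log\rho+\alpha-\tfrac12u_i)=0$ on every $\mathbf{e}_i$ rod. The space-periodic soliton is $$\mathbf{g}_{\rm sol}=-\rho^2e^{-\sum_iu_i}dt^2+e^{2\alpha}(d\rho^2+dz^2)+\sum_{i=1}^ne^{u_i}(d\phi^i)^2,$$ where $\phi^i$ has period $2\pi$, extended smoothly over the rods (over the interior of an $\mathbf{e}_i$ rod the circle generated by $\partial_{\phi^i}$ collapses; at a corner where two rods meet both circles collapse). Its time slice is the complete Riemannian manifold with metric $g=e^{2\alpha}(d\rho^2+dz^2)+\sum_ie^{u_i}(d\phi^i)^2$. The quotient solitons are those obtained, for each allowed period, by dividing by the isometry $z\mapsto z+L$. The time slices $(M^{n+2},g)$ considered are those of the space-periodic solitons with period $\mathbf{e}_1,\dots,\mathbf{e}_n$, and those of the quotient solitons for all allowed periods. Static $(n-1)$-axisymmetric vacuum solution: a Ricci flat Lorentzian metric, static with static Killing field $\partial_t$, invariant under an effective $U(1)^{n-1}$-action generated by the remaining $\partial_{\phi^j}$, $j\neq i$. Horizon rod: an interval of the axis $\{\rho=0\}$ on which no rotational Killing field degenerates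 but $|\partial_t|$ vanishes. Black hole solution: one possessing horizon rods. Here the rods with structure $\mathbf{e}_i$ of the soliton play the role of horizon rods, and the rods with structure $\mathbf{e}_j$, $j\ne i$, remain axis rods. Regular: the metric extends smoothly across the axis rods, with no conical singularities there, i.e. $\lim_{\rho\to0}(\log\rho+\alpha-\tfrac12u_j)=0$ on each $\mathbf{e}_j$ axis rod, $j\neq i$. Kasner asymptotics: as $\rho\to\infty$, for a suitable radial coordinate $\tau=\tau(\rho)\to\infty$, each metric coefficient has, up to a positive multiplicative constant, the leading-order behavior of the Kasner-type metric $-\tau^{2p_i}dt^2+d\tau^2+\tau^{2p_0}dz^2+\sum_{j\neq i}\tau^{2p_j}(d\phi^j)^2$, where $\sum_{j=0}^np_j=\sum_{j=0}^np_j^2=1$. *)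

theory Defs
  imports "HOL-Analysis.Analysis"
begin

section \<open>Pseudo-Riemannian geometry in coordinates\<close>

text \<open>A metric on an open set of \<open>real ^ 'm\<close> is the field of its component matrices.\<close>

type_synonym 'm metric_field = "real ^ 'm \<Rightarrow> real ^ 'm ^ 'm"

definition partial :: "'m \<Rightarrow> (real ^ 'm \<Rightarrow> 'b::real_normed_vector) \<Rightarrow> real ^ 'm \<Rightarrow> 'b"
  where "partial k F x = frechet_derivative F (at x) (axis k 1)"

text \<open>\<open>C\<^sup>\<infinity>\<close>: every iterated partial derivative is (Frechet) differentiable.\<close>

definition smooth_on :: "(real ^ 'm) set \<Rightarrow> (real ^ 'm \<Rightarrow> 'b::real_normed_vector) \<Rightarrow> bool"
  where "smooth_on S F \<longleftrightarrow> open S \<and> (\<forall>ks. foldr partial ks F differentiable_on S)"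

definition lorentzian :: "real ^ 'm ^ 'm \<Rightarrow> bool"
  where "lorentzian A \<longleftrightarrow> transpose A = A \<and>
    (\<exists>(P :: real ^ 'm ^ 'm) k0. invertible P \<and> transpose P ** A ** P =
       (\<chi> k l. if k \<noteq> l then 0 else if k = k0 then - 1 else 1))"

definition lorentzian_metric_on :: "(real ^ 'm) set \<Rightarrow> 'm metric_field \<Rightarrow> bool"
  where "lorentzian_metric_on S g \<longleftrightarrow> smooth_on S g \<and> (\<forall>x\<in>S. lorentzian (g x))"

definition christoffel :: "'m metric_field \<Rightarrow> 'm \<Rightarrow> 'm \<Rightarrow> 'm \<Rightarrow> real ^ 'm \<Rightarrow> real"
  where "christoffel g k i j x =
    (\<Sum>l\<in>UNIV. matrix_inv (g x) $ k $ l *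
       (partial i (\<lambda>y. g y $ l $ j) x + partial j (\<lambda>y. g y $ l $ i) x
        - partial l (\<lambda>y. g y $ i $ j) x)) / 2"

definition ricci :: "'m metric_field \<Rightarrow> 'm \<Rightarrow> 'm \<Rightarrow> real ^ 'm \<Rightarrow> real"
  where "ricci g i j x =
    (\<Sum>k\<in>UNIV. partial k (christoffel g k i j) x - partial j (christoffel g k i k) x)
    + (\<Sum>k\<in>UNIV. \<Sum>l\<in>UNIV.
         christoffel g k k l x * christoffel g l i j x
         - christoffel g k j l x * christoffel g l i k x)"

definition ricci_flat_on :: "(real ^ 'm) set \<Rightarrow> 'm metric_field \<Rightarrow> bool"
  where "ricci_flat_on S g \<longleftrightarrow> (\<forall>x\<in>S. \<forall>i j. ricci g i j x = 0)"

definition pullback :: "(real ^ 'm \<Rightarrow> real ^ 'm) \<Rightarrow> 'm metric_field \<Rightarrow> 'm metric_field"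
  where "pullback F g x =
    transpose (jacobian F (at x)) ** g (F x) ** jacobian F (at x)"

definition invariant_under_translation ::
    "(real ^ 'm) set \<Rightarrow> 'm metric_field \<Rightarrow> real ^ 'm \<Rightarrow> bool"
  where "invariant_under_translation S g d \<longleftrightarrow>
    (\<forall>x\<in>S. x + d \<in> S \<and> pullback (\<lambda>y. y + d) g x = g x)"

definition lie_derivative_metric ::
    "(real ^ 'm \<Rightarrow> real ^ 'm) \<Rightarrow> 'm metric_field \<Rightarrow> 'm \<Rightarrow> 'm \<Rightarrow> real ^ 'm \<Rightarrow> real"
  where "lie_derivative_metric X g i j x =
    (\<Sum>k\<in>UNIV. X x $ k * partial k (\<lambda>y. g y $ i $ j) x
        + g x $ k $ j * partial i (\<lambda>y. X y $ k) x
        + g x $ i $ k * partial j (\<lambda>y. X y $ k) x)"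

definition killing_field_on ::
    "(real ^ 'm) set \<Rightarrow> 'm metric_field \<Rightarrow> (real ^ 'm \<Rightarrow> real ^ 'm) \<Rightarrow> bool"
  where "killing_field_on S g X \<longleftrightarrow>
    smooth_on S X \<and> (\<forall>x\<in>S. \<forall>i j. lie_derivative_metric X g i j x = 0)"

text \<open>The Frobenius condition \<open>\<xi> \<and> d\<xi> = 0\<close> for the one-form \<open>\<xi>\<close> dual to \<open>X\<close>.\<close>

definition hypersurface_orthogonal_on ::
    "(real ^ 'm) set \<Rightarrow> 'm metric_field \<Rightarrow> (real ^ 'm \<Rightarrow> real ^ 'm) \<Rightarrow> bool"
  where "hypersurface_orthogonal_on S g X \<longleftrightarrow>
    (let \<xi> = (\<lambda>k x. (g x *v X x) $ k);
         d\<xi> = (\<lambda>k l x. partial k (\<xi> l) x - partial l (\<xi> k) x)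
     in \<forall>x\<in>S. \<forall>i j k. \<xi> i x * d\<xi> j k x + \<xi> j x * d\<xi> k i x + \<xi> k x * d\<xi> i j x = 0)"

definition static_killing_field_on ::
    "(real ^ 'm) set \<Rightarrow> 'm metric_field \<Rightarrow> (real ^ 'm \<Rightarrow> real ^ 'm) \<Rightarrow> bool"
  where "static_killing_field_on S g X \<longleftrightarrow>
    killing_field_on S g X \<and> hypersurface_orthogonal_on S g X \<and>
    (\<forall>x\<in>S. X x \<bullet> (g x *v X x) < 0)"


section \<open>Solitons with periodic rod structure\<close>

text \<open>Coordinates \<open>(\<rho>, z, \<phi>)\<close>. After the Wick rotation of \<open>\<phi>\<^sup>i\<close> the slot \<open>Phi i\<close> holds \<open>t\<close>.\<close>

datatype 'n coord = Rho | Zc | Phi 'n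

lemma UNIV_coord: "(UNIV :: 'n coord set) = insert Rho (insert Zc (range Phi))"
proof -
  have "c \<in> insert Rho (insert Zc (range Phi))" for c :: "'n coord"
    by (cases c) auto
  then show ?thesis by blast
qed

instance coord :: (finite) finite
  by standard (simp add: UNIV_coord)

text \<open>
  The index \<open>j\<close> stands for the rod structure \<open>\<^bold>e\<^sub>j\<close>, a standard basis vector; \<open>e\<close> enumerates
  the indices, so that \<open>e 1, \<dots>, e n\<close> are the structures written \<open>\<^bold>e\<^sub>1, \<dots>, \<^bold>e\<^sub>n\<close>.
\<close>

definition basic_period :: "nat \<Rightarrow> (nat \<Rightarrow> 'n) \<Rightarrow> 'n list"
  where "basic_period n e = map e [1..<Suc n]"

definition allowed_period :: "nat \<Rightarrow> (nat \<Rightarrow> 'n) \<Rightarrow> 'n list \<Rightarrow> bool"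
  where "allowed_period n e P \<longleftrightarrow>
    P = basic_period n e \<or>
    (n = 2 \<and> P = [e 1, e 2, e 1, e 2]) \<or>
    (n = 3 \<and> P = [e 1, e 2, e 1, e 3]) \<or>
    (n = 4 \<and> P = [e 1, e 2, e 1, e 3, e 4])"

text \<open>
  Rod number \<open>k\<close> is the interval from \<open>rod_end z0 L P k\<close> to \<open>rod_end z0 L P (k + 1)\<close>, where
  the position \<open>z0\<close> of the zeroth corner is arbitrary.
\<close>

definition rod_end :: "real \<Rightarrow> real \<Rightarrow> 'n list \<Rightarrow> int \<Rightarrow> real"
  where "rod_end z0 L P k = z0 + of_int k * (L / real (length P))"

definition rod_structure :: "'n list \<Rightarrow> int \<Rightarrow> 'n"
  where "rod_structure P k = P ! nat (k mod int (length P))"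

definition rod_potential :: "real \<Rightarrow> real \<Rightarrow> real \<Rightarrow> real \<Rightarrow> real"
  where "rod_potential a b \<rho> z =
    ln (sqrt (\<rho>\<^sup>2 + (z - a)\<^sup>2) - (z - a)) - ln (sqrt (\<rho>\<^sup>2 + (z - b)\<^sup>2) - (z - b))"

definition rods_upto :: "'n list \<Rightarrow> 'n \<Rightarrow> nat \<Rightarrow> int set"
  where "rods_upto P i m =
    {k. - int m * int (length P) \<le> k \<and> k < (int m + 1) * int (length P) \<and> rod_structure P k = i}"

definition soliton_u ::
    "real \<Rightarrow> real \<Rightarrow> 'n list \<Rightarrow> ('n \<Rightarrow> real) \<Rightarrow> 'n \<Rightarrow> real \<Rightarrow> real \<Rightarrow> real"
  where "soliton_u z0 L P \<kappa> i \<rho> z =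
    lim (\<lambda>m. (\<Sum>k\<in>rods_upto P i m. rod_potential (rod_end z0 L P k) (rod_end z0 L P (k + 1)) \<rho> z)
             + 2 * real (count_list P i) / real (length P) * ln (real m))
    + \<kappa> i"

definition d\<rho> :: "(real \<Rightarrow> real \<Rightarrow> real) \<Rightarrow> real \<Rightarrow> real \<Rightarrow> real"
  where "d\<rho> F \<rho> z = deriv (\<lambda>r. F r z) \<rho>"

definition dz :: "(real \<Rightarrow> real \<Rightarrow> real) \<Rightarrow> real \<Rightarrow> real \<Rightarrow> real"
  where "dz F \<rho> z = deriv (\<lambda>s. F \<rho> s) z"

definition alpha_equations ::
    "('n::finite \<Rightarrow> real \<Rightarrow> real \<Rightarrow> real) \<Rightarrow> (real \<Rightarrow> real \<Rightarrow> real) \<Rightarrow> bool"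
  where "alpha_equations u \<alpha> \<longleftrightarrow>
    (let logf = (\<lambda>\<rho> z. \<Sum>i\<in>UNIV. u i \<rho> z) in
     \<forall>\<rho> z. \<rho> > 0 \<longrightarrow>
       ((\<lambda>r. \<alpha> r z) has_real_derivative
          \<rho> / 8 * ((d\<rho> logf \<rho> z)\<^sup>2 - (dz logf \<rho> z)\<^sup>2
                   + (\<Sum>i\<in>UNIV. (d\<rho> (u i) \<rho> z)\<^sup>2 - (dz (u i) \<rho> z)\<^sup>2)
                   - 4 / \<rho> * d\<rho> logf \<rho> z)) (at \<rho>) \<and>
       ((\<lambda>s. \<alpha> \<rho> s) has_real_derivative
          \<rho> / 4 * (d\<rho> logf \<rho> z * dz logf \<rho> z
                   + (\<Sum>i\<in>UNIV. d\<rho> (u i) \<rho> z * dz (u i) \<rho> z)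
                   - 2 / \<rho> * dz logf \<rho> z)) (at z))"

text \<open>
  The constants \<open>\<kappa>\<close> and the integration constant of \<open>\<alpha>\<close> are those for which there are no conical
  singularities on any rod.
\<close>

definition soliton ::
    "real \<Rightarrow> real \<Rightarrow> 'n::finite list \<Rightarrow> ('n \<Rightarrow> real) \<Rightarrow> (real \<Rightarrow> real \<Rightarrow> real) \<Rightarrow> bool"
  where "soliton z0 L P \<kappa> \<alpha> \<longleftrightarrow>
    alpha_equations (soliton_u z0 L P \<kappa>) \<alpha> \<and>
    (\<forall>k z. rod_end z0 L P k < z \<and> z < rod_end z0 L P (k + 1) \<longrightarrow>
      ((\<lambda>\<rho>. ln \<rho> + \<alpha> \<rho> z - soliton_u z0 L P \<kappa> (rod_structure P k) \<rho> z / 2) \<longlongrightarrow> 0) (at_right 0))"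

definition slice_metric ::
    "('n::finite \<Rightarrow> real \<Rightarrow> real \<Rightarrow> real) \<Rightarrow> (real \<Rightarrow> real \<Rightarrow> real) \<Rightarrow> 'n coord metric_field"
  where "slice_metric u \<alpha> x = (\<chi> k l. if k \<noteq> l then 0 else
    (case k of
       Rho \<Rightarrow> exp (2 * \<alpha> (x $ Rho) (x $ Zc))
     | Zc \<Rightarrow> exp (2 * \<alpha> (x $ Rho) (x $ Zc))
     | Phi j \<Rightarrow> exp (u j (x $ Rho) (x $ Zc))))"

text \<open>
  \<open>\<phi>\<^sup>i \<rightarrow> \<surd>-1 t\<close> for a metric that is independent of \<open>\<phi>\<^sup>i\<close> and has no cross terms with \<open>d\<phi>\<^sup>i\<close>:
  \<open>(d\<phi>\<^sup>i)\<^sup>2\<close> becomes \<open>- dt\<^sup>2\<close>.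
\<close>

definition wick_rotation :: "'n::finite \<Rightarrow> 'n coord metric_field \<Rightarrow> 'n coord metric_field"
  where "wick_rotation i g x =
    (\<chi> k l. if k = Phi i \<and> l = Phi i then - (g x $ k $ l) else g x $ k $ l)"


section \<open>Regular static black holes with Kasner asymptotics\<close>

definition off_axis :: "(real ^ 'n::finite coord) set"
  where "off_axis = {x. x $ Rho > 0}"

abbreviation coord_field :: "'n::finite coord \<Rightarrow> real ^ 'n coord \<Rightarrow> real ^ 'n coord"
  where "coord_field c \<equiv> (\<lambda>_. axis c 1)"

definition rotational :: "'n \<Rightarrow> real ^ 'n::finite coord \<Rightarrow> bool"
  where "rotational i v \<longleftrightarrow> v $ Rho = 0 \<and> v $ Zc = 0 \<and> v $ Phi i = 0"

text \<open>
  Away from the axis the spacetime is \<open>off_axis\<close> modulo these translations: \<open>\<phi>\<^sup>j\<close>, \<open>j \<noteq> i\<close>, has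
  period \<open>2\<pi>\<close>, \<open>t\<close> ranges over the line, and \<open>z\<close> is identified with \<open>z + L\<close> in the quotient case.
\<close>

definition identifications :: "'n \<Rightarrow> bool \<Rightarrow> real \<Rightarrow> (real ^ 'n::finite coord) set"
  where "identifications i quot L =
    {d. d $ Rho = 0 \<and> d $ Phi i = 0 \<and>
        (\<forall>j. j \<noteq> i \<longrightarrow> (\<exists>m::int. d $ Phi j = 2 * pi * of_int m)) \<and>
        (if quot then \<exists>m::int. d $ Zc = of_int m * L else d $ Zc = 0)}"

text \<open>
  The group \<open>U(1)\<^sup>n\<^sup>-\<^sup>1\<close> is the space of rotational vectors modulo \<open>2\<pi>\<int>\<close> in each angle, acting by
  translation. It is effective if only its neutral element fixes every point of the quotient.
\<close>

definition effective_torus_symmetry ::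
    "'n \<Rightarrow> bool \<Rightarrow> real \<Rightarrow> 'n::finite coord metric_field \<Rightarrow> bool"
  where "effective_torus_symmetry i quot L g \<longleftrightarrow>
    (\<forall>j. j \<noteq> i \<longrightarrow> killing_field_on off_axis g (coord_field (Phi j))) \<and>
    (\<forall>d. rotational i d \<longrightarrow> invariant_under_translation off_axis g d) \<and>
    (\<forall>d. rotational i d \<and>
         (\<forall>x\<in>off_axis. \<exists>d'\<in>identifications i quot L. x + d = x + d') \<longrightarrow>
         (\<forall>j. \<exists>m::int. d $ Phi j = 2 * pi * of_int m))"

definition static_axisymmetric_vacuum ::
    "'n \<Rightarrow> bool \<Rightarrow> real \<Rightarrow> 'n::finite coord metric_field \<Rightarrow> bool"
  where "static_axisymmetric_vacuum i quot L g \<longleftrightarrow>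
    lorentzian_metric_on off_axis g \<and>
    ricci_flat_on off_axis g \<and>
    (\<forall>d\<in>identifications i quot L. invariant_under_translation off_axis g d) \<and>
    static_killing_field_on off_axis g (coord_field (Phi i)) \<and>
    effective_torus_symmetry i quot L g"

definition with_rho :: "real \<Rightarrow> real ^ 'n::finite coord \<Rightarrow> real ^ 'n coord"
  where "with_rho \<rho> x = (\<chi> c. if c = Rho then \<rho> else x $ c)"

definition axis_norm_limit ::
    "'n::finite coord metric_field \<Rightarrow> real ^ 'n coord \<Rightarrow> real \<Rightarrow> real \<Rightarrow> bool"
  where "axis_norm_limit g v z l \<longleftrightarrow>
    (\<forall>x. x $ Zc = z \<longrightarrow> ((\<lambda>\<rho>. v \<bullet> (g (with_rho \<rho> x) *v v)) \<longlongrightarrow> l) (at_right 0))"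

definition horizon_rod ::
    "'n \<Rightarrow> real \<Rightarrow> real \<Rightarrow> 'n::finite coord metric_field \<Rightarrow> bool"
  where "horizon_rod i a b g \<longleftrightarrow> a < b \<and>
    (\<forall>z\<in>{a<..<b}.
      axis_norm_limit g (axis (Phi i) 1) z 0 \<and>
      (\<forall>v. rotational i v \<and> v \<noteq> 0 \<longrightarrow> (\<exists>c>0. axis_norm_limit g v z c)))"

definition axis_rod ::
    "'n \<Rightarrow> 'n \<Rightarrow> real \<Rightarrow> real \<Rightarrow> 'n::finite coord metric_field \<Rightarrow> bool"
  where "axis_rod i j a b g \<longleftrightarrow> a < b \<and>
    (\<forall>z\<in>{a<..<b}.
      axis_norm_limit g (axis (Phi j) 1) z 0 \<and>
      (\<exists>c<0. axis_norm_limit g (axis (Phi i) 1) z c) \<and>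
      (\<forall>v. rotational i v \<and> v \<notin> span {axis (Phi j) 1} \<longrightarrow> (\<exists>c>0. axis_norm_limit g v z c)))"

text \<open>
  \<open>ln \<rho> + \<alpha> - u\<^sub>j / 2 \<rightarrow> 0\<close>, where \<open>g\<^sub>\<rho>\<^sub>\<rho> = exp (2\<alpha>)\<close> and \<open>g(\<partial>\<^sub>\<phi>\<^sub>j, \<partial>\<^sub>\<phi>\<^sub>j) = exp u\<^sub>j\<close>.
\<close>

definition no_conical_singularity ::
    "'n \<Rightarrow> real \<Rightarrow> real \<Rightarrow> 'n::finite coord metric_field \<Rightarrow> bool"
  where "no_conical_singularity j a b g \<longleftrightarrow>
    (\<forall>x. x $ Zc \<in> {a<..<b} \<longrightarrow>
      ((\<lambda>\<rho>. ln \<rho> + ln (g (with_rho \<rho> x) $ Rho $ Rho) / 2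
             - ln (g (with_rho \<rho> x) $ Phi j $ Phi j) / 2) \<longlongrightarrow> 0) (at_right 0))"

text \<open>
  \<open>chart\<close> maps points off the axis to coordinates that remain valid on the set \<open>A\<close> of axis points.
\<close>

definition extends_smoothly ::
    "(real ^ 'n coord \<Rightarrow> real ^ 'n coord) \<Rightarrow> (real ^ 'n coord) set \<Rightarrow>
     'n::finite coord metric_field \<Rightarrow> bool"
  where "extends_smoothly chart A g \<longleftrightarrow>
    (\<exists>V h. A \<subseteq> V \<and> lorentzian_metric_on V h \<and>
       (\<forall>x\<in>off_axis. chart x \<in> V \<longrightarrow> g x = pullback chart h x))"

text \<open>Cartesian coordinates \<open>(\<rho> cos \<phi>\<^sup>j, \<rho> sin \<phi>\<^sup>j)\<close> in the slots \<open>Rho\<close> and \<open>Phi j\<close>.\<close>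

definition rod_chart :: "'n::finite \<Rightarrow> real ^ 'n coord \<Rightarrow> real ^ 'n coord"
  where "rod_chart j x = (\<chi> c.
    if c = Rho then x $ Rho * cos (x $ Phi j)
    else if c = Phi j then x $ Rho * sin (x $ Phi j)
    else x $ c)"

definition rod_chart_axis :: "'n::finite \<Rightarrow> real \<Rightarrow> real \<Rightarrow> (real ^ 'n coord) set"
  where "rod_chart_axis j a b = {y. y $ Rho = 0 \<and> y $ Phi j = 0 \<and> y $ Zc \<in> {a<..<b}}"

text \<open>
  At a corner \<open>z = c\<close> with axis rods of structure \<open>j\<close> below and \<open>k\<close> above, put
  \<open>z - c = (r\<^sup>2 - s\<^sup>2) / 2\<close> and \<open>\<rho> = r s\<close>. Then the rods are \<open>r = 0\<close> and \<open>s = 0\<close>, and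
  \<open>(r, \<phi>\<^sup>j)\<close>, \<open>(s, \<phi>\<^sup>k)\<close> are polar coordinates in two planes that meet at the corner.
\<close>

definition corner_chart :: "real \<Rightarrow> 'n \<Rightarrow> 'n \<Rightarrow> real ^ 'n::finite coord \<Rightarrow> real ^ 'n coord"
  where "corner_chart c j k x =
    (let R = sqrt ((x $ Rho)\<^sup>2 + (x $ Zc - c)\<^sup>2);
         r = sqrt (R + (x $ Zc - c));
         s = sqrt (R - (x $ Zc - c))
     in \<chi> d. if d = Rho then r * cos (x $ Phi j)
            else if d = Phi j then r * sin (x $ Phi j)
            else if d = Zc then s * cos (x $ Phi k)
            else if d = Phi k then s * sin (x $ Phi k)
            else x $ d)"

definition corner_chart_axis :: "'n \<Rightarrow> 'n \<Rightarrow> (real ^ 'n::finite coord) set"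
  where "corner_chart_axis j k = {y. y $ Rho = 0 \<and> y $ Phi j = 0 \<and> y $ Zc = 0 \<and> y $ Phi k = 0}"

text \<open>
  Rod number \<open>k\<close> is \<open>[c k, c (k + 1)]\<close> with structure \<open>\<sigma> k\<close>; structure \<open>i\<close> marks horizon rods.
\<close>

definition black_hole ::
    "'n \<Rightarrow> (int \<Rightarrow> real) \<Rightarrow> (int \<Rightarrow> 'n) \<Rightarrow> 'n::finite coord metric_field \<Rightarrow> bool"
  where "black_hole i c \<sigma> g \<longleftrightarrow>
    (\<exists>k. \<sigma> k = i) \<and>
    (\<forall>k. \<sigma> k = i \<longrightarrow> horizon_rod i (c k) (c (k + 1)) g) \<and>
    (\<forall>k. \<sigma> k \<noteq> i \<longrightarrow> axis_rod i (\<sigma> k) (c k) (c (k + 1)) g)"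

definition regular ::
    "'n \<Rightarrow> (int \<Rightarrow> real) \<Rightarrow> (int \<Rightarrow> 'n) \<Rightarrow> 'n::finite coord metric_field \<Rightarrow> bool"
  where "regular i c \<sigma> g \<longleftrightarrow>
    (\<forall>k. \<sigma> k \<noteq> i \<longrightarrow>
       extends_smoothly (rod_chart (\<sigma> k)) (rod_chart_axis (\<sigma> k) (c k) (c (k + 1))) g \<and>
       no_conical_singularity (\<sigma> k) (c k) (c (k + 1)) g) \<and>
    (\<forall>k. \<sigma> k \<noteq> i \<and> \<sigma> (k + 1) \<noteq> i \<longrightarrow>
       extends_smoothly (corner_chart (c (k + 1)) (\<sigma> k) (\<sigma> (k + 1)))
         (corner_chart_axis (\<sigma> k) (\<sigma> (k + 1))) g)"

text \<open>
  Limits are uniform in the remaining coordinates. The coefficient of \<open>d\<tau>\<^sup>2\<close> is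
  \<open>g\<^sub>\<rho>\<^sub>\<rho> / (d\<tau>/d\<rho>)\<^sup>2\<close>.
\<close>

definition kasner_asymptotics :: "'n \<Rightarrow> 'n::finite coord metric_field \<Rightarrow> bool"
  where "kasner_asymptotics i g \<longleftrightarrow>
    (\<exists>\<tau> R p0 p C.
       (\<forall>\<rho>>R. deriv \<tau> \<rho> > 0 \<and> (\<forall>m. (deriv ^^ m) \<tau> field_differentiable at \<rho>)) \<and>
       filterlim \<tau> at_top at_top \<and>
       p0 + (\<Sum>j\<in>UNIV. p j) = 1 \<and> p0\<^sup>2 + (\<Sum>j\<in>UNIV. (p j)\<^sup>2) = 1 \<and>
       (\<forall>c. C c > 0) \<and>
       uniform_limit UNIV (\<lambda>\<rho> x. g (with_rho \<rho> x) $ Rho $ Rho / (deriv \<tau> \<rho>)\<^sup>2)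
         (\<lambda>_. C Rho) at_top \<and>
       uniform_limit UNIV (\<lambda>\<rho> x. g (with_rho \<rho> x) $ Zc $ Zc / \<tau> \<rho> powr (2 * p0))
         (\<lambda>_. C Zc) at_top \<and>
       uniform_limit UNIV (\<lambda>\<rho> x. - g (with_rho \<rho> x) $ Phi i $ Phi i / \<tau> \<rho> powr (2 * p i))
         (\<lambda>_. C (Phi i)) at_top \<and>
       (\<forall>j. j \<noteq> i \<longrightarrow>
          uniform_limit UNIV (\<lambda>\<rho> x. g (with_rho \<rho> x) $ Phi j $ Phi j / \<tau> \<rho> powr (2 * p j))
            (\<lambda>_. C (Phi j)) at_top) \<and>
       (\<forall>x\<in>off_axis. \<forall>k l. k \<noteq> l \<longrightarrow> g x $ k $ l = 0))"

end

theory Submission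
  imports Defs
begin

text \<open>
  In the variables \<open>s = \<rho>\<^sup>2\<close> and \<open>z\<close> every potential is a finite sum of reflections and translates
  of the half-line potential \<open>ln (r + x)\<close> and of its renormalized periodic array, which are smooth
  also for slightly negative \<open>s\<close>. Hence, up to explicit logarithms, the \<open>u\<^sub>i\<close> are smooth across rods
  and corners, and so is \<open>\<alpha>\<close>, obtained by integrating its equations from the axis. In the Cartesian
  charts the metric is diagonal plus squares of the one-forms \<open>x\<^sub>1 dx\<^sub>2 - x\<^sub>2 dx\<^sub>1\<close>; their coefficients
  are smooth because the absence of conical singularities makes the relevant difference vanish on
  the axis. Ricci flatness uses harmonicity of the \<open>u\<^sub>i\<close>, the equations for \<open>\<alpha>\<close>, and \<open>\<Sum>u\<^sub>i = 2 ln \<rho> + const\<close>.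
  At infinity the oscillation in \<open>z\<close> decays, so by symmetry \<open>u\<^sub>i = 2 q\<^sub>i ln \<rho> + const + o(1)\<close> with \<open>q\<^sub>i\<close>
  the frequency of \<open>i\<close> in the period, and then \<open>\<alpha> = a ln \<rho> + const + o(1)\<close> with
  \<open>a = (\<Sum>q\<^sub>i\<^sup>2 - 1) / 2\<close>; \<open>\<tau> = \<rho>\<^sup>a\<^sup>+\<^sup>1 / (a + 1)\<close> gives the Kasner exponents \<open>a / (a + 1)\<close> and \<open>q\<^sub>i / (a + 1)\<close>.
\<close>

section \<open>Smooth functions\<close>

text \<open>A function of \<open>s\<close> and \<open>z\<close> that is smooth also for slightly
  negative \<open>s\<close> becomes smooth in Cartesian coordinates on putting x1^2 + x2^2 for
  \<open>s\<close>. To reach negative \<open>s\<close>, a half-line whose singular side covers the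
  point is exchanged for the opposite one; (r + x)(r - x) = s makes this cost exactly one ln s.

  The obstacle is \<alpha>, given only by equations that are singular on the axis and by its limits
  on the rods. Once the logarithms are split off from the potentials, the singular terms cancel,
  because each logarithm is carried by exactly one potential. At a corner this needs in addition ln
  (2 R), the logarithm of the conformal factor between d\<rho>^2 + dz^2 and the flat metric of the
  two planes. There \<alpha> is integrated from one of the two rods, and the condition on the other
  rod becomes a compatibility statement with a proof of its own.

  At infinity the symmetry is that all rods have equal length: the potentials of a rod and its
  periodic translates, for the different rods of a period, are translates of one function, and their
  sum is the explicit potential of the full axis. Each rod therefore receives the same share of ln
  s.\<close>

primrec Ck :: "nat \<Rightarrow> 'a::euclidean_space set \<Rightarrow> ('a \<Rightarrow> real) \<Rightarrow> bool" where
  "Ck 0 S F \<longleftrightarrow> True"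
| "Ck (Suc k) S F \<longleftrightarrow>
     (\<exists>F'. (\<forall>x\<in>S. (F has_derivative F' x) (at x)) \<and> (\<forall>v. Ck k S (\<lambda>x. F' x v)))"

text \<open>Smoothness is stated for every finite order, so that closure properties follow by
  induction on the order with the function generalized. \<open>Ck\<close> quantifies the derivative
  existentially: a closure lemma may exhibit whatever formula the rules of calculus produce.\<close>

definition Cinf :: "'a::euclidean_space set \<Rightarrow> ('a \<Rightarrow> real) \<Rightarrow> bool"
  where "Cinf S F \<longleftrightarrow> open S \<and> (\<forall>k. Ck k S F)"

lemma CkI:
  assumes "\<And>x. x \<in> S \<Longrightarrow> (F has_derivative F' x) (at x)" and "\<And>v. Ck k S (\<lambda>x. F' x v)"
  shows "Ck (Suc k) S F"
  using assms by auto

lemma CkD: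
  "Ck (Suc k) S F \<Longrightarrow> \<exists>F'. (\<forall>x\<in>S. (F has_derivative F' x) (at x)) \<and> (\<forall>v. Ck k S (\<lambda>x. F' x v))"
  by simp

declare Ck.simps(2) [simp del]

lemma Cinf_open: "Cinf S F \<Longrightarrow> open S"
  by (simp add: Cinf_def)

lemma Ck_mono: "Ck (Suc k) S F \<Longrightarrow> Ck k S F"
proof (induction k arbitrary: F)
  case 0
  then show ?case by simp
next
  case (Suc k)
  obtain F' where F': "\<And>x. x \<in> S \<Longrightarrow> (F has_derivative F' x) (at x)"
    "\<And>v. Ck (Suc k) S (\<lambda>x. F' x v)"
    using CkD[OF Suc.prems] by blast
  then show ?case
    by (intro CkI[of S F F'] Suc.IH)
qed

lemma Ck_subset: "Ck k S F \<Longrightarrow> T \<subseteq> S \<Longrightarrow> Ck k T F"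
proof (induction k arbitrary: F)
  case (Suc k)
  obtain F' where F': "\<And>x. x \<in> S \<Longrightarrow> (F has_derivative F' x) (at x)" "\<And>v. Ck k S (\<lambda>x. F' x v)"
    using CkD[OF Suc.prems(1)] by blast
  show ?case
    by (rule CkI[of T F F']) (use F' Suc in auto)
qed simp

lemma Cinf_subset: "Cinf S F \<Longrightarrow> open T \<Longrightarrow> T \<subseteq> S \<Longrightarrow> Cinf T F"
  using Ck_subset unfolding Cinf_def by blast

lemma Ck_cong:
  assumes "open S" and "\<And>x. x \<in> S \<Longrightarrow> F x = G x" and "Ck k S F"
  shows "Ck k S G"
proof (cases k)
  case (Suc l)
  then obtain F' where F': "\<And>x. x \<in> S \<Longrightarrow> (F has_derivative F' x) (at x)"
    "\<And>v. Ck l S (\<lambda>x. F' x v)"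
    using CkD[of l S F] assms(3) by blast
  have "(G has_derivative F' x) (at x)" if "x \<in> S" for x
    using has_derivative_transform_within_open[OF F'(1)[OF that] assms(1) that assms(2)] .
  then show ?thesis
    unfolding Suc by (rule CkI[OF _ F'(2)])
qed simp

lemma Cinf_cong:
  assumes "Cinf S F" and "\<And>x. x \<in> S \<Longrightarrow> F x = G x"
  shows "Cinf S G"
  using assms Ck_cong[of S F G] by (auto simp: Cinf_def)

text \<open>The witnesses for different orders are derivatives of the same function, hence agree on
  \<open>S\<close>, and the Frechet derivative serves for all of them. In this form smoothness
  unfolds by one derivative with no order to keep track of.\<close>

lemma Cinf_iff:
  "Cinf S F \<longleftrightarrow> open S \<and>
     (\<exists>F'. (\<forall>x\<in>S. (F has_derivative F' x) (at x)) \<and> (\<forall>v. Cinf S (\<lambda>x. F' x v)))"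
  (is "?l \<longleftrightarrow> ?r")
proof
  assume l: ?l
  then have op: "open S" by (simp add: Cinf_def)
  define D where "D x = frechet_derivative F (at x)" for x
  have D: "(F has_derivative D x) (at x)" if "x \<in> S" for x
  proof -
    have "Ck (Suc 0) S F" using l by (simp add: Cinf_def del: Ck.simps)
    then have "F differentiable (at x)"
      using that CkD[of 0 S F] by (auto simp: differentiable_def)
    then show ?thesis
      unfolding D_def by (simp add: frechet_derivative_works)
  qed
  have "Ck k S (\<lambda>x. D x v)" for k v
  proof -
    have "Ck (Suc k) S F" using l by (simp add: Cinf_def del: Ck.simps)
    then obtain F' where F': "\<And>x. x \<in> S \<Longrightarrow> (F has_derivative F' x) (at x)"
      "\<And>v. Ck k S (\<lambda>x. F' x v)"
      using CkD[of k S F] by blast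
    show ?thesis
      by (rule Ck_cong[OF op _ F'(2)[of v]])
        (metis D F'(1) has_derivative_unique)
  qed
  then show ?r
    using op D by (auto simp: Cinf_def)
next
  assume ?r
  then obtain F' where op: "open S" and F': "\<forall>x\<in>S. (F has_derivative F' x) (at x)"
    "\<forall>v. Cinf S (\<lambda>x. F' x v)" by blast
  have "Ck k S F" for k
    by (cases k) (use F' in \<open>auto simp: Cinf_def intro: CkI\<close>)
  then show ?l using op by (simp add: Cinf_def)
qed

lemma Cinf_frechet:
  assumes "Cinf S F"
  shows "x \<in> S \<Longrightarrow> (F has_derivative frechet_derivative F (at x)) (at x)"
    and "Cinf S (\<lambda>x. frechet_derivative F (at x) v)"
proof -
  obtain F' where F': "\<And>x. x \<in> S \<Longrightarrow> (F has_derivative F' x) (at x)"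
    "\<And>v. Cinf S (\<lambda>x. F' x v)"
    using assms unfolding Cinf_iff[of S F] by blast
  show 1: "(F has_derivative frechet_derivative F (at x)) (at x)" if "x \<in> S" for x
    using F'(1)[OF that] frechet_derivative_at by metis
  show "Cinf S (\<lambda>x. frechet_derivative F (at x) v)"
    by (rule Cinf_cong[OF F'(2)[of v]]) (metis 1 F'(1) has_derivative_unique)
qed

lemma Cinf_imp_continuous_on: "Cinf S F \<Longrightarrow> continuous_on S F"
  by (meson Cinf_frechet(1) continuous_at_imp_continuous_on has_derivative_continuous)

lemma Cinf_imp_isCont: "Cinf S F \<Longrightarrow> x \<in> S \<Longrightarrow> isCont F x"
  by (meson Cinf_frechet(1) has_derivative_continuous)

lemma Ck_const: "Ck k S (\<lambda>_. c)"
  by (induction k arbitrary: c) (auto intro!: CkI[where F' = "\<lambda>_ _. 0"])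

lemma Ck_linear: "bounded_linear f \<Longrightarrow> Ck k S f"
  by (cases k) (auto intro!: CkI[where F' = "\<lambda>_. f"] Ck_const bounded_linear_imp_has_derivative)

lemma Ck_add: "Ck k S F \<Longrightarrow> Ck k S G \<Longrightarrow> Ck k S (\<lambda>x. F x + G x)"
proof (induction k arbitrary: F G)
  case (Suc k)
  obtain F' G' where "\<And>x. x \<in> S \<Longrightarrow> (F has_derivative F' x) (at x)" "\<And>v. Ck k S (\<lambda>x. F' x v)"
    "\<And>x. x \<in> S \<Longrightarrow> (G has_derivative G' x) (at x)" "\<And>v. Ck k S (\<lambda>x. G' x v)"
    using CkD[OF Suc.prems(1)] CkD[OF Suc.prems(2)] by metis
  then show ?case
    by (intro CkI[where F' = "\<lambda>x v. F' x v + G' x v"] has_derivative_add Suc.IH)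
qed simp

lemma Ck_mult: "Ck k S F \<Longrightarrow> Ck k S G \<Longrightarrow> Ck k S (\<lambda>x. F x * G x)"
proof (induction k arbitrary: F G)
  case (Suc k)
  obtain F' G' where *: "\<And>x. x \<in> S \<Longrightarrow> (F has_derivative F' x) (at x)" "\<And>v. Ck k S (\<lambda>x. F' x v)"
    "\<And>x. x \<in> S \<Longrightarrow> (G has_derivative G' x) (at x)" "\<And>v. Ck k S (\<lambda>x. G' x v)"
    using CkD[OF Suc.prems(1)] CkD[OF Suc.prems(2)] by metis
  have "Ck k S F" "Ck k S G" using Suc.prems Ck_mono by blast+
  then show ?case
    by (intro CkI[where F' = "\<lambda>x v. F x * G' x v + F' x v * G x"] has_derivative_mult Ck_add
        Suc.IH *)
qed simp

lemma Ck_sum: "finite I \<Longrightarrow> (\<And>i. i \<in> I \<Longrightarrow> Ck k S (F i)) \<Longrightarrow> Ck k S (\<lambda>x. \<Sum>i\<in>I. F i x)"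
  by (induction I rule: finite_induct) (auto intro: Ck_const Ck_add)

text \<open>The derivative is a sum of products of an inner derivative with an outer derivative at
  \<open>g x\<close>. The outer factor is again a composition, so the induction is over
  \<open>f\<close> with \<open>g\<close> fixed.\<close>

lemma Ck_compose:
  fixes f :: "'b::euclidean_space \<Rightarrow> real" and g :: "'a::euclidean_space \<Rightarrow> 'b"
  assumes "Ck k T f" and "\<And>b. b \<in> Basis \<Longrightarrow> Ck k S (\<lambda>x. g x \<bullet> b)" and "\<And>x. x \<in> S \<Longrightarrow> g x \<in> T"
  shows "Ck k S (\<lambda>x. f (g x))"
  using assms(1,2)
proof (induction k arbitrary: f)
  case (Suc k)
  obtain f' where f': "\<And>y. y \<in> T \<Longrightarrow> (f has_derivative f' y) (at y)" "\<And>v. Ck k T (\<lambda>y. f' y v)"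
    using CkD[OF Suc.prems(1)] by blast
  have "\<forall>b. \<exists>g'. b \<in> Basis \<longrightarrow> (\<forall>x\<in>S. ((\<lambda>x. g x \<bullet> b) has_derivative g' x) (at x)) \<and>
      (\<forall>v. Ck k S (\<lambda>x. g' x v))"
    using CkD[OF Suc.prems(2)] by blast
  then obtain g' where g': "\<And>b x. b \<in> Basis \<Longrightarrow> x \<in> S \<Longrightarrow> ((\<lambda>x. g x \<bullet> b) has_derivative g' b x) (at x)"
    "\<And>b v. b \<in> Basis \<Longrightarrow> Ck k S (\<lambda>x. g' b x v)"
    by metis
  have g: "(g has_derivative (\<lambda>v. \<Sum>b\<in>Basis. g' b x v *\<^sub>R b)) (at x)" if "x \<in> S" for x
    by (subst has_derivative_componentwise_within)
      (auto simp: inner_sum_left inner_Basis if_distrib cong: if_cong intro!: g'(1) that)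
  have "((\<lambda>x. f (g x)) has_derivative (\<lambda>v. \<Sum>b\<in>Basis. g' b x v * f' (g x) b)) (at x)"
    if x: "x \<in> S" for x
  proof -
    have lin: "linear (f' (g x))"
      using f'(1)[OF assms(3)[OF x]] has_derivative_linear by blast
    have "((\<lambda>x. f (g x)) has_derivative (\<lambda>v. f' (g x) (\<Sum>b\<in>Basis. g' b x v *\<^sub>R b))) (at x)"
      by (rule has_derivative_compose[OF g[OF x] f'(1)[OF assms(3)[OF x]]])
    then show ?thesis
      by (simp add: linear_sum[OF lin] linear_scale[OF lin])
  qed
  moreover have "Ck k S (\<lambda>x. \<Sum>b\<in>Basis. g' b x v * f' (g x) b)" for v
    by (intro Ck_sum Ck_mult g'(2) Suc.IH[OF f'(2)] Ck_mono[OF Suc.prems(2)]) auto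
  ultimately show ?case by (rule CkI)
qed simp

lemma Cinf_const: "open S \<Longrightarrow> Cinf S (\<lambda>_. c)"
  by (simp add: Cinf_def Ck_const)

lemma Cinf_linear: "open S \<Longrightarrow> bounded_linear f \<Longrightarrow> Cinf S f"
  by (simp add: Cinf_def Ck_linear)

lemma Cinf_nth: "open S \<Longrightarrow> Cinf S (\<lambda>x :: real ^ 'm. x $ k)"
  by (simp add: Cinf_linear bounded_linear_vec_nth)

lemma Cinf_fst: "open S \<Longrightarrow> Cinf S (fst :: real \<times> real \<Rightarrow> real)"
  and Cinf_snd: "open S \<Longrightarrow> Cinf S (snd :: real \<times> real \<Rightarrow> real)"
  by (simp_all add: Cinf_linear bounded_linear_fst bounded_linear_snd)

lemma Cinf_add: "Cinf S F \<Longrightarrow> Cinf S G \<Longrightarrow> Cinf S (\<lambda>x. F x + G x)"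
  and Cinf_mult: "Cinf S F \<Longrightarrow> Cinf S G \<Longrightarrow> Cinf S (\<lambda>x. F x * G x)"
  by (simp_all add: Cinf_def Ck_add Ck_mult)

lemma Cinf_minus: "Cinf S F \<Longrightarrow> Cinf S (\<lambda>x. - F x)"
  using Cinf_mult[OF Cinf_const[of S "-1"], of F] by (simp add: Cinf_def)

lemma Cinf_diff: "Cinf S F \<Longrightarrow> Cinf S G \<Longrightarrow> Cinf S (\<lambda>x. F x - G x)"
  using Cinf_add[OF _ Cinf_minus, of S F G] by simp

lemma Cinf_power: "Cinf S F \<Longrightarrow> Cinf S (\<lambda>x. F x ^ n)"
  by (induction n) (auto intro: Cinf_mult Cinf_const simp: Cinf_open)

lemma Cinf_sum:
  "open S \<Longrightarrow> finite I \<Longrightarrow> (\<And>i. i \<in> I \<Longrightarrow> Cinf S (F i)) \<Longrightarrow> Cinf S (\<lambda>x. \<Sum>i\<in>I. F i x)"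
  by (simp add: Cinf_def Ck_sum)

lemma Cinf_compose:
  assumes "Cinf T f" and "Cinf S g" and "\<And>x. x \<in> S \<Longrightarrow> g x \<in> T"
  shows "Cinf S (\<lambda>x. f (g x :: real))"
  using assms Ck_compose[of _ T f S g] by (simp add: Cinf_def)

lemma Cinf_compose2:
  assumes "Cinf T f" and "Cinf S g" and "Cinf S h" and "\<And>x. x \<in> S \<Longrightarrow> (g x, h x) \<in> T"
  shows "Cinf S (\<lambda>x. f (g x, h x :: real) :: real)"
  unfolding Cinf_def
proof (intro conjI allI)
  show "Ck k S (\<lambda>x. f (g x, h x))" for k
    by (rule Ck_compose[of k T]) (use assms in \<open>auto simp: Cinf_def Basis_prod_def\<close>)
qed (use assms in \<open>simp add: Cinf_def\<close>)

lemma Cinf_real_deriv: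
  fixes F :: "real \<Rightarrow> real"
  assumes "open S" and "\<And>x. x \<in> S \<Longrightarrow> (F has_real_derivative G x) (at x)" and "Ck k S G"
  shows "Ck (Suc k) S F"
  using assms
  by (auto intro!: CkI[where F' = "\<lambda>x v. G x * v"] Ck_mult Ck_const simp: has_field_derivative_def)

lemma Cinf_exp: "Cinf UNIV (exp :: real \<Rightarrow> real)"
proof -
  have "Ck k UNIV (exp :: real \<Rightarrow> real)" for k
    by (induction k) (auto intro: Cinf_real_deriv DERIV_exp)
  then show ?thesis by (simp add: Cinf_def)
qed

lemma Cinf_inverse: "Cinf {x. x \<noteq> 0} (inverse :: real \<Rightarrow> real)"
proof -
  have op: "open {x::real. x \<noteq> 0}" by (simp add: open_Collect_neq)
  have "Ck k {x. x \<noteq> 0} (inverse :: real \<Rightarrow> real)" for k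
  proof (induction k)
    case (Suc k)
    have d: "(inverse has_real_derivative - 1 * (inverse x * inverse x)) (at x)"
      if "x \<in> {x. x \<noteq> 0}" for x :: real
      using DERIV_inverse[of x] that by (simp add: power2_eq_square)
    show ?case
      by (intro Cinf_real_deriv[OF op d] Ck_mult Ck_const Suc)
  qed simp
  then show ?thesis using op by (simp add: Cinf_def)
qed

lemma Cinf_divide:
  assumes "Cinf S F" and "Cinf S G" and "\<And>x. x \<in> S \<Longrightarrow> G x \<noteq> 0"
  shows "Cinf S (\<lambda>x. F x / G x)"
  unfolding divide_inverse
  by (intro Cinf_mult assms Cinf_compose[OF Cinf_inverse]) (use assms in auto)

lemmas Cinf_exp' = Cinf_compose[OF Cinf_exp]

section \<open>Partial derivatives of functions of two variables\<close>

definition pdir1 :: "(real \<times> real \<Rightarrow> real) \<Rightarrow> real \<times> real \<Rightarrow> real"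
  where "pdir1 F y = frechet_derivative F (at y) (1, 0)"

definition pdir2 :: "(real \<times> real \<Rightarrow> real) \<Rightarrow> real \<times> real \<Rightarrow> real"
  where "pdir2 F y = frechet_derivative F (at y) (0, 1)"

text \<open>Total differentiability with named coefficients: it can be composed with curves and
  charts, and it determines both \<open>pdir1\<close> and \<open>pdir2\<close>.\<close>

definition has_grad :: "(real \<times> real \<Rightarrow> real) \<Rightarrow> real \<Rightarrow> real \<Rightarrow> real \<times> real \<Rightarrow> bool"
  where "has_grad F a b y \<longleftrightarrow> (F has_derivative (\<lambda>v. a * fst v + b * snd v)) (at y)"

lemma has_gradD: "has_grad F a b y \<Longrightarrow> pdir1 F y = a" "has_grad F a b y \<Longrightarrow> pdir2 F y = b"
  unfolding has_grad_def pdir1_def pdir2_def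
  using frechet_derivative_at[of F "\<lambda>v. a * fst v + b * snd v" y] by (metis fst_conv snd_conv
      mult_1_right mult_zero_right add_0 add_0_right)+

lemma Cinf_grad:
  assumes "Cinf S F" and "y \<in> S"
  shows "has_grad F (pdir1 F y) (pdir2 F y) y"
proof -
  let ?D = "frechet_derivative F (at y)"
  have D: "(F has_derivative ?D) (at y)"
    using Cinf_frechet(1)[OF assms] .
  then have lin: "linear ?D" using has_derivative_linear by blast
  have "?D v = pdir1 F y * fst v + pdir2 F y * snd v" for v
  proof -
    have "v = fst v *\<^sub>R (1, 0) + snd v *\<^sub>R (0, 1)" by (simp add: prod_eq_iff)
    then have "?D v = ?D (fst v *\<^sub>R (1, 0) + snd v *\<^sub>R (0, 1))" by simp
    also have "\<dots> = pdir1 F y * fst v + pdir2 F y * snd v"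
      by (simp only: linear_add[OF lin] linear_scale[OF lin])
        (simp add: pdir1_def pdir2_def)
    finally show ?thesis .
  qed
  then have "?D = (\<lambda>v. pdir1 F y * fst v + pdir2 F y * snd v)" by auto
  then show ?thesis using D unfolding has_grad_def by simp
qed

lemma Cinf_pdir: "Cinf S F \<Longrightarrow> Cinf S (pdir1 F)" "Cinf S F \<Longrightarrow> Cinf S (pdir2 F)"
  unfolding pdir1_def[abs_def] pdir2_def[abs_def] by (simp_all add: Cinf_frechet)

lemma Cinf_gradI:
  assumes "open S" and "\<And>y. y \<in> S \<Longrightarrow> has_grad F (A y) (B y) y" and "Cinf S A" and "Cinf S B"
  shows "Cinf S F"
  unfolding Cinf_iff[of S F]
  using assms
  by (auto intro!: exI[of _ "\<lambda>y v. A y * fst v + B y * snd v"] Cinf_add Cinf_mult Cinf_const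
      simp: has_grad_def)

lemma Ck_gradI:
  assumes "\<And>y. y \<in> S \<Longrightarrow> has_grad F (A y) (B y) y" and "Ck k S A" and "Ck k S B"
  shows "Ck (Suc k) S F"
  using assms
  by (auto intro!: CkI[where F' = "\<lambda>y v. A y * fst v + B y * snd v"] Ck_add Ck_mult Ck_const
      simp: has_grad_def)

lemma has_grad_real_derivative1:
  assumes "has_grad F a b (x, y)"
  shows "((\<lambda>x. F (x, y)) has_real_derivative a) (at x)"
proof -
  have "((\<lambda>x. (x, y)) has_derivative (\<lambda>h. (h, 0))) (at x)"
    by (auto intro!: derivative_eq_intros)
  from has_derivative_compose[OF this assms[unfolded has_grad_def]] show ?thesis
    by (simp add: has_field_derivative_def)
qed

lemma has_grad_real_derivative2:
  assumes "has_grad F a b (x, y)"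
  shows "((\<lambda>y. F (x, y)) has_real_derivative b) (at y)"
proof -
  have "((\<lambda>y. (x, y)) has_derivative (\<lambda>h. (0, h))) (at y)"
    by (auto intro!: derivative_eq_intros)
  from has_derivative_compose[OF this assms[unfolded has_grad_def]] show ?thesis
    by (simp add: has_field_derivative_def)
qed

lemma has_grad_curve:
  assumes "has_grad F a b (f t, g t)" and "(f has_real_derivative f') (at t)"
    and "(g has_real_derivative g') (at t)"
  shows "((\<lambda>t. F (f t, g t)) has_real_derivative a * f' + b * g') (at t)"
proof -
  have "((\<lambda>t. (f t, g t)) has_derivative (\<lambda>h. (h * f', h * g'))) (at t)"
    using assms(2,3) by (auto intro!: derivative_eq_intros simp: has_field_derivative_def mult.commute)
  from has_derivative_compose[OF this assms(1)[unfolded has_grad_def]] show ?thesis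
    unfolding has_field_derivative_def by (rule has_derivative_eq_rhs) (auto simp: algebra_simps)
qed

text \<open>Parametric integrals, for Taylor expansion across the axis.\<close>

definition scale_integral :: "nat \<Rightarrow> (real \<times> real \<Rightarrow> real) \<Rightarrow> real \<times> real \<Rightarrow> real"
  where "scale_integral m f y = integral {0..1} (\<lambda>t. t ^ m * f (t * fst y, snd y))"

text \<open>Differentiating f (t s, z) in \<open>s\<close> brings out a factor t. This is why the
  integrals carry a weight t^m: the family over all \<open>m\<close> is closed under
  differentiation.\<close>

lemma has_grad_scale_integral:
  assumes f: "Cinf S f" and sc: "\<And>s z t. (s, z) \<in> S \<Longrightarrow> 0 \<le> t \<Longrightarrow> t \<le> 1 \<Longrightarrow> (t * s, z) \<in> S"
    and y: "y \<in> S"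
  shows "has_grad (scale_integral m f) (scale_integral (Suc m) (pdir1 f) y)
    (scale_integral m (pdir2 f) y) y"
proof -
  have op: "open S" using f Cinf_open by blast
  then obtain e where e: "e > 0" "ball y e \<subseteq> S"
    using y openE by blast
  let ?U = "ball y e"
  \<comment> \<open>The derivative of the integrand as a bounded linear functional, the form in
    which \<open>leibniz_rule\<close> expects it.\<close>
  define fx where "fx = (\<lambda>(x::real\<times>real) t::real.
     (t ^ Suc m * pdir1 f (t * fst x, snd x)) *\<^sub>R (fst_blinfun :: (real \<times> real) \<Rightarrow>\<^sub>L real)
     + (t ^ m * pdir2 f (t * fst x, snd x)) *\<^sub>R (snd_blinfun :: (real \<times> real) \<Rightarrow>\<^sub>L real))"
  have inS: "(t * fst x, snd x) \<in> S" if "x \<in> S" "t \<in> {0..1}" for x t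
    using sc[of "fst x" "snd x" t] that by simp
  have cont: "continuous_on (S \<times> {0..1}) (\<lambda>q. g (snd q * fst (fst q), snd (fst q)))"
    if "Cinf S g" for g
    by (rule continuous_on_compose2[OF Cinf_imp_continuous_on[OF that]])
      (auto intro!: continuous_intros inS simp: split_beta)
  have cont1: "continuous_on {0..1} (\<lambda>t. g (t * fst x, snd x))" if "Cinf S g" "x \<in> S" for g x
    by (rule continuous_on_compose2[OF Cinf_imp_continuous_on[OF that(1)]])
      (use that in \<open>auto intro!: continuous_intros inS\<close>)
  have "((\<lambda>x. integral (cbox 0 1) (\<lambda>t. t ^ m * f (t * fst x, snd x))) has_derivative
     blinfun_apply (integral (cbox 0 1) (fx y))) (at y within ?U)"
  proof (rule leibniz_rule)
    fix x t assume xt: "x \<in> ?U" "t \<in> cbox (0::real) 1"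
    then have "(t * fst x, snd x) \<in> S" using inS e by auto
    from Cinf_grad[OF f this]
    have "(f has_derivative (\<lambda>v. pdir1 f (t * fst x, snd x) * fst v + pdir2 f (t * fst x, snd x) * snd v))
       (at (t * fst x, snd x))" by (simp add: has_grad_def)
    moreover have "((\<lambda>x. (t * fst x, snd x)) has_derivative (\<lambda>v. (t * fst v, snd v))) (at x within ?U)"
      by (auto intro!: derivative_eq_intros)
    ultimately have "((\<lambda>x. f (t * fst x, snd x)) has_derivative
        (\<lambda>v. pdir1 f (t * fst x, snd x) * (t * fst v) + pdir2 f (t * fst x, snd x) * snd v))
        (at x within ?U)"
      using has_derivative_compose by fastforce
    from has_derivative_mult_right[OF this, of "t ^ m"]
    show "((\<lambda>x. t ^ m * f (t * fst x, snd x)) has_derivative blinfun_apply (fx x t)) (at x within ?U)"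
      by (rule has_derivative_eq_rhs) (auto simp: fx_def blinfun.bilinear_simps algebra_simps)
  next
    show "(\<lambda>t. t ^ m * f (t * fst x, snd x)) integrable_on cbox 0 1" if "x \<in> ?U" for x
      using that e
      by (intro integrable_continuous) (auto intro!: continuous_intros cont1 f)
  next
    have "continuous_on (S \<times> {0..1}) (\<lambda>q. fx (fst q) (snd q))"
      unfolding fx_def
      by (intro continuous_intros cont Cinf_pdir f)
    then show "continuous_on (?U \<times> cbox 0 1) (\<lambda>(x, t). fx x t)"
      unfolding split_beta using e by (auto elim!: continuous_on_subset)
  qed (use e in auto)
  moreover have "blinfun_apply (integral (cbox 0 1) (fx y)) = (\<lambda>v.
     scale_integral (Suc m) (pdir1 f) y * fst v + scale_integral m (pdir2 f) y * snd v)"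
  proof (rule ext)
    fix v :: "real \<times> real"
    have i1: "(\<lambda>t. t ^ k * g (t * fst y, snd y)) integrable_on {0..1}" if "Cinf S g" for g k
      by (intro integrable_continuous_interval continuous_intros cont1 that y)
    have "continuous_on {0..1} (fx y)"
      unfolding fx_def
      by (intro continuous_intros cont1 Cinf_pdir f y)
    then have "fx y integrable_on {0..1}"
      by (rule integrable_continuous_interval)
    then have "blinfun_apply (integral {0..1} (fx y)) v = integral {0..1} (\<lambda>t. blinfun_apply (fx y t) v)"
      by (rule blinfun_apply_integral)
    also have "\<dots> = integral {0..1} (\<lambda>t. t ^ Suc m * pdir1 f (t * fst y, snd y) * fst v
         + t ^ m * pdir2 f (t * fst y, snd y) * snd v)"
      by (simp add: fx_def blinfun.bilinear_simps)
    also have "\<dots> = scale_integral (Suc m) (pdir1 f) y * fst v + scale_integral m (pdir2 f) y * snd v"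
      unfolding scale_integral_def
      by (subst integral_add) (auto intro!: integrable_on_mult_left i1 Cinf_pdir f
          simp del: power_Suc)
    finally show "blinfun_apply (integral (cbox 0 1) (fx y)) v =
      scale_integral (Suc m) (pdir1 f) y * fst v + scale_integral m (pdir2 f) y * snd v" by simp
  qed
  moreover have "at y within ?U = at y" by (rule at_within_open) (use e in simp_all)
  ultimately show ?thesis
    unfolding has_grad_def scale_integral_def[abs_def] by simp
qed

lemma Cinf_scale_integral:
  assumes "Cinf S f" and sc: "\<And>s z t. (s, z) \<in> S \<Longrightarrow> 0 \<le> t \<Longrightarrow> t \<le> 1 \<Longrightarrow> (t * s, z) \<in> S"
  shows "Cinf S (scale_integral m f)"
proof -
  have "Ck k S (scale_integral m f)" if "Cinf S f" for k f m
    using that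
  proof (induction k arbitrary: f m)
    case (Suc k)
    show ?case
      by (rule Ck_gradI[OF has_grad_scale_integral[OF Suc.prems sc]])
        (auto intro: Suc.IH Cinf_pdir Suc.prems)
  qed simp
  then show ?thesis using assms by (simp add: Cinf_def)
qed

text \<open>Hadamard's lemma in the variable \<open>s\<close>. Together with
  \<open>Cinf_scale_integral\<close> it divides a function that vanishes on the axis by
  \<open>s\<close> without losing smoothness.\<close>

lemma scale_integral_ftc:
  assumes "Cinf S f" and sc: "\<And>t. 0 \<le> t \<Longrightarrow> t \<le> 1 \<Longrightarrow> (t * s, z) \<in> S"
  shows "f (s, z) = f (0, z) + s * scale_integral 0 (pdir1 f) (s, z)"
proof -
  have "((\<lambda>t. f (t * s, z)) has_real_derivative s * pdir1 f (t * s, z)) (at t within {0..1})"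
    if "t \<in> {0..1}" for t
  proof -
    have "(t * s, z) \<in> S" using sc that by auto
    have "((\<lambda>t. f (t * s, z)) has_real_derivative pdir1 f (t * s, z) * s + pdir2 f (t * s, z) * 0) (at t)"
      by (rule has_grad_curve[of f _ _ "\<lambda>t. t * s" t "\<lambda>_. z", OF Cinf_grad[OF assms(1)]])
        (auto intro!: derivative_eq_intros \<open>(t * s, z) \<in> S\<close>)
    then show ?thesis
      by (auto simp: mult.commute intro: has_field_derivative_at_within)
  qed
  then have "((\<lambda>t. s * pdir1 f (t * s, z)) has_integral f (1 * s, z) - f (0 * s, z)) {0..1}"
    by (intro fundamental_theorem_of_calculus)
      (auto simp: has_real_derivative_iff_has_vector_derivative)
  then show ?thesis
    by (auto simp: scale_integral_def dest!: integral_unique)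
qed


section \<open>The potential of a periodic array of half-lines\<close>

text \<open>Points are \<open>(s, x)\<close> with \<open>s = \<rho>\<^sup>2\<close>; negative \<open>s\<close> is what lies beyond the axis.\<close>

definition pole_dist :: "real \<times> real \<Rightarrow> real"
  where "pole_dist y = sqrt (fst y + (snd y)\<^sup>2)"

definition half_line :: "real \<times> real \<Rightarrow> real"
  where "half_line y = ln (pole_dist y + snd y)"

text \<open>With r = \<open>pole_dist y\<close> and x = \<open>snd y\<close> these are x^a r^-b (r +
  x)^-c. They contain the gradient of \<open>half_line\<close>, and their span is closed under both
  partial derivatives, so smoothness and decay of all derivatives reduce to this one family.\<close>

definition monom3 :: "nat \<Rightarrow> nat \<Rightarrow> nat \<Rightarrow> real \<times> real \<Rightarrow> real"
  where "monom3 a b c y = snd y ^ a * inverse (pole_dist y) ^ b * inverse (pole_dist y + snd y) ^ c"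

definition half_dom :: "(real \<times> real) set"
  where "half_dom = {y. 0 < fst y + (snd y)\<^sup>2 \<and> (0 < fst y \<or> 0 < snd y)}"

lemma half_dom_pos:
  assumes "y \<in> half_dom"
  shows "0 < pole_dist y" and "0 < pole_dist y + snd y" and "(pole_dist y)\<^sup>2 = fst y + (snd y)\<^sup>2"
proof -
  show p: "0 < pole_dist y" and "(pole_dist y)\<^sup>2 = fst y + (snd y)\<^sup>2"
    using assms by (auto simp: half_dom_def pole_dist_def)
  show "0 < pole_dist y + snd y"
  proof (cases "0 < snd y")
    case False
    then have "0 < fst y" using assms by (auto simp: half_dom_def)
    then have "sqrt ((snd y)\<^sup>2) < pole_dist y"
      unfolding pole_dist_def by (intro real_sqrt_less_mono) simp
    then show ?thesis by simp
  qed (use p in simp)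
qed

lemma open_half_dom: "open half_dom"
  unfolding half_dom_def
  by (intro open_Collect_conj open_Collect_disj open_Collect_less continuous_intros)

lemma has_grad_pole_dist:
  assumes "y \<in> half_dom"
  shows "has_grad pole_dist (inverse (pole_dist y) / 2) (snd y * inverse (pole_dist y)) y"
proof -
  have "0 < fst y + (snd y)\<^sup>2" using assms by (simp add: half_dom_def)
  then have "((\<lambda>y. sqrt (fst y + (snd y)\<^sup>2)) has_derivative
     (\<lambda>v. (fst v + 2 * snd y * snd v) * (inverse (sqrt (fst y + (snd y)\<^sup>2)) / 2))) (at y)"
    by (auto intro!: derivative_eq_intros simp: field_simps)
  then show ?thesis
    unfolding has_grad_def pole_dist_def[abs_def]
    by (rule has_derivative_eq_rhs) (auto simp: algebra_simps)
qed

lemma has_grad_half_line: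
  assumes "y \<in> half_dom"
  shows "has_grad half_line (monom3 0 1 1 y / 2) (monom3 0 1 0 y) y"
proof -
  note p = half_dom_pos[OF assms]
  have "((\<lambda>y. pole_dist y + snd y) has_derivative
      (\<lambda>v. inverse (pole_dist y) / 2 * fst v + snd y * inverse (pole_dist y) * snd v + snd v)) (at y)"
    using has_grad_pole_dist[OF assms] unfolding has_grad_def
    by (intro has_derivative_add has_derivative_snd has_derivative_ident)
  then have "((\<lambda>y. ln (pole_dist y + snd y)) has_derivative
      (\<lambda>v. (inverse (pole_dist y) / 2 * fst v + snd y * inverse (pole_dist y) * snd v + snd v)
         * inverse (pole_dist y + snd y))) (at y)"
    by (rule has_derivative_ln[rotated]) (rule p(2))
  \<comment> \<open>The x-derivative of r + x is (r + x) / r, so the x-derivative of ln (r + x) is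
    just 1 / r.\<close>
  moreover have "(inverse (pole_dist y) / 2 * a + snd y * inverse (pole_dist y) * b + b)
      * inverse (pole_dist y + snd y) = monom3 0 1 1 y / 2 * a + monom3 0 1 0 y * b" for a b
  proof -
    have "snd y * inverse (pole_dist y) * b + b = inverse (pole_dist y) * b * (pole_dist y + snd y)"
      using p by (simp add: field_simps)
    then have "(inverse (pole_dist y) / 2 * a + snd y * inverse (pole_dist y) * b + b) * q
        = inverse (pole_dist y) / 2 * a * q + inverse (pole_dist y) * b * ((pole_dist y + snd y) * q)" for q
      by (simp add: distrib_right add.assoc mult.assoc)
    from this[of "inverse (pole_dist y + snd y)"] show ?thesis
      using p(2) by (simp add: monom3_def)
  qed
  ultimately show ?thesis
    unfolding has_grad_def half_line_def[abs_def] by simp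
qed

definition monom3_d1 :: "nat \<Rightarrow> nat \<Rightarrow> nat \<Rightarrow> real \<times> real \<Rightarrow> real"
  where "monom3_d1 a b c y = - (b * monom3 a (b + 2) c y + c * monom3 a (b + 1) (c + 1) y) / 2"

definition monom3_d2 :: "nat \<Rightarrow> nat \<Rightarrow> nat \<Rightarrow> real \<times> real \<Rightarrow> real"
  where "monom3_d2 a b c y =
    a * monom3 (a - 1) b c y - b * monom3 (a + 1) (b + 2) c y - c * monom3 a (b + 1) c y"

text \<open>Since the x-derivative of r + x is (r + x) / r, that of (r + x)^-c is - c (r + x)^-c /
  r; the result stays in the family without a sum as a new factor.\<close>

lemma has_grad_monom3:
  assumes "y \<in> half_dom"
  shows "has_grad (monom3 a b c) (monom3_d1 a b c y) (monom3_d2 a b c y) y"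
proof -
  note p = half_dom_pos[OF assms]
  define r q where "r = inverse (pole_dist y)" and "q = inverse (pole_dist y + snd y)"
  have dr: "((\<lambda>y. inverse (pole_dist y)) has_derivative
      (\<lambda>v. - (r ^ 3) * (fst v / 2 + snd y * snd v))) (at y)"
    by (rule has_derivative_eq_rhs[OF Deriv.has_derivative_inverse[OF _ has_grad_pole_dist[OF assms, unfolded has_grad_def]]])
      (use p in \<open>auto simp: r_def field_simps power3_eq_cube\<close>)
  have dq: "((\<lambda>y. inverse (pole_dist y + snd y)) has_derivative
      (\<lambda>v. - r * q * (q * fst v / 2 + snd v))) (at y)"
  proof -
    have "((\<lambda>y. pole_dist y + snd y) has_derivative
      (\<lambda>v. r / 2 * fst v + snd y * r * snd v + snd v)) (at y)"
      using has_grad_pole_dist[OF assms] unfolding has_grad_def r_def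
      by (intro has_derivative_add has_derivative_snd has_derivative_ident)
    from Deriv.has_derivative_inverse[OF _ this] p
    have "((\<lambda>y. inverse (pole_dist y + snd y)) has_derivative
        (\<lambda>v. - (q * (r / 2 * fst v + snd y * r * snd v + snd v) * q))) (at y)"
      by (simp add: q_def)
    moreover have "q * (r / 2 * h1 + snd y * r * h2 + h2) * q = r * q * (q * h1 / 2 + h2)" for h1 h2
    proof -
      have "snd y * r * h2 + h2 = r * h2 * (pole_dist y + snd y)"
        using p by (simp add: r_def field_simps)
      then have "(snd y * r * h2 + h2) * q = r * h2" using p(2) by (simp add: q_def)
      moreover have "q * (A + B) * q = q * A * q + q * (B * q)" for A B :: real
        by (simp add: algebra_simps)
      ultimately have "q * (r / 2 * h1 + (snd y * r * h2 + h2)) * q = q * (r / 2 * h1) * q + q * (r * h2)"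
        by metis
      then show ?thesis by (simp add: algebra_simps)
    qed
    ultimately show ?thesis by (simp only: mult_minus_left)
  qed
  have drb: "((\<lambda>y. inverse (pole_dist y) ^ b) has_derivative
      (\<lambda>v. - b * r ^ (b + 2) * (fst v / 2 + snd y * snd v))) (at y)"
    using has_derivative_power[OF dr, of b]
    by (rule has_derivative_eq_rhs)
      (unfold r_def[symmetric], cases b; auto simp: power_add power2_eq_square power3_eq_cube algebra_simps)
  have dqc: "((\<lambda>y. inverse (pole_dist y + snd y) ^ c) has_derivative
      (\<lambda>v. - c * r * (q ^ (c + 1) * fst v / 2 + q ^ c * snd v))) (at y)"
    using has_derivative_power[OF dq, of c]
    by (rule has_derivative_eq_rhs)
      (unfold q_def[symmetric], cases c; auto simp: algebra_simps add_divide_distrib diff_divide_distrib)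
  have dxa: "((\<lambda>y. snd y ^ a) has_derivative (\<lambda>v. a * snd y ^ (a - 1) * snd v)) (at y)"
    by (rule has_derivative_eq_rhs[OF has_derivative_power[OF has_derivative_snd[OF has_derivative_ident]]])
      auto
  from has_derivative_mult[OF has_derivative_mult[OF dxa drb] dqc]
  show ?thesis
    unfolding has_grad_def monom3_def[abs_def]
    by (rule has_derivative_eq_rhs)
      (unfold monom3_def monom3_d1_def monom3_d2_def r_def[symmetric] q_def[symmetric],
        auto simp: power_add algebra_simps add_divide_distrib diff_divide_distrib)
qed

lemma Cinf_half_line: "Cinf half_dom half_line"
proof -
  have "Ck k half_dom (monom3 a b c)" for k a b c
  proof (induction k arbitrary: a b c)
    case (Suc k)
    have 1: "monom3_d1 a b c = (\<lambda>y. (- b / 2) * monom3 a (b + 2) c y + (- c / 2) * monom3 a (b + 1) (c + 1) y)"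
      by (auto simp: monom3_d1_def field_simps)
    have 2: "monom3_d2 a b c = (\<lambda>y. a * monom3 (a - 1) b c y + (- b) * monom3 (a + 1) (b + 2) c y
        + (- c) * monom3 a (b + 1) c y)"
      by (auto simp: monom3_d2_def field_simps)
    show ?case
      by (rule Ck_gradI[OF has_grad_monom3]) (assumption, unfold 1 2, (intro Ck_add Ck_mult Ck_const Suc)+)
  qed simp
  then have "Cinf half_dom (\<lambda>y. monom3 0 1 1 y / 2)" "Cinf half_dom (monom3 0 1 0)"
    using Ck_mult[OF _ Ck_const[of _ _ "1/2"], of _ half_dom "monom3 0 1 1"]
    by (auto simp: Cinf_def open_half_dom)
  from Cinf_gradI[OF open_half_dom has_grad_half_line this] show ?thesis .
qed

section \<open>Termwise differentiation and estimates far from the end points\<close>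

lemma has_grad_series:
  assumes U: "open U" "convex U"
    and d: "\<And>n y. y \<in> U \<Longrightarrow> has_grad (f n) (p n y) (q n y) y"
    and M: "summable (M :: nat \<Rightarrow> real)"
    and bd: "\<And>n y. n \<ge> m \<Longrightarrow> y \<in> U \<Longrightarrow> \<bar>f n y\<bar> \<le> M n \<and> \<bar>p n y\<bar> \<le> M n \<and> \<bar>q n y\<bar> \<le> M n"
    and y: "y \<in> U"
  shows "has_grad (\<lambda>y. \<Sum>n. f n y) (\<Sum>n. p n y) (\<Sum>n. q n y) y"
proof -
  have ev: "\<forall>\<^sub>F n in sequentially. \<forall>y\<in>U. norm (g n y) \<le> M n"
    if "\<And>n y. n \<ge> m \<Longrightarrow> y \<in> U \<Longrightarrow> \<bar>g n y\<bar> \<le> M n" for g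
    unfolding eventually_sequentially using that by (intro exI[of _ m]) auto
  have up: "uniform_limit U (\<lambda>n y. \<Sum>i<n. p i y) (\<lambda>y. \<Sum>i. p i y) sequentially"
    and uq: "uniform_limit U (\<lambda>n y. \<Sum>i<n. q i y) (\<lambda>y. \<Sum>i. q i y) sequentially"
    by (intro Weierstrass_m_test_ev[OF ev M]; use bd in blast)+
  have sf: "summable (\<lambda>n. f n y)" if "y \<in> U" for y
    by (rule summable_comparison_test'[OF M, of m]) (use bd[OF _ that] in simp)
  have "\<exists>g. \<forall>y\<in>U. (\<lambda>n. f n y) sums g y \<and>
      (g has_derivative (\<lambda>v. (\<Sum>n. p n y) * fst v + (\<Sum>n. q n y) * snd v)) (at y within U)"
  proof (rule has_derivative_series[where f' = "\<lambda>n y v. p n y * fst v + q n y * snd v"])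
    show "(f n has_derivative (\<lambda>v. p n y * fst v + q n y * snd v)) (at y within U)"
      if "y \<in> U" for n y
      using d[OF that] unfolding has_grad_def by (rule has_derivative_at_withinI)
  next
    fix e :: real assume e: "e > 0"
    have "\<forall>\<^sub>F n in sequentially. \<forall>y\<in>U. dist (\<Sum>i<n. p i y) (\<Sum>i. p i y) < e / 2"
      "\<forall>\<^sub>F n in sequentially. \<forall>y\<in>U. dist (\<Sum>i<n. q i y) (\<Sum>i. q i y) < e / 2"
      using uniform_limitD[OF up, of "e/2"] uniform_limitD[OF uq, of "e/2"] e by auto
    then show "\<forall>\<^sub>F n in sequentially. \<forall>y\<in>U. \<forall>h.
        norm ((\<Sum>i<n. p i y * fst h + q i y * snd h) - ((\<Sum>n. p n y) * fst h + (\<Sum>n. q n y) * snd h))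
          \<le> e * norm h"
    proof eventually_elim
      case (elim n)
      show ?case
      proof (intro ballI allI)
        fix y h assume y: "y \<in> U"
        let ?a = "(\<Sum>i<n. p i y) - (\<Sum>n. p n y)" and ?b = "(\<Sum>i<n. q i y) - (\<Sum>n. q n y)"
        have "\<bar>?a\<bar> \<le> e / 2" "\<bar>?b\<bar> \<le> e / 2" using elim y by (auto simp: dist_real_def less_imp_le)
        moreover have "\<bar>fst h\<bar> \<le> norm h" "\<bar>snd h\<bar> \<le> norm h"
          using norm_fst_le[of "fst h" "snd h"] norm_snd_le[of "snd h" "fst h"] by simp_all
        ultimately have "\<bar>?a\<bar> * \<bar>fst h\<bar> \<le> e / 2 * norm h" "\<bar>?b\<bar> * \<bar>snd h\<bar> \<le> e / 2 * norm h"
          using e by (intro mult_mono; simp)+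
        moreover have "(\<Sum>i<n. p i y * fst h + q i y * snd h) - ((\<Sum>n. p n y) * fst h + (\<Sum>n. q n y) * snd h)
            = ?a * fst h + ?b * snd h"
          by (simp add: sum.distrib sum_distrib_right left_diff_distrib)
        moreover have "\<bar>?a * fst h + ?b * snd h\<bar> \<le> \<bar>?a\<bar> * \<bar>fst h\<bar> + \<bar>?b\<bar> * \<bar>snd h\<bar>"
          using abs_triangle_ineq[of "?a * fst h" "?b * snd h"] by (simp only: abs_mult)
        ultimately show "norm ((\<Sum>i<n. p i y * fst h + q i y * snd h) -
            ((\<Sum>n. p n y) * fst h + (\<Sum>n. q n y) * snd h)) \<le> e * norm h"
          unfolding real_norm_def by linarith
      qed
    qed
  next
    show "(\<lambda>n. f n y) sums (\<Sum>n. f n y)" using sf[OF y] by (rule summable_sums)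
  qed (use U y in auto)
  then obtain g where g: "\<And>y. y \<in> U \<Longrightarrow> (\<lambda>n. f n y) sums g y"
    "\<And>y. y \<in> U \<Longrightarrow> (g has_derivative (\<lambda>v. (\<Sum>n. p n y) * fst v + (\<Sum>n. q n y) * snd v)) (at y within U)"
    by blast
  have "(g has_derivative (\<lambda>v. (\<Sum>n. p n y) * fst v + (\<Sum>n. q n y) * snd v)) (at y)"
    using g(2)[OF y] at_within_open[OF y U(1)] by simp
  then show ?thesis
    unfolding has_grad_def
    by (rule has_derivative_transform_within_open[OF _ U(1) y]) (use g(1) sums_unique in blast)
qed

lemma summable_inverse_Suc_sq: "summable (\<lambda>n. C / (real (Suc n))\<^sup>2)"
proof -
  have "summable (\<lambda>n. inverse (real (Suc n) ^ 2))"
    by (rule iffD2[OF summable_Suc_iff inverse_power_summable]) simp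
  from summable_mult[OF this, of C] show ?thesis by (simp add: divide_inverse)
qed

text \<open>The end point lies at distance about \<open>k\<close> while \<open>s\<close> and
  \<open>x\<close> are bounded by \<open>B\<close>; the factor 8 leaves room for both r and X to be
  comparable to \<open>k\<close>. The last estimate comes from (r - X)(r + X) = s.\<close>

lemma far_bounds:
  fixes B k s x :: real
  assumes B: "B \<ge> 1" and y: "\<bar>s\<bar> \<le> B" "\<bar>x\<bar> \<le> B" and k: "k \<ge> 8 * B"
  defines "X \<equiv> k + x" and "r \<equiv> pole_dist (s, k + x)"
  shows "k / 2 \<le> X" and "1 \<le> X" and "X / 2 \<le> r" and "k / 4 \<le> r" and "\<bar>r - X\<bar> \<le> 2 * B / k"
proof -
  show 1: "k / 2 \<le> X" using k y B by (simp add: X_def abs_le_iff field_simps)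
  then show 2: "1 \<le> X" using k B by simp
  have r: "r = sqrt (s + X\<^sup>2)" by (simp add: pole_dist_def r_def X_def)
  have x4: "X \<ge> 4 * B" using 1 k by simp
  have "4 * B * (4 * B) \<le> X * X" by (rule mult_mono) (use x4 B in auto)
  moreover have "B * 1 \<le> B * B" using B by (intro mult_left_mono) auto
  moreover have "0 \<le> B * B" by simp
  ultimately have sx: "4 * B \<le> X\<^sup>2" unfolding power2_eq_square by linarith
  have "(X / 2)\<^sup>2 \<le> s + X\<^sup>2"
    using sx y B by (simp add: power_divide abs_le_iff)
  then show 3: "X / 2 \<le> r" unfolding r by (rule real_le_rsqrt)
  then show "k / 4 \<le> r" using 1 by simp
  have "r\<^sup>2 = s + X\<^sup>2" unfolding r using sx y B by (simp add: abs_le_iff)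
  then have "(r - X) * (r + X) = s" by (simp add: power2_eq_square algebra_simps)
  moreover have px: "k / 2 \<le> r + X" using 1 3 2 by simp
  have kp: "k > 0" using k B by simp
  ultimately have "\<bar>r - X\<bar> * \<bar>r + X\<bar> \<le> B" using y by (metis abs_mult)
  moreover have "k / 2 \<le> \<bar>r + X\<bar>" using px by linarith
  then have "\<bar>r - X\<bar> * (k / 2) \<le> \<bar>r - X\<bar> * \<bar>r + X\<bar>"
    by (intro mult_left_mono) auto
  ultimately show "\<bar>r - X\<bar> \<le> 2 * B / k"
    using kp by (simp add: field_simps)
qed

text \<open>Both r and r + X are at least a constant times X, so the monomial is at most of order
  X^(a - b - c). The hypothesis \<open>dec\<close> turns this into X^-2, as X \<ge> 1, and X \<ge> k
  / 2.\<close>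

lemma monom3_far_real:
  fixes B k s x :: real
  assumes "B \<ge> 1" and "\<bar>s\<bar> \<le> B" and "\<bar>x\<bar> \<le> B" and "k \<ge> 8 * B"
    and dec: "a + 2 \<le> b + c"
  shows "\<bar>monom3 a b c (s, k + x)\<bar> \<le> 2 ^ b * 4 / k\<^sup>2"
proof -
  define X r where "X = k + x" and "r = pole_dist (s, k + x)"
  note f = far_bounds[OF assms(1-4), folded X_def r_def]
  have kp: "k > 0" using assms by linarith
  have x: "X > 0" using f(2) by linarith
  have ir: "inverse r \<le> 2 * inverse X" "0 \<le> inverse r"
    using f(3) x le_imp_inverse_le[of "X / 2" r] by (auto simp: inverse_eq_divide)
  have rx: "inverse (r + X) \<le> inverse X" "0 \<le> inverse (r + X)"
    using f(3) x by (auto intro!: le_imp_inverse_le)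
  have p1: "inverse r ^ b \<le> (2 * inverse X) ^ b" by (rule power_mono[OF ir])
  have p2: "inverse (r + X) ^ c \<le> inverse X ^ c" by (rule power_mono[OF rx])
  have p3: "0 \<le> inverse r ^ b" by (rule zero_le_power[OF ir(2)])
  have p4: "0 \<le> inverse (r + X) ^ c" by (rule zero_le_power[OF rx(2)])
  have x0: "0 \<le> X ^ a" "0 \<le> (2 * inverse X) ^ b" using x by simp_all
  have nn: "0 \<le> X ^ a * inverse r ^ b * inverse (r + X) ^ c"
    by (intro mult_nonneg_nonneg p3 p4 x0)
  have e: "X ^ a * inverse X ^ (b + c) \<le> inverse X ^ 2"
  proof -
    obtain d where d: "b + c = a + (2 + d)" using dec by (metis add.assoc le_Suc_ex)
    have "X ^ a * inverse X ^ (b + c) = (X * inverse X) ^ a * inverse X ^ 2 * inverse X ^ d"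
      unfolding d power_add power_mult_distrib by (simp add: ac_simps)
    also have "\<dots> = inverse X ^ 2 * inverse X ^ d" using x by simp
    also have "\<dots> \<le> inverse X ^ 2 * 1"
      using f(2) x by (intro mult_left_mono power_le_one) (auto simp: inverse_le_1_iff)
    finally show ?thesis by simp
  qed
  have k2: "inverse X ^ 2 \<le> 4 / k\<^sup>2"
  proof -
    have "inverse X ^ 2 \<le> (2 / k) ^ 2"
      using f(1) x kp le_imp_inverse_le[of "k / 2" X] by (intro power_mono) (auto simp: inverse_eq_divide)
    then show ?thesis by (simp add: power_divide)
  qed
  have "X ^ a * inverse r ^ b * inverse (r + X) ^ c \<le> X ^ a * (2 * inverse X) ^ b * inverse X ^ c"
    by (rule mult_mono[OF mult_left_mono[OF p1 x0(1)] p2]) (use x0 p4 in auto)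
  also have "\<dots> = 2 ^ b * (X ^ a * inverse X ^ (b + c))"
    by (simp add: power_mult_distrib power_add)
  also have "\<dots> \<le> 2 ^ b * (4 / k\<^sup>2)"
    by (intro mult_left_mono order_trans[OF e k2]) simp
  finally show ?thesis
    using nn by (simp add: monom3_def X_def r_def)
qed

lemma inverse_pole_far:
  fixes B k s x :: real
  assumes "B \<ge> 1" and "\<bar>s\<bar> \<le> B" and "\<bar>x\<bar> \<le> B" and "k \<ge> 8 * B"
  shows "\<bar>monom3 0 1 0 (s, k + x) - 1 / k\<bar> \<le> 12 * B / k\<^sup>2"
proof -
  define X r where "X = k + x" and "r = pole_dist (s, k + x)"
  note f = far_bounds[OF assms(1-4), folded X_def r_def]
  have kp: "k > 0" using assms by linarith
  have rp: "r > 0" using f(4) kp by linarith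
  have "2 * B / k \<le> 2 * B / 1" by (rule divide_left_mono) (use assms kp in auto)
  then have b: "\<bar>r - k\<bar> \<le> 3 * B" using f(5) assms(3) unfolding X_def by linarith
  have "1 / r - 1 / k = (k - r) / (r * k)" using rp kp by (simp add: field_simps)
  then have "\<bar>1 / r - 1 / k\<bar> = \<bar>r - k\<bar> / (r * k)"
    using rp kp by (simp add: abs_divide abs_minus_commute)
  also have "\<dots> \<le> 3 * B / (k / 4 * k)"
    using b f(4) kp assms by (intro frac_le mult_right_mono) auto
  also have "\<dots> = 12 * B / k\<^sup>2"
    by (simp add: power2_eq_square)
  finally show ?thesis by (simp add: monom3_def r_def inverse_eq_divide)
qed

text \<open>Here r + X = 2 k (1 + t) with t = x / k + O(1 / k^2). Expanding ln (1 + t) to first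
  order leaves an error of second order in 1 / k, which is why exactly ln (2 k) and x / k are
  subtracted in \<open>array_term\<close>.\<close>

lemma half_line_far:
  fixes B k s x :: real
  assumes "B \<ge> 1" and "\<bar>s\<bar> \<le> B" and "\<bar>x\<bar> \<le> B" and "k \<ge> 8 * B"
  shows "\<bar>half_line (s, k + x) - ln (2 * k) - x / k\<bar> \<le> 9 * B\<^sup>2 / k\<^sup>2"
proof -
  define X r where "X = k + x" and "r = pole_dist (s, k + x)"
  note f = far_bounds[OF assms(1-4), folded X_def r_def]
  have kp: "k > 0" using assms by linarith
  have rp: "r > 0" using f(4) kp by linarith
  have xp: "X > 0" using f(2) by linarith
  define d t where "d = (r - X) / (2 * k)" and "t = d + x / k"
  have t1: "1 + t = (r + X) / (2 * k)" using kp by (simp add: t_def d_def X_def field_simps)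
  have "\<bar>d\<bar> = \<bar>r - X\<bar> / (2 * k)" using kp by (simp add: d_def)
  also have "\<dots> \<le> (2 * B / k) / (2 * k)" by (rule divide_right_mono[OF f(5)]) (use kp in simp)
  finally have d: "\<bar>d\<bar> \<le> B / k\<^sup>2" by (simp add: power2_eq_square)
  define w where "w = B / k"
  have w: "0 \<le> w" "w \<le> 1 / 8" using assms kp by (simp_all add: w_def field_simps)
  have dw: "B / k\<^sup>2 \<le> w\<^sup>2"
  proof -
    have "B \<le> B\<^sup>2" using assms by (simp add: power2_eq_square)
    then show ?thesis using kp by (simp add: w_def power_divide divide_right_mono)
  qed
  have "w\<^sup>2 \<le> 1 / 8 * w" unfolding power2_eq_square by (rule mult_right_mono[OF w(2) w(1)])
  moreover have "\<bar>x / k\<bar> \<le> w" using assms kp by (simp add: w_def divide_right_mono)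
  ultimately have tb: "\<bar>t\<bar> \<le> 9 / 8 * w"
    using d dw abs_triangle_ineq[of d "x / k"] unfolding t_def by linarith
  then have "\<bar>t\<bar> \<le> 1 / 2" using w by linarith
  then have l: "\<bar>ln (1 + t) - t\<bar> \<le> 2 * t\<^sup>2" by (rule abs_ln_one_plus_x_minus_x_bound)
  have "half_line (s, k + x) - ln (2 * k) = ln (1 + t)"
    using kp rp xp by (simp add: half_line_def t1 ln_div X_def r_def)
  then have "\<bar>half_line (s, k + x) - ln (2 * k) - x / k\<bar> \<le> 2 * t\<^sup>2 + w\<^sup>2"
    using l d dw by (simp add: t_def)
  also have "2 * t\<^sup>2 + w\<^sup>2 \<le> 9 * w\<^sup>2"
  proof -
  have "t\<^sup>2 \<le> (9 / 8 * w)\<^sup>2"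
    using tb by (metis abs_ge_zero power2_abs power_mono)
  then have "2 * t\<^sup>2 + w\<^sup>2 \<le> 2 * (81 / 64 * w\<^sup>2) + w\<^sup>2"
    by (simp add: power_mult_distrib power_divide)
  also have "\<dots> \<le> 9 * w\<^sup>2" using zero_le_power2[of w] by linarith
  finally show ?thesis .
  qed
  finally show ?thesis by (simp add: w_def power_divide)
qed

section \<open>The renormalized series of shifted half-line potentials\<close>

context
  fixes L :: real
  assumes L: "L > 0"
begin

definition shift :: "nat \<Rightarrow> real \<times> real \<Rightarrow> real \<times> real"
  where "shift n y = (fst y, real (Suc n) * L + snd y)"

text \<open>This is the condition that \<open>shift 0 y\<close> lies in \<open>half_dom\<close>. The
  other end points are further away and impose nothing more (\<open>shift_half_dom\<close>).\<close>

definition array_dom :: "(real \<times> real) set"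
  where "array_dom = {y. 0 < fst y \<or> (0 < snd y + L \<and> 0 < fst y + (snd y + L)\<^sup>2)}"

definition monom_sum :: "nat \<Rightarrow> nat \<Rightarrow> nat \<Rightarrow> real \<times> real \<Rightarrow> real"
  where "monom_sum a b c y = (\<Sum>n. monom3 a b c (shift n y))"

text \<open>The sum of the terms 1 / r diverges like the harmonic series; the subtracted part is the
  x-derivative of the linear counterterm in \<open>array_term\<close>.\<close>

definition array_d2 :: "real \<times> real \<Rightarrow> real"
  where "array_d2 y = (\<Sum>n. monom3 0 1 0 (shift n y) - 1 / (real (Suc n) * L))"

text \<open>The subtracted terms make the series converge; at \<open>s = 0\<close> the sum is
  \<open>- ln \<Gamma>(1 + x / L) - \<gamma> x / L\<close>.\<close>

definition array_term :: "nat \<Rightarrow> real \<times> real \<Rightarrow> real"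
  where "array_term n y =
    half_line (shift n y) - ln (2 * (real (Suc n) * L)) - snd y / (real (Suc n) * L)"

definition array :: "real \<times> real \<Rightarrow> real"
  where "array y = (\<Sum>n. array_term n y)"

lemma open_array_dom: "open array_dom"
  unfolding array_dom_def
  by (intro open_Collect_conj open_Collect_disj open_Collect_less continuous_intros)

lemma shift_half_dom: "y \<in> array_dom \<Longrightarrow> shift n y \<in> half_dom"
proof -
  assume y: "y \<in> array_dom"
  have "L \<le> real (Suc n) * L" using L by simp
  then have 1: "snd y + L \<le> real (Suc n) * L + snd y" by simp
  show ?thesis
  proof (cases "0 < fst y")
    case True
    then show ?thesis
      by (auto simp: half_dom_def shift_def intro: add_pos_nonneg)
  next
    case False
    then have *: "0 < snd y + L" "0 < fst y + (snd y + L)\<^sup>2" using y by (auto simp: array_dom_def)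
    have "(snd y + L)\<^sup>2 \<le> (real (Suc n) * L + snd y)\<^sup>2"
      using 1 * by (intro power_mono) auto
    then have "0 < fst y + (real (Suc n) * L + snd y)\<^sup>2" "0 < real (Suc n) * L + snd y"
      using * 1 by linarith+
    then show ?thesis
      by (simp add: half_dom_def shift_def del: of_nat_Suc)
  qed
qed

lemma monom3_far:
  fixes B :: real
  assumes B: "B \<ge> 1" and y: "\<bar>fst y\<bar> \<le> B" "\<bar>snd y\<bar> \<le> B" and n: "real (Suc n) * L \<ge> 8 * B"
    and dec: "a + 2 \<le> b + c"
  shows "\<bar>monom3 a b c (shift n y)\<bar> \<le> (2 ^ b * 4 / L\<^sup>2) / (real (Suc n))\<^sup>2"
proof -
  define k where "k = real (Suc n) * L"
  have "\<bar>monom3 a b c (fst y, k + snd y)\<bar> \<le> 2 ^ b * 4 / k\<^sup>2"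
    using monom3_far_real[OF B y _ dec] n by (simp add: k_def del: of_nat_Suc)
  also have "\<dots> = (2 ^ b * 4 / L\<^sup>2) / (real (Suc n))\<^sup>2"
    by (simp add: k_def power_mult_distrib mult.commute del: of_nat_Suc)
  finally show ?thesis by (simp only: shift_def k_def)
qed

lemma locally_far:
  obtains B n0 :: real where "B \<ge> 1" and "\<And>y'. y' \<in> ball (y :: real \<times> real) 1 \<Longrightarrow> \<bar>fst y'\<bar> \<le> B \<and> \<bar>snd y'\<bar> \<le> B"
proof -
  have "\<bar>fst y'\<bar> \<le> norm y + 1 \<and> \<bar>snd y'\<bar> \<le> norm y + 1" if "y' \<in> ball y 1" for y'
  proof -
    have "norm y' \<le> norm y + 1"
      using that norm_triangle_ineq2[of y' y] by (simp add: dist_norm norm_minus_commute)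
    then show ?thesis
      using norm_fst_le[of "fst y'" "snd y'"] norm_snd_le[of "snd y'" "fst y'"] by simp
  qed
  then show thesis by (intro that[of "norm y + 1"]) auto
qed

lemma far_ex: "\<exists>n0. \<forall>n\<ge>n0. real (Suc n) * L \<ge> B"
proof -
  obtain n0 where n0: "real n0 * L > B" using reals_Archimedean3[OF L] by blast
  have "real (Suc n) * L \<ge> B" if "n \<ge> n0" for n
  proof -
    have "real n0 * L \<le> real (Suc n) * L" using that L by (intro mult_right_mono) auto
    then show ?thesis using n0 by simp
  qed
  then show ?thesis by blast
qed

text \<open>In a ball of radius at most 1 the coordinates are bounded by some \<open>B\<close>, and
  all but finitely many end points are then at distance at least 8 B. From that index on the bounds
  are a summable majorant, uniform on the ball.\<close>

lemma has_grad_shifted_series: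
  assumes d: "\<And>n y. y \<in> array_dom \<Longrightarrow> has_grad (f n) (p n y) (q n y) y"
    and bd: "\<And>B. B \<ge> 1 \<Longrightarrow> \<exists>C. \<forall>n y. \<bar>fst y\<bar> \<le> B \<and> \<bar>snd y\<bar> \<le> B \<and> real (Suc n) * L \<ge> 8 * B \<longrightarrow>
       \<bar>f n y\<bar> \<le> C / (real (Suc n))\<^sup>2 \<and> \<bar>p n y\<bar> \<le> C / (real (Suc n))\<^sup>2 \<and> \<bar>q n y\<bar> \<le> C / (real (Suc n))\<^sup>2"
    and y: "y \<in> array_dom"
  shows "has_grad (\<lambda>y. \<Sum>n. f n y) (\<Sum>n. p n y) (\<Sum>n. q n y) y"
proof -
  obtain B :: real where B: "B \<ge> 1" "\<And>y'. y' \<in> ball y 1 \<Longrightarrow> \<bar>fst y'\<bar> \<le> B \<and> \<bar>snd y'\<bar> \<le> B"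
    using locally_far by metis
  obtain C where C: "\<And>n y. \<bar>fst y\<bar> \<le> B \<Longrightarrow> \<bar>snd y\<bar> \<le> B \<Longrightarrow> real (Suc n) * L \<ge> 8 * B \<Longrightarrow>
      \<bar>f n y\<bar> \<le> C / (real (Suc n))\<^sup>2 \<and> \<bar>p n y\<bar> \<le> C / (real (Suc n))\<^sup>2 \<and> \<bar>q n y\<bar> \<le> C / (real (Suc n))\<^sup>2"
    using bd[OF B(1)] by blast
  obtain n0 where n0: "\<And>n. n \<ge> n0 \<Longrightarrow> real (Suc n) * L \<ge> 8 * B" using far_ex by blast
  obtain e where e: "e > 0" "ball y e \<subseteq> array_dom" using open_array_dom y openE by blast
  let ?U = "ball y (min e 1)"
  show ?thesis
  proof (rule has_grad_series[where U = ?U and M = "\<lambda>n. C / (real (Suc n))\<^sup>2" and m = n0])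
    show "summable (\<lambda>n. C / (real (Suc n))\<^sup>2)" by (rule summable_inverse_Suc_sq)
  next
    fix n z assume "z \<in> ?U"
    then have z: "z \<in> ball y 1" "z \<in> array_dom" using e by auto
    show "has_grad (f n) (p n z) (q n z) z" using d z by blast
    show "\<bar>f n z\<bar> \<le> C / (real (Suc n))\<^sup>2 \<and> \<bar>p n z\<bar> \<le> C / (real (Suc n))\<^sup>2 \<and> \<bar>q n z\<bar> \<le> C / (real (Suc n))\<^sup>2"
      if "n \<ge> n0" using C[of z n] B(2)[OF z(1)] n0[OF that] by blast
  qed (use e in auto)
qed

lemma has_grad_shift:
  assumes "has_grad f a b (shift n y)"
  shows "has_grad (\<lambda>y. f (shift n y)) a b y"
proof -
  have "(shift n has_derivative (\<lambda>v. v)) (at y)"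
    unfolding shift_def[abs_def]
    by (rule has_derivative_eq_rhs[OF has_derivative_Pair[OF has_derivative_fst[OF has_derivative_ident]
       has_derivative_add[OF has_derivative_const has_derivative_snd[OF has_derivative_ident]]]]) auto
  from has_derivative_compose[OF this assms[unfolded has_grad_def]] show ?thesis
    by (simp add: has_grad_def)
qed

lemma summable_shifted:
  assumes "\<And>B. B \<ge> 1 \<Longrightarrow> \<exists>C. \<forall>n y. \<bar>fst y\<bar> \<le> B \<and> \<bar>snd y\<bar> \<le> B \<and> real (Suc n) * L \<ge> 8 * B \<longrightarrow>
       \<bar>f n y\<bar> \<le> C / (real (Suc n))\<^sup>2"
  shows "summable (\<lambda>n. f n y)"
proof -
  obtain B :: real where B: "B \<ge> 1" "\<bar>fst y\<bar> \<le> B \<and> \<bar>snd y\<bar> \<le> B"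
    using locally_far[of y] by (metis centre_in_ball zero_less_one)
  obtain C where C: "\<And>n. real (Suc n) * L \<ge> 8 * B \<Longrightarrow> \<bar>f n y\<bar> \<le> C / (real (Suc n))\<^sup>2"
    using assms[OF B(1)] B(2) by blast
  obtain n0 where n0: "\<And>n. n \<ge> n0 \<Longrightarrow> real (Suc n) * L \<ge> 8 * B" using far_ex by blast
  show ?thesis
    by (rule summable_comparison_test'[OF summable_inverse_Suc_sq[of C], of n0]) (use C n0 in auto)
qed

lemma monom3_far_ex:
  assumes "a + 2 \<le> b + c" and "B \<ge> 1"
  shows "\<exists>C. \<forall>n y. \<bar>fst y\<bar> \<le> B \<and> \<bar>snd y\<bar> \<le> B \<and> real (Suc n) * L \<ge> 8 * B \<longrightarrow>
       \<bar>monom3 a b c (shift n y)\<bar> \<le> C / (real (Suc n))\<^sup>2"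
  using monom3_far[OF assms(2) _ _ _ assms(1)] by blast

lemma summable_monom: "a + 2 \<le> b + c \<Longrightarrow> summable (\<lambda>n. monom3 a b c (shift n y))"
  by (rule summable_shifted) (rule monom3_far_ex)

lemma far_ex_max:
  assumes "\<exists>C::real. \<forall>n y. P n y \<longrightarrow> f n y \<le> C / (real (Suc n))\<^sup>2"
    and "\<exists>C::real. \<forall>n y. P n y \<longrightarrow> g n y \<le> C / (real (Suc n))\<^sup>2"
    and "\<exists>C::real. \<forall>n y. P n y \<longrightarrow> h n y \<le> C / (real (Suc n))\<^sup>2"
  shows "\<exists>C. \<forall>n y. P n y \<longrightarrow> f n y \<le> C / (real (Suc n))\<^sup>2 \<and> g n y \<le> C / (real (Suc n))\<^sup>2
    \<and> h n y \<le> C / (real (Suc n))\<^sup>2"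
proof -
  obtain C1 C2 C3 where *: "\<And>n y. P n y \<Longrightarrow> f n y \<le> C1 / (real (Suc n))\<^sup>2"
    "\<And>n y. P n y \<Longrightarrow> g n y \<le> C2 / (real (Suc n))\<^sup>2" "\<And>n y. P n y \<Longrightarrow> h n y \<le> C3 / (real (Suc n))\<^sup>2"
    using assms by blast
  let ?C = "max C1 (max C2 C3)"
  have le: "c / (real (Suc n))\<^sup>2 \<le> ?C / (real (Suc n))\<^sup>2" if "c \<le> ?C" for c n
    using that by (intro divide_right_mono) auto
  have "C1 \<le> ?C" "C2 \<le> ?C" "C3 \<le> ?C" by auto
  then show ?thesis
    using * le by (intro exI[of _ ?C]) (meson order_trans)
qed

lemma far_ex_add:
  assumes "\<exists>C::real. \<forall>n y. P n y \<longrightarrow> \<bar>f n y\<bar> \<le> C / (real (Suc n))\<^sup>2"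
    and "\<exists>C::real. \<forall>n y. P n y \<longrightarrow> \<bar>g n y\<bar> \<le> C / (real (Suc n))\<^sup>2"
  shows "\<exists>C. \<forall>n y. P n y \<longrightarrow> \<bar>u * f n y + v * g n y\<bar> \<le> C / (real (Suc n))\<^sup>2"
proof -
  obtain C1 C2 where *: "\<And>n y. P n y \<Longrightarrow> \<bar>f n y\<bar> \<le> C1 / (real (Suc n))\<^sup>2"
    "\<And>n y. P n y \<Longrightarrow> \<bar>g n y\<bar> \<le> C2 / (real (Suc n))\<^sup>2" using assms by blast
  have "\<bar>u * f n y + v * g n y\<bar> \<le> (\<bar>u\<bar> * C1 + \<bar>v\<bar> * C2) / (real (Suc n))\<^sup>2" if "P n y" for n y
  proof -
    have "\<bar>u * f n y + v * g n y\<bar> \<le> \<bar>u\<bar> * \<bar>f n y\<bar> + \<bar>v\<bar> * \<bar>g n y\<bar>"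
      by (metis abs_mult abs_triangle_ineq)
    also have "\<dots> \<le> \<bar>u\<bar> * (C1 / (real (Suc n))\<^sup>2) + \<bar>v\<bar> * (C2 / (real (Suc n))\<^sup>2)"
      using *[OF that] by (intro add_mono mult_left_mono) auto
    finally show ?thesis by (simp add: add_divide_distrib)
  qed
  then show ?thesis by blast
qed

lemma monom3_d1_far_ex:
  assumes "a + 2 \<le> b + c" and "B \<ge> 1"
  shows "\<exists>C. \<forall>n y. \<bar>fst y\<bar> \<le> B \<and> \<bar>snd y\<bar> \<le> B \<and> real (Suc n) * L \<ge> 8 * B \<longrightarrow>
       \<bar>monom3_d1 a b c (shift n y)\<bar> \<le> C / (real (Suc n))\<^sup>2"
proof -
  have "monom3_d1 a b c = (\<lambda>y. (- b / 2) * monom3 a (b + 2) c y + (- c / 2) * monom3 a (b + 1) (c + 1) y)"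
    by (auto simp: monom3_d1_def field_simps)
  then show ?thesis
    by (simp only:) (rule far_ex_add[OF monom3_far_ex monom3_far_ex]; use assms in simp)
qed

lemma monom3_d2_far_ex:
  assumes "a + 2 \<le> b + c" and "B \<ge> 1"
  shows "\<exists>C. \<forall>n y. \<bar>fst y\<bar> \<le> B \<and> \<bar>snd y\<bar> \<le> B \<and> real (Suc n) * L \<ge> 8 * B \<longrightarrow>
       \<bar>monom3_d2 a b c (shift n y)\<bar> \<le> C / (real (Suc n))\<^sup>2"
proof -
  have "monom3_d2 a b c = (\<lambda>y. 1 * (a * monom3 (a - 1) b c y + (- b) * monom3 (a + 1) (b + 2) c y)
      + (- c) * monom3 a (b + 1) c y)"
    by (auto simp: monom3_d2_def field_simps)
  then show ?thesis
    by (simp only:) (rule far_ex_add[OF far_ex_add[OF monom3_far_ex monom3_far_ex] monom3_far_ex]; use assms in simp)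
qed

lemma has_grad_monom_sum:
  assumes "a + 2 \<le> b + c" and "y \<in> array_dom"
  shows "has_grad (monom_sum a b c)
    (- (b * monom_sum a (b + 2) c y + c * monom_sum a (b + 1) (c + 1) y) / 2)
    (a * monom_sum (a - 1) b c y - b * monom_sum (a + 1) (b + 2) c y - c * monom_sum a (b + 1) c y) y"
proof -
  have "has_grad (\<lambda>y. \<Sum>n. monom3 a b c (shift n y)) (\<Sum>n. monom3_d1 a b c (shift n y))
      (\<Sum>n. monom3_d2 a b c (shift n y)) y"
    by (rule has_grad_shifted_series[OF _ far_ex_max assms(2)])
      (intro has_grad_shift has_grad_monom3 shift_half_dom monom3_far_ex monom3_d1_far_ex
        monom3_d2_far_ex assms(1); assumption)+
  moreover have "(\<Sum>n. monom3_d1 a b c (shift n y)) =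
      - (b * monom_sum a (b + 2) c y + c * monom_sum a (b + 1) (c + 1) y) / 2"
  proof -
    have "summable (\<lambda>n. monom3 a (b + 2) c (shift n y))" "summable (\<lambda>n. monom3 a (b + 1) (c + 1) (shift n y))"
      using assms(1) by (auto intro!: summable_monom)
    then have "(\<lambda>n. monom3_d1 a b c (shift n y)) sums
      (- (b * monom_sum a (b + 2) c y + c * monom_sum a (b + 1) (c + 1) y) / 2)"
      unfolding monom3_d1_def monom_sum_def
      by (intro sums_divide sums_minus sums_add sums_mult summable_sums)
    then show ?thesis by (rule sums_unique[symmetric])
  qed
  moreover have "(\<Sum>n. monom3_d2 a b c (shift n y)) =
      a * monom_sum (a - 1) b c y - b * monom_sum (a + 1) (b + 2) c y - c * monom_sum a (b + 1) c y"
  proof -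
    have "summable (\<lambda>n. monom3 (a - 1) b c (shift n y))" "summable (\<lambda>n. monom3 (a + 1) (b + 2) c (shift n y))"
      "summable (\<lambda>n. monom3 a (b + 1) c (shift n y))"
      using assms(1) by (auto intro!: summable_monom)
    then have "(\<lambda>n. monom3_d2 a b c (shift n y)) sums
      (a * monom_sum (a - 1) b c y - b * monom_sum (a + 1) (b + 2) c y - c * monom_sum a (b + 1) c y)"
      unfolding monom3_d2_def monom_sum_def
      by (intro sums_diff sums_mult summable_sums)
    then show ?thesis by (rule sums_unique[symmetric])
  qed
  ultimately show ?thesis by (simp add: monom_sum_def[abs_def])
qed

lemma Cinf_monom_sum:
  assumes "a + 2 \<le> b + c"
  shows "Cinf array_dom (monom_sum a b c)"
proof -
  have "Ck k array_dom (monom_sum a b c)" if "a + 2 \<le> b + c" for k a b c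
    using that
  proof (induction k arbitrary: a b c)
    case (Suc k)
    have 1: "(\<lambda>y. - (b * monom_sum a (b + 2) c y + c * monom_sum a (b + 1) (c + 1) y) / 2) =
       (\<lambda>y. (- b / 2) * monom_sum a (b + 2) c y + (- c / 2) * monom_sum a (b + 1) (c + 1) y)"
      by (auto simp: field_simps)
    have 2: "(\<lambda>y. a * monom_sum (a - 1) b c y - b * monom_sum (a + 1) (b + 2) c y - c * monom_sum a (b + 1) c y)
      = (\<lambda>y. a * monom_sum (a - 1) b c y + (- b) * monom_sum (a + 1) (b + 2) c y + (- c) * monom_sum a (b + 1) c y)"
      by (auto simp: field_simps)
    show ?case
      by (rule Ck_gradI[OF has_grad_monom_sum[OF Suc.prems]])
        (assumption, unfold 1 2, (intro Ck_add Ck_mult Ck_const Suc.IH; use Suc.prems in simp)+)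
  qed simp
  then show ?thesis using assms by (simp add: Cinf_def open_array_dom)
qed

lemma array_d2_term_far:
  assumes "B \<ge> 1"
  shows "\<exists>C. \<forall>n y. \<bar>fst y\<bar> \<le> B \<and> \<bar>snd y\<bar> \<le> B \<and> real (Suc n) * L \<ge> 8 * B \<longrightarrow>
       \<bar>monom3 0 1 0 (shift n y) - 1 / (real (Suc n) * L)\<bar> \<le> C / (real (Suc n))\<^sup>2"
proof -
  have "\<bar>monom3 0 1 0 (shift n y) - 1 / (real (Suc n) * L)\<bar> \<le> (12 * B / L\<^sup>2) / (real (Suc n))\<^sup>2"
    if y: "\<bar>fst y\<bar> \<le> B" "\<bar>snd y\<bar> \<le> B" and n: "real (Suc n) * L \<ge> 8 * B" for n y
    using inverse_pole_far[OF assms y n]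
    by (simp add: shift_def power_mult_distrib mult.commute del: of_nat_Suc)
  then show ?thesis by blast
qed

lemma array_term_far:
  assumes "B \<ge> 1"
  shows "\<exists>C. \<forall>n y. \<bar>fst y\<bar> \<le> B \<and> \<bar>snd y\<bar> \<le> B \<and> real (Suc n) * L \<ge> 8 * B \<longrightarrow>
       \<bar>array_term n y\<bar> \<le> C / (real (Suc n))\<^sup>2"
proof -
  have "\<bar>array_term n y\<bar> \<le> (9 * B\<^sup>2 / L\<^sup>2) / (real (Suc n))\<^sup>2"
    if y: "\<bar>fst y\<bar> \<le> B" "\<bar>snd y\<bar> \<le> B" and n: "real (Suc n) * L \<ge> 8 * B" for n y
    using half_line_far[OF assms y n]
    by (simp add: array_term_def shift_def power_mult_distrib mult.commute del: of_nat_Suc)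
  then show ?thesis by blast
qed

lemma has_grad_array_d2:
  assumes "y \<in> array_dom"
  shows "has_grad array_d2 (- monom_sum 0 3 0 y / 2) (- monom_sum 1 3 0 y) y"
proof -
  have hg: "has_grad (\<lambda>y. monom3 0 1 0 (shift n y) - 1 / (real (Suc n) * L)) (monom3_d1 0 1 0 (shift n y))
     (monom3_d2 0 1 0 (shift n y)) y" if "y \<in> array_dom" for n y
    using has_grad_shift[OF has_grad_monom3[OF shift_half_dom[OF that]], of 0 1 0 n]
    unfolding has_grad_def by (auto intro!: derivative_eq_intros)
  have e1: "monom3_d1 0 1 0 = (\<lambda>y. (-1/2) * monom3 0 3 0 y + 0 * monom3 0 3 0 y)"
    and e2: "monom3_d2 0 1 0 = (\<lambda>y. (-1) * monom3 1 3 0 y + 0 * monom3 0 3 0 y)"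
    by (auto simp: monom3_d1_def monom3_d2_def numeral_3_eq_3)
  have "has_grad array_d2 (\<Sum>n. monom3_d1 0 1 0 (shift n y)) (\<Sum>n. monom3_d2 0 1 0 (shift n y)) y"
    unfolding array_d2_def[abs_def]
    by (rule has_grad_shifted_series[OF hg far_ex_max assms], assumption, rule array_d2_term_far, assumption)
      (unfold e1 e2, (rule far_ex_add[OF monom3_far_ex monom3_far_ex]; simp)+)
  then show ?thesis
    using suminf_mult[OF summable_monom[of 0 3 0 y], of "-1/2"] suminf_mult[OF summable_monom[of 1 3 0 y], of "-1"]
    unfolding e1 e2 by (simp add: monom_sum_def)
qed

lemma has_grad_array:
  assumes "y \<in> array_dom"
  shows "has_grad array (monom_sum 0 1 1 y / 2) (array_d2 y) y"
proof -
  have hg: "has_grad (array_term n) (1 / 2 * monom3 0 1 1 (shift n y) + 0 * monom3 0 1 1 (shift n y))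
     (monom3 0 1 0 (shift n y) - 1 / (real (Suc n) * L)) y" if "y \<in> array_dom" for n y
  proof -
    define k where "k = real (Suc n) * L"
    have "((\<lambda>y. half_line (shift n y) - ln (2 * k) - snd y * (1 / k)) has_derivative
      (\<lambda>v. monom3 0 1 1 (shift n y) / 2 * fst v + monom3 0 1 0 (shift n y) * snd v - 0 - snd v * (1 / k))) (at y)"
      using has_grad_shift[OF has_grad_half_line[OF shift_half_dom[OF that]], of n]
      unfolding has_grad_def
      by (intro has_derivative_diff has_derivative_const has_derivative_mult_left
          has_derivative_snd has_derivative_ident)
    then show ?thesis
      unfolding has_grad_def array_term_def[abs_def] k_def[symmetric]
      by (simp add: algebra_simps)
  qed
  have "has_grad array (\<Sum>n. 1 / 2 * monom3 0 1 1 (shift n y) + 0 * monom3 0 1 1 (shift n y))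
      (\<Sum>n. monom3 0 1 0 (shift n y) - 1 / (real (Suc n) * L)) y"
    unfolding array_def[abs_def]
    by (rule has_grad_shifted_series[OF hg far_ex_max assms])
     (assumption, rule array_term_far, assumption, rule far_ex_add[OF monom3_far_ex monom3_far_ex],
       simp, assumption, simp, assumption, rule array_d2_term_far)
  then show ?thesis
    using summable_monom[of 0 1 1 y]
    by (simp add: monom_sum_def array_d2_def suminf_divide)
qed

lemma Cinf_array: "Cinf array_dom array"
proof (rule Cinf_gradI[OF open_array_dom has_grad_array])
  have "Cinf array_dom (\<lambda>y. 1 / 2 * monom_sum 0 1 1 y)"
    by (intro Cinf_mult Cinf_const open_array_dom Cinf_monom_sum) simp
  then show "Cinf array_dom (\<lambda>y. monom_sum 0 1 1 y / 2)" by simp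
  have "Cinf array_dom (\<lambda>y. - 1 / 2 * monom_sum 0 3 0 y)" "Cinf array_dom (\<lambda>y. - 1 * monom_sum 1 3 0 y)"
    by (intro Cinf_mult Cinf_const open_array_dom Cinf_monom_sum; simp)+
  then show "Cinf array_dom array_d2"
    by (intro Cinf_gradI[OF open_array_dom has_grad_array_d2]) simp_all
qed

lemma summable_array_term: "summable (\<lambda>n. array_term n y)"
  by (rule summable_shifted) (rule array_term_far)

end


section \<open>Axially symmetric harmonic functions\<close>

lemma pdir_cong:
  assumes "open S" and "y \<in> S" and "\<And>x. x \<in> S \<Longrightarrow> F x = G x"
  shows "pdir1 F y = pdir1 G y" and "pdir2 F y = pdir2 G y"
proof -
  have "(F has_derivative D) (at y) \<longleftrightarrow> (G has_derivative D) (at y)" for D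
    using has_derivative_transform_within_open[OF _ assms(1,2)] assms(3) by metis
  then have "frechet_derivative F (at y) = frechet_derivative G (at y)"
    by (simp add: frechet_derivative_def)
  then show "pdir1 F y = pdir1 G y" "pdir2 F y = pdir2 G y"
    by (simp_all add: pdir1_def pdir2_def)
qed

text \<open>In the variables \<open>s = \<rho>\<^sup>2\<close> and \<open>z\<close> the axially symmetric Laplacian is
  \<open>4 (s \<partial>\<^sub>s\<^sup>2 + \<partial>\<^sub>s) + \<partial>\<^sub>z\<^sup>2\<close>.\<close>

definition axial_harmonic :: "(real \<times> real) set \<Rightarrow> (real \<times> real \<Rightarrow> real) \<Rightarrow> bool"
  where "axial_harmonic S F \<longleftrightarrow> Cinf S F \<and>
    (\<forall>y\<in>S. 4 * (fst y * pdir1 (pdir1 F) y + pdir1 F y) + pdir2 (pdir2 F) y = 0)"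

lemma axial_harmonicI:
  assumes "Cinf S F" and "\<And>y. y \<in> S \<Longrightarrow> has_grad F (A y) (B y) y"
    and "\<And>y. y \<in> S \<Longrightarrow> has_grad A (a y) (a' y) y" and "\<And>y. y \<in> S \<Longrightarrow> has_grad B (b' y) (b y) y"
    and "\<And>y. y \<in> S \<Longrightarrow> 4 * (fst y * a y + A y) + b y = 0"
  shows "axial_harmonic S F"
proof -
  have op: "open S" using assms(1) Cinf_open by blast
  have "pdir1 (pdir1 F) y = a y" "pdir2 (pdir2 F) y = b y" if "y \<in> S" for y
    using pdir_cong(1)[OF op that, of "pdir1 F" A] pdir_cong(2)[OF op that, of "pdir2 F" B]
      has_gradD[OF assms(2)] has_gradD(1)[OF assms(3)] has_gradD(2)[OF assms(4)] that by metis+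
  then show ?thesis
    using assms has_gradD(1)[OF assms(2)] by (auto simp: axial_harmonic_def)
qed

lemma has_grad_const: "has_grad (\<lambda>_. c) 0 0 y"
  by (simp add: has_grad_def)

lemma has_grad_add: "has_grad F a b y \<Longrightarrow> has_grad G a' b' y \<Longrightarrow> has_grad (\<lambda>y. F y + G y) (a + a') (b + b') y"
  unfolding has_grad_def
  by (drule (1) has_derivative_add) (simp add: algebra_simps)

lemma has_grad_cmult: "has_grad F a b y \<Longrightarrow> has_grad (\<lambda>y. c * F y) (c * a) (c * b) y"
  unfolding has_grad_def
  by (drule has_derivative_mult_right[of _ _ _ c]) (simp add: algebra_simps)

lemma has_grad_reflect:
  assumes "has_grad F a b (fst y, d + e * snd y)"
  shows "has_grad (\<lambda>y. F (fst y, d + e * snd y)) a (e * b) y"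
proof -
  have "((\<lambda>y. (fst y, d + e * snd y)) has_derivative (\<lambda>v. (fst v, 0 + e * snd v))) (at y)"
    by (intro has_derivative_Pair has_derivative_fst has_derivative_snd has_derivative_ident
        has_derivative_add has_derivative_const has_derivative_mult_right)
  from has_derivative_compose[OF this assms[unfolded has_grad_def]]
  show ?thesis by (simp add: has_grad_def mult.left_commute mult.assoc)
qed

lemma axial_harmonic_Cinf: "axial_harmonic S F \<Longrightarrow> Cinf S F"
  by (simp add: axial_harmonic_def)

lemma axial_harmonic_const: "open S \<Longrightarrow> axial_harmonic S (\<lambda>_. c)"
  by (rule axial_harmonicI[where A = "\<lambda>_. 0" and B = "\<lambda>_. 0"]) (auto intro: Cinf_const has_grad_const)

lemma axial_harmonic_add:
  assumes "axial_harmonic S F" and "axial_harmonic S G"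
  shows "axial_harmonic S (\<lambda>y. F y + G y)"
proof (rule axial_harmonicI)
  show "Cinf S (\<lambda>y. F y + G y)" using assms by (intro Cinf_add axial_harmonic_Cinf)
  fix y assume y: "y \<in> S"
  note c = axial_harmonic_Cinf[OF assms(1)] axial_harmonic_Cinf[OF assms(2)]
  show "has_grad (\<lambda>y. F y + G y) (pdir1 F y + pdir1 G y) (pdir2 F y + pdir2 G y) y"
    and "has_grad (\<lambda>y. pdir1 F y + pdir1 G y) (pdir1 (pdir1 F) y + pdir1 (pdir1 G) y)
      (pdir2 (pdir1 F) y + pdir2 (pdir1 G) y) y"
    and "has_grad (\<lambda>y. pdir2 F y + pdir2 G y) (pdir1 (pdir2 F) y + pdir1 (pdir2 G) y)
      (pdir2 (pdir2 F) y + pdir2 (pdir2 G) y) y"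
    by (intro has_grad_add Cinf_grad[OF _ y] Cinf_pdir c)+
  have "4 * (fst y * pdir1 (pdir1 F) y + pdir1 F y) + pdir2 (pdir2 F) y = 0"
    "4 * (fst y * pdir1 (pdir1 G) y + pdir1 G y) + pdir2 (pdir2 G) y = 0"
    using assms y by (simp_all add: axial_harmonic_def)
  then show "4 * (fst y * (pdir1 (pdir1 F) y + pdir1 (pdir1 G) y) + (pdir1 F y + pdir1 G y)) +
    (pdir2 (pdir2 F) y + pdir2 (pdir2 G) y) = 0"
    unfolding distrib_left by linarith
qed

lemma axial_harmonic_cmult:
  assumes "axial_harmonic S F"
  shows "axial_harmonic S (\<lambda>y. c * F y)"
proof (rule axial_harmonicI)
  note C = axial_harmonic_Cinf[OF assms]
  show "Cinf S (\<lambda>y. c * F y)" by (intro Cinf_mult C Cinf_const Cinf_open[OF C])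
  fix y assume y: "y \<in> S"
  show "has_grad (\<lambda>y. c * F y) (c * pdir1 F y) (c * pdir2 F y) y"
    and "has_grad (\<lambda>y. c * pdir1 F y) (c * pdir1 (pdir1 F) y) (c * pdir2 (pdir1 F) y) y"
    and "has_grad (\<lambda>y. c * pdir2 F y) (c * pdir1 (pdir2 F) y) (c * pdir2 (pdir2 F) y) y"
    by (intro has_grad_cmult Cinf_grad[OF _ y] Cinf_pdir C)+
  have "c * (4 * (fst y * pdir1 (pdir1 F) y + pdir1 F y) + pdir2 (pdir2 F) y) = 0"
    using assms y by (simp add: axial_harmonic_def)
  then show "4 * (fst y * (c * pdir1 (pdir1 F) y) + c * pdir1 F y) + c * pdir2 (pdir2 F) y = 0"
    by (simp add: algebra_simps)
qed

lemma axial_harmonic_diff: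
  "axial_harmonic S F \<Longrightarrow> axial_harmonic S G \<Longrightarrow> axial_harmonic S (\<lambda>y. F y - G y)"
  using axial_harmonic_add[OF _ axial_harmonic_cmult[of S G "-1"]] by simp

lemma axial_harmonic_sum:
  assumes "open S"
  shows "finite I \<Longrightarrow> (\<And>i. i \<in> I \<Longrightarrow> axial_harmonic S (F i)) \<Longrightarrow> axial_harmonic S (\<lambda>y. \<Sum>i\<in>I. F i y)"
proof (induction I rule: finite_induct)
  case (insert i I)
  then show ?case by (simp add: axial_harmonic_add)
qed (simp add: axial_harmonic_const assms)

text \<open>The z-derivative enters the Laplacian only to second order, so translations and the
  reflection, \<open>e\<close> = 1 or \<open>e\<close> = -1, preserve it.\<close>

lemma axial_harmonic_reflect:
  assumes F: "axial_harmonic T F" and "open S" and T: "\<And>y. y \<in> S \<Longrightarrow> (fst y, d + e * snd y) \<in> T"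
    and e: "e * e = 1"
  shows "axial_harmonic S (\<lambda>y. F (fst y, d + e * snd y))"
proof (rule axial_harmonicI)
  note C = axial_harmonic_Cinf[OF F]
  show "Cinf S (\<lambda>y. F (fst y, d + e * snd y))"
    by (rule Cinf_compose2[OF C]) (use T \<open>open S\<close> in \<open>auto intro!: Cinf_fst Cinf_snd Cinf_add Cinf_mult Cinf_const\<close>)
  fix y assume y: "y \<in> S"
  let ?r = "\<lambda>y. (fst y, d + e * snd y)"
  show "has_grad (\<lambda>y. F (?r y)) (pdir1 F (?r y)) (e * pdir2 F (?r y)) y"
    and "has_grad (\<lambda>y. pdir1 F (?r y)) (pdir1 (pdir1 F) (?r y)) (e * pdir2 (pdir1 F) (?r y)) y"
    and "has_grad (\<lambda>y. e * pdir2 F (?r y)) (e * pdir1 (pdir2 F) (?r y)) (e * (e * pdir2 (pdir2 F) (?r y))) y"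
    by (intro has_grad_cmult has_grad_reflect Cinf_grad[OF _ T[OF y]] Cinf_pdir C)+
  show "4 * (fst y * pdir1 (pdir1 F) (?r y) + pdir1 F (?r y)) + e * (e * pdir2 (pdir2 F) (?r y)) = 0"
  proof -
    have ee: "e * (e * q) = q" for q using e by (simp add: mult.assoc[symmetric])
    show ?thesis using F T[OF y] unfolding axial_harmonic_def ee by force
  qed
qed

text \<open>The left side is the Laplacian of ln (r + x) written in monomials. The factorization s =
  (R - x)(R + x) reduces it to an identity of rational functions in R and x.\<close>

lemma monom3_harmonic:
  assumes "y \<in> half_dom"
  shows "- fst y * (monom3 0 3 1 y + monom3 0 2 2 y) + 2 * monom3 0 1 1 y - monom3 1 3 0 y = 0"
proof -
  note p = half_dom_pos[OF assms]
  define R x where "R = pole_dist y" and "x = snd y"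
  have s: "fst y = (R - x) * (R + x)" using p(3) by (simp add: R_def x_def power2_eq_square algebra_simps)
  have p1: "R > 0" "R + x > 0" using p by (simp_all add: R_def x_def)
  have "- ((R - x) * (R + x)) * (inverse R ^ 3 * inverse (R + x) + inverse R ^ 2 * inverse (R + x) ^ 2)
      + 2 * (inverse R * inverse (R + x)) - x * inverse R ^ 3 = 0"
    using p1 by (simp add: divide_simps power2_eq_square power3_eq_cube) (simp add: algebra_simps)
  then show ?thesis
    unfolding s monom3_def by (simp add: R_def x_def)
qed

lemma axial_harmonic_half_line: "axial_harmonic half_dom half_line"
proof (rule axial_harmonicI[OF Cinf_half_line has_grad_half_line])
  fix y assume y: "y \<in> half_dom"
  show "has_grad (\<lambda>y. monom3 0 1 1 y / 2) (monom3_d1 0 1 1 y / 2) (monom3_d2 0 1 1 y / 2) y"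
    using has_grad_cmult[OF has_grad_monom3[OF y, of 0 1 1], of "1/2"] by simp
  show "has_grad (monom3 0 1 0) (monom3_d1 0 1 0 y) (monom3_d2 0 1 0 y) y"
    by (rule has_grad_monom3[OF y])
  show "4 * (fst y * (monom3_d1 0 1 1 y / 2) + monom3 0 1 1 y / 2) + monom3_d2 0 1 0 y = 0"
    using monom3_harmonic[OF y]
    by (simp add: monom3_d1_def monom3_d2_def numeral_2_eq_2[symmetric] numeral_3_eq_3[symmetric] field_simps)
qed

lemma axial_harmonic_array:
  assumes L: "L > 0"
  shows "axial_harmonic (array_dom L) (array L)"
proof (rule axial_harmonicI[OF Cinf_array[OF L] has_grad_array[OF L]])
  fix y assume y: "y \<in> array_dom L"
  show "has_grad (\<lambda>y. monom_sum L 0 1 1 y / 2)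
     (- (monom_sum L 0 3 1 y + monom_sum L 0 2 2 y) / 4)
     (1 / 2 * (real 0 * monom_sum L (0 - 1) 1 1 y - real 1 * monom_sum L (0 + 1) (1 + 2) 1 y
       - real 1 * monom_sum L 0 (1 + 1) 1 y)) y"
    using has_grad_cmult[OF has_grad_monom_sum[OF L _ y, of 0 1 1], of "1/2"]
    by (simp add: numeral_2_eq_2[symmetric] numeral_3_eq_3[symmetric])
  show "has_grad (array_d2 L) (- monom_sum L 0 3 0 y / 2) (- monom_sum L 1 3 0 y) y"
    by (rule has_grad_array_d2[OF L y])
  have "(\<lambda>n. - fst y * (monom3 0 3 1 (shift L n y) + monom3 0 2 2 (shift L n y)) + 2 * monom3 0 1 1 (shift L n y)
      - monom3 1 3 0 (shift L n y)) sums
      (- fst y * (monom_sum L 0 3 1 y + monom_sum L 0 2 2 y) + 2 * monom_sum L 0 1 1 y - monom_sum L 1 3 0 y)"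
    unfolding monom_sum_def[OF L]
    by (intro sums_add sums_diff sums_mult summable_sums summable_monom[OF L]; simp)
  moreover have "- fst y * (monom3 0 3 1 (shift L n y) + monom3 0 2 2 (shift L n y)) + 2 * monom3 0 1 1 (shift L n y)
      - monom3 1 3 0 (shift L n y) = 0" for n
    using monom3_harmonic[OF shift_half_dom[OF L y, of n]] by (simp add: shift_def[OF L])
  ultimately have "- fst y * (monom_sum L 0 3 1 y + monom_sum L 0 2 2 y) + 2 * monom_sum L 0 1 1 y - monom_sum L 1 3 0 y = 0"
    using sums_unique2[OF _ sums_zero] by (simp only:)
  then show "4 * (fst y * (- (monom_sum L 0 3 1 y + monom_sum L 0 2 2 y) / 4) + monom_sum L 0 1 1 y / 2)
      + - monom_sum L 1 3 0 y = 0"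
    by (simp add: field_simps)
qed

section \<open>The potentials of the soliton\<close>

lemma half_line_reflect:
  assumes "0 < s"
  shows "half_line (s, x) + half_line (s, - x) = ln s"
proof -
  have p: "0 < pole_dist (s, x) + x" "0 < pole_dist (s, x) - x" "(pole_dist (s, x))\<^sup>2 = s + x\<^sup>2"
    using half_dom_pos(2,3)[of "(s, x)"] half_dom_pos(2)[of "(s, - x)"] assms
    by (auto simp: half_dom_def pole_dist_def add_pos_nonneg)
  have "half_line (s, x) + half_line (s, - x) = ln ((pole_dist (s, x) + x) * (pole_dist (s, x) - x))"
    using p by (simp add: half_line_def ln_mult pole_dist_def)
  also have "(pole_dist (s, x) + x) * (pole_dist (s, x) - x) = s"
    using p(3) by (simp add: power2_eq_square algebra_simps)
  finally show ?thesis .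
qed

lemma sum_periodic_window:
  fixes f :: "int \<Rightarrow> real"
  assumes per: "\<And>k. f (k + N) = f k" and N: "N > 0"
  shows "sum f {K - N<..K} = sum f {K' - N<..K'}"
proof -
  have step: "sum f {K + 1 - N<..K + 1} = sum f {K - N<..K}" for K
  proof -
    have 1: "{K + 1 - N<..K + 1} = insert (K + 1) {K + 1 - N<..K}" using N by auto
    have 2: "{K - N<..K} = insert (K + 1 - N) {K + 1 - N<..K}" using N by auto
    show ?thesis unfolding 1 2 using per[of "K + 1 - N"] by (simp add: N)
  qed
  have "sum f {K - N<..K} = sum f {0 - N<..0}" for K
  proof (induction K rule: int_induct[of _ 0])
    case (step2 i)
    then show ?case using step[of "i - 1"] by simp
  qed (use step in auto)
  then show ?thesis by metis
qed

text \<open>What the construction takes from the allowed periods: every structure occurs, so each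
  choice of angle has a horizon rod, and neighbouring rods, also across the end of a period, differ
  in structure.\<close>

locale rod_array =
  fixes z0 L :: real and P :: "'n::finite list"
  assumes L: "L > 0" and N2: "length P \<ge> 2" and cover: "set P = UNIV"
    and alt: "\<And>k. rod_structure P k \<noteq> rod_structure P (k + 1)"
begin

abbreviation \<sigma> :: "int \<Rightarrow> 'n" where "\<sigma> \<equiv> rod_structure P"

definition c :: "int \<Rightarrow> real" where "c = rod_end z0 L P"

definition N :: int where "N = int (length P)"

definition gap :: real where "gap = L / N"

lemma N: "N \<ge> 2" and gap: "gap > 0" and N_gap: "N * gap = L"
proof -
  show "N \<ge> 2" using N2 by (simp add: N_def)
  then show "gap > 0" "N * gap = L" using L by (simp_all add: gap_def)
qed

lemma c_add: "c (k + m) = c k + m * gap"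
  by (simp add: c_def rod_end_def gap_def N_def add_divide_distrib distrib_left mult.commute)

lemma c_period: "c (k + p * N) = c k + p * L"
  using c_add[of k "p * N"] N_gap by simp

lemma c_less: "j < k \<Longrightarrow> c j < c k" and c_le: "j \<le> k \<Longrightarrow> c j \<le> c k"
  using c_add[of j "k - j"] gap by (simp_all add: zero_less_mult_iff)

lemma \<sigma>_period: "\<sigma> (k + p * N) = \<sigma> k"
  by (simp add: rod_structure_def N_def)

text \<open>A rod is a difference of two half-lines. This is the sum of the rods displaced by L, 2
  L, ... to one side, with the counterterms that make it converge.\<close>

definition pairs :: "real \<times> real \<Rightarrow> real"
  where "pairs y = array L y - array L (fst y, gap + 1 * snd y)"

definition rodU :: "int \<Rightarrow> real \<times> real \<Rightarrow> real"
  where "rodU k y = half_line (fst y, c k + (-1) * snd y) - half_line (fst y, c (k + 1) + (-1) * snd y)"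

text \<open>Translates above are seen from \<open>c k\<close>, those below, after reflection, from
  \<open>c (k + 1)\<close>. Euler's constant arises because the counterterms of the two sides add up
  to 2 / N times a harmonic number, while the potentials are renormalized by 2 / N times ln
  m.\<close>

definition rod_pairs :: "int \<Rightarrow> real \<times> real \<Rightarrow> real"
  where "rod_pairs k y = pairs (fst y, c k + (-1) * snd y) + pairs (fst y, - c (k + 1) + 1 * snd y)
     - 2 * euler_mascheroni / N"

text \<open>Rod \<open>k\<close> together with all its translates by multiples of \<open>L\<close>.\<close>

definition rodW :: "int \<Rightarrow> real \<times> real \<Rightarrow> real"
  where "rodW k y = rodU k y + rod_pairs k y"

lemma rodU_eq: "rodU k (s, z) = half_line (s, c k - z) - half_line (s, c (k + 1) - z)"
  by (simp add: rodU_def)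

lemma rod_potential_eq: "rod_potential (c k) (c (k + 1)) \<rho> z = rodU k (\<rho>\<^sup>2, z)"
  by (simp add: rod_potential_def rodU_def half_line_def pole_dist_def power2_commute algebra_simps)

definition pair_term :: "nat \<Rightarrow> real \<times> real \<Rightarrow> real"
  where "pair_term n y = array_term L n y - array_term L n (fst y, gap + snd y)"

lemma pair_term_sums: "(\<lambda>n. pair_term n y) sums pairs y"
  unfolding pair_term_def pairs_def array_def[OF L]
  by (simp add: sums_diff summable_sums summable_array_term[OF L])

lemma pair_term_eq:
  "half_line (s, real (Suc n) * L + x) - half_line (s, real (Suc n) * L + (gap + x)) =
     pair_term n (s, x) - (1 / N) * (1 / real (Suc n))"
proof -
  have e: "gap / (real (Suc n) * L) = (1 / N) * (1 / real (Suc n))"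
    using L by (simp add: gap_def)
  have "pair_term n (s, x) = half_line (s, real (Suc n) * L + x) - half_line (s, real (Suc n) * L + (gap + x))
     + gap / (real (Suc n) * L)"
    by (simp add: pair_term_def array_term_def[OF L] shift_def[OF L] add_divide_distrib del: of_nat_Suc)
  then show ?thesis unfolding e by simp
qed

lemma rodU_up:
  "rodU (k + int (Suc n) * N) (s, z) = pair_term n (s, c k - z) - (1 / N) * (1 / real (Suc n))"
proof -
  have e: "c (k + int (Suc n) * N) - z = real (Suc n) * L + (c k - z)"
    "c (k + int (Suc n) * N + 1) - z = real (Suc n) * L + (gap + (c k - z))"
    using c_period[of k "int (Suc n)"] c_add[of "k + int (Suc n) * N" 1] by simp_all
  show ?thesis
    unfolding rodU_eq e pair_term_eq ..
qed

text \<open>Reflecting a half-line costs ln s and a sign. The two ends of a rod each contribute ln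
  s, which cancels in their difference.\<close>

lemma rodU_down:
  assumes "0 < s"
  shows "rodU (k - int (Suc n) * N) (s, z) = pair_term n (s, z - c (k + 1)) - (1 / N) * (1 / real (Suc n))"
proof -
  have e: "c (k - int (Suc n) * N) - z = - (real (Suc n) * L + (gap + (z - c (k + 1))))"
    "c (k - int (Suc n) * N + 1) - z = - (real (Suc n) * L + (z - c (k + 1)))"
    using c_period[of k "- int (Suc n)"] c_add[of "k - int (Suc n) * N" 1] c_add[of k 1]
    by (simp_all del: of_nat_Suc)
  have "rodU (k - int (Suc n) * N) (s, z) =
      half_line (s, real (Suc n) * L + (z - c (k + 1))) - half_line (s, real (Suc n) * L + (gap + (z - c (k + 1))))"
    using half_line_reflect[OF assms, of "real (Suc n) * L + (z - c (k + 1))"]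
      half_line_reflect[OF assms, of "real (Suc n) * L + (gap + (z - c (k + 1)))"]
    unfolding rodU_eq e by linarith
  then show ?thesis by (simp only: pair_term_eq)
qed

lemma sum_symmetric_int:
  fixes f :: "int \<Rightarrow> real"
  shows "(\<Sum>p\<in>{- int m..int m}. f p) = f 0 + (\<Sum>n<m. f (int (Suc n)) + f (- int (Suc n)))"
proof (induction m)
  case (Suc m)
  have "{- int (Suc m)..int (Suc m)} = insert (int (Suc m)) (insert (- int (Suc m)) {- int m..int m})"
    by auto
  then show ?case using Suc by simp
qed simp

lemma rod_limit:
  assumes "0 < s"
  shows "(\<lambda>m. (\<Sum>p\<in>{- int m..int m}. rodU (k + p * N) (s, z)) + 2 / N * ln (real m)) \<longlonglongrightarrow> rodW k (s, z)"
proof -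
  let ?x = "c k - z" and ?x' = "z - c (k + 1)"
  have eq: "(\<Sum>p\<in>{- int m..int m}. rodU (k + p * N) (s, z)) + 2 / N * ln (real m) =
     rodU k (s, z) + ((\<Sum>n<m. pair_term n (s, ?x)) + (\<Sum>n<m. pair_term n (s, ?x')))
     - 2 / N * (harm m - ln (real m))" for m
  proof -
    have h: "(\<Sum>n<m. 1 / real (Suc n)) = harm m"
      by (simp add: harm_def sum.atLeast1_atMost_eq inverse_eq_divide atLeast0LessThan)
    have "(\<Sum>p\<in>{- int m..int m}. rodU (k + p * N) (s, z)) = rodU k (s, z) +
       (\<Sum>n<m. (pair_term n (s, ?x) - (1 / N) * (1 / real (Suc n))) +
          (pair_term n (s, ?x') - (1 / N) * (1 / real (Suc n))))"
      using rodU_up[of k _ s z] rodU_down[OF assms, of k _ z]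
      by (simp add: sum_symmetric_int del: of_nat_Suc)
    also have "\<dots> = rodU k (s, z) + ((\<Sum>n<m. pair_term n (s, ?x)) + (\<Sum>n<m. pair_term n (s, ?x')))
      - 2 * (1 / N * (\<Sum>n<m. 1 / real (Suc n)))"
      by (simp only: sum.distrib sum_subtractf sum_distrib_left[symmetric])
    finally show ?thesis unfolding h by (simp add: diff_divide_distrib right_diff_distrib)
  qed
  have "(\<lambda>m. rodU k (s, z) + ((\<Sum>n<m. pair_term n (s, ?x)) + (\<Sum>n<m. pair_term n (s, ?x')))
     - 2 / N * (harm m - ln (real m))) \<longlonglongrightarrow>
     rodU k (s, z) + (pairs (s, ?x) + pairs (s, ?x')) - 2 / N * euler_mascheroni"
    using pair_term_sums unfolding sums_def
    by (intro tendsto_intros euler_mascheroni_LIMSEQ)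
  then show ?thesis
    unfolding eq by (simp add: rodW_def rod_pairs_def algebra_simps)
qed

lemma rodU_tendsto:
  assumes "0 < s"
  shows "(\<lambda>n. rodU (k + int (Suc n) * N) (s, z)) \<longlonglongrightarrow> 0" "(\<lambda>n. rodU (k - int (Suc n) * N) (s, z)) \<longlonglongrightarrow> 0"
proof -
  have t: "(\<lambda>n. pair_term n y - (1 / N) * (1 / real (Suc n))) \<longlonglongrightarrow> 0 - 1 / N * 0" for y
    by (intro tendsto_diff tendsto_mult tendsto_const LIMSEQ_Suc[OF lim_1_over_n] summable_LIMSEQ_zero
        sums_summable[OF pair_term_sums])
  show "(\<lambda>n. rodU (k + int (Suc n) * N) (s, z)) \<longlonglongrightarrow> 0"
    unfolding rodU_up using t by simp
  show "(\<lambda>n. rodU (k - int (Suc n) * N) (s, z)) \<longlonglongrightarrow> 0"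
    unfolding rodU_down[OF assms] using t by simp
qed

text \<open>Starting one period later changes the symmetric partial sum by one rod gained at one end
  and one lost at the other, and the potential of a single rod tends to 0 as the rod moves
  away.\<close>

lemma rodW_period:
  assumes "0 < s"
  shows "rodW (k + N) (s, z) = rodW k (s, z)"
proof -
  let ?f = "\<lambda>k m. (\<Sum>p\<in>{- int m..int m}. rodU (k + p * N) (s, z)) + 2 / N * ln (real m)"
  have d: "?f (k + N) (Suc m) = ?f k (Suc m) + rodU (k + int (Suc (Suc m)) * N) (s, z)
      - rodU (k - int (Suc m) * N) (s, z)" for m
  proof -
    have "(\<Sum>p\<in>{- int (Suc m)..int (Suc m)}. rodU (k + N + p * N) (s, z)) =
       (\<Sum>p\<in>{- int m..int (Suc (Suc m))}. rodU (k + p * N) (s, z))"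
      by (rule sum.reindex_bij_witness[where i = "\<lambda>p. p - 1" and j = "\<lambda>p. p + 1"])
        (auto simp: algebra_simps)
    moreover have "{- int m..int (Suc (Suc m))} = insert (int (Suc (Suc m))) {- int m..int (Suc m)}"
      "{- int (Suc m)..int (Suc m)} = insert (- int (Suc m)) {- int m..int (Suc m)}"
      by auto
    ultimately show ?thesis by (simp add: algebra_simps)
  qed
  have "(\<lambda>m. ?f k (Suc m) + rodU (k + int (Suc (Suc m)) * N) (s, z) - rodU (k - int (Suc m) * N) (s, z))
      \<longlonglongrightarrow> rodW k (s, z) + 0 - 0"
    by (intro tendsto_add tendsto_diff LIMSEQ_Suc[OF rod_limit[OF assms]] rodU_tendsto[OF assms]
        LIMSEQ_Suc[OF rodU_tendsto(1)[OF assms]])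
  moreover have "(\<lambda>m. ?f (k + N) (Suc m)) \<longlonglongrightarrow> rodW (k + N) (s, z)"
    by (rule LIMSEQ_Suc[OF rod_limit[OF assms]])
  ultimately show ?thesis
    unfolding d using LIMSEQ_unique by fastforce
qed

lemma rodW_translate: "rodW (k + j) (s, z + j * gap) = rodW k (s, z)"
  using c_add[of k j] c_add[of "k + 1" j]
  by (simp add: rodW_def rodU_def rod_pairs_def add.commute add.left_commute)

lemma window_eq: "{N - 1 - N<..N - 1} = {0..<N}"
  by auto

text \<open>Division with remainder by \<open>N\<close> sends a rod to the index of its period and
  its position there.\<close>

lemma sum_rods_upto:
  fixes f :: "int \<Rightarrow> real"
  shows "sum f (rods_upto P i m) = (\<Sum>j\<in>{0..<N}. if \<sigma> j = i then \<Sum>p\<in>{- int m..int m}. f (j + p * N) else 0)"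
proof -
  have "sum f (rods_upto P i m) =
     (\<Sum>(j, p)\<in>Sigma {j\<in>{0..<N}. \<sigma> j = i} (\<lambda>_. {- int m..int m}). f (j + p * N))"
  proof (rule sum.reindex_bij_witness[where i = "\<lambda>(j, p). j + p * N" and j = "\<lambda>k. (k mod N, k div N)"])
    fix k assume k: "k \<in> rods_upto P i m"
    have "- int m \<le> k div N"
    proof -
      have "- int m * N div N \<le> k div N"
        using k N by (intro zdiv_mono1) (auto simp: rods_upto_def N_def[symmetric])
      moreover have "- int m * N div N = - int m" using N by (intro nonzero_mult_div_cancel_right) simp
      ultimately show ?thesis by (simp only:)
    qed
    moreover have "k div N < int m + 1"
    proof -
      have "k div N * N \<le> k" using N by (simp add: minus_mod_eq_div_mult[symmetric])
      then have "k div N * N < (int m + 1) * N"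
        using k by (simp add: rods_upto_def N_def[symmetric])
      then show ?thesis using N by (simp add: mult_less_cancel_right)
    qed
    moreover have "\<sigma> (k mod N) = \<sigma> k" by (simp add: rod_structure_def N_def)
    ultimately show "(k mod N, k div N) \<in> Sigma {j\<in>{0..<N}. \<sigma> j = i} (\<lambda>_. {- int m..int m})"
      using k N by (simp add: rods_upto_def)
  next
    fix a assume a: "a \<in> Sigma {j\<in>{0..<N}. \<sigma> j = i} (\<lambda>_. {- int m..int m})"
    obtain j p where ap: "a = (j, p)" "0 \<le> j" "j < N" "\<sigma> j = i" "- int m \<le> p" "p \<le> int m"
      using a by auto
    show "((case a of (j, p) \<Rightarrow> j + p * N) mod N, (case a of (j, p) \<Rightarrow> j + p * N) div N) = a"
      using ap N by simp
    have "- int m * N \<le> p * N" "p * N \<le> int m * N" using ap N by (intro mult_right_mono; simp)+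
    then have "- int m * N \<le> j + p * N" "j + p * N < (int m + 1) * N"
      using ap unfolding distrib_right by linarith+
    then show "(case a of (j, p) \<Rightarrow> j + p * N) \<in> rods_upto P i m"
      unfolding ap(1) rods_upto_def N_def[symmetric] using ap(4) by (simp add: \<sigma>_period)
  qed (simp_all add: ac_simps)
  also have "\<dots> = (\<Sum>j\<in>{j\<in>{0..<N}. \<sigma> j = i}. \<Sum>p\<in>{- int m..int m}. f (j + p * N))"
    by (rule sum.Sigma[symmetric]) (auto intro: finite_subset[of _ "{0..<N}"])
  also have "\<dots> = (\<Sum>j\<in>{0..<N}. if \<sigma> j = i then \<Sum>p\<in>{- int m..int m}. f (j + p * N) else 0)"
    by (rule sum.inter_filter) simp
  finally show ?thesis .
qed

lemma count_eq: "real (count_list P i) = (\<Sum>j\<in>{0..<N}. if \<sigma> j = i then 1 else 0)"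
proof -
  have "count_list P i = card {j. j < length P \<and> P ! j = i}"
    by (simp add: count_list_eq_length_filter length_filter_conv_card eq_commute)
  also have "\<dots> = card {j\<in>{0..<N}. \<sigma> j = i}"
    by (rule bij_betw_same_card[of int], rule bij_betw_byWitness[where f' = nat])
      (auto simp: rod_structure_def N_def)
  finally show ?thesis by (simp add: sum.inter_filter[symmetric])
qed

text \<open>\<open>K\<close> is free so that the window of \<open>N\<close> consecutive rods can be
  placed around a given rod or corner.\<close>

lemma soliton_u_eq:
  assumes \<rho>: "\<rho> > 0"
  shows "soliton_u z0 L P \<kappa> i \<rho> z = (\<Sum>k\<in>{K - N<..K}. if \<sigma> k = i then rodW k (\<rho>\<^sup>2, z) else 0) + \<kappa> i"
proof -
  have s: "0 < \<rho>\<^sup>2" using \<rho> by simp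
  have "(\<lambda>m. \<Sum>j\<in>{0..<N}. if \<sigma> j = i then (\<Sum>p\<in>{- int m..int m}. rodU (j + p * N) (\<rho>\<^sup>2, z)) + 2 / N * ln (real m) else 0)
      \<longlonglongrightarrow> (\<Sum>j\<in>{0..<N}. if \<sigma> j = i then rodW j (\<rho>\<^sup>2, z) else 0)"
    by (rule tendsto_sum) (use rod_limit[OF s] in \<open>simp split: if_split\<close>)
  moreover have "(\<Sum>k\<in>rods_upto P i m. rod_potential (rod_end z0 L P k) (rod_end z0 L P (k + 1)) \<rho> z)
      + 2 * real (count_list P i) / real (length P) * ln (real m) =
      (\<Sum>j\<in>{0..<N}. if \<sigma> j = i then (\<Sum>p\<in>{- int m..int m}. rodU (j + p * N) (\<rho>\<^sup>2, z)) + 2 / N * ln (real m) else 0)"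
    for m
  proof -
    have "2 * real (count_list P i) / real (length P) * ln (real m) =
       2 / N * ln (real m) * real (count_list P i)" by (simp add: N_def)
    also have "\<dots> = (\<Sum>j\<in>{0..<N}. if \<sigma> j = i then 2 / N * ln (real m) else 0)"
      unfolding count_eq sum_distrib_left by (rule sum.cong) auto
    finally have "2 * real (count_list P i) / real (length P) * ln (real m) =
       (\<Sum>j\<in>{0..<N}. if \<sigma> j = i then 2 / N * ln (real m) else 0)" .
    then show ?thesis
      unfolding sum_rods_upto by (auto simp: rod_potential_eq[unfolded c_def] sum.distrib[symmetric] intro!: sum.cong)
  qed
  ultimately have "soliton_u z0 L P \<kappa> i \<rho> z = (\<Sum>j\<in>{0..<N}. if \<sigma> j = i then rodW j (\<rho>\<^sup>2, z) else 0) + \<kappa> i"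
    unfolding soliton_u_def by (simp add: limI)
  also have "(\<Sum>j\<in>{0..<N}. if \<sigma> j = i then rodW j (\<rho>\<^sup>2, z) else 0) =
     (\<Sum>k\<in>{K - N<..K}. if \<sigma> k = i then rodW k (\<rho>\<^sup>2, z) else 0)"
    unfolding window_eq[symmetric]
    by (rule sum_periodic_window) (use N \<sigma>_period[of _ 1] rodW_period[OF s] in auto)
  finally show ?thesis .
qed

lemma half_line_ln_tendsto: "(\<lambda>n. half_line (s, real (Suc n) * L + x) - ln (real (Suc n))) \<longlonglongrightarrow> ln (2 * L)"
proof -
  have "(\<lambda>n. array_term L n (s, x) + ln (2 * L) + x / L * (1 / real (Suc n))) \<longlonglongrightarrow> 0 + ln (2 * L) + x / L * 0"
    by (intro tendsto_intros LIMSEQ_Suc[OF lim_1_over_n] summable_LIMSEQ_zero summable_array_term[OF L])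
  moreover have "array_term L n (s, x) + ln (2 * L) + x / L * (1 / real (Suc n)) =
     half_line (s, real (Suc n) * L + x) - ln (real (Suc n))" for n
  proof -
    have "ln (2 * (real (Suc n) * L)) = ln (2 * L) + ln (real (Suc n))"
      using L ln_mult[of "2 * L" "real (Suc n)"] by (simp add: mult.left_commute mult.commute)
    then show ?thesis
      using L by (simp add: array_term_def[OF L] shift_def[OF L] del: of_nat_Suc)
  qed
  ultimately show ?thesis by simp
qed

text \<open>All rods together telescope to a difference of two half-lines with ends far below and
  far above. Reflecting the lower one produces ln s; both then behave like ln (2 m L), and the
  renormalization removes 2 ln m.\<close>

lemma sum_rodW:
  assumes "0 < s"
  shows "(\<Sum>k\<in>{K - N<..K}. rodW k (s, z)) = ln s - 2 * ln (2 * L)"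
proof -
  let ?h = "\<lambda>k. half_line (s, c k - z)"
  have one: "(\<Sum>j\<in>{0..<N}. rodU (j + p * N) (s, z)) = ?h (p * N) - ?h ((p + 1) * N)" for p
  proof -
    have "(\<Sum>j\<in>{0..<N}. rodU (j + p * N) (s, z)) = (\<Sum>j<length P. ?h (int j + p * N) - ?h (int (Suc j) + p * N))"
      by (rule sum.reindex_bij_witness[where i = int and j = nat]) (auto simp: N_def rodU_def ac_simps)
    also have "\<dots> = ?h (p * N) - ?h ((p + 1) * N)"
      by (simp only: sum_lessThan_telescope'[where f = "\<lambda>j. ?h (int j + p * N)"]) (simp add: N_def algebra_simps)
    finally show ?thesis .
  qed
  have all: "(\<Sum>j\<in>{0..<N}. \<Sum>p\<in>{- int m..int m}. rodU (j + p * N) (s, z)) = ?h (- int m * N) - ?h ((int m + 1) * N)" for m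
  proof -
    have "(\<Sum>j\<in>{0..<N}. \<Sum>p\<in>{- int m..int m}. rodU (j + p * N) (s, z)) = (\<Sum>p\<in>{- int m..int m}. ?h (p * N) - ?h ((p + 1) * N))"
      by (subst sum.swap) (simp add: one)
    also have "\<dots> = ?h (- int m * N) - ?h ((int m + 1) * N)"
    proof (induction m)
      case (Suc m)
      have "{- int (Suc m)..int (Suc m)} = insert (int (Suc m)) (insert (- int (Suc m)) {- int m..int m})"
        by auto
      then show ?case using Suc by (simp add: ac_simps)
    qed simp
    finally show ?thesis .
  qed
  have "(\<lambda>m. \<Sum>j\<in>{0..<N}. (\<Sum>p\<in>{- int m..int m}. rodU (j + p * N) (s, z)) + 2 / N * ln (real m))
      \<longlonglongrightarrow> (\<Sum>j\<in>{0..<N}. rodW j (s, z))"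
    by (intro tendsto_sum rod_limit assms)
  then have "(\<lambda>m. ?h (- int m * N) - ?h ((int m + 1) * N) + 2 * ln (real m)) \<longlonglongrightarrow> (\<Sum>j\<in>{0..<N}. rodW j (s, z))"
    using N by (simp add: sum.distrib all)
  then have lim: "(\<lambda>n. ?h (- int (Suc n) * N) - ?h ((int (Suc n) + 1) * N) + 2 * ln (real (Suc n)))
      \<longlonglongrightarrow> (\<Sum>j\<in>{0..<N}. rodW j (s, z))"
    by (rule LIMSEQ_Suc)
  have eq: "?h (- int (Suc n) * N) - ?h ((int (Suc n) + 1) * N) + 2 * ln (real (Suc n)) =
     ln s - (half_line (s, real (Suc n) * L + (z - c 0)) - ln (real (Suc n)))
     - (half_line (s, real (Suc n) * L + (L + c 0 - z)) - ln (real (Suc n)))" for n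
  proof -
    have e: "c (- int (Suc n) * N) - z = - (real (Suc n) * L + (z - c 0))"
      "c ((int (Suc n) + 1) * N) - z = real (Suc n) * L + (L + c 0 - z)"
      using c_period[of 0 "- int (Suc n)"] c_period[of 0 "int (Suc n) + 1"] by (simp_all add: algebra_simps)
    show ?thesis
      unfolding e using half_line_reflect[OF assms, of "real (Suc n) * L + (z - c 0)"] by linarith
  qed
  have "(\<lambda>n. ln s - (half_line (s, real (Suc n) * L + (z - c 0)) - ln (real (Suc n)))
     - (half_line (s, real (Suc n) * L + (L + c 0 - z)) - ln (real (Suc n)))) \<longlonglongrightarrow> ln s - ln (2 * L) - ln (2 * L)"
    by (intro tendsto_diff tendsto_const half_line_ln_tendsto)
  then have "(\<Sum>j\<in>{0..<N}. rodW j (s, z)) = ln s - 2 * ln (2 * L)"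
    using LIMSEQ_unique[OF lim[unfolded eq]] by simp
  moreover have "(\<Sum>k\<in>{K - N<..K}. rodW k (s, z)) = (\<Sum>j\<in>{0..<N}. rodW j (s, z))"
    unfolding window_eq[symmetric]
    by (rule sum_periodic_window) (use N rodW_period[OF assms] in auto)
  ultimately show ?thesis by simp
qed

lemma sum_soliton_u:
  assumes "\<rho> > 0"
  shows "(\<Sum>i\<in>UNIV. soliton_u z0 L P \<kappa> i \<rho> z) = 2 * ln \<rho> + ((\<Sum>i\<in>UNIV. \<kappa> i) - 2 * ln (2 * L))"
proof -
  have "(\<Sum>i\<in>UNIV. soliton_u z0 L P \<kappa> i \<rho> z) =
     (\<Sum>k\<in>{0 - N<..0}. \<Sum>i\<in>UNIV. if \<sigma> k = i then rodW k (\<rho>\<^sup>2, z) else 0) + (\<Sum>i\<in>UNIV. \<kappa> i)"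
    by (simp only: soliton_u_eq[OF assms, of _ _ _ 0] sum.distrib) (subst sum.swap, simp)
  also have "\<dots> = (ln (\<rho>\<^sup>2) - 2 * ln (2 * L)) + (\<Sum>i\<in>UNIV. \<kappa> i)"
    using sum_rodW[of "\<rho>\<^sup>2" z 0] assms by simp
  finally show ?thesis using assms by (simp add: ln_realpow)
qed

lemma soliton_u_period:
  assumes "\<rho> > 0"
  shows "soliton_u z0 L P \<kappa> i \<rho> (z + L) = soliton_u z0 L P \<kappa> i \<rho> z"
proof -
  have "rodW k (\<rho>\<^sup>2, z + L) = rodW k (\<rho>\<^sup>2, z)" for k
    using rodW_translate[of "k - N" N "\<rho>\<^sup>2" z] rodW_period[of "\<rho>\<^sup>2" "k - N" z] assms N_gap by simp
  then show ?thesis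
    by (simp only: soliton_u_eq[OF assms, of _ _ _ 0])
qed

end


section \<open>Regular parts of the potentials near rods and corners\<close>

context rod_array
begin

lemma square_mono_pos: "0 < a \<Longrightarrow> a \<le> x \<Longrightarrow> 0 < s + a\<^sup>2 \<Longrightarrow> 0 < s + (x::real)\<^sup>2"
  using power_mono[of a x 2] by linarith

lemma array_dom_shift:
  assumes "y \<in> array_dom L"
  shows "(fst y, gap + 1 * snd y) \<in> array_dom L"
  using assms gap square_mono_pos[of "snd y + L" "gap + snd y + L" "fst y"]
  by (auto simp: array_dom_def[OF L])

lemma axial_harmonic_pairs: "axial_harmonic (array_dom L) pairs"
  unfolding pairs_def[abs_def]
  by (intro axial_harmonic_diff axial_harmonic_array[OF L]
      axial_harmonic_reflect[OF axial_harmonic_array[OF L]] open_array_dom[OF L] array_dom_shift) simp_all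

definition potU :: "('n \<Rightarrow> real) \<Rightarrow> 'n \<Rightarrow> real \<times> real \<Rightarrow> real"
  where "potU \<kappa> i y = (\<Sum>k\<in>{0 - N<..0}. if \<sigma> k = i then rodW k y else 0) + \<kappa> i"

lemma soliton_u_potU: "\<rho> > 0 \<Longrightarrow> soliton_u z0 L P \<kappa> i \<rho> z = potU \<kappa> i (\<rho>\<^sup>2, z)"
  by (simp only: soliton_u_eq[of _ _ _ _ 0] potU_def)

lemma open_upper: "open {y :: real \<times> real. 0 < fst y}"
  by (intro open_Collect_less continuous_intros)

lemma axial_harmonic_potU: "axial_harmonic {y. 0 < fst y} (potU \<kappa> i)"
proof -
  have h: "axial_harmonic {y. 0 < fst y} (\<lambda>y. half_line (fst y, d + e * snd y))" if "e * e = 1" for d e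
    by (rule axial_harmonic_reflect[OF axial_harmonic_half_line open_upper _ that])
      (simp add: half_dom_def add_pos_nonneg)
  have p: "axial_harmonic {y. 0 < fst y} (\<lambda>y. pairs (fst y, d + e * snd y))" if "e * e = 1" for d e
    by (rule axial_harmonic_reflect[OF axial_harmonic_pairs open_upper _ that])
      (simp add: array_dom_def[OF L])
  have "axial_harmonic {y. 0 < fst y} (rodW k)" for k
    unfolding rodW_def[abs_def] rodU_def rod_pairs_def
    by (intro axial_harmonic_add axial_harmonic_diff axial_harmonic_const open_upper h p; simp)
  then have "axial_harmonic {y. 0 < fst y} (\<lambda>y. if \<sigma> k = i then rodW k y else 0)" for k
    using axial_harmonic_const[OF open_upper, of 0] by (cases "\<sigma> k = i") simp_all
  then show ?thesis
    unfolding potU_def[abs_def]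
    by (intro axial_harmonic_add axial_harmonic_sum axial_harmonic_const open_upper) auto
qed

text \<open>Near the corner \<open>c (K + 1)\<close>, with \<open>R\<close> the distance to it, these are \<open>ln (R + (z - c))\<close> and
  \<open>ln (R - (z - c))\<close>.\<close>

definition right_log :: "int \<Rightarrow> real \<times> real \<Rightarrow> real"
  where "right_log K y = half_line (fst y, - c (K + 1) + 1 * snd y)"

definition left_log :: "int \<Rightarrow> real \<times> real \<Rightarrow> real"
  where "left_log K y = half_line (fst y, c (K + 1) + (-1) * snd y)"

lemma right_log_left_log: "0 < s \<Longrightarrow> right_log K (s, z) + left_log K (s, z) = ln s"
  using half_line_reflect[of s "z - c (K + 1)"] by (simp add: right_log_def left_log_def)

text \<open>What remains of \<open>rodW k\<close> after \<open>right_log\<close> and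
  \<open>left_log\<close> are split off. By reflection the half-lines are turned away from the
  corner, so that they are singular only beyond a neighbouring corner.\<close>

definition corner_reg :: "int \<Rightarrow> int \<Rightarrow> real \<times> real \<Rightarrow> real"
  where "corner_reg K k y = (if k = K then - half_line (fst y, - c K + 1 * snd y)
    else if k = K + 1 then - half_line (fst y, c (K + 2) + (-1) * snd y)
    else half_line (fst y, - c (k + 1) + 1 * snd y) - half_line (fst y, - c k + 1 * snd y)) + rod_pairs k y"

text \<open>The window contains the two rods at the corner and otherwise only rods below it, hence
  the three cases of \<open>corner_reg\<close>. It is also the range for which both arrays in
  \<open>rod_pairs\<close> are regular on \<open>corner_dom\<close>, see the last two parts of
  \<open>corner_dom_half\<close>.\<close>

definition cornerV :: "('n \<Rightarrow> real) \<Rightarrow> int \<Rightarrow> 'n \<Rightarrow> real \<times> real \<Rightarrow> real"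
  where "cornerV \<kappa> K i y = (\<Sum>k\<in>{K + 1 - N<..K + 1}. if \<sigma> k = i then corner_reg K k y else 0) + \<kappa> i"

definition corner_dom :: "int \<Rightarrow> (real \<times> real) set"
  where "corner_dom K = {y. c K < snd y \<and> snd y < c (K + 2) \<and>
     0 < fst y + (snd y - c K)\<^sup>2 \<and> 0 < fst y + (c (K + 2) - snd y)\<^sup>2}"

lemma open_corner_dom: "open (corner_dom K)"
  unfolding corner_dom_def
  by (intro open_Collect_conj open_Collect_less continuous_intros)

lemma corner_dom_half:
  assumes "y \<in> corner_dom K"
  shows "k \<le> K \<Longrightarrow> (fst y, - c k + 1 * snd y) \<in> half_dom"
    and "k \<ge> K + 2 \<Longrightarrow> (fst y, c k + (-1) * snd y) \<in> half_dom"
    and "k \<le> K + N \<Longrightarrow> (fst y, - c k + 1 * snd y) \<in> array_dom L"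
    and "k \<ge> K + 2 - N \<Longrightarrow> (fst y, c k + (-1) * snd y) \<in> array_dom L"
proof -
  have 1: "0 < - c k + snd y \<and> 0 < fst y + (- c k + snd y)\<^sup>2" if "k \<le> K" for k
    using assms c_le[OF that] square_mono_pos[of "snd y - c K" "- c k + snd y" "fst y"]
    by (auto simp: corner_dom_def)
  have 2: "0 < c k - snd y \<and> 0 < fst y + (c k - snd y)\<^sup>2" if "k \<ge> K + 2" for k
    using assms c_le[OF that] square_mono_pos[of "c (K + 2) - snd y" "c k - snd y" "fst y"]
    by (auto simp: corner_dom_def)
  show "(fst y, - c k + 1 * snd y) \<in> half_dom" if "k \<le> K"
    using 1[OF that] by (simp add: half_dom_def)
  show "(fst y, c k + (-1) * snd y) \<in> half_dom" if "k \<ge> K + 2"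
    using 2[OF that] by (simp add: half_dom_def)
  show "(fst y, - c k + 1 * snd y) \<in> array_dom L" if "k \<le> K + N"
    using 1[of "k + (-1) * N"] that by (simp only: c_period) (simp add: array_dom_def[OF L] algebra_simps)
  show "(fst y, c k + (-1) * snd y) \<in> array_dom L" if "k \<ge> K + 2 - N"
    using 2[of "k + 1 * N"] that by (simp only: c_period) (simp add: array_dom_def[OF L] algebra_simps)
qed

lemma axial_harmonic_cornerV: "axial_harmonic (corner_dom K) (cornerV \<kappa> K i)"
proof -
  note op = open_corner_dom[of K]
  have "axial_harmonic (corner_dom K) (corner_reg K k)" if k: "k \<in> {K + 1 - N<..K + 1}" for k
  proof -
    have h: "axial_harmonic (corner_dom K) (\<lambda>y. half_line (fst y, - c m + 1 * snd y))" if "m \<le> K" for m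
      by (rule axial_harmonic_reflect[OF axial_harmonic_half_line op]) (use corner_dom_half(1) that in auto)
    have h': "axial_harmonic (corner_dom K) (\<lambda>y. half_line (fst y, c (K + 2) + (-1) * snd y))"
      by (rule axial_harmonic_reflect[OF axial_harmonic_half_line op]) (use corner_dom_half(2) in auto)
    have p: "axial_harmonic (corner_dom K) (\<lambda>y. pairs (fst y, - c (k + 1) + 1 * snd y))"
      by (rule axial_harmonic_reflect[OF axial_harmonic_pairs op]) (use corner_dom_half(3)[of _ K "k + 1"] k N in auto)
    have p': "axial_harmonic (corner_dom K) (\<lambda>y. pairs (fst y, c k + (-1) * snd y))"
      by (rule axial_harmonic_reflect[OF axial_harmonic_pairs op]) (use corner_dom_half(4)[of _ K k] k N in auto)
    have rp: "axial_harmonic (corner_dom K) (rod_pairs k)"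
      unfolding rod_pairs_def[abs_def] using p p'
      by (intro axial_harmonic_diff axial_harmonic_add axial_harmonic_const op)
    consider "k = K" | "k = K + 1" | "k < K" using k by force
    then show ?thesis
    proof cases
      case 1
      then show ?thesis
        using axial_harmonic_add[OF axial_harmonic_cmult[OF h[of K], of "-1"] rp]
        by (simp add: corner_reg_def[abs_def])
    next
      case 2
      then show ?thesis
        using axial_harmonic_add[OF axial_harmonic_cmult[OF h', of "-1"] rp]
        by (simp add: corner_reg_def[abs_def])
    next
      case 3
      then show ?thesis
        using axial_harmonic_add[OF axial_harmonic_diff[OF h[of "k + 1"] h[of k]] rp]
        by (simp add: corner_reg_def[abs_def])
    qed
  qed
  then have "axial_harmonic (corner_dom K) (\<lambda>y. if \<sigma> k = i then corner_reg K k y else 0)"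
    if "k \<in> {K + 1 - N<..K + 1}" for k
    using that axial_harmonic_const[OF op, of 0] by (cases "\<sigma> k = i") simp_all
  then show ?thesis
    unfolding cornerV_def[abs_def]
    by (intro axial_harmonic_add axial_harmonic_sum axial_harmonic_const op) auto
qed

lemmas Cinf_cornerV = axial_harmonic_Cinf[OF axial_harmonic_cornerV]
  and Cinf_potU = axial_harmonic_Cinf[OF axial_harmonic_potU]

lemma potU_window:
  assumes "0 < s"
  shows "potU \<kappa> i (s, z) = (\<Sum>k\<in>{K - N<..K}. if \<sigma> k = i then rodW k (s, z) else 0) + \<kappa> i"
proof -
  have "0 < sqrt s" "(sqrt s)\<^sup>2 = s" using assms by simp_all
  then show ?thesis
    using soliton_u_eq[of "sqrt s" \<kappa> i z K] soliton_u_potU[of "sqrt s" \<kappa> i z] by metis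
qed

lemma potU_corner:
  assumes "0 < s"
  shows "potU \<kappa> i (s, z) = cornerV \<kappa> K i (s, z) + (if \<sigma> K = i then right_log K (s, z) else 0)
     + (if \<sigma> (K + 1) = i then left_log K (s, z) else 0)"
proof -
  let ?W = "{K + 1 - N<..K + 1}"
  have hl: "half_line (s, c k - z) = ln s - half_line (s, z - c k)" for k
    using half_line_reflect[OF assms, of "z - c k"] by simp
  have "(if \<sigma> k = i then rodW k (s, z) else 0) = (if \<sigma> k = i then corner_reg K k (s, z) else 0) +
      ((if k = K then (if \<sigma> K = i then right_log K (s, z) else 0) else 0) +
       (if k = K + 1 then (if \<sigma> (K + 1) = i then left_log K (s, z) else 0) else 0))" if "k \<in> ?W" for k
    using hl[of k] hl[of "k + 1"]
    by (auto simp: rodW_def rodU_def corner_reg_def right_log_def left_log_def add.commute)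
  then have "(\<Sum>k\<in>?W. if \<sigma> k = i then rodW k (s, z) else 0) = (\<Sum>k\<in>?W. (if \<sigma> k = i then corner_reg K k (s, z) else 0) +
      ((if k = K then (if \<sigma> K = i then right_log K (s, z) else 0) else 0) +
       (if k = K + 1 then (if \<sigma> (K + 1) = i then left_log K (s, z) else 0) else 0)))"
    by (intro sum.cong) simp_all
  also have "\<dots> = (\<Sum>k\<in>?W. if \<sigma> k = i then corner_reg K k (s, z) else 0) +
     ((if \<sigma> K = i then right_log K (s, z) else 0) + (if \<sigma> (K + 1) = i then left_log K (s, z) else 0))"
    using N by (simp only: sum.distrib sum.delta finite_greaterThanAtMost_int) simp
  finally show ?thesis
    unfolding potU_window[OF assms, of _ _ _ "K + 1"] cornerV_def by simp
qed

definition rod_dom :: "int \<Rightarrow> (real \<times> real) set"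
  where "rod_dom K = {y. c K < snd y \<and> snd y < c (K + 1) \<and>
     0 < fst y + (snd y - c K)\<^sup>2 \<and> 0 < fst y + (c (K + 1) - snd y)\<^sup>2}"

text \<open>Over the rod \<open>K\<close>, \<open>left_log\<close> is regular and
  \<open>right_log\<close> equals ln s - \<open>left_log\<close>. Hence the structure of rod
  \<open>K\<close> keeps - \<open>left_log\<close> in its regular part and has ln s as its singular
  part.\<close>

definition rodV :: "('n \<Rightarrow> real) \<Rightarrow> int \<Rightarrow> 'n \<Rightarrow> real \<times> real \<Rightarrow> real"
  where "rodV \<kappa> K i y = cornerV \<kappa> K i y +
     ((if \<sigma> (K + 1) = i then 1 else 0) - (if \<sigma> K = i then 1 else 0)) * left_log K y"

lemma open_rod_dom: "open (rod_dom K)"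
  unfolding rod_dom_def
  by (intro open_Collect_conj open_Collect_less continuous_intros)

lemma rod_dom_corner: "rod_dom K \<subseteq> corner_dom K"
proof
  fix y assume y: "y \<in> rod_dom K"
  then show "y \<in> corner_dom K"
    using c_less[of "K + 1" "K + 2"] square_mono_pos[of "c (K + 1) - snd y" "c (K + 2) - snd y" "fst y"]
    by (auto simp: rod_dom_def corner_dom_def)
qed

lemma Cinf_left_log: "Cinf (rod_dom K) (left_log K)"
  unfolding left_log_def[abs_def]
  by (rule Cinf_compose2[OF Cinf_half_line])
    (intro Cinf_fst Cinf_snd Cinf_add Cinf_mult Cinf_const open_rod_dom | auto simp: rod_dom_def half_dom_def)+

lemma Cinf_rodV: "Cinf (rod_dom K) (rodV \<kappa> K i)"
  unfolding rodV_def[abs_def]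
  by (intro Cinf_add Cinf_mult Cinf_const open_rod_dom Cinf_left_log
      Cinf_subset[OF Cinf_cornerV open_rod_dom rod_dom_corner])

lemma potU_rod:
  assumes "0 < s"
  shows "potU \<kappa> i (s, z) = rodV \<kappa> K i (s, z) + (if \<sigma> K = i then ln s else 0)"
  using potU_corner[OF assms, of \<kappa> i z K] right_log_left_log[OF assms, of K z] alt[of K]
  by (auto simp: rodV_def)

lemma rod_dom_scale:
  assumes "(s, z) \<in> rod_dom K" and "0 \<le> t" and "t \<le> 1"
  shows "(t * s, z) \<in> rod_dom K"
proof -
  have "0 < t * s + q" if "0 < s + q" "0 < q" for q :: real
  proof (cases "s \<ge> 0")
    case True
    then show ?thesis using assms that by (simp add: add_nonneg_pos)
  next
    case False
    then have "s \<le> t * s" using assms by (simp add: mult_le_cancel_right1)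
    then show ?thesis using that by simp
  qed
  then show ?thesis using assms by (auto simp: rod_dom_def)
qed

text \<open>The fundamental theorem for a function known only for positive arguments and through its
  limit at 0. It gives \<alpha>, known off the axis and by limits on rods, a formula that makes
  sense on and beyond the axis.\<close>

lemma scale_integral_limit:
  assumes s: "0 < s"
    and d: "\<And>t. 0 < t \<Longrightarrow> t \<le> s \<Longrightarrow> (g has_real_derivative A (t, z)) (at t)"
    and lim: "(g \<longlongrightarrow> l) (at_right 0)"
  shows "g s = l + s * scale_integral 0 A (s, z)"
proof -
  define h where "h t = (if t = 0 then l else g (t * s))" for t
  have dh: "(h has_real_derivative A (t * s, z) * s) (at t)" if "0 < t" "t \<le> 1" for t
  proof -
    have "((\<lambda>t. g (t * s)) has_real_derivative A (t * s, z) * s) (at t)"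
      by (rule DERIV_chain'[where g = g])
        (use d[of "t * s"] that s in \<open>auto intro!: derivative_eq_intros simp: mult_le_cancel_right1\<close>)
    then show ?thesis
      by (rule has_field_derivative_transform_within_open[where S = "{0<..}"]) (use that in \<open>auto simp: h_def\<close>)
  qed
  have "((\<lambda>t. s * A (t * s, z)) has_integral h 1 - h 0) {0..1}"
  proof (rule fundamental_theorem_of_calculus_interior)
    show "continuous_on {0..1} h"
      unfolding continuous_on_eq_continuous_within
    proof
      fix t :: real assume t: "t \<in> {0..1}"
      show "continuous (at t within {0..1}) h"
      proof (cases "t = 0")
        case True
        have f: "filterlim (\<lambda>t. t * s) (at_right 0) (at_right 0)"
          unfolding filterlim_at using s
          by (auto intro!: tendsto_eq_intros simp: eventually_at_filter)
        have "((\<lambda>t. g (t * s)) \<longlongrightarrow> l) (at_right 0)"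
          by (rule filterlim_compose[OF lim f])
        then have "(h \<longlongrightarrow> l) (at_right 0)"
          by (rule Lim_transform_eventually) (auto simp: h_def eventually_at_filter)
        then have "(h \<longlongrightarrow> h 0) (at 0 within {0..1})"
          by (simp add: h_def at_within_Icc_at_right)
        then show ?thesis using True by (simp add: continuous_within)
      next
        case False
        then have "isCont h t" using dh[of t] t by (auto intro: DERIV_isCont)
        then show ?thesis by (rule continuous_at_imp_continuous_at_within)
      qed
    qed
    show "(h has_vector_derivative s * A (t * s, z)) (at t)" if "t \<in> {0<..<1}" for t
      using dh[of t] that by (simp add: has_real_derivative_iff_has_vector_derivative mult.commute)
  qed simp
  from integral_unique[OF this] show ?thesis by (simp add: h_def scale_integral_def)
qed

end

section \<open>The function \<alpha> across the rods\<close>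

locale soliton_array = rod_array z0 L P for z0 L :: real and P :: "'n::finite list" +
  fixes \<kappa> :: "'n \<Rightarrow> real" and \<alpha> :: "real \<Rightarrow> real \<Rightarrow> real"
  assumes sol: "soliton z0 L P \<kappa> \<alpha>"
begin

abbreviation u :: "'n \<Rightarrow> real \<Rightarrow> real \<Rightarrow> real" where "u \<equiv> soliton_u z0 L P \<kappa>"
abbreviation U :: "'n \<Rightarrow> real \<times> real \<Rightarrow> real" where "U \<equiv> potU \<kappa>"
abbreviation V :: "int \<Rightarrow> 'n \<Rightarrow> real \<times> real \<Rightarrow> real" where "V \<equiv> rodV \<kappa>"
abbreviation W :: "int \<Rightarrow> 'n \<Rightarrow> real \<times> real \<Rightarrow> real" where "W \<equiv> cornerV \<kappa>"

definition aS :: "real \<times> real \<Rightarrow> real" where "aS y = \<alpha> (sqrt (fst y)) (snd y)"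

text \<open>The derivative of \<alpha> in s = \<rho>^2, where the sum of the potentials has been
  replaced by 2 ln \<rho> + const. All terms with log f then combine to - 4 / s in the bracket; in
  \<open>A2\<close> they vanish.\<close>

definition A1 :: "real \<times> real \<Rightarrow> real"
  where "A1 y = ((\<Sum>i\<in>UNIV. 4 * fst y * (pdir1 (U i) y)\<^sup>2 - (pdir2 (U i) y)\<^sup>2) - 4 / fst y) / 16"

definition A2 :: "real \<times> real \<Rightarrow> real"
  where "A2 y = fst y / 2 * (\<Sum>i\<in>UNIV. pdir1 (U i) y * pdir2 (U i) y)"

lemma has_grad_U: "0 < fst y \<Longrightarrow> has_grad (U i) (pdir1 (U i) y) (pdir2 (U i) y) y"
  by (rule Cinf_grad[OF Cinf_potU]) simp

lemma u_derivs:
  assumes "\<rho> > 0"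
  shows "((\<lambda>r. u i r z) has_real_derivative 2 * \<rho> * pdir1 (U i) (\<rho>\<^sup>2, z)) (at \<rho>)"
    and "((\<lambda>z. u i \<rho> z) has_real_derivative pdir2 (U i) (\<rho>\<^sup>2, z)) (at z)"
proof -
  have "((\<lambda>r. U i (r\<^sup>2, z)) has_real_derivative pdir1 (U i) (\<rho>\<^sup>2, z) * (2 * \<rho>) + pdir2 (U i) (\<rho>\<^sup>2, z) * 0) (at \<rho>)"
    by (rule has_grad_curve[of _ _ _ "\<lambda>r. r\<^sup>2" _ "\<lambda>_. z", OF has_grad_U])
      (use assms in \<open>auto intro!: derivative_eq_intros\<close>)
  then have "((\<lambda>r. u i r z) has_real_derivative pdir1 (U i) (\<rho>\<^sup>2, z) * (2 * \<rho>) + pdir2 (U i) (\<rho>\<^sup>2, z) * 0) (at \<rho>)"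
    by (rule has_field_derivative_transform_within_open[where S = "{0<..}"])
      (use assms in \<open>auto simp: soliton_u_potU\<close>)
  then show "((\<lambda>r. u i r z) has_real_derivative 2 * \<rho> * pdir1 (U i) (\<rho>\<^sup>2, z)) (at \<rho>)"
    by (simp add: mult.commute)
  show "((\<lambda>z. u i \<rho> z) has_real_derivative pdir2 (U i) (\<rho>\<^sup>2, z)) (at z)"
    using has_grad_real_derivative2[OF has_grad_U[of "(\<rho>\<^sup>2, z)" i]] assms
    by (simp add: soliton_u_potU)
qed

lemma alpha_derivs:
  assumes \<rho>: "\<rho> > 0"
  shows "((\<lambda>r. \<alpha> r z) has_real_derivative 2 * \<rho> * A1 (\<rho>\<^sup>2, z)) (at \<rho>)"
    and "((\<lambda>z. \<alpha> \<rho> z) has_real_derivative A2 (\<rho>\<^sup>2, z)) (at z)"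
proof -
  define logf where "logf = (\<lambda>\<rho> z. \<Sum>i\<in>UNIV. u i \<rho> z)"
  obtain C where C: "\<And>\<rho> z. \<rho> > 0 \<Longrightarrow> logf \<rho> z = 2 * ln \<rho> + C"
    unfolding logf_def using sum_soliton_u by blast
  have "((\<lambda>r. 2 * ln r + C) has_real_derivative 2 / \<rho>) (at \<rho>)"
    using \<rho> by (auto intro!: derivative_eq_intros)
  then have "((\<lambda>r. logf r z) has_real_derivative 2 / \<rho>) (at \<rho>)"
    by (rule has_field_derivative_transform_within_open[where S = "{0<..}"]) (use \<rho> C in auto)
  then have r: "d\<rho> logf \<rho> z = 2 / \<rho>" by (simp add: d\<rho>_def DERIV_imp_deriv)
  have z: "dz logf \<rho> z = 0" by (simp add: dz_def C[OF \<rho>])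
  have ru: "d\<rho> (u i) \<rho> z = 2 * \<rho> * pdir1 (U i) (\<rho>\<^sup>2, z)" "dz (u i) \<rho> z = pdir2 (U i) (\<rho>\<^sup>2, z)" for i
    using u_derivs[OF \<rho>] by (auto simp: d\<rho>_def dz_def DERIV_imp_deriv)
  have eqs: "((\<lambda>r. \<alpha> r z) has_real_derivative
          \<rho> / 8 * ((d\<rho> logf \<rho> z)\<^sup>2 - (dz logf \<rho> z)\<^sup>2
                   + (\<Sum>i\<in>UNIV. (d\<rho> (u i) \<rho> z)\<^sup>2 - (dz (u i) \<rho> z)\<^sup>2)
                   - 4 / \<rho> * d\<rho> logf \<rho> z)) (at \<rho>)"
       "((\<lambda>s. \<alpha> \<rho> s) has_real_derivative
          \<rho> / 4 * (d\<rho> logf \<rho> z * dz logf \<rho> z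
                   + (\<Sum>i\<in>UNIV. d\<rho> (u i) \<rho> z * dz (u i) \<rho> z)
                   - 2 / \<rho> * dz logf \<rho> z)) (at z)"
    using sol \<rho> unfolding soliton_def alpha_equations_def logf_def Let_def by blast+
  have "\<rho> / 8 * ((d\<rho> logf \<rho> z)\<^sup>2 - (dz logf \<rho> z)\<^sup>2
                   + (\<Sum>i\<in>UNIV. (d\<rho> (u i) \<rho> z)\<^sup>2 - (dz (u i) \<rho> z)\<^sup>2)
                   - 4 / \<rho> * d\<rho> logf \<rho> z) = 2 * \<rho> * A1 (\<rho>\<^sup>2, z)"
  proof -
    have "(2 / \<rho>)\<^sup>2 - 0\<^sup>2 + S - 4 / \<rho> * (2 / \<rho>) = S - 4 / \<rho>\<^sup>2" for S
      by (simp add: power2_eq_square)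
    then show ?thesis
      unfolding r z ru A1_def by (simp add: power_mult_distrib)
  qed
  then show "((\<lambda>r. \<alpha> r z) has_real_derivative 2 * \<rho> * A1 (\<rho>\<^sup>2, z)) (at \<rho>)"
    using eqs(1) by (simp only:)
  have "\<rho> / 4 * (d\<rho> logf \<rho> z * dz logf \<rho> z + (\<Sum>i\<in>UNIV. d\<rho> (u i) \<rho> z * dz (u i) \<rho> z)
                   - 2 / \<rho> * dz logf \<rho> z) = A2 (\<rho>\<^sup>2, z)"
    unfolding r z ru A2_def
    by (simp add: power2_eq_square sum_distrib_left mult.assoc mult.left_commute)
  then show "((\<lambda>z. \<alpha> \<rho> z) has_real_derivative A2 (\<rho>\<^sup>2, z)) (at z)"
    using eqs(2) by (simp only:)
qed

lemma Cinf_A1: "Cinf {y. 0 < fst y} A1" and Cinf_A2: "Cinf {y. 0 < fst y} A2"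
proof -
  have "Cinf {y. 0 < fst y} (\<lambda>y. (1 / 16) * ((\<Sum>i\<in>UNIV. 4 * fst y * (pdir1 (U i) y)\<^sup>2 - (pdir2 (U i) y)\<^sup>2) - 4 / fst y))"
    by (intro Cinf_mult Cinf_diff Cinf_divide Cinf_sum Cinf_const Cinf_power Cinf_pdir Cinf_potU Cinf_fst open_upper)
      auto
  then show "Cinf {y. 0 < fst y} A1" unfolding A1_def[abs_def] by simp
  have "Cinf {y. 0 < fst y} (\<lambda>y. (1 / 2) * fst y * (\<Sum>i\<in>UNIV. pdir1 (U i) y * pdir2 (U i) y))"
    by (intro Cinf_mult Cinf_sum Cinf_const Cinf_pdir Cinf_potU Cinf_fst open_upper) auto
  then show "Cinf {y. 0 < fst y} A2" unfolding A2_def[abs_def] by simp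
qed

text \<open>The equations give only the two partial derivatives; continuity of \<open>A2\<close>
  upgrades them to a total derivative.\<close>

lemma has_grad_aS:
  assumes "0 < fst y"
  shows "has_grad aS (A1 y) (A2 y) y"
proof -
  obtain s z where y: "y = (s, z)" by fastforce
  have s: "s > 0" using assms y by simp
  have 1: "((\<lambda>s. \<alpha> (sqrt s) z) has_real_derivative A1 (s, z)) (at s)"
  proof -
    have "((\<lambda>s. \<alpha> (sqrt s) z) has_real_derivative (2 * sqrt s * A1 ((sqrt s)\<^sup>2, z)) * (inverse (sqrt s) / 2)) (at s)"
      by (rule DERIV_chain'[where g = "\<lambda>r. \<alpha> r z"])
        (use s in \<open>auto intro!: DERIV_real_sqrt alpha_derivs(1)[of "sqrt s" z, simplified]\<close>)
    then show ?thesis using s by (simp add: field_simps)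
  qed
  have bl: "blinfun_apply (a *\<^sub>R id_blinfun) = (*) a" for a :: real
    by (auto simp: blinfun.bilinear_simps)
  have "((\<lambda>(s, z). \<alpha> (sqrt s) z) has_derivative
      (\<lambda>(tx, ty). A1 (s, z) * tx + blinfun_apply (A2 (s, z) *\<^sub>R id_blinfun) ty)) (at (s, z) within {0<..} \<times> UNIV)"
  proof (rule has_derivative_partialsI[where fy = "\<lambda>s z. A2 (s, z) *\<^sub>R id_blinfun"])
    show "((\<lambda>s. \<alpha> (sqrt s) z) has_derivative (*) (A1 (s, z))) (at s within {0<..})"
      using 1 by (simp add: has_field_derivative_def has_derivative_at_withinI)
    show "((\<lambda>z. \<alpha> (sqrt s) z) has_derivative blinfun_apply (A2 (s, z) *\<^sub>R id_blinfun)) (at z within UNIV)"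
      if "s \<in> {0<..}" for s z
      using alpha_derivs(2)[of "sqrt s" z] that
      by (simp add: has_field_derivative_def bl)
    have "isCont A2 (s, z)" by (rule Cinf_imp_isCont[OF Cinf_A2]) (use s in simp)
    then have "isCont (\<lambda>y. A2 y *\<^sub>R (id_blinfun :: real \<Rightarrow>\<^sub>L real)) (s, z)"
      by (intro continuous_intros)
    then show "continuous (at (s, z) within {0<..} \<times> UNIV) (\<lambda>(s, z). A2 (s, z) *\<^sub>R (id_blinfun :: real \<Rightarrow>\<^sub>L real))"
      unfolding split_beta prod.collapse by (rule continuous_at_imp_continuous_at_within)
  qed auto
  moreover have "at (s, z) within {0<..} \<times> UNIV = at (s, z)"
    by (rule at_within_open) (use s in \<open>auto intro: open_Times\<close>)
  ultimately show ?thesis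
    unfolding has_grad_def y aS_def[abs_def] by (simp add: case_prod_unfold bl)
qed

lemma Cinf_aS: "Cinf {y. 0 < fst y} aS"
  by (rule Cinf_gradI[OF open_upper has_grad_aS Cinf_A1 Cinf_A2]) simp

definition rod_rhs :: "int \<Rightarrow> real \<times> real \<Rightarrow> real"
  where "rod_rhs K y = pdir1 (V K (\<sigma> K)) y / 2
     + (\<Sum>i\<in>UNIV. 4 * fst y * (pdir1 (V K i) y)\<^sup>2 - (pdir2 (V K i) y)\<^sup>2) / 16"

lemma Cinf_rod_rhs: "Cinf (rod_dom K) (rod_rhs K)"
proof -
  have "Cinf (rod_dom K) (\<lambda>y. (1 / 2) * pdir1 (V K (\<sigma> K)) y
     + (1 / 16) * (\<Sum>i\<in>UNIV. 4 * fst y * (pdir1 (V K i) y)\<^sup>2 - (pdir2 (V K i) y)\<^sup>2))"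
    by (intro Cinf_add Cinf_mult Cinf_diff Cinf_sum Cinf_const Cinf_power Cinf_pdir Cinf_rodV Cinf_fst open_rod_dom)
      auto
  then show ?thesis unfolding rod_rhs_def[abs_def] by simp
qed

text \<open>For the collapsing circle the potential is \<open>V\<close> + ln s, and 4 s times its
  squared s-derivative contains 4 / s. This cancels the - 4 / s of \<open>A1\<close>, and the cross
  term 8 \<open>pdir1 V\<close> gives the first summand of \<open>rod_rhs\<close>.\<close>

lemma A1_rod:
  assumes y: "y \<in> rod_dom K" and s: "0 < fst y"
  shows "A1 y = rod_rhs K y"
proof -
  let ?j = "\<sigma> K"
  let ?S = "rod_dom K \<inter> {y. 0 < fst y}"
  have op: "open ?S" by (intro open_Int open_rod_dom open_upper)
  have g: "has_grad (U i) (pdir1 (V K i) y + (if ?j = i then 1 / fst y else 0)) (pdir2 (V K i) y) y" for i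
  proof -
    have "has_grad (\<lambda>y. if ?j = i then ln (fst y) else 0) (if ?j = i then 1 / fst y else 0) 0 y"
      using s by (auto simp: has_grad_def field_simps intro!: derivative_eq_intros)
    from has_grad_add[OF Cinf_grad[OF Cinf_rodV y] this]
    have "has_grad (\<lambda>y. V K i y + (if ?j = i then ln (fst y) else 0))
      (pdir1 (V K i) y + (if ?j = i then 1 / fst y else 0)) (pdir2 (V K i) y) y" by simp
    then show ?thesis
      unfolding has_grad_def
      by (rule has_derivative_transform_within_open[OF _ op]) (use y s potU_rod[of _ \<kappa> i _ K] in auto)
  qed
  have "4 * fst y * (pdir1 (U i) y)\<^sup>2 - (pdir2 (U i) y)\<^sup>2 =
     (4 * fst y * (pdir1 (V K i) y)\<^sup>2 - (pdir2 (V K i) y)\<^sup>2) + (if i = ?j then 8 * pdir1 (V K i) y + 4 / fst y else 0)" for i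
    using has_gradD[OF g[of i]] s by (auto simp: power2_eq_square field_simps)
  then have "(\<Sum>i\<in>UNIV. 4 * fst y * (pdir1 (U i) y)\<^sup>2 - (pdir2 (U i) y)\<^sup>2) =
     (\<Sum>i\<in>UNIV. 4 * fst y * (pdir1 (V K i) y)\<^sup>2 - (pdir2 (V K i) y)\<^sup>2) + (8 * pdir1 (V K ?j) y + 4 / fst y)"
    by (simp add: sum.distrib)
  then show ?thesis by (simp add: A1_def rod_rhs_def)
qed

text \<open>The value on the axis is dictated by the absence of conical singularities: ln \<rho> +
  \<alpha> - u / 2 tends to 0 where u = V + 2 ln \<rho>.\<close>

definition rodA :: "int \<Rightarrow> real \<times> real \<Rightarrow> real"
  where "rodA K y = V K (\<sigma> K) (0, snd y) / 2 + fst y * scale_integral 0 (rod_rhs K) y"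

lemma rod_dom_axis: "c K < z \<Longrightarrow> z < c (K + 1) \<Longrightarrow> 0 \<le> s \<Longrightarrow> (s, z) \<in> rod_dom K"
  by (simp add: rod_dom_def add_nonneg_pos)

lemma Cinf_rodA: "Cinf (rod_dom K) (rodA K)"
proof -
  have "Cinf (rod_dom K) (\<lambda>y. V K (\<sigma> K) (0, snd y))"
    by (rule Cinf_compose2[OF Cinf_rodV])
      (intro Cinf_const Cinf_snd open_rod_dom | auto simp: rod_dom_def intro!: rod_dom_axis)+
  then have "Cinf (rod_dom K) (\<lambda>y. (1 / 2) * V K (\<sigma> K) (0, snd y) + fst y * scale_integral 0 (rod_rhs K) y)"
    by (intro Cinf_add Cinf_mult Cinf_const Cinf_fst open_rod_dom Cinf_scale_integral Cinf_rod_rhs rod_dom_scale)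
  then show ?thesis unfolding rodA_def[abs_def] by simp
qed

lemma aS_tendsto_axis:
  assumes "c K < z" and "z < c (K + 1)"
  shows "((\<lambda>s. aS (s, z)) \<longlongrightarrow> V K (\<sigma> K) (0, z) / 2) (at_right 0)"
proof -
  have lim: "((\<lambda>\<rho>. ln \<rho> + \<alpha> \<rho> z - u (\<sigma> K) \<rho> z / 2) \<longlongrightarrow> 0) (at_right 0)"
    using sol assms unfolding soliton_def c_def by blast
  have sq: "filterlim sqrt (at_right 0) (at_right 0)"
    unfolding filterlim_at by (auto intro!: tendsto_eq_intros simp: eventually_at_filter)
  have "((\<lambda>s. ln (sqrt s) + \<alpha> (sqrt s) z - u (\<sigma> K) (sqrt s) z / 2) \<longlongrightarrow> 0) (at_right 0)"
    by (rule filterlim_compose[OF lim sq])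
  moreover have "((\<lambda>s. V K (\<sigma> K) (s, z) / 2) \<longlongrightarrow> V K (\<sigma> K) (0, z) / 2) (at_right 0)"
  proof -
    have "isCont (\<lambda>s. V K (\<sigma> K) (s, z)) 0"
      by (rule DERIV_isCont[OF has_grad_real_derivative1[OF Cinf_grad[OF Cinf_rodV rod_dom_axis[OF assms order_refl]]]])
    then have "((\<lambda>s. V K (\<sigma> K) (s, z)) \<longlongrightarrow> V K (\<sigma> K) (0, z)) (at_right 0)"
      unfolding isCont_def by (rule filterlim_mono[OF _ order_refl at_le]) simp
    then show ?thesis by (intro tendsto_intros) auto
  qed
  ultimately have "((\<lambda>s. (ln (sqrt s) + \<alpha> (sqrt s) z - u (\<sigma> K) (sqrt s) z / 2) + V K (\<sigma> K) (s, z) / 2)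
      \<longlongrightarrow> 0 + V K (\<sigma> K) (0, z) / 2) (at_right 0)"
    by (rule tendsto_add)
  then have "((\<lambda>s. (ln (sqrt s) + \<alpha> (sqrt s) z - u (\<sigma> K) (sqrt s) z / 2) + V K (\<sigma> K) (s, z) / 2)
      \<longlongrightarrow> V K (\<sigma> K) (0, z) / 2) (at_right 0)"
    by simp
  then show ?thesis
  proof (rule Lim_transform_eventually)
    have "(ln (sqrt s) + \<alpha> (sqrt s) z - u (\<sigma> K) (sqrt s) z / 2) + V K (\<sigma> K) (s, z) / 2 = aS (s, z)" if "s > 0" for s
      using that potU_rod[OF that, of \<kappa> "\<sigma> K" z K] by (simp add: aS_def soliton_u_potU ln_sqrt add_divide_distrib)
    then show "\<forall>\<^sub>F s in at_right 0. (ln (sqrt s) + \<alpha> (sqrt s) z - u (\<sigma> K) (sqrt s) z / 2) + V K (\<sigma> K) (s, z) / 2 = aS (s, z)"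
      by (auto simp: eventually_at_filter)
  qed
qed

lemma aS_rod:
  assumes z: "c K < z" "z < c (K + 1)" and s: "0 < s"
  shows "aS (s, z) = rodA K (s, z)"
proof -
  have "aS (s, z) = V K (\<sigma> K) (0, z) / 2 + s * scale_integral 0 (rod_rhs K) (s, z)"
  proof (rule scale_integral_limit[where g = "\<lambda>s. aS (s, z)", OF s _ aS_tendsto_axis[OF z]])
    show "((\<lambda>s. aS (s, z)) has_real_derivative rod_rhs K (t, z)) (at t)" if "0 < t" "t \<le> s" for t
      using has_grad_real_derivative1[OF has_grad_aS, of t z] A1_rod[of "(t, z)" K] rod_dom_axis[OF z, of t] that
      by simp
  qed
  then show ?thesis by (simp add: rodA_def)
qed

end


section \<open>Smooth data over rods and at corners\<close>

lemma has_grad_cong: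
  "has_grad F a b y \<Longrightarrow> open S \<Longrightarrow> y \<in> S \<Longrightarrow> (\<And>x. x \<in> S \<Longrightarrow> F x = G x) \<Longrightarrow> has_grad G a b y"
  unfolding has_grad_def by (rule has_derivative_transform_within_open)

context soliton_array
begin

text \<open>By the value of \<open>rodA\<close> on the axis the two exponentials agree at s = 0.
  Dividing their difference by \<open>s\<close> yields \<open>q\<close>, the coefficient of the
  squared one-form in the Cartesian chart.\<close>

lemma rod_extension:
  obtains a q :: "real \<times> real \<Rightarrow> real" and w :: "'n \<Rightarrow> real \<times> real \<Rightarrow> real"
  where "Cinf (rod_dom K) a" and "Cinf (rod_dom K) q" and "\<And>i. Cinf (rod_dom K) (w i)"
    and "\<And>s z. 0 < s \<Longrightarrow> c K < z \<Longrightarrow> z < c (K + 1) \<Longrightarrow> aS (s, z) = a (s, z)"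
    and "\<And>i s z. 0 < s \<Longrightarrow> U i (s, z) = w i (s, z) + (if \<sigma> K = i then ln s else 0)"
    and "\<And>s z. (s, z) \<in> rod_dom K \<Longrightarrow> exp (w (\<sigma> K) (s, z)) = exp (2 * a (s, z)) + s * q (s, z)"
proof -
  define F where "F y = exp (V K (\<sigma> K) y) - exp (2 * rodA K y)" for y
  have F: "Cinf (rod_dom K) F"
    unfolding F_def[abs_def]
    by (intro Cinf_diff Cinf_exp' Cinf_mult Cinf_const Cinf_rodV Cinf_rodA open_rod_dom) auto
  show thesis
  proof (rule that[of "rodA K" "scale_integral 0 (pdir1 F)" "V K"])
    show "Cinf (rod_dom K) (scale_integral 0 (pdir1 F))"
      by (intro Cinf_scale_integral Cinf_pdir F rod_dom_scale)
    show "exp (V K (\<sigma> K) (s, z)) = exp (2 * rodA K (s, z)) + s * scale_integral 0 (pdir1 F) (s, z)"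
      if "(s, z) \<in> rod_dom K" for s z
    proof -
      have "F (s, z) = F (0, z) + s * scale_integral 0 (pdir1 F) (s, z)"
        by (rule scale_integral_ftc[OF F]) (rule rod_dom_scale[OF that])
      moreover have "F (0, z) = 0" by (simp add: F_def rodA_def)
      ultimately show ?thesis by (simp add: F_def)
    qed
  qed (simp_all only: Cinf_rodA Cinf_rodV aS_rod[where K = K] potU_rod[where K = K])
qed

text \<open>Near a corner use \<open>X = R + (z - c)\<close> and \<open>Y = R - (z - c)\<close>, so that \<open>s = X Y\<close> and
  \<open>z = c + (X - Y) / 2\<close>.\<close>

definition corner_pt :: "int \<Rightarrow> real \<times> real \<Rightarrow> real \<times> real"
  where "corner_pt K y = (fst y * snd y, c (K + 1) + (fst y - snd y) / 2)"

text \<open>The half-width gap / 2 gives s > - (gap / 2)^2 and keeps z within gap / 2 of the corner,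
  which places \<open>corner_pt\<close> in \<open>corner_dom\<close>. The box is symmetric under
  exchange of the two coordinates.\<close>

definition box :: "(real \<times> real) set"
  where "box = {y. \<bar>fst y\<bar> < gap / 2 \<and> \<bar>snd y\<bar> < gap / 2}"

lemma open_box: "open box"
  unfolding box_def by (intro open_Collect_conj open_Collect_less continuous_intros)

lemma corner_pt_dom: "y \<in> box \<Longrightarrow> corner_pt K y \<in> corner_dom K"
proof -
  assume y: "y \<in> box"
  obtain X Y where [simp]: "y = (X, Y)" by fastforce
  have XY: "\<bar>X\<bar> < gap / 2" "\<bar>Y\<bar> < gap / 2" using y by (auto simp: box_def)
  have "\<bar>X * Y\<bar> < gap / 2 * (gap / 2)"
    unfolding abs_mult by (rule mult_strict_mono') (use XY in auto)
  then have s: "0 < X * Y + (gap / 2)\<^sup>2" by (simp add: power2_eq_square)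
  have c: "c (K + 1) = c K + gap" "c (K + 2) = c K + 2 * gap" using c_add[of K 1] c_add[of K 2] by auto
  define d where "d = (X - Y) / 2"
  have d: "gap / 2 \<le> gap + d" "gap / 2 \<le> gap - d" using XY by (simp_all add: d_def abs_less_iff field_simps)
  have p: "corner_pt K y = (X * Y, c K + gap + d)" by (simp add: corner_pt_def c d_def)
  show ?thesis
    using square_mono_pos[OF _ d(1) s] square_mono_pos[OF _ d(2) s] gap d
    unfolding p by (simp add: corner_dom_def c add.assoc)
qed

lemma Cinf_corner_pt:
  assumes "Cinf (corner_dom K) F"
  shows "Cinf box (\<lambda>y. F (corner_pt K y))"
proof -
  have "Cinf box (\<lambda>y. F (fst y * snd y, c (K + 1) + (1 / 2) * (fst y - snd y)))"
  proof (rule Cinf_compose2[OF assms])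
    show "Cinf box (\<lambda>y. fst y * snd y)" "Cinf box (\<lambda>y. c (K + 1) + (1 / 2) * (fst y - snd y))"
      by (intro Cinf_mult Cinf_add Cinf_diff Cinf_const Cinf_fst Cinf_snd open_box)+
    show "(fst y * snd y, c (K + 1) + 1 / 2 * (fst y - snd y)) \<in> corner_dom K" if "y \<in> box" for y
      using corner_pt_dom[OF that, of K] by (simp add: corner_pt_def)
  qed
  then show ?thesis by (simp add: corner_pt_def)
qed

text \<open>The X-derivative of 2 \<alpha> + ln (X + Y) with its singular terms cancelled
  (\<open>corner_rhs_eq\<close>). The logarithm belongs there because d\<rho>^2 + dz^2 is X + Y
  times the flat metric in sqrt X and sqrt Y: the exponential of the combination is the metric
  coefficient in the corner chart.\<close>

definition corner_rhs :: "int \<Rightarrow> real \<times> real \<Rightarrow> real"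
  where "corner_rhs K y = (1 / 2) * snd y * (\<Sum>i\<in>UNIV. fst y * (fst y + snd y) * (pdir1 (W K i) (corner_pt K y))\<^sup>2
        - (fst y * pdir1 (W K i) (corner_pt K y) - (1 / 2) * pdir2 (W K i) (corner_pt K y))\<^sup>2)
     + snd y * pdir1 (W K (\<sigma> K)) (corner_pt K y) + (1 / 2) * pdir2 (W K (\<sigma> (K + 1))) (corner_pt K y)"

lemma Cinf_corner_rhs: "Cinf box (corner_rhs K)"
  unfolding corner_rhs_def[abs_def]
  by (intro Cinf_add Cinf_mult Cinf_diff Cinf_sum Cinf_const Cinf_power Cinf_fst Cinf_snd open_box
      Cinf_corner_pt Cinf_pdir Cinf_cornerV) auto

text \<open>The edge X = 0 lies on rod \<open>K\<close>. There 2 \<alpha> equals the regular part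
  over the rod, which is \<open>W\<close> - ln Y, and adding ln (X + Y) = ln Y leaves the initial
  value.\<close>

definition cornerPhi :: "int \<Rightarrow> real \<times> real \<Rightarrow> real"
  where "cornerPhi K y = W K (\<sigma> K) (corner_pt K (0, snd y)) + fst y * scale_integral 0 (corner_rhs K) y"

lemma box_scale: "(X, Y) \<in> box \<Longrightarrow> 0 \<le> t \<Longrightarrow> t \<le> 1 \<Longrightarrow> (t * X, Y) \<in> box"
  using mult_right_mono[of t 1 "\<bar>X\<bar>"] by (auto simp: box_def abs_mult)

lemma Cinf_cornerPhi: "Cinf box (cornerPhi K)"
proof -
  have "Cinf box (\<lambda>y. W K (\<sigma> K) (corner_pt K (0, snd y)))"
    by (rule Cinf_compose2[OF Cinf_corner_pt[OF Cinf_cornerV]])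
      (intro Cinf_const Cinf_snd open_box | use gap in \<open>simp add: box_def\<close>)+
  then show ?thesis
    unfolding cornerPhi_def[abs_def]
    by (intro Cinf_add Cinf_mult Cinf_fst open_box Cinf_scale_integral Cinf_corner_rhs box_scale)
qed

lemma corner_pole:
  assumes "0 < X" and "0 < Y"
  shows "pole_dist (X * Y, (X - Y) / 2) = (X + Y) / 2"
proof -
  have "X * Y + ((X - Y) / 2)\<^sup>2 = ((X + Y) / 2)\<^sup>2" by (simp add: power2_eq_square field_simps)
  then show ?thesis using assms by (simp add: pole_dist_def)
qed

lemma corner_logs:
  assumes "0 < X" and "0 < Y"
  shows "right_log K (corner_pt K (X, Y)) = ln X" and "left_log K (corner_pt K (X, Y)) = ln Y"
    and "has_grad (right_log K) (1 / ((X + Y) * X)) (2 / (X + Y)) (corner_pt K (X, Y))"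
    and "has_grad (left_log K) (1 / ((X + Y) * Y)) (- 2 / (X + Y)) (corner_pt K (X, Y))"
proof -
  have r: "pole_dist (X * Y, (X - Y) / 2) = (X + Y) / 2" "pole_dist (X * Y, (Y - X) / 2) = (X + Y) / 2"
    using corner_pole[OF assms] corner_pole[OF assms(2,1)] by (simp_all add: mult.commute add.commute)
  show "right_log K (corner_pt K (X, Y)) = ln X" "left_log K (corner_pt K (X, Y)) = ln Y"
    using r by (simp_all add: right_log_def left_log_def corner_pt_def half_line_def field_simps)
  have d: "(X * Y, (X - Y) / 2) \<in> half_dom" "(X * Y, (Y - X) / 2) \<in> half_dom"
    using assms by (simp_all add: half_dom_def add_pos_nonneg)
  have "has_grad half_line (1 / ((X + Y) * X)) (2 / (X + Y)) (X * Y, (X - Y) / 2)"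
  proof -
    have e: "(X + Y) / 2 + (X - Y) / 2 = X" by (simp add: field_simps)
    show ?thesis
      using has_grad_half_line[OF d(1)] assms by (simp add: monom3_def r e inverse_eq_divide)
  qed
  then have "has_grad (\<lambda>y. half_line (fst y, - c (K + 1) + 1 * snd y)) (1 / ((X + Y) * X)) (1 * (2 / (X + Y))) (corner_pt K (X, Y))"
    by (intro has_grad_reflect) (simp add: corner_pt_def)
  then show "has_grad (right_log K) (1 / ((X + Y) * X)) (2 / (X + Y)) (corner_pt K (X, Y))"
    by (simp add: right_log_def[abs_def])
  have "has_grad half_line (1 / ((X + Y) * Y)) (2 / (X + Y)) (X * Y, (Y - X) / 2)"
  proof -
    have e: "(X + Y) / 2 + (Y - X) / 2 = Y" by (simp add: field_simps)
    show ?thesis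
      using has_grad_half_line[OF d(2)] assms by (simp add: monom3_def r e inverse_eq_divide)
  qed
  moreover have "(fst (corner_pt K (X, Y)), c (K + 1) + (-1) * snd (corner_pt K (X, Y))) = (X * Y, (Y - X) / 2)"
    by (simp add: corner_pt_def field_simps)
  ultimately have "has_grad (\<lambda>y. half_line (fst y, c (K + 1) + (-1) * snd y)) (1 / ((X + Y) * Y)) ((-1) * (2 / (X + Y))) (corner_pt K (X, Y))"
    by (intro has_grad_reflect) (simp only:)
  then show "has_grad (left_log K) (1 / ((X + Y) * Y)) (- 2 / (X + Y)) (corner_pt K (X, Y))"
    by (simp add: left_log_def[abs_def])
qed

lemma potU_corner_pt:
  assumes "0 < X" and "0 < Y"
  shows "U i (corner_pt K (X, Y)) = W K i (corner_pt K (X, Y)) + (if \<sigma> K = i then ln X else 0)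
    + (if \<sigma> (K + 1) = i then ln Y else 0)"
proof -
  have "0 < X * Y" using assms by simp
  from potU_corner[OF this, of \<kappa> i "c (K + 1) + (X - Y) / 2" K] show ?thesis
    using corner_logs(1,2)[OF assms, of K] by (simp add: corner_pt_def)
qed

text \<open>\<open>Q a b\<close> is what one potential with s-derivative a and z-derivative b
  contributes to the X-derivative of 2 \<alpha>. The first form is the one used in
  \<open>corner_rhs\<close>; the others record the effect of adding the gradient of ln X or of ln Y
  to the regular part.\<close>

lemma corner_summand:
  fixes X Y p q :: real
  assumes "0 < X" and "0 < Y"
  defines "Q \<equiv> \<lambda>a b. Y / 8 * (4 * (X * Y) * a\<^sup>2 - b\<^sup>2) + X * Y / 2 * (a * b)"
  shows "Q p q = (1 / 2) * Y * (X * (X + Y) * p\<^sup>2 - (X * p - (1 / 2) * q)\<^sup>2)"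
    and "Q (p + 1 / ((X + Y) * X)) (q + 2 / (X + Y)) = Q p q + (Y * p + Y / (2 * X * (X + Y)))"
    and "Q (p + 1 / ((X + Y) * Y)) (q + (- 2 / (X + Y))) = Q p q + ((1 / 2) * q - 1 / (2 * (X + Y)))"
proof -
  show "Q p q = (1 / 2) * Y * (X * (X + Y) * p\<^sup>2 - (X * p - (1 / 2) * q)\<^sup>2)"
    by (simp add: Q_def power2_eq_square field_simps)
  \<comment> \<open>With the reciprocals named, the identities are polynomial modulo X R + Y R = 1,
    X A = 1 and Y B = 1.\<close>
  define R where "R = 1 / (X + Y)"
  define A where "A = 1 / X"
  define B where "B = 1 / Y"
  have R: "X * R = 1 - Y * R" using assms by (simp add: R_def field_simps)
  have A: "X * A = 1" "Y * B = 1" using assms by (simp_all add: A_def B_def)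
  have e: "1 / ((X + Y) * X) = R * A" "2 / (X + Y) = 2 * R" "Y / (2 * X * (X + Y)) = Y * A * R / 2"
    "1 / ((X + Y) * Y) = R * B" "- 2 / (X + Y) = - (2 * R)" "1 / (2 * (X + Y)) = R / 2"
    by (simp_all add: R_def A_def B_def)
  have "Q (p + R * A) (q + 2 * R) - Q p q - (Y * p + Y * A * R / 2) = 0"
  proof -
    have "Q (p + R * A) (q + 2 * R) - Q p q = Y * p * (Y * R * (X * A) + X * R) + Y * q * (- R / 2 + R * (X * A) / 2)
       + Y * (R * (Y * R) * A * (X * A) / 2 - R * R / 2 + R * R * (X * A))"
      by (simp add: Q_def power2_eq_square field_simps)
    also have "\<dots> = Y * p * (Y * R + X * R) + Y * R * (Y * R * A + R) / 2"
      unfolding A by (simp add: field_simps)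
    also have "Y * R * A + R = R * A * (X + Y)" using A by (simp add: algebra_simps)
    also have "R * A * (X + Y) = A" using R by (simp add: algebra_simps) 
    finally show ?thesis using R by (simp add: mult.assoc)
  qed
  then show "Q (p + 1 / ((X + Y) * X)) (q + 2 / (X + Y)) = Q p q + (Y * p + Y / (2 * X * (X + Y)))"
    unfolding e by simp
  have "Q (p + R * B) (q + - (2 * R)) = Q p q + ((1 / 2) * q - R / 2)"
  proof -
    have "Q (p + R * B) (q + - (2 * R)) - Q p q = X * Y * p * (R * (Y * B) - R) + q * (Y * R + X * R * (Y * B)) / 2
       + (X * R * R * (Y * B) * (Y * B) / 2 - Y * R * R / 2 - X * R * R * (Y * B))"
      by (simp add: Q_def power2_eq_square field_simps)
    also have "\<dots> = q * (Y * R + X * R) / 2 - R * (X * R + Y * R) / 2"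
      unfolding A by (simp add: field_simps)
    also have "\<dots> = q / 2 - R / 2" using R by simp
    finally show ?thesis by simp
  qed
  then show "Q (p + 1 / ((X + Y) * Y)) (q + (- 2 / (X + Y))) = Q p q + ((1 / 2) * q - 1 / (2 * (X + Y)))"
    unfolding e by simp
qed

lemma corner_rhs_eq:
  fixes K :: int
  assumes XY: "0 < X" "0 < Y" and b: "(X, Y) \<in> box"
  defines "y \<equiv> corner_pt K (X, Y)"
  shows "2 * (A1 y * Y + A2 y * (1 / 2)) + 1 / (X + Y) = corner_rhs K (X, Y)"
proof -
  let ?j = "\<sigma> K" and ?k = "\<sigma> (K + 1)"
  define Q where "Q a b = Y / 8 * (4 * (X * Y) * a\<^sup>2 - b\<^sup>2) + X * Y / 2 * (a * b)" for a b
  note cs = corner_summand[OF XY, folded Q_def]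
  have yd: "y \<in> corner_dom K" unfolding y_def by (rule corner_pt_dom[OF b])
  have fy: "fst y = X * Y" by (simp add: y_def corner_pt_def)
  let ?S = "corner_dom K \<inter> {y. 0 < fst y}"
  have op: "open ?S" by (intro open_Int open_corner_dom open_upper)
  let ?p = "\<lambda>i. pdir1 (W K i) y" and ?q = "\<lambda>i. pdir2 (W K i) y"
  have g: "has_grad (U i) (?p i + (if ?j = i then 1 else 0) * (1 / ((X + Y) * X)) + (if ?k = i then 1 else 0) * (1 / ((X + Y) * Y)))
       (?q i + (if ?j = i then 1 else 0) * (2 / (X + Y)) + (if ?k = i then 1 else 0) * (- 2 / (X + Y))) y" for i
  proof (rule has_grad_cong[OF _ op])
    show "has_grad (\<lambda>y. W K i y + (if ?j = i then 1 else 0) * right_log K y + (if ?k = i then 1 else 0) * left_log K y)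
      (?p i + (if ?j = i then 1 else 0) * (1 / ((X + Y) * X)) + (if ?k = i then 1 else 0) * (1 / ((X + Y) * Y)))
       (?q i + (if ?j = i then 1 else 0) * (2 / (X + Y)) + (if ?k = i then 1 else 0) * (- 2 / (X + Y))) y"
      using corner_logs(3,4)[OF XY, of K] unfolding y_def[symmetric]
      by (intro has_grad_add has_grad_cmult Cinf_grad[OF Cinf_cornerV yd])
    show "W K i x + (if ?j = i then 1 else 0) * right_log K x + (if ?k = i then 1 else 0) * left_log K x = U i x" if "x \<in> ?S" for x
      using potU_corner[of "fst x" \<kappa> i "snd x" K] that by auto
    show "y \<in> ?S" using yd fy XY by simp
  qed
  have "Q (pdir1 (U i) y) (pdir2 (U i) y) = (1 / 2) * Y * (X * (X + Y) * (?p i)\<^sup>2 - (X * ?p i - (1 / 2) * ?q i)\<^sup>2)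
     + ((if i = ?j then Y * ?p ?j + Y / (2 * X * (X + Y)) else 0) + (if i = ?k then (1 / 2) * ?q ?k - 1 / (2 * (X + Y)) else 0))" for i
    using has_gradD[OF g[of i]] cs[of "?p i" "?q i"] alt[of K] by auto
  then have sq: "(\<Sum>i\<in>UNIV. Q (pdir1 (U i) y) (pdir2 (U i) y)) = corner_rhs K (X, Y) + Y / (2 * X * (X + Y)) - 1 / (2 * (X + Y))"
    by (simp add: sum.distrib corner_rhs_def y_def[symmetric] sum_distrib_left mult.assoc)
  have "2 * (A1 y * Y + A2 y * (1 / 2)) = (\<Sum>i\<in>UNIV. Q (pdir1 (U i) y) (pdir2 (U i) y)) - 1 / (2 * X)"
  proof -
    have "(\<Sum>i\<in>UNIV. Q (pdir1 (U i) y) (pdir2 (U i) y)) =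
       Y / 8 * (\<Sum>i\<in>UNIV. 4 * (X * Y) * (pdir1 (U i) y)\<^sup>2 - (pdir2 (U i) y)\<^sup>2) +
       X * Y / 2 * (\<Sum>i\<in>UNIV. pdir1 (U i) y * pdir2 (U i) y)"
      by (simp add: Q_def sum.distrib sum_distrib_left)
    moreover have "2 * ((S - 4 / (X * Y)) / 16 * Y + X * Y / 2 * T * (1 / 2)) = Y / 8 * S + X * Y / 2 * T - 1 / (2 * X)" for S T
      using XY by (simp add: field_simps)
    ultimately show ?thesis
      unfolding A1_def A2_def fy by (simp only:)
  qed
  then have "2 * (A1 y * Y + A2 y * (1 / 2)) + 1 / (X + Y) =
      corner_rhs K (X, Y) + (Y / (2 * X * (X + Y)) - 1 / (2 * (X + Y)) - 1 / (2 * X) + 1 / (X + Y))"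
    unfolding sq by simp
  \<comment> \<open>The contributions of ln X, of ln Y, of the term - 4 / s in \<open>A1\<close>,
    and of ln (X + Y), in this order.\<close>
  also have "Y / (2 * X * (X + Y)) - 1 / (2 * (X + Y)) - 1 / (2 * X) + 1 / (X + Y) = 0"
    using XY by (simp add: divide_simps) (simp add: algebra_simps)
  finally show ?thesis by simp
qed

lemma at_right_of_isCont: "isCont (f :: real \<Rightarrow> real) a \<Longrightarrow> (f \<longlongrightarrow> f a) (at_right a)"
  by (simp add: isCont_def filterlim_at_split)

lemma corner_phi:
  assumes XY: "0 < X" "0 < Y" and b: "(X, Y) \<in> box"
  shows "2 * aS (corner_pt K (X, Y)) + ln (X + Y) = cornerPhi K (X, Y)"
proof -
  let ?j = "\<sigma> K"
  let ?g = "\<lambda>X. 2 * aS (corner_pt K (X, Y)) + ln (X + Y)"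
  have Yb: "Y < gap / 2" using b XY by (simp add: box_def)
  have c: "c (K + 1) = c K + gap" using c_add[of K 1] by simp
  have "?g X = W K ?j (corner_pt K (0, Y)) + X * scale_integral 0 (corner_rhs K) (X, Y)"
  proof (rule scale_integral_limit[where g = ?g, OF XY(1)])
    fix t assume t: "0 < t" "t \<le> X"
    have tb: "(t, Y) \<in> box" using t b by (auto simp: box_def)
    have "((\<lambda>X. aS (X * Y, c (K + 1) + (X - Y) / 2)) has_real_derivative
      A1 (t * Y, c (K + 1) + (t - Y) / 2) * Y + A2 (t * Y, c (K + 1) + (t - Y) / 2) * (1 / 2)) (at t)"
      by (rule has_grad_curve[OF has_grad_aS]) (use t XY in \<open>auto intro!: derivative_eq_intros\<close>)
    then have "((\<lambda>X. 2 * aS (X * Y, c (K + 1) + (X - Y) / 2) + ln (X + Y)) has_real_derivative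
      2 * (A1 (t * Y, c (K + 1) + (t - Y) / 2) * Y + A2 (t * Y, c (K + 1) + (t - Y) / 2) * (1 / 2)) + 1 / (t + Y)) (at t)"
      using t XY by (intro DERIV_add DERIV_cmult) (auto intro!: derivative_eq_intros)
    then show "(?g has_real_derivative corner_rhs K (t, Y)) (at t)"
      using corner_rhs_eq[OF t(1) XY(2) tb, of K] by (simp add: corner_pt_def)
  next
    \<comment> \<open>For X < Y the point lies over rod \<open>K\<close>, where \<open>rodA\<close>
      represents \<alpha> and is regular up to X = 0; the limit is read off there.\<close>
    let ?h = "\<lambda>X. 2 * rodA K (X * Y, c (K + 1) + (X - Y) / 2) + ln (X + Y)"
    have z0: "c K < c (K + 1) + (0 - Y) / 2" "c (K + 1) + (0 - Y) / 2 < c (K + 1)"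
      using Yb XY gap by (simp_all add: c)
    have ic: "isCont ?h 0"
    proof -
      have "isCont (\<lambda>X. rodA K (X * Y, c (K + 1) + (X - Y) / 2)) 0"
        by (rule DERIV_isCont[OF has_grad_curve[OF Cinf_grad[OF Cinf_rodA[of K]], where f' = Y and g' = "1/2"]])
          (use rod_dom_axis[OF z0] in \<open>auto intro!: derivative_eq_intros\<close>)
      then show ?thesis using XY by (intro continuous_intros) auto
    qed
    have hl0: "half_line (0, Y / 2) = ln Y" using XY by (simp add: half_line_def pole_dist_def)
    have "2 * rodA K (0, c (K + 1) - Y / 2) = W K ?j (0, c (K + 1) - Y / 2) - ln Y"
      using alt[of K] hl0 by (simp add: rodA_def rodV_def left_log_def)
    then have "?h 0 = W K ?j (corner_pt K (0, Y))" by (simp add: corner_pt_def)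
    then have "(?h \<longlongrightarrow> W K ?j (corner_pt K (0, Y))) (at_right 0)"
      using at_right_of_isCont[OF ic] by simp
    then show "(?g \<longlongrightarrow> W K ?j (corner_pt K (0, Y))) (at_right 0)"
    proof (rule Lim_transform_eventually)
      have "?h X = ?g X" if "0 < X" "X < Y" for X
      proof -
        have "0 < gap + (X - Y) / 2" using that XY Yb by (simp add: field_simps)
        then show ?thesis
          using aS_rod[of K "c (K + 1) + (X - Y) / 2" "X * Y"] that XY by (simp add: corner_pt_def c)
      qed
      then show "\<forall>\<^sub>F X in at_right 0. ?h X = ?g X"
        using XY by (auto simp: eventually_at_right[OF XY(2)] intro!: exI[of _ Y])
    qed
  qed
  then show ?thesis by (simp add: cornerPhi_def)
qed

text \<open>\<open>cornerPhi\<close> was integrated from rod \<open>K\<close>; its value on the edge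
  Y = 0 is controlled by the absence of a conical singularity on rod \<open>K + 1\<close>. At fixed
  X > 0 the point lies over that rod as Y tends to 0, and the corner itself follows by
  continuity.\<close>

lemma cornerPhi_edge:
  assumes "0 \<le> X" and "X < gap / 2"
  shows "cornerPhi K (X, 0) = W K (\<sigma> (K + 1)) (corner_pt K (X, 0))"
proof -
  let ?k = "\<sigma> (K + 1)"
  have c: "c (K + 1) = c K + gap" "c (K + 1 + 1) = c K + 2 * gap"
    using c_add[of K 1] c_add[of "K + 1" 1] by simp_all
  have pos: "cornerPhi K (X, 0) = W K ?k (corner_pt K (X, 0))" if X: "0 < X" "X < gap / 2" for X
  proof -
    let ?z = "c (K + 1) + X / 2"
    have z: "c (K + 1) < ?z" "?z < c (K + 1 + 1)" using X gap unfolding c by simp_all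
    have xb: "(X, 0) \<in> box" using X by (simp add: box_def)
    let ?h = "\<lambda>Y. 2 * rodA (K + 1) (X * Y, c (K + 1) + (X - Y) / 2) + ln (X + Y)"
    have "isCont (\<lambda>Y. rodA (K + 1) (X * Y, c (K + 1) + (X - Y) / 2)) 0"
      by (rule DERIV_isCont[OF has_grad_curve[OF Cinf_grad[OF Cinf_rodA[of "K + 1"]], where f' = X and g' = "-1/2"]])
        (use rod_dom_axis[OF z, of 0] in \<open>auto intro!: derivative_eq_intros\<close>)
    then have "isCont ?h 0" using X by (intro continuous_intros) auto
    then have l1: "(?h \<longlongrightarrow> ?h 0) (at_right 0)" by (rule at_right_of_isCont)
    have "isCont (\<lambda>Y. cornerPhi K (X, Y)) 0"
      by (rule DERIV_isCont[OF has_grad_real_derivative2[OF Cinf_grad[OF Cinf_cornerPhi xb]]])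
    then have l2: "((\<lambda>Y. cornerPhi K (X, Y)) \<longlongrightarrow> cornerPhi K (X, 0)) (at_right 0)"
      by (rule at_right_of_isCont)
    have eq: "cornerPhi K (X, Y) = ?h Y" if "0 < Y" "Y < X" for Y
    proof -
      have "aS (X * Y, c (K + 1) + (X - Y) / 2) = rodA (K + 1) (X * Y, c (K + 1) + (X - Y) / 2)"
        by (rule aS_rod; (unfold c)?; use that X gap in simp)
      then show ?thesis
        using corner_phi[of X Y K] that X by (simp add: corner_pt_def box_def)
    qed
    have "((\<lambda>Y. cornerPhi K (X, Y)) \<longlongrightarrow> ?h 0) (at_right 0)"
      by (rule Lim_transform_eventually[OF l1])
        (use eq X in \<open>auto simp: eventually_at_right[OF X(1)] intro!: exI[of _ X]\<close>)
    from tendsto_unique[OF _ l2 this] have 1: "cornerPhi K (X, 0) = V (K + 1) ?k (0, ?z) + ln X"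
      by (simp add: rodA_def)
    have "isCont (\<lambda>s. V (K + 1) ?k (s, ?z)) 0"
      by (rule DERIV_isCont[OF has_grad_real_derivative1[OF Cinf_grad[OF Cinf_rodV rod_dom_axis[OF z order_refl]]]])
    then have l3: "((\<lambda>s. V (K + 1) ?k (s, ?z)) \<longlongrightarrow> V (K + 1) ?k (0, ?z)) (at_right 0)" by (rule at_right_of_isCont)
    have "(0, ?z) \<in> corner_dom K" using corner_pt_dom[OF xb, of K] by (simp add: corner_pt_def)
    then have i1: "isCont (\<lambda>s. W K ?k (s, ?z)) 0"
      by (rule DERIV_isCont[OF has_grad_real_derivative1[OF Cinf_grad[OF Cinf_cornerV]]])
    have hd: "(0, X / 2) \<in> half_dom" using X by (simp add: half_dom_def)
    have i2: "isCont (\<lambda>s. half_line (s, X / 2)) 0"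
      by (rule DERIV_isCont[OF has_grad_real_derivative1[OF has_grad_half_line[OF hd]]])
    have l4: "((\<lambda>s. W K ?k (s, ?z) - half_line (s, X / 2)) \<longlongrightarrow> W K ?k (0, ?z) - half_line (0, X / 2)) (at_right 0)"
      by (intro tendsto_diff at_right_of_isCont[OF i1] at_right_of_isCont[OF i2])
    \<comment> \<open>The two regular parts of one potential, relative to the corner and relative to
      rod \<open>K + 1\<close>, differ by \<open>right_log\<close>.\<close>
    have "W K ?k (s, ?z) - half_line (s, X / 2) = V (K + 1) ?k (s, ?z)" if "s > 0" for s
      using potU_rod[OF that, of \<kappa> ?k ?z "K + 1"] potU_corner[OF that, of \<kappa> ?k ?z K] alt[of K]
        right_log_left_log[OF that, of K ?z] by (simp add: right_log_def)
    then have "((\<lambda>s. V (K + 1) ?k (s, ?z)) \<longlongrightarrow> W K ?k (0, ?z) - half_line (0, X / 2)) (at_right 0)"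
      by (intro Lim_transform_eventually[OF l4]) (auto simp: eventually_at_filter)
    from tendsto_unique[OF _ l3 this] have "V (K + 1) ?k (0, ?z) = W K ?k (0, ?z) - ln X"
      using X by (simp add: half_line_def pole_dist_def)
    then show ?thesis using 1 by (simp add: corner_pt_def)
  qed
  show ?thesis
  proof (cases "X = 0")
    case True
    have xb: "(0, 0) \<in> box" using gap by (simp add: box_def)
    have "isCont (\<lambda>X. cornerPhi K (X, 0)) 0"
      by (rule DERIV_isCont[OF has_grad_real_derivative1[OF Cinf_grad[OF Cinf_cornerPhi xb]]])
    then have l1: "((\<lambda>X. cornerPhi K (X, 0)) \<longlongrightarrow> cornerPhi K (0, 0)) (at_right 0)" by (rule at_right_of_isCont)
    have "isCont (\<lambda>X. W K ?k (corner_pt K (X, 0))) 0"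
      by (rule DERIV_isCont[OF has_grad_real_derivative1[OF Cinf_grad[OF Cinf_corner_pt[OF Cinf_cornerV] xb]]])
    then have l2: "((\<lambda>X. W K ?k (corner_pt K (X, 0))) \<longlongrightarrow> W K ?k (corner_pt K (0, 0))) (at_right 0)"
      by (rule at_right_of_isCont)
    have "((\<lambda>X. cornerPhi K (X, 0)) \<longlongrightarrow> W K ?k (corner_pt K (0, 0))) (at_right 0)"
      by (rule Lim_transform_eventually[OF l2])
        (use pos gap in \<open>auto simp: eventually_at_right[of 0 "gap / 2"] intro!: exI[of _ "gap / 2"]\<close>)
    from tendsto_unique[OF _ l1 this] show ?thesis using True by simp
  qed (use pos assms in auto)
qed

lemma corner_extension:
  obtains \<Phi> p q :: "real \<times> real \<Rightarrow> real" and w :: "'n \<Rightarrow> real \<times> real \<Rightarrow> real"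
  where "Cinf box \<Phi>" and "Cinf box p" and "Cinf box q" and "\<And>i. Cinf box (w i)"
    and "\<And>X Y. 0 < X \<Longrightarrow> 0 < Y \<Longrightarrow> (X, Y) \<in> box \<Longrightarrow> 2 * aS (corner_pt K (X, Y)) + ln (X + Y) = \<Phi> (X, Y)"
    and "\<And>i X Y. 0 < X \<Longrightarrow> 0 < Y \<Longrightarrow> U i (corner_pt K (X, Y)) = w i (X, Y)
        + (if \<sigma> K = i then ln X else 0) + (if \<sigma> (K + 1) = i then ln Y else 0)"
    and "\<And>X Y. (X, Y) \<in> box \<Longrightarrow> 0 \<le> X \<Longrightarrow> 0 \<le> Y \<Longrightarrow> exp (w (\<sigma> K) (X, Y)) = exp (\<Phi> (X, Y)) + X * p (X, Y)"
    and "\<And>X Y. (X, Y) \<in> box \<Longrightarrow> 0 \<le> X \<Longrightarrow> 0 \<le> Y \<Longrightarrow> exp (w (\<sigma> (K + 1)) (X, Y)) = exp (\<Phi> (X, Y)) + Y * q (X, Y)"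
proof -
  define w where "w i y = W K i (corner_pt K y)" for i y
  have w: "Cinf box (w i)" for i
    unfolding w_def[abs_def] by (rule Cinf_corner_pt[OF Cinf_cornerV])
  define F where "F i y = exp (w i y) - exp (cornerPhi K y)" for i y
  have F: "Cinf box (F i)" for i
    unfolding F_def[abs_def] by (intro Cinf_diff Cinf_exp' w Cinf_cornerPhi) auto
  \<comment> \<open>\<open>scale_integral\<close> divides by the first coordinate, so the difference
    that vanishes on Y = 0 is treated with the coordinates exchanged.\<close>
  define G where "G y = F (\<sigma> (K + 1)) (snd y, fst y)" for y
  have swap: "(x, y) \<in> box \<longleftrightarrow> (y, x) \<in> box" for x y by (auto simp: box_def)
  have G: "Cinf box G"
    unfolding G_def[abs_def]
    by (rule Cinf_compose2[OF F]) (intro Cinf_fst Cinf_snd open_box | simp add: swap)+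
  have GI: "Cinf box (scale_integral 0 (pdir1 G))"
    by (intro Cinf_scale_integral Cinf_pdir G box_scale)
  show thesis
  proof (rule that[of "cornerPhi K" "scale_integral 0 (pdir1 (F (\<sigma> K)))" "\<lambda>y. scale_integral 0 (pdir1 G) (snd y, fst y)" w])
    show "Cinf box (scale_integral 0 (pdir1 (F (\<sigma> K))))"
      by (intro Cinf_scale_integral Cinf_pdir F box_scale)
    show "Cinf box (\<lambda>y. scale_integral 0 (pdir1 G) (snd y, fst y))"
      by (rule Cinf_compose2[OF GI]) (intro Cinf_fst Cinf_snd open_box | simp add: swap)+
    fix X Y assume b: "(X, Y) \<in> box" "0 \<le> X" "0 \<le> Y"
    have "F (\<sigma> K) (X, Y) = F (\<sigma> K) (0, Y) + X * scale_integral 0 (pdir1 (F (\<sigma> K))) (X, Y)"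
      by (rule scale_integral_ftc[OF F]) (rule box_scale[OF b(1)])
    moreover have "F (\<sigma> K) (0, Y) = 0" by (simp add: F_def w_def cornerPhi_def)
    ultimately show "exp (w (\<sigma> K) (X, Y)) = exp (cornerPhi K (X, Y)) + X * scale_integral 0 (pdir1 (F (\<sigma> K))) (X, Y)"
      by (simp add: F_def)
    have "G (Y, X) = G (0, X) + Y * scale_integral 0 (pdir1 G) (Y, X)"
      by (rule scale_integral_ftc[OF G]) (rule box_scale, use b in \<open>simp add: swap\<close>)
    moreover have "G (0, X) = 0"
      using cornerPhi_edge[of X K] b by (simp add: G_def F_def w_def box_def)
    ultimately show "exp (w (\<sigma> (K + 1)) (X, Y)) = exp (cornerPhi K (X, Y)) + Y * scale_integral 0 (pdir1 G) (snd (X, Y), fst (X, Y))"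
      by (simp add: G_def F_def)
  qed (auto intro: Cinf_cornerPhi w corner_phi simp: potU_corner_pt w_def)
qed

end


section \<open>Coordinate geometry of diagonal metrics\<close>

text \<open>After a translation that puts the first coordinate of the point at 0, write f by
  \<open>scale_integral_ftc\<close> and differentiate in z under the integral; then apply
  \<open>scale_integral_ftc\<close> to \<open>pdir2 f\<close> itself. Both mixed derivatives have
  the same mean over every segment from 0 to s \<noteq> 0, and s \<rightarrow> 0 gives equality at
  the point.\<close>

lemma pdir_commute:
  assumes F: "Cinf S F" and y: "y \<in> S"
  shows "pdir1 (pdir2 F) y = pdir2 (pdir1 F) y"
proof -
  obtain a b where ab: "y = (a, b)" by fastforce
  obtain e where e: "e > 0" "ball y e \<subseteq> S" using Cinf_open[OF F] y openE by blast
  define B where "B = ball (0::real, b) e"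
  define f where "f = (\<lambda>v. F (a + fst v, snd v))"
  have inS: "(a + fst v, snd v) \<in> S" if "v \<in> B" for v
    using that e by (auto simp: B_def ab dist_prod_def dist_real_def)
  have op: "open B" by (simp add: B_def)
  have tr: "Cinf B (\<lambda>v. G (a + fst v, snd v))" if "Cinf S G" for G
    by (rule Cinf_compose2[OF that]) (intro Cinf_add Cinf_const Cinf_fst Cinf_snd op | simp add: inS)+
  have gr: "has_grad (\<lambda>v. G (a + fst v, snd v)) (pdir1 G (a + fst v, snd v)) (pdir2 G (a + fst v, snd v)) v"
    if "Cinf S G" "v \<in> B" for G v
  proof -
    have "((\<lambda>v. (a + fst v, snd v)) has_derivative (\<lambda>v. (0 + fst v, snd v))) (at v)"
      by (intro has_derivative_Pair has_derivative_fst has_derivative_snd has_derivative_ident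
          has_derivative_add has_derivative_const)
    from has_derivative_compose[OF this Cinf_grad[OF that(1) inS[OF that(2)], unfolded has_grad_def]]
    show ?thesis by (simp add: has_grad_def)
  qed
  have sc: "(t * s, z) \<in> B" if "(s, z) \<in> B" "0 \<le> t" "t \<le> 1" for s z t
  proof -
    have "\<bar>t * s\<bar> \<le> \<bar>s\<bar>" using that by (simp add: abs_mult mult_left_le_one_le)
    then have "(t * s)\<^sup>2 \<le> s\<^sup>2" by (simp add: abs_le_square_iff)
    then have "sqrt ((t * s)\<^sup>2 + (b - z)\<^sup>2) \<le> sqrt (s\<^sup>2 + (b - z)\<^sup>2)" by simp
    moreover have "sqrt (s\<^sup>2 + (b - z)\<^sup>2) < e" using that(1) by (simp add: B_def dist_prod_def dist_real_def)
    ultimately have "sqrt ((t * s)\<^sup>2 + (b - z)\<^sup>2) < e" by linarith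
    then show ?thesis by (simp add: B_def dist_prod_def dist_real_def)
  qed
  have f: "Cinf B f" unfolding f_def by (rule tr[OF F])
  have p1: "pdir1 f v = pdir1 F (a + fst v, snd v)" and p2: "pdir2 f v = pdir2 F (a + fst v, snd v)" if "v \<in> B" for v
    using has_gradD[OF gr[OF F that]] unfolding f_def by auto
  have f12: "pdir2 (pdir1 f) v = pdir2 (pdir1 F) (a + fst v, snd v)"
    "pdir1 (pdir2 f) v = pdir1 (pdir2 F) (a + fst v, snd v)" if "v \<in> B" for v
    using pdir_cong(2)[OF op that p1] pdir_cong(1)[OF op that p2]
      has_gradD[OF gr[OF Cinf_pdir(1)[OF F] that]] has_gradD[OF gr[OF Cinf_pdir(2)[OF F] that]] by simp_all
  let ?g = "\<lambda>v. pdir2 (pdir1 f) v - pdir1 (pdir2 f) v"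
  have Cg: "Cinf B (pdir2 (pdir1 f))" "Cinf B (pdir1 (pdir2 f))" by (intro Cinf_pdir f)+
  have z: "scale_integral 0 (pdir2 (pdir1 f)) (s, b) = scale_integral 0 (pdir1 (pdir2 f)) (s, b)"
    if s: "(s, b) \<in> B" "s \<noteq> 0" for s
  proof -
    let ?I = "\<lambda>v. fst v * scale_integral 0 (pdir1 f) v"
    have ftc: "f v = f (0, snd v) + ?I v" if "v \<in> B" for v
      using scale_integral_ftc[OF f, of "fst v" "snd v"] sc[of "fst v" "snd v"] that by simp
    have g1: "((\<lambda>z. f (s, z)) has_real_derivative pdir2 f (s, b)) (at b)"
      by (rule has_grad_real_derivative2[OF Cinf_grad[OF f s(1)]])
    have b0: "(0, b) \<in> B" using e by (simp add: B_def)
    have g2: "((\<lambda>z. f (0, z)) has_real_derivative pdir2 f (0, b)) (at b)"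
      by (rule has_grad_real_derivative2[OF Cinf_grad[OF f b0]])
    have g3: "((\<lambda>z. scale_integral 0 (pdir1 f) (s, z)) has_real_derivative scale_integral 0 (pdir2 (pdir1 f)) (s, b)) (at b)"
      by (rule has_grad_real_derivative2[OF has_grad_scale_integral[OF Cinf_pdir(1)[OF f] sc s(1)]])
    have g4: "((\<lambda>z. f (0, z) + s * scale_integral 0 (pdir1 f) (s, z)) has_real_derivative
        pdir2 f (0, b) + s * scale_integral 0 (pdir2 (pdir1 f)) (s, b)) (at b)"
      by (intro DERIV_add DERIV_cmult g2 g3)
    have opz: "open {z. (s, z) \<in> B}"
    proof -
      have "{z. (s, z) \<in> B} = Pair s -` B" by auto
      then show ?thesis using open_vimage[OF op, of "Pair s"] by (simp add: continuous_on_Pair)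
    qed
    have "((\<lambda>z. f (s, z)) has_real_derivative pdir2 f (0, b) + s * scale_integral 0 (pdir2 (pdir1 f)) (s, b)) (at b)"
      by (rule has_field_derivative_transform_within_open[OF g4 opz]) (use s ftc in auto)
    from DERIV_unique[OF g1 this] have "pdir2 f (s, b) = pdir2 f (0, b) + s * scale_integral 0 (pdir2 (pdir1 f)) (s, b)" .
    moreover have "pdir2 f (s, b) = pdir2 f (0, b) + s * scale_integral 0 (pdir1 (pdir2 f)) (s, b)"
      by (rule scale_integral_ftc[OF Cinf_pdir(2)[OF f]]) (rule sc[OF s(1)])
    ultimately show ?thesis using s(2) by simp
  qed
  have b0: "(0, b) \<in> B" using e by (simp add: B_def)
  have ic: "isCont (\<lambda>s. scale_integral 0 h (s, b)) 0" if "Cinf B h" for h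
    by (rule DERIV_isCont[OF has_grad_real_derivative1[OF has_grad_scale_integral[OF that sc b0]]])
  have ev: "\<forall>\<^sub>F s in at 0. scale_integral 0 (pdir2 (pdir1 f)) (s, b) = scale_integral 0 (pdir1 (pdir2 f)) (s, b)"
    unfolding eventually_at using e z
    by (intro exI[of _ e]) (auto simp: B_def dist_prod_def dist_real_def)
  have "(\<lambda>s. scale_integral 0 (pdir1 (pdir2 f)) (s, b)) \<midarrow>0\<rightarrow> scale_integral 0 (pdir2 (pdir1 f)) (0, b)"
    by (rule Lim_transform_eventually[OF _ ev]) (use ic[OF Cg(1)] in \<open>simp add: isCont_def\<close>)
  then have "scale_integral 0 (pdir2 (pdir1 f)) (0, b) = scale_integral 0 (pdir1 (pdir2 f)) (0, b)"
    using ic[OF Cg(2)] LIM_unique unfolding isCont_def by blast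
  then have "pdir2 (pdir1 f) (0, b) = pdir1 (pdir2 f) (0, b)"
    by (simp add: scale_integral_def)
  then show ?thesis using f12[OF b0] ab by simp
qed

section \<open>Smooth matrix fields, diagonal matrices and signature\<close>

lemma partial_eq: "(F has_derivative F') (at x) \<Longrightarrow> partial k F x = F' (axis k 1)"
  unfolding partial_def using frechet_derivative_at by metis

lemma partial_cong:
  assumes "open S" and "x \<in> S" and "\<And>y. y \<in> S \<Longrightarrow> F y = G y"
  shows "partial k F x = partial k G x"
proof -
  have "(F has_derivative D) (at x) \<longleftrightarrow> (G has_derivative D) (at x)" for D
    using has_derivative_transform_within_open[OF _ assms(1,2)] assms(3) by metis
  then show ?thesis by (simp add: partial_def frechet_derivative_def)
qed

lemma partial_const [simp]: "partial k (\<lambda>_. c) x = 0"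
  by (rule partial_eq[OF has_derivative_const, THEN trans]) simp

lemma has_derivative_matrix:
  fixes h :: "real ^ 'm \<Rightarrow> real ^ 'p ^ 'q"
  assumes "\<And>k l. ((\<lambda>x. h x $ k $ l) has_derivative D k l) (at x)"
  shows "(h has_derivative (\<lambda>v. \<chi> k l. D k l v)) (at x)"
  unfolding has_derivative_componentwise_within[of h]
  using assms by (auto simp: Basis_vec_def inner_axis)

text \<open>The entries of an iterated partial derivative are, on \<open>S\<close>, directional
  derivatives of entries; the induction over the list therefore carries \<open>Cinf\<close> of every
  entry.\<close>

lemma smooth_on_matrix:
  fixes h :: "real ^ 'm \<Rightarrow> real ^ 'p ^ 'q"
  assumes "open S" and "\<And>k l. Cinf S (\<lambda>x. h x $ k $ l)"
  shows "smooth_on S h"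
proof -
  have d: "(g has_derivative (\<lambda>v. \<chi> k l. frechet_derivative (\<lambda>x. g x $ k $ l) (at x) v)) (at x)"
    if "\<And>k l. Cinf S (\<lambda>x. g x $ k $ l)" "x \<in> S" for g :: "real ^ 'm \<Rightarrow> real ^ 'p ^ 'q" and x
    by (rule has_derivative_matrix) (rule Cinf_frechet(1)[OF that])
  have "Cinf S (\<lambda>x. foldr partial ks h x $ k $ l)" for ks k l
  proof (induction ks arbitrary: k l)
    case (Cons m ks)
    show ?case
      by (rule Cinf_cong[OF Cinf_frechet(2)[OF Cons.IH[of k l], of "axis m 1"]])
        (simp add: partial_eq[OF d[OF Cons.IH]])
  qed (simp add: assms)
  then show ?thesis
    unfolding smooth_on_def using d assms(1)
    by (meson differentiableI differentiable_at_imp_differentiable_on)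
qed

lemma smooth_on_const:
  assumes "open S"
  shows "smooth_on S (\<lambda>_. c)"
proof -
  have e: "foldr partial ks (\<lambda>_. c) = (\<lambda>_. if ks = [] then c else 0)" for ks
  proof (induction ks)
    case (Cons k ks)
    have "partial k (\<lambda>_. if ks = [] then c else 0) = (\<lambda>_. 0)" by (rule ext) simp
    then show ?case by (simp add: Cons)
  qed simp
  have "foldr partial ks (\<lambda>_. c) differentiable_on S" for ks
    unfolding e by (rule differentiable_on_const)
  then show ?thesis using assms by (simp only: smooth_on_def) blast
qed

lemma pullback_translation: "pullback (\<lambda>y. y + d) g x = g (x + d)"
proof -
  have "((\<lambda>y. y + d) has_derivative (\<lambda>v. v)) (at x)"
    by (auto intro!: derivative_eq_intros)
  then have "jacobian (\<lambda>y. y + d) (at x) = matrix (\<lambda>v. v)"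
    unfolding jacobian_def using frechet_derivative_at by metis
  then show ?thesis
    by (simp add: pullback_def matrix_id_mat_1[unfolded id_def] transpose_mat)
qed

definition diag :: "('m \<Rightarrow> real) \<Rightarrow> real ^ 'm ^ 'm"
  where "diag d = (\<chi> k l. if k = l then d k else 0)"

lemma diag_mult: "diag a ** diag b = diag (\<lambda>k. a k * b k :: real)" for a :: "'m::finite \<Rightarrow> real"
  by (simp add: diag_def matrix_matrix_mult_def vec_eq_iff if_distrib[of "\<lambda>x. x * _"] if_distrib[of "\<lambda>x. _ * x"]
      cong: if_cong)

lemma diag_one: "diag (\<lambda>_. 1) = mat 1"
  by (simp add: diag_def mat_def)

lemma transpose_diag: "transpose (diag d) = diag d"
  by (auto simp: diag_def transpose_def vec_eq_iff)

lemma diag_inverse: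
  fixes d :: "'m::finite \<Rightarrow> real"
  assumes "\<And>k. d k \<noteq> 0"
  shows "diag d ** diag (\<lambda>k. 1 / d k) = mat 1" and "diag (\<lambda>k. 1 / d k) ** diag d = mat 1"
  using assms by (simp_all add: diag_mult diag_one)

lemma matrix_inv_diag:
  fixes d :: "'m::finite \<Rightarrow> real"
  assumes "\<And>k. d k \<noteq> 0"
  shows "matrix_inv (diag d) = diag (\<lambda>k. 1 / d k)"
proof -
  note i = diag_inverse[OF assms]
  have inv: "diag d ** matrix_inv (diag d) = mat 1 \<and> matrix_inv (diag d) ** diag d = mat 1"
    unfolding matrix_inv_def by (rule someI[where x = "diag (\<lambda>k. 1 / d k)"]) (intro conjI i)
  have "matrix_inv (diag d) = (diag (\<lambda>k. 1 / d k) ** diag d) ** matrix_inv (diag d)"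
    by (simp only: i matrix_mul_lid)
  also have "\<dots> = diag (\<lambda>k. 1 / d k)"
    using inv by (simp only: matrix_mul_assoc[symmetric] matrix_mul_rid)
  finally show ?thesis .
qed

lemma lorentzian_diag:
  fixes d :: "'m::finite \<Rightarrow> real"
  assumes "d m < 0" and "\<And>k. k \<noteq> m \<Longrightarrow> 0 < d k"
  shows "lorentzian (diag d)"
proof -
  define e where "e k = 1 / sqrt \<bar>d k\<bar>" for k
  have nz: "d k \<noteq> 0" for k using assms by (cases "k = m") (auto dest: assms(2))
  have e0: "e k \<noteq> 0" for k using nz by (simp add: e_def)
  have "e k * d k * e k = (if k = m then - 1 else 1)" for k
  proof -
    have "e k * d k * e k = d k / (sqrt \<bar>d k\<bar> * sqrt \<bar>d k\<bar>)" by (simp add: e_def)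
    also have "\<dots> = d k / \<bar>d k\<bar>" by simp
    finally show ?thesis using assms(1) assms(2)[of k] by (cases "k = m") auto
  qed
  then have "transpose (diag e) ** diag d ** diag e = (\<chi> k l. if k \<noteq> l then 0 else if k = m then - 1 else 1)"
    by (simp only: transpose_diag diag_mult) (simp add: diag_def vec_eq_iff)
  moreover have "invertible (diag e)"
    unfolding invertible_def using diag_inverse[of e] e0 by blast
  ultimately show ?thesis
    unfolding lorentzian_def transpose_diag[of d] by blast
qed

lemma lorentzian_congruent:
  fixes A Q :: "real ^ 'm::finite ^ 'm"
  assumes "lorentzian (transpose Q ** A ** Q)" and "transpose A = A" and "invertible Q"
  shows "lorentzian A"
proof -
  obtain P :: "real ^ 'm ^ 'm" and k0 where P: "invertible P" "transpose P ** (transpose Q ** A ** Q) ** P =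
       (\<chi> k l. if k \<noteq> l then 0 else if k = k0 then - 1 else 1)"
    using assms(1) unfolding lorentzian_def by blast
  have "transpose (Q ** P) ** A ** (Q ** P) = transpose P ** (transpose Q ** A ** Q) ** P"
    by (simp only: matrix_transpose_mul matrix_mul_assoc)
  moreover have "invertible (Q ** P)" using assms(3) P(1) by (rule invertible_mult)
  ultimately have "transpose (Q ** P) ** A ** (Q ** P) = (\<chi> k l. if k \<noteq> l then 0 else if k = k0 then - 1 else 1)"
    "invertible (Q ** P)" using P(2) by (simp_all only:)
  then show ?thesis using assms(2) unfolding lorentzian_def by blast
qed

subsection \<open>Ricci curvature of Weyl metrics\<close>

lemma sum_coord: "(\<Sum>c\<in>UNIV. h c) = h Rho + h Zc + (\<Sum>j\<in>UNIV. h (Phi j))"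
  for h :: "'n::finite coord \<Rightarrow> 'b::comm_monoid_add"
proof -
  have "(\<Sum>c\<in>range Phi. h c) = (\<Sum>j\<in>UNIV. h (Phi j))"
    by (rule sum.reindex_cong[OF _ refl]) (auto simp: inj_on_def)
  moreover have "(Rho :: 'n coord) \<notin> insert Zc (range Phi)" "(Zc :: 'n coord) \<notin> range Phi" by auto
  moreover have "finite (range (Phi :: 'n \<Rightarrow> 'n coord))" by simp
  ultimately show ?thesis unfolding UNIV_coord
    by (simp only: sum.insert finite_insert not_False_eq_True add.assoc)
qed

lemma coord_eq_simps [simp]: "(\<forall>c. Q c) \<longleftrightarrow> Q Rho \<and> Q Zc \<and> (\<forall>j. Q (Phi j))" for Q :: "'n coord \<Rightarrow> bool"
  by (metis coord.exhaust)

lemma has_derivative_rho_z: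
  assumes "has_grad f a b (x $ Rho, x $ Zc)"
  shows "((\<lambda>x :: real ^ 'n::finite coord. f (x $ Rho, x $ Zc)) has_derivative (\<lambda>v. a * v $ Rho + b * v $ Zc)) (at x)"
proof -
  have "((\<lambda>x :: real ^ 'n coord. (x $ Rho, x $ Zc)) has_derivative (\<lambda>v. (v $ Rho, v $ Zc))) (at x)"
    by (intro has_derivative_Pair bounded_linear_imp_has_derivative bounded_linear_vec_nth)
  from has_derivative_compose[OF this assms[unfolded has_grad_def]] show ?thesis by simp
qed

lemma partial_rho_z:
  assumes "has_grad f a b (x $ Rho, x $ Zc)"
  shows "partial Rho (\<lambda>x :: real ^ 'n::finite coord. f (x $ Rho, x $ Zc)) x = a"
    and "partial Zc (\<lambda>x :: real ^ 'n coord. f (x $ Rho, x $ Zc)) x = b"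
    and "partial (Phi j) (\<lambda>x :: real ^ 'n coord. f (x $ Rho, x $ Zc)) x = 0"
  using partial_eq[OF has_derivative_rho_z[OF assms]] by (simp_all add: axis_def)

lemma open_off_axis: "open (off_axis :: (real ^ 'n::finite coord) set)"
  unfolding off_axis_def by (intro open_Collect_less continuous_intros)

text \<open>The first coordinate is here \<rho> itself and not its square, as the metric is written
  in \<rho> and z.\<close>

locale weyl =
  fixes a :: "real \<times> real \<Rightarrow> real" and w :: "'n::finite \<Rightarrow> real \<times> real \<Rightarrow> real" and i :: 'n
    and H :: "(real \<times> real) set"
  assumes H_def: "H = {y. 0 < fst y}" and Ca: "Cinf H a" and Cw: "\<And>j. Cinf H (w j)"
begin

definition coef :: "'n coord \<Rightarrow> real \<times> real \<Rightarrow> real"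
  where "coef k y = (case k of Rho \<Rightarrow> exp (2 * a y) | Zc \<Rightarrow> exp (2 * a y)
     | Phi j \<Rightarrow> (if j = i then - exp (w j y) else exp (w j y)))"

definition G :: "'n coord metric_field"
  where "G x = diag (\<lambda>k. coef k (x $ Rho, x $ Zc))"

lemma off_axis_H: "x \<in> off_axis \<longleftrightarrow> (x $ Rho, x $ Zc) \<in> H"
  by (simp add: off_axis_def H_def)

lemma open_H: "open H" unfolding H_def by (intro open_Collect_less continuous_intros)

lemma coef_nz: "coef k y \<noteq> 0" by (simp add: coef_def split: coord.split)

lemma Cinf_if: "(b \<Longrightarrow> Cinf S f) \<Longrightarrow> (\<not> b \<Longrightarrow> Cinf S g) \<Longrightarrow> Cinf S (\<lambda>y. if b then f y else g y)"
  by (cases b) simp_all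

lemma Cinf_half: "Cinf H f \<Longrightarrow> Cinf H (\<lambda>y. f y / 2)"
  using Cinf_mult[OF Cinf_const[OF open_H, of "1/2"], of f] by simp

lemmas Cinf_ints = Cinf_half Cinf_if Cinf_const open_H Ca Cw Cinf_exp' Cinf_mult Cinf_minus Cinf_diff Cinf_pdir UNIV_I

lemma Cinf_coef: "Cinf H (coef k)"
  by (cases k; simp only: coef_def[abs_def] coord.case; intro Cinf_ints)

lemma Cinf_rho_z: "Cinf H f \<Longrightarrow> Cinf off_axis (\<lambda>x :: real ^ 'n coord. f (x $ Rho, x $ Zc))"
  by (rule Cinf_compose2) (auto intro: Cinf_nth open_off_axis simp: off_axis_H)

lemma smooth_G: "smooth_on off_axis G"
proof (rule smooth_on_matrix[OF open_off_axis])
  show "Cinf off_axis (\<lambda>x. G x $ k $ l)" for k l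
    using Cinf_rho_z[OF Cinf_coef, of k] Cinf_const[OF open_off_axis, of 0]
    by (cases "k = l") (simp_all add: G_def diag_def)
qed

lemma lorentzian_G: "lorentzian (G x)"
  unfolding G_def by (rule lorentzian_diag[of _ "Phi i"]) (auto simp: coef_def split: coord.split)

definition dcoef :: "'n coord \<Rightarrow> 'n coord \<Rightarrow> real \<times> real \<Rightarrow> real"
  where "dcoef k m y = coef k y * (case m of
      Rho \<Rightarrow> (case k of Phi j \<Rightarrow> pdir1 (w j) y | _ \<Rightarrow> 2 * pdir1 a y)
    | Zc \<Rightarrow> (case k of Phi j \<Rightarrow> pdir2 (w j) y | _ \<Rightarrow> 2 * pdir2 a y)
    | Phi j \<Rightarrow> 0)"

lemma has_grad_exp: "has_grad f p q y \<Longrightarrow> has_grad (\<lambda>y. exp (f y)) (exp (f y) * p) (exp (f y) * q) y"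
  unfolding has_grad_def by (auto intro!: derivative_eq_intros simp: algebra_simps)

lemma has_grad_coef:
  assumes "y \<in> H"
  shows "has_grad (coef k) (dcoef k Rho y) (dcoef k Zc y) y"
proof -
  note ga = has_grad_exp[OF has_grad_cmult[OF Cinf_grad[OF Ca assms], of 2]]
    and gw = has_grad_exp[OF Cinf_grad[OF Cw assms]]
  show ?thesis
    using ga gw[of "the_Phi"] has_grad_cmult[OF gw, of "-1"] gw
    by (cases k) (auto simp: coef_def[abs_def] dcoef_def)
qed

lemma partial_G:
  assumes "x \<in> off_axis"
  shows "partial m (\<lambda>y. G y $ k $ l) x = (if k = l then dcoef k m (x $ Rho, x $ Zc) else 0)"
proof (cases "k = l")
  case True
  have "has_grad (coef k) (dcoef k Rho (x $ Rho, x $ Zc)) (dcoef k Zc (x $ Rho, x $ Zc)) (x $ Rho, x $ Zc)"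
    using has_grad_coef assms by (simp add: off_axis_H)
  from partial_rho_z[OF this] show ?thesis
    using True by (cases m) (simp_all add: G_def diag_def dcoef_def)
next
  case False
  then show ?thesis by (simp add: G_def diag_def)
qed

text \<open>The symbol with lower indices in one angle is minus half a derivative of its
  coefficient; the Wick rotation reverses that sign for \<open>i\<close> only.\<close>

definition sg :: "'n \<Rightarrow> real" where "sg j = (if j = i then 1 / 2 else - 1 / 2)"

text \<open>A table of functions of (\<rho>, z) in place of the sums defining the Christoffel
  symbols, so that their derivatives can be computed case by case; the last equation collects the
  vanishing symbols.\<close>

fun Gam :: "'n coord \<Rightarrow> 'n coord \<Rightarrow> 'n coord \<Rightarrow> (real \<times> real \<Rightarrow> real)" where
  "Gam Rho Rho Rho = (\<lambda>y. pdir1 a y)"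
| "Gam Rho Rho Zc = (\<lambda>y. pdir2 a y)"
| "Gam Rho Zc Rho = (\<lambda>y. pdir2 a y)"
| "Gam Rho Zc Zc = (\<lambda>y. - pdir1 a y)"
| "Gam Zc Zc Zc = (\<lambda>y. pdir2 a y)"
| "Gam Zc Rho Zc = (\<lambda>y. pdir1 a y)"
| "Gam Zc Zc Rho = (\<lambda>y. pdir1 a y)"
| "Gam Zc Rho Rho = (\<lambda>y. - pdir2 a y)"
| "Gam Rho (Phi j) (Phi k) = (\<lambda>y. (if j = k then sg j * exp (w j y - 2 * a y) * pdir1 (w j) y else 0))"
| "Gam Zc (Phi j) (Phi k) = (\<lambda>y. (if j = k then sg j * exp (w j y - 2 * a y) * pdir2 (w j) y else 0))"
| "Gam (Phi j) Rho (Phi k) = (\<lambda>y. (if j = k then pdir1 (w j) y / 2 else 0))"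
| "Gam (Phi j) (Phi k) Rho = (\<lambda>y. (if j = k then pdir1 (w j) y / 2 else 0))"
| "Gam (Phi j) Zc (Phi k) = (\<lambda>y. (if j = k then pdir2 (w j) y / 2 else 0))"
| "Gam (Phi j) (Phi k) Zc = (\<lambda>y. (if j = k then pdir2 (w j) y / 2 else 0))"
| "Gam _ _ _ = (\<lambda>y. 0)"

lemma christoffel_G:
  assumes x: "x \<in> off_axis"
  shows "christoffel G k l m x = Gam k l m (x $ Rho, x $ Zc)"
proof -
  let ?y = "(x $ Rho, x $ Zc)"
  have "matrix_inv (G x) = diag (\<lambda>k. 1 / coef k ?y)"
    unfolding G_def by (rule matrix_inv_diag) (rule coef_nz)
  then have "christoffel G k l m x = 1 / coef k ?y * (partial l (\<lambda>y. G y $ k $ m) x + partial m (\<lambda>y. G y $ k $ l) x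
        - partial k (\<lambda>y. G y $ l $ m) x) / 2"
    unfolding christoffel_def by (simp add: diag_def if_distrib[of "\<lambda>x. x * _"] cong: if_cong)
  also have "\<dots> = Gam k l m ?y"
    unfolding partial_G[OF x]
    by (cases k; cases l; cases m; auto simp: sg_def dcoef_def coef_def exp_diff field_simps)
  finally show ?thesis .
qed

definition Gam1 :: "'n coord \<Rightarrow> 'n coord \<Rightarrow> 'n coord \<Rightarrow> real \<times> real \<Rightarrow> real"
  where "Gam1 k l m = pdir1 (Gam k l m)"
definition Gam2 :: "'n coord \<Rightarrow> 'n coord \<Rightarrow> 'n coord \<Rightarrow> real \<times> real \<Rightarrow> real"
  where "Gam2 k l m = pdir2 (Gam k l m)"

lemma has_grad_mult: "has_grad F p q y \<Longrightarrow> has_grad F' p' q' y \<Longrightarrow>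
    has_grad (\<lambda>y. F y * F' y) (F y * p' + p * F' y) (F y * q' + q * F' y) y"
  unfolding has_grad_def by (auto intro!: derivative_eq_intros simp: algebra_simps)

lemma Gam_grads:
  assumes y: "y \<in> H"
  shows "has_grad (pdir1 a) (pdir1 (pdir1 a) y) (pdir2 (pdir1 a) y) y"
    and "has_grad (pdir2 a) (pdir1 (pdir2 a) y) (pdir2 (pdir2 a) y) y"
    and "has_grad (pdir1 (w j)) (pdir1 (pdir1 (w j)) y) (pdir2 (pdir1 (w j)) y) y"
    and "has_grad (pdir2 (w j)) (pdir1 (pdir2 (w j)) y) (pdir2 (pdir2 (w j)) y) y"
    and "has_grad (\<lambda>y. exp (w j y - 2 * a y)) (exp (w j y - 2 * a y) * (pdir1 (w j) y - 2 * pdir1 a y))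
      (exp (w j y - 2 * a y) * (pdir2 (w j) y - 2 * pdir2 a y)) y"
proof -
  have "has_grad (\<lambda>y. w j y + (-2) * a y) (pdir1 (w j) y + (-2) * pdir1 a y) (pdir2 (w j) y + (-2) * pdir2 a y) y"
    by (intro has_grad_add has_grad_cmult Cinf_grad[OF _ y] Ca Cw)
  from has_grad_exp[OF this]
  show "has_grad (\<lambda>y. exp (w j y - 2 * a y)) (exp (w j y - 2 * a y) * (pdir1 (w j) y - 2 * pdir1 a y))
      (exp (w j y - 2 * a y) * (pdir2 (w j) y - 2 * pdir2 a y)) y" by simp
qed (intro Cinf_grad[OF _ y] Cinf_pdir Ca Cw)+

lemma partial_christoffel:
  assumes x: "x \<in> off_axis"
  shows "partial m (christoffel G k l n) x =
    (case m of Rho \<Rightarrow> Gam1 k l n (x $ Rho, x $ Zc) | Zc \<Rightarrow> Gam2 k l n (x $ Rho, x $ Zc) | Phi _ \<Rightarrow> 0)"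
proof -
  let ?y = "(x $ Rho, x $ Zc)"
  have y: "?y \<in> H" using x by (simp add: off_axis_H)
  have "partial m (christoffel G k l n) x = partial m (\<lambda>x. Gam k l n (x $ Rho, x $ Zc)) x"
    by (rule partial_cong[OF open_off_axis x christoffel_G])
  moreover have "Cinf H (Gam k l n)"
    by (cases k; cases l; cases n; simp only: Gam.simps; intro Cinf_ints)
  ultimately show ?thesis
    using partial_rho_z[OF Cinf_grad[OF _ y], of "Gam k l n"] by (simp add: Gam1_def Gam2_def split: coord.split)
qed

lemma pdir_Gam:
  assumes y: "y \<in> H"
  shows "pdir1 (\<lambda>_. 0) y = 0" and "pdir2 (\<lambda>_. 0) y = 0"
    and "pdir1 (\<lambda>y. if b then f y else 0) y = (if b then pdir1 f y else 0)"
    and "pdir2 (\<lambda>y. if b then f y else 0) y = (if b then pdir2 f y else 0)"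
    and "pdir1 (\<lambda>y. - pdir1 a y) y = - pdir1 (pdir1 a) y" and "pdir2 (\<lambda>y. - pdir1 a y) y = - pdir2 (pdir1 a) y"
    and "pdir1 (\<lambda>y. - pdir2 a y) y = - pdir1 (pdir2 a) y" and "pdir2 (\<lambda>y. - pdir2 a y) y = - pdir2 (pdir2 a) y"
    and "pdir1 (\<lambda>y. pdir1 (w j) y / 2) y = pdir1 (pdir1 (w j)) y / 2"
    and "pdir1 (\<lambda>y. pdir2 (w j) y / 2) y = pdir1 (pdir2 (w j)) y / 2"
    and "pdir2 (\<lambda>y. pdir1 (w j) y / 2) y = pdir2 (pdir1 (w j)) y / 2"
    and "pdir2 (\<lambda>y. pdir2 (w j) y / 2) y = pdir2 (pdir2 (w j)) y / 2"
    and "pdir1 (\<lambda>y. s * exp (w j y - 2 * a y) * pdir1 (w j) y) y =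
      s * exp (w j y - 2 * a y) * (pdir1 (pdir1 (w j)) y + (pdir1 (w j) y - 2 * pdir1 a y) * pdir1 (w j) y)"
    and "pdir2 (\<lambda>y. s * exp (w j y - 2 * a y) * pdir2 (w j) y) y =
      s * exp (w j y - 2 * a y) * (pdir2 (pdir2 (w j)) y + (pdir2 (w j) y - 2 * pdir2 a y) * pdir2 (w j) y)"
proof -
  note g = Gam_grads[OF y]
  show "pdir1 (\<lambda>_. 0) y = 0" "pdir2 (\<lambda>_. 0) y = 0" using has_gradD[OF has_grad_const] by auto
  then show "pdir1 (\<lambda>y. if b then f y else 0) y = (if b then pdir1 f y else 0)"
    "pdir2 (\<lambda>y. if b then f y else 0) y = (if b then pdir2 f y else 0)" by simp_all
  show "pdir1 (\<lambda>y. - pdir1 a y) y = - pdir1 (pdir1 a) y" "pdir2 (\<lambda>y. - pdir1 a y) y = - pdir2 (pdir1 a) y"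
    "pdir1 (\<lambda>y. - pdir2 a y) y = - pdir1 (pdir2 a) y" "pdir2 (\<lambda>y. - pdir2 a y) y = - pdir2 (pdir2 a) y"
    using has_gradD[OF has_grad_cmult[OF g(1), of "-1"]] has_gradD[OF has_grad_cmult[OF g(2), of "-1"]] by simp_all
  show "pdir1 (\<lambda>y. pdir1 (w j) y / 2) y = pdir1 (pdir1 (w j)) y / 2"
    "pdir1 (\<lambda>y. pdir2 (w j) y / 2) y = pdir1 (pdir2 (w j)) y / 2"
    "pdir2 (\<lambda>y. pdir1 (w j) y / 2) y = pdir2 (pdir1 (w j)) y / 2"
    "pdir2 (\<lambda>y. pdir2 (w j) y / 2) y = pdir2 (pdir2 (w j)) y / 2"
    using has_gradD[OF has_grad_cmult[OF g(3), of "1/2"]] has_gradD[OF has_grad_cmult[OF g(4), of "1/2"]] by simp_all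
  show "pdir1 (\<lambda>y. s * exp (w j y - 2 * a y) * pdir1 (w j) y) y =
      s * exp (w j y - 2 * a y) * (pdir1 (pdir1 (w j)) y + (pdir1 (w j) y - 2 * pdir1 a y) * pdir1 (w j) y)"
    using has_gradD(1)[OF has_grad_mult[OF has_grad_cmult[OF g(5), of s] g(3)]] by (simp add: algebra_simps)
  show "pdir2 (\<lambda>y. s * exp (w j y - 2 * a y) * pdir2 (w j) y) y =
      s * exp (w j y - 2 * a y) * (pdir2 (pdir2 (w j)) y + (pdir2 (w j) y - 2 * pdir2 a y) * pdir2 (w j) y)"
    using has_gradD(2)[OF has_grad_mult[OF has_grad_cmult[OF g(5), of s] g(4)]] by (simp add: algebra_simps)
qed

lemma has_grad_setsum:
  assumes "\<And>j :: 'n. has_grad (f j) (p j) (q j) y"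
  shows "has_grad (\<lambda>y. \<Sum>j\<in>UNIV. f j y) (\<Sum>j\<in>UNIV. p j) (\<Sum>j\<in>UNIV. q j) y"
proof -
  have "((\<lambda>y. \<Sum>j\<in>UNIV. f j y) has_derivative (\<lambda>v. \<Sum>j\<in>UNIV. p j * fst v + q j * snd v)) (at y)"
    using assms unfolding has_grad_def by (intro has_derivative_sum)
  then show ?thesis unfolding has_grad_def by (simp add: sum.distrib sum_distrib_right)
qed

lemma delta_mult: "(if b then p else 0) * (if b' then q else 0) = (if b then if b' then p * q else 0 else (0 :: real))"
  by simp

text \<open>The (\<rho>, z) block reduces to the Laplacian of \<open>a\<close> and the two
  first-order equations. The angular diagonal entries are multiples of the harmonic equation: half
  of the sum of the \<rho>-derivatives of the potentials is 1 / \<rho>, the coefficient of its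
  first-order term. The rotated index enters only through \<open>sg\<close>.\<close>

lemma ricci_G:
  assumes x: "x \<in> off_axis"
    and sums: "\<And>y. y \<in> H \<Longrightarrow> (\<Sum>j\<in>UNIV. w j y) = 2 * ln (fst y) + C"
    and harm: "\<And>y j. y \<in> H \<Longrightarrow> pdir1 (pdir1 (w j)) y + pdir1 (w j) y / fst y + pdir2 (pdir2 (w j)) y = 0"
    and a1: "\<And>y. y \<in> H \<Longrightarrow> pdir1 a y = fst y / 8 * (\<Sum>j\<in>UNIV. (pdir1 (w j) y)\<^sup>2 - (pdir2 (w j) y)\<^sup>2) - 1 / (2 * fst y)"
    and a2: "\<And>y. y \<in> H \<Longrightarrow> pdir2 a y = fst y / 4 * (\<Sum>j\<in>UNIV. pdir1 (w j) y * pdir2 (w j) y)"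
  shows "ricci G k l x = 0"
proof -
  define y where "y = (x $ Rho, x $ Zc)"
  have y: "y \<in> H" using x by (simp add: off_axis_H y_def)
  have \<rho>: "fst y > 0" using y by (simp add: H_def)
  have s1: "(\<Sum>j\<in>UNIV. pdir1 (w j) y) = 2 / fst y \<and> (\<Sum>j\<in>UNIV. pdir2 (w j) y) = 0" if y: "y \<in> H" for y
  proof -
    have "0 < fst y" using y by (simp add: H_def)
    then have g: "has_grad (\<lambda>y. 2 * ln (fst y) + C) (2 / fst y) 0 y"
      by (auto simp: has_grad_def field_simps intro!: derivative_eq_intros)
    have "has_grad (\<lambda>y. \<Sum>j\<in>UNIV. w j y) (2 / fst y) 0 y"
      using g by (rule has_grad_cong[OF _ open_H y]) (simp add: sums)
    then show ?thesis
      using has_gradD[OF has_grad_setsum[OF Cinf_grad[OF Cw y]]] by (auto dest: has_gradD)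
  qed
  have s2: "(\<Sum>j\<in>UNIV. pdir1 (pdir1 (w j)) y) = - 2 / (fst y)\<^sup>2" "(\<Sum>j\<in>UNIV. pdir2 (pdir1 (w j)) y) = 0"
  proof -
    have g: "has_grad (\<lambda>y. 2 / fst y) (- 2 / (fst y)\<^sup>2) 0 y"
      using \<rho> by (auto simp: has_grad_def field_simps power2_eq_square intro!: derivative_eq_intros)
    have "has_grad (\<lambda>y. \<Sum>j\<in>UNIV. pdir1 (w j) y) (- 2 / (fst y)\<^sup>2) 0 y"
      using g by (rule has_grad_cong[OF _ open_H y]) (simp add: s1)
    then show "(\<Sum>j\<in>UNIV. pdir1 (pdir1 (w j)) y) = - 2 / (fst y)\<^sup>2" "(\<Sum>j\<in>UNIV. pdir2 (pdir1 (w j)) y) = 0"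
      using has_gradD[OF has_grad_setsum[OF Cinf_grad[OF Cinf_pdir(1)[OF Cw] y]]] by (auto dest: has_gradD)
  qed
  have c12: "pdir1 (pdir2 a) y = pdir2 (pdir1 a) y" "\<And>j. pdir1 (pdir2 (w j)) y = pdir2 (pdir1 (w j)) y"
    using pdir_commute[OF _ y] Ca Cw by blast+
  define A B T where "A = (\<Sum>j\<in>UNIV. pdir1 (w j) y * pdir1 (w j) y)"
    and "B = (\<Sum>j\<in>UNIV. pdir2 (w j) y * pdir2 (w j) y)" and "T = (\<Sum>j\<in>UNIV. pdir1 (w j) y * pdir2 (w j) y)"
  have T': "(\<Sum>j\<in>UNIV. pdir2 (w j) y * pdir1 (w j) y) = T" by (simp add: T_def mult.commute)
  have a1': "pdir1 a y = fst y / 8 * (A - B) - 1 / (2 * fst y)"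
    using a1[OF y] by (simp add: A_def B_def power2_eq_square sum_subtractf)
  have a2': "pdir2 a y = fst y / 4 * T" using a2[OF y] by (simp add: T_def)
  \<comment> \<open>Second derivatives of \<open>a\<close> come from differentiating its first-order
    equations. The mixed derivatives of the potentials cancel in the sum, and harmonicity eliminates
    the others.\<close>
  have lap: "pdir1 (pdir1 a) y + pdir2 (pdir2 a) y = (A - B) / 8 - A / 4 + 1 / (2 * (fst y)\<^sup>2)"
  proof -
    let ?S = "\<lambda>y. \<Sum>j\<in>UNIV. pdir1 (w j) y * pdir1 (w j) y + (-1) * (pdir2 (w j) y * pdir2 (w j) y)"
    let ?T = "\<lambda>y. \<Sum>j\<in>UNIV. pdir1 (w j) y * pdir2 (w j) y"
    note g = Gam_grads(3,4)[OF y]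
    have gf: "has_grad fst 1 0 y"
      by (auto simp: has_grad_def intro!: derivative_eq_intros)
    have gi: "has_grad (\<lambda>y. - 1 / (2 * fst y)) (1 / (2 * (fst y)\<^sup>2)) 0 y"
      using \<rho> by (auto simp: has_grad_def field_simps power2_eq_square intro!: derivative_eq_intros)
    note gS = has_grad_setsum[OF has_grad_add[OF has_grad_mult[OF g(1) g(1)] has_grad_cmult[OF has_grad_mult[OF g(2) g(2)], of "-1"]]]
    note gT = has_grad_setsum[OF has_grad_mult[OF g]]
    have "pdir1 (pdir1 a) y = pdir1 (\<lambda>y. 1 / 8 * (fst y * ?S y) + - 1 / (2 * fst y)) y"
      by (rule pdir_cong[OF open_H y]) (simp add: a1 power2_eq_square)
    also have "\<dots> = 1 / 8 * (fst y * (\<Sum>j\<in>UNIV. (pdir1 (w j) y * pdir1 (pdir1 (w j)) y + pdir1 (pdir1 (w j)) y * pdir1 (w j) y)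
        + (-1) * (pdir2 (w j) y * pdir1 (pdir2 (w j)) y + pdir1 (pdir2 (w j)) y * pdir2 (w j) y)) + 1 * ?S y) + 1 / (2 * (fst y)\<^sup>2)"
      by (rule has_gradD(1)[OF has_grad_add[OF has_grad_cmult[OF has_grad_mult[OF gf gS]] gi]])
    finally have 0: "pdir1 (pdir1 a) y = 1 / 8 * (fst y * (\<Sum>j\<in>UNIV. (pdir1 (w j) y * pdir1 (pdir1 (w j)) y + pdir1 (pdir1 (w j)) y * pdir1 (w j) y)
        + (-1) * (pdir2 (w j) y * pdir1 (pdir2 (w j)) y + pdir1 (pdir2 (w j)) y * pdir2 (w j) y)) + 1 * ?S y) + 1 / (2 * (fst y)\<^sup>2)" .
    have 1: "pdir1 (pdir1 a) y = fst y / 4 * (\<Sum>j\<in>UNIV. pdir1 (w j) y * pdir1 (pdir1 (w j)) y - pdir2 (w j) y * pdir2 (pdir1 (w j)) y)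
        + (A - B) / 8 + 1 / (2 * (fst y)\<^sup>2)"
    proof -
      have "(\<Sum>j\<in>UNIV. (pdir1 (w j) y * pdir1 (pdir1 (w j)) y + pdir1 (pdir1 (w j)) y * pdir1 (w j) y)
        + (-1) * (pdir2 (w j) y * pdir1 (pdir2 (w j)) y + pdir1 (pdir2 (w j)) y * pdir2 (w j) y))
        = 2 * (\<Sum>j\<in>UNIV. pdir1 (w j) y * pdir1 (pdir1 (w j)) y - pdir2 (w j) y * pdir2 (pdir1 (w j)) y)"
        unfolding sum_distrib_left by (rule sum.cong) (simp_all add: c12)
      moreover have "?S y = A - B" by (simp add: A_def B_def sum_subtractf)
      ultimately show ?thesis using 0 by (simp only:) (simp add: algebra_simps diff_divide_distrib)
    qed
    have "pdir2 (pdir2 a) y = pdir2 (\<lambda>y. 1 / 4 * (fst y * ?T y)) y"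
      by (rule pdir_cong[OF open_H y]) (simp add: a2)
    also have "\<dots> = 1 / 4 * (fst y * (\<Sum>j\<in>UNIV. pdir1 (w j) y * pdir2 (pdir2 (w j)) y + pdir2 (pdir1 (w j)) y * pdir2 (w j) y) + 0 * ?T y)"
      by (rule has_gradD(2)[OF has_grad_cmult[OF has_grad_mult[OF gf gT]]])
    finally have 2: "pdir2 (pdir2 a) y = fst y / 4 * (\<Sum>j\<in>UNIV. pdir1 (w j) y * pdir2 (pdir2 (w j)) y + pdir2 (pdir1 (w j)) y * pdir2 (w j) y)"
      by simp
    have "pdir1 (pdir1 a) y + pdir2 (pdir2 a) y = fst y / 4 * (\<Sum>j\<in>UNIV. pdir1 (w j) y * (pdir1 (pdir1 (w j)) y + pdir2 (pdir2 (w j)) y))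
        + (A - B) / 8 + 1 / (2 * (fst y)\<^sup>2)"
      unfolding 1 2 by (simp add: sum.distrib sum_subtractf algebra_simps)
    also have "(\<Sum>j\<in>UNIV. pdir1 (w j) y * (pdir1 (pdir1 (w j)) y + pdir2 (pdir2 (w j)) y)) = - A / fst y"
    proof -
      have e: "pdir1 (pdir1 (w j)) y + pdir2 (pdir2 (w j)) y = - (pdir1 (w j) y / fst y)" for j
        using harm[OF y, of j] by linarith
      show ?thesis unfolding e by (simp add: A_def sum_negf sum_divide_distrib)
    qed
    finally show ?thesis using \<rho> by simp
  qed
  have s22: "(\<Sum>j\<in>UNIV. pdir2 (pdir2 (w j)) y) = 0"
  proof -
    have e: "pdir2 (pdir2 (w j)) y = - (pdir1 (pdir1 (w j)) y + pdir1 (w j) y / fst y)" for j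
      using harm[OF y, of j] by linarith
    show ?thesis
      using s1[OF y] s2 \<rho> unfolding e
      by (simp add: sum_negf sum.distrib sum_subtractf sum_divide_distrib[symmetric] power2_eq_square)
  qed
  have a1q: "pdir1 a y / fst y = (A - B) / 8 - 1 / (2 * (fst y)\<^sup>2)" and a2q: "pdir2 a y / fst y = T / 4"
    using \<rho> by (simp_all add: a1' a2' power2_eq_square diff_divide_distrib)
  note expand = ricci_def partial_christoffel[OF x] christoffel_G[OF x] y_def[symmetric] sum_coord
  note simps = Gam1_def Gam2_def pdir_Gam[OF y] c12 delta_mult if_distrib[of uminus] sum.distrib sum_subtractf sum_negf
    sum_divide_distrib[symmetric] sum_distrib_right[symmetric] s1[OF y] s2 s22 A_def[symmetric] B_def[symmetric]
    T_def[symmetric] T'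
  have r11: "ricci G Rho Rho x = 0"
    unfolding expand using lap a1q by (simp add: simps cong: if_cong)
  have r22: "ricci G Zc Zc x = 0"
  proof -
    have aux: "- p - q + (X - (A - B) / 8 - B / 4) = 0" if "p + q = (A - B) / 8 - A / 4 + X" for p q X :: real
      using that by (simp add: field_simps)
    show ?thesis
      unfolding expand using a1q by (simp add: simps cong: if_cong) (rule aux[OF lap])
  qed
  have r12: "ricci G Rho Zc x = 0" "ricci G Zc Rho x = 0"
    unfolding expand using a2q by (simp_all add: simps cong: if_cong)
  have r0: "ricci G Rho (Phi m) x = 0" "ricci G (Phi m) Rho x = 0" "ricci G Zc (Phi m) x = 0" "ricci G (Phi m) Zc x = 0" for m
    unfolding expand by (simp_all add: simps cong: if_cong)
  have rpp: "ricci G (Phi m) (Phi m') x = 0" for m m'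
  proof (cases "m = m'")
    case True
    have "pdir2 (pdir2 (w m)) y = - (pdir1 (pdir1 (w m)) y + pdir1 (w m) y / fst y)"
      using harm[OF y, of m] by linarith
    then show ?thesis
      using True unfolding expand by (simp add: simps cong: if_cong) (simp add: algebra_simps)
  next
    case False
    then show ?thesis unfolding expand by (simp add: simps cong: if_cong)
  qed
  show ?thesis
    by (cases k; cases l; simp add: r11 r22 r12 r0 rpp)
qed

end


section \<open>The Wick rotated soliton\<close>

lemma periodic_int:
  fixes f :: "real \<Rightarrow> real" and L :: real
  assumes "\<And>z. f (z + L) = f z"
  shows "f (z + of_int m * L) = f z"
proof (induction m rule: int_induct[of _ 0])
  case (step1 m)
  then show ?case using assms[of "z + of_int m * L"] by (simp add: algebra_simps)
next
  case (step2 m)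
  then show ?case using assms[of "z + of_int (m - 1) * L"] by (simp add: algebra_simps)
qed simp

context soliton_array
begin

definition gm :: "'n \<Rightarrow> 'n coord metric_field"
  where "gm i = wick_rotation i (slice_metric u \<alpha>)"

lemma Cinf_square:
  fixes F :: "real \<times> real \<Rightarrow> real"
  assumes "Cinf {y. 0 < fst y} F"
  shows "Cinf {y. 0 < fst y} (\<lambda>y. F ((fst y)\<^sup>2, snd y))"
  by (rule Cinf_compose2[OF assms]) (auto intro: Cinf_power Cinf_fst Cinf_snd open_upper)

lemma Cinf_u: "Cinf {y. 0 < fst y} (\<lambda>y. u j (fst y) (snd y))"
  by (rule Cinf_cong[OF Cinf_square[OF Cinf_potU]]) (simp add: soliton_u_potU)

lemma Cinf_alpha: "Cinf {y. 0 < fst y} (\<lambda>y. \<alpha> (fst y) (snd y))"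
  by (rule Cinf_cong[OF Cinf_square[OF Cinf_aS]]) (simp add: aS_def)

sublocale W: weyl "\<lambda>y. \<alpha> (fst y) (snd y)" "\<lambda>j y. u j (fst y) (snd y)" i "{y. 0 < fst y}" for i
  by unfold_locales (auto intro: Cinf_u Cinf_alpha)

lemma gm_eq: "gm i = W.G i"
  by (auto simp: fun_eq_iff gm_def wick_rotation_def slice_metric_def W.G_def W.coef_def diag_def vec_eq_iff
      split: coord.split)

lemma has_grad_square:
  assumes "has_grad F a b ((fst y)\<^sup>2, snd y)"
  shows "has_grad (\<lambda>y. F ((fst y)\<^sup>2, snd y)) (2 * fst y * a) b y"
proof -
  have "((\<lambda>y. ((fst y)\<^sup>2, snd y)) has_derivative (\<lambda>v. (2 * fst y * fst v, snd v))) (at y)"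
    by (auto intro!: derivative_eq_intros)
  from has_derivative_compose[OF this assms[unfolded has_grad_def]] show ?thesis
    by (simp add: has_grad_def algebra_simps)
qed

text \<open>Under s = \<rho>^2 the operator 4 (s d_s^2 + d_s) becomes d_\<rho>^2 + (1 / \<rho>)
  d_\<rho>, so axial harmonicity turns into the equation that \<open>ricci_G\<close> asks
  for.\<close>

lemma pdir_u:
  assumes y: "0 < fst y"
  shows "pdir1 (\<lambda>y. u j (fst y) (snd y)) y = 2 * fst y * pdir1 (U j) ((fst y)\<^sup>2, snd y)"
    and "pdir2 (\<lambda>y. u j (fst y) (snd y)) y = pdir2 (U j) ((fst y)\<^sup>2, snd y)"
    and "pdir1 (pdir1 (\<lambda>y. u j (fst y) (snd y))) y = 2 * pdir1 (U j) ((fst y)\<^sup>2, snd y)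
      + 4 * (fst y)\<^sup>2 * pdir1 (pdir1 (U j)) ((fst y)\<^sup>2, snd y)"
    and "pdir2 (pdir2 (\<lambda>y. u j (fst y) (snd y))) y = pdir2 (pdir2 (U j)) ((fst y)\<^sup>2, snd y)"
proof -
  have d: "has_grad F (pdir1 F ((fst y)\<^sup>2, snd y)) (pdir2 F ((fst y)\<^sup>2, snd y)) ((fst y)\<^sup>2, snd y)"
    if "Cinf {y. 0 < fst y} F" "0 < fst y" for F y
    by (rule Cinf_grad[OF that(1)]) (use that in simp)
  have g: "has_grad (\<lambda>y. u j (fst y) (snd y)) (2 * fst y * pdir1 (U j) ((fst y)\<^sup>2, snd y)) (pdir2 (U j) ((fst y)\<^sup>2, snd y)) y"
    if "0 < fst y" for y
    by (rule has_grad_cong[OF has_grad_square[OF d[OF Cinf_potU that]] open_upper]) (use that in \<open>auto simp: soliton_u_potU\<close>)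
  show 1: "pdir1 (\<lambda>y. u j (fst y) (snd y)) y = 2 * fst y * pdir1 (U j) ((fst y)\<^sup>2, snd y)"
    "pdir2 (\<lambda>y. u j (fst y) (snd y)) y = pdir2 (U j) ((fst y)\<^sup>2, snd y)"
    using has_gradD[OF g[OF y]] by auto
  have gf: "has_grad fst 1 0 y" by (auto simp: has_grad_def intro!: derivative_eq_intros)
  have y': "y \<in> {y. 0 < fst y}" using y by simp
  have "pdir1 (pdir1 (\<lambda>y. u j (fst y) (snd y))) y = pdir1 (\<lambda>y. 2 * (fst y * pdir1 (U j) ((fst y)\<^sup>2, snd y))) y"
    by (rule pdir_cong[OF open_upper y']) (use has_gradD[OF g] in auto)
  also have "\<dots> = 2 * (fst y * (2 * fst y * pdir1 (pdir1 (U j)) ((fst y)\<^sup>2, snd y)) + 1 * pdir1 (U j) ((fst y)\<^sup>2, snd y))"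
    by (rule has_gradD(1)[OF has_grad_cmult[OF W.has_grad_mult[OF gf has_grad_square[OF d[OF Cinf_pdir(1)[OF Cinf_potU] y]]]]])
  finally show "pdir1 (pdir1 (\<lambda>y. u j (fst y) (snd y))) y = 2 * pdir1 (U j) ((fst y)\<^sup>2, snd y)
      + 4 * (fst y)\<^sup>2 * pdir1 (pdir1 (U j)) ((fst y)\<^sup>2, snd y)"
    by (simp add: power2_eq_square)
  have "pdir2 (pdir2 (\<lambda>y. u j (fst y) (snd y))) y = pdir2 (\<lambda>y. pdir2 (U j) ((fst y)\<^sup>2, snd y)) y"
    by (rule pdir_cong[OF open_upper y']) (use has_gradD[OF g] in auto)
  also have "\<dots> = pdir2 (pdir2 (U j)) ((fst y)\<^sup>2, snd y)"
    by (rule has_gradD(2)[OF has_grad_square[OF d[OF Cinf_pdir(2)[OF Cinf_potU] y]]])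
  finally show "pdir2 (pdir2 (\<lambda>y. u j (fst y) (snd y))) y = pdir2 (pdir2 (U j)) ((fst y)\<^sup>2, snd y)" .
qed

lemma pdir_alpha:
  assumes y: "0 < fst y"
  shows "pdir1 (\<lambda>y. \<alpha> (fst y) (snd y)) y = 2 * fst y * A1 ((fst y)\<^sup>2, snd y)"
    and "pdir2 (\<lambda>y. \<alpha> (fst y) (snd y)) y = A2 ((fst y)\<^sup>2, snd y)"
proof -
  have "has_grad aS (A1 ((fst y)\<^sup>2, snd y)) (A2 ((fst y)\<^sup>2, snd y)) ((fst y)\<^sup>2, snd y)"
    by (rule has_grad_aS) (use y in simp)
  from has_grad_square[OF this] have "has_grad (\<lambda>y. \<alpha> (fst y) (snd y)) (2 * fst y * A1 ((fst y)\<^sup>2, snd y)) (A2 ((fst y)\<^sup>2, snd y)) y"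
    by (rule has_grad_cong[OF _ open_upper]) (use y in \<open>auto simp: aS_def\<close>)
  from has_gradD[OF this] show "pdir1 (\<lambda>y. \<alpha> (fst y) (snd y)) y = 2 * fst y * A1 ((fst y)\<^sup>2, snd y)"
    "pdir2 (\<lambda>y. \<alpha> (fst y) (snd y)) y = A2 ((fst y)\<^sup>2, snd y)" by auto
qed

lemma ricci_gm: "x \<in> off_axis \<Longrightarrow> ricci (gm i) k l x = 0"
  unfolding gm_eq
proof (rule W.ricci_G)
  fix y :: "real \<times> real" assume "y \<in> {y. 0 < fst y}"
  then have y: "0 < fst y" by simp
  show "(\<Sum>j\<in>UNIV. u j (fst y) (snd y)) = 2 * ln (fst y) + ((\<Sum>j\<in>UNIV. \<kappa> j) - 2 * ln (2 * L))"
    by (rule sum_soliton_u[OF y])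
  show "pdir1 (pdir1 (\<lambda>y. u j (fst y) (snd y))) y + pdir1 (\<lambda>y. u j (fst y) (snd y)) y / fst y
      + pdir2 (pdir2 (\<lambda>y. u j (fst y) (snd y))) y = 0" for j
  proof -
    have "4 * (fst y ^ 2 * pdir1 (pdir1 (U j)) ((fst y)\<^sup>2, snd y) + pdir1 (U j) ((fst y)\<^sup>2, snd y))
        + pdir2 (pdir2 (U j)) ((fst y)\<^sup>2, snd y) = 0"
      using axial_harmonic_potU[of \<kappa> j] y unfolding axial_harmonic_def by force
    then show ?thesis unfolding pdir_u[OF y] using y by simp
  qed
  show "pdir1 (\<lambda>y. \<alpha> (fst y) (snd y)) y = fst y / 8 * (\<Sum>j\<in>UNIV. (pdir1 (\<lambda>y. u j (fst y) (snd y)) y)\<^sup>2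
      - (pdir2 (\<lambda>y. u j (fst y) (snd y)) y)\<^sup>2) - 1 / (2 * fst y)"
    unfolding pdir_u[OF y] pdir_alpha[OF y] A1_def using y
    by (simp add: power_mult_distrib power2_eq_square[of "fst y"] field_simps)
  show "pdir2 (\<lambda>y. \<alpha> (fst y) (snd y)) y = fst y / 4 * (\<Sum>j\<in>UNIV. pdir1 (\<lambda>y. u j (fst y) (snd y)) y
      * pdir2 (\<lambda>y. u j (fst y) (snd y)) y)"
    unfolding pdir_u[OF y] pdir_alpha[OF y] A2_def
    by (simp add: sum_distrib_left power2_eq_square mult.assoc)
qed

section \<open>Periodicity, symmetries and rods of the rotated metric\<close>

lemma U_period: "0 < s \<Longrightarrow> U j (s, z + L) = U j (s, z)"
  using soliton_u_period[of "sqrt s" \<kappa> j z] soliton_u_potU[of "sqrt s" \<kappa> j] by simp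

lemma pdir_U_period:
  assumes "0 < s"
  shows "pdir1 (U j) (s, z + L) = pdir1 (U j) (s, z)" and "pdir2 (U j) (s, z + L) = pdir2 (U j) (s, z)"
proof -
  have "has_grad (\<lambda>y. U j (fst y, L + 1 * snd y)) (pdir1 (U j) (s, L + z)) (1 * pdir2 (U j) (s, L + z)) (s, z)"
    using has_grad_reflect[of "U j" _ _ "(s, z)" L 1] has_grad_U[of "(s, L + z)"] assms by simp
  then have "has_grad (U j) (pdir1 (U j) (s, L + z)) (1 * pdir2 (U j) (s, L + z)) (s, z)"
    by (rule has_grad_cong[OF _ open_upper]) (use U_period assms in \<open>auto simp: add.commute\<close>)
  from has_gradD[OF this] show "pdir1 (U j) (s, z + L) = pdir1 (U j) (s, z)"
    "pdir2 (U j) (s, z + L) = pdir2 (U j) (s, z)" by (simp_all add: add.commute)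
qed

text \<open>The absence of conical singularities on both of two translated rods fixes the constant.\<close>

lemma alpha_period:
  assumes "\<rho> > 0"
  shows "\<alpha> \<rho> (z + L) = \<alpha> \<rho> z"
proof -
  define D where "D \<rho> z = \<alpha> \<rho> (z + L) - \<alpha> \<rho> z" for \<rho> z
  have A: "A1 (s, z + L) = A1 (s, z)" "A2 (s, z + L) = A2 (s, z)" if "0 < s" for s z
    using pdir_U_period[OF that] by (simp_all add: A1_def A2_def)
  have d1: "((\<lambda>\<rho>. D \<rho> z) has_real_derivative 0) (at \<rho>)" if "\<rho> > 0" for \<rho> z
    using DERIV_diff[OF alpha_derivs(1)[OF that, of "z + L"] alpha_derivs(1)[OF that, of z]] A(1)[of "\<rho>\<^sup>2" z] that
    by (simp add: D_def[abs_def])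
  have d2: "((\<lambda>z. D \<rho> z) has_real_derivative 0) (at z)" if "\<rho> > 0" for \<rho> z
  proof -
    have "((\<lambda>z. \<alpha> \<rho> (z + L)) has_real_derivative A2 (\<rho>\<^sup>2, z + L)) (at z)"
      using alpha_derivs(2)[OF that, of "z + L"] by (simp add: DERIV_shift)
    from DERIV_diff[OF this alpha_derivs(2)[OF that]] show ?thesis
      using A(2)[of "\<rho>\<^sup>2" z] that by (simp add: D_def[abs_def])
  qed
  define z1 where "z1 = c 0 + gap / 2"
  have z1: "c 0 < z1" "z1 < c (0 + 1)" "c N < z1 + L" "z1 + L < c (N + 1)"
    using gap c_add[of 0 1] c_add[of 0 N] c_add[of N 1] N_gap by (simp_all add: z1_def)
  have const: "D r z1 = D \<rho> z1" if "r > 0" for r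
  proof -
    have "\<exists>C. \<forall>r\<in>{0<..}. D r z1 = C"
      by (rule has_field_derivative_zero_constant) (auto intro: d1 has_field_derivative_at_within)
    then show ?thesis using that assms by auto
  qed
  have per: "\<sigma> N = \<sigma> 0" using \<sigma>_period[of 0 1] by simp
  have "((\<lambda>r. (ln r + \<alpha> r (z1 + L) - u (\<sigma> N) r (z1 + L) / 2) - (ln r + \<alpha> r z1 - u (\<sigma> 0) r z1 / 2)) \<longlongrightarrow> 0 - 0) (at_right 0)"
    by (rule tendsto_diff) (use sol z1 in \<open>unfold soliton_def c_def, blast\<close>)+
  moreover have "\<forall>\<^sub>F r in at_right 0. (ln r + \<alpha> r (z1 + L) - u (\<sigma> N) r (z1 + L) / 2) - (ln r + \<alpha> r z1 - u (\<sigma> 0) r z1 / 2) = D \<rho> z1"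
  proof -
    have "(ln r + \<alpha> r (z1 + L) - u (\<sigma> N) r (z1 + L) / 2) - (ln r + \<alpha> r z1 - u (\<sigma> 0) r z1 / 2) = D \<rho> z1" if "r > 0" for r
      using const[OF that] soliton_u_period[OF that, of \<kappa> "\<sigma> 0" z1] by (simp add: D_def per)
    then show ?thesis by (auto simp: eventually_at_filter)
  qed
  ultimately have "((\<lambda>r. D \<rho> z1) \<longlongrightarrow> 0) (at_right (0::real))"
    using Lim_transform_eventually by force
  then have "D \<rho> z1 = 0" by (simp only: tendsto_const_iff[OF trivial_limit_at_right_real])
  moreover have "\<exists>C. \<forall>z\<in>UNIV. D \<rho> z = C"
    by (rule has_field_derivative_zero_constant) (auto intro: d2 assms)
  ultimately show ?thesis by (simp add: D_def) (metis right_minus_eq)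
qed

lemma gm_nth: "gm i x $ k $ l = (if k = l then W.coef i k (x $ Rho, x $ Zc) else 0)"
  by (simp add: gm_eq W.G_def diag_def)

lemma gm_translate:
  assumes "x \<in> off_axis" and "d $ Rho = 0" and "d $ Zc = of_int m * L"
  shows "x + d \<in> off_axis" and "gm i (x + d) = gm i x"
proof -
  have \<rho>: "x $ Rho > 0" using assms by (simp add: off_axis_def)
  then show "x + d \<in> off_axis" using assms by (simp add: off_axis_def)
  have "\<alpha> (x $ Rho) (x $ Zc + of_int m * L) = \<alpha> (x $ Rho) (x $ Zc)"
    "u j (x $ Rho) (x $ Zc + of_int m * L) = u j (x $ Rho) (x $ Zc)" for j
    by (rule periodic_int, rule alpha_period[OF \<rho>], rule periodic_int, rule soliton_u_period[OF \<rho>])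
  then show "gm i (x + d) = gm i x"
    using assms by (auto simp: vec_eq_iff gm_nth W.coef_def split: coord.split)
qed

lemma invariant_gm:
  assumes "d $ Rho = 0" and "\<exists>m::int. d $ Zc = of_int m * L"
  shows "invariant_under_translation off_axis (gm i) d"
  unfolding invariant_under_translation_def pullback_translation
  using assms gm_translate by blast

lemma partial_Phi_gm: "x \<in> off_axis \<Longrightarrow> partial (Phi j) (\<lambda>y. gm i y $ k $ l) x = 0"
  unfolding gm_eq by (simp add: W.partial_G W.dcoef_def)

lemma killing_Phi: "killing_field_on off_axis (gm i) (coord_field (Phi j))"
proof -
  have "lie_derivative_metric (coord_field (Phi j)) (gm i) k l x = 0" if x: "x \<in> off_axis" for k l x
  proof -
    have "axis (Phi j) 1 $ m * partial m (\<lambda>y. gm i y $ k $ l) x = 0" for m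
      using partial_Phi_gm[OF x] by (cases "m = Phi j") (auto simp: axis_def)
    then show ?thesis unfolding lie_derivative_metric_def by (simp only: partial_const) simp
  qed
  then show ?thesis
    by (simp only: killing_field_on_def) (simp add: smooth_on_const[OF open_off_axis])
qed

lemma gm_mult: "(gm i x *v v) $ k = W.coef i k (x $ Rho, x $ Zc) * v $ k"
  by (simp add: matrix_vector_mult_def gm_nth if_distrib[of "\<lambda>x. x * _"] cong: if_cong)

text \<open>The dual one-form has the single component g(dt, dt)-coefficient times dt, independent
  of t. Each Frobenius term then vanishes or cancels against another.\<close>

lemma static_gm: "static_killing_field_on off_axis (gm i) (coord_field (Phi i))"
proof -
  define \<xi> where "\<xi> k x = (gm i x *v axis (Phi i) 1) $ k" for k x
  have \<xi>: "\<xi> k = (if k = Phi i then (\<lambda>x. gm i x $ Phi i $ Phi i) else (\<lambda>_. 0))" for k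
    by (auto simp: \<xi>_def gm_mult gm_nth axis_def)
  have p: "partial m (\<xi> l) x = (if l = Phi i then partial m (\<lambda>x. gm i x $ Phi i $ Phi i) x else 0)" for m l x
    by (simp add: \<xi>)
  have "hypersurface_orthogonal_on off_axis (gm i) (coord_field (Phi i))"
    unfolding hypersurface_orthogonal_on_def Let_def \<xi>_def[symmetric]
  proof (intro ballI allI)
    fix x :: "real ^ 'n coord" and k l m :: "'n coord"
    assume x: "x \<in> off_axis"
    show "\<xi> k x * (partial l (\<xi> m) x - partial m (\<xi> l) x) + \<xi> l x * (partial m (\<xi> k) x - partial k (\<xi> m) x)
        + \<xi> m x * (partial k (\<xi> l) x - partial l (\<xi> k) x) = 0"
      unfolding p unfolding \<xi> by (auto simp: partial_Phi_gm[OF x])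
  qed
  moreover have "axis (Phi i) 1 \<bullet> (gm i x *v axis (Phi i) 1) < 0" for x
    by (simp add: inner_axis' gm_mult W.coef_def)
  ultimately show ?thesis
    by (simp add: static_killing_field_on_def killing_Phi)
qed

lemma vacuum_gm: "static_axisymmetric_vacuum i quot L (gm i)"
proof -
  have "lorentzian_metric_on off_axis (gm i)"
    unfolding lorentzian_metric_on_def gm_eq using W.smooth_G W.lorentzian_G by blast
  moreover have "ricci_flat_on off_axis (gm i)"
    unfolding ricci_flat_on_def using ricci_gm by blast
  moreover have "invariant_under_translation off_axis (gm i) d" if "d \<in> identifications i quot L" for d
  proof (rule invariant_gm)
    show "d $ Rho = 0" using that by (simp add: identifications_def)
    show "\<exists>m::int. d $ Zc = of_int m * L"
      using that by (cases quot) (auto simp: identifications_def intro: exI[of _ 0])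
  qed
  moreover have "effective_torus_symmetry i quot L (gm i)"
    unfolding effective_torus_symmetry_def
  proof (intro conjI allI impI)
    fix d :: "real ^ 'n coord" assume "rotational i d"
    then show "invariant_under_translation off_axis (gm i) d"
      by (intro invariant_gm) (auto simp: rotational_def intro: exI[of _ 0])
  next
    fix d :: "real ^ 'n coord" and j
    assume d: "rotational i d \<and> (\<forall>x\<in>off_axis. \<exists>d'\<in>identifications i quot L. x + d = x + d')"
    \<comment> \<open>One test point suffices: x + d = x + d' forces d = d'.\<close>
    have "axis Rho 1 \<in> (off_axis :: (real ^ 'n coord) set)" by (simp add: off_axis_def)
    then have "d \<in> identifications i quot L" using d by fastforce
    then show "\<exists>m::int. d $ Phi j = 2 * pi * of_int m"
      using d by (cases "j = i") (auto simp: identifications_def intro: exI[of _ 0])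
  qed (rule killing_Phi)
  ultimately show ?thesis
    by (auto simp only: static_axisymmetric_vacuum_def static_gm)
qed

lemma exp_u_limit:
  assumes z: "c K < z" "z < c (K + 1)"
  shows "((\<lambda>\<rho>. exp (u j \<rho> z)) \<longlongrightarrow> (if \<sigma> K = j then 0 else exp (V K j (0, z)))) (at_right 0)"
proof -
  have ic: "isCont (\<lambda>s. V K j (s, z)) 0"
    by (rule DERIV_isCont[OF has_grad_real_derivative1[OF Cinf_grad[OF Cinf_rodV rod_dom_axis[OF z order_refl]]]])
  have sq: "((\<lambda>\<rho>::real. \<rho>\<^sup>2) \<longlongrightarrow> 0) (at_right 0)" by (auto intro!: tendsto_eq_intros)
  have "((\<lambda>\<rho>. exp (V K j (\<rho>\<^sup>2, z))) \<longlongrightarrow> exp (V K j (0, z))) (at_right 0)"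
    by (intro tendsto_exp isCont_tendsto_compose[OF ic sq])
  then have "((\<lambda>\<rho>. exp (V K j (\<rho>\<^sup>2, z)) * (if \<sigma> K = j then \<rho>\<^sup>2 else 1)) \<longlongrightarrow> (if \<sigma> K = j then 0 else exp (V K j (0, z)))) (at_right 0)"
    using tendsto_mult[OF _ sq, of "\<lambda>\<rho>. exp (V K j (\<rho>\<^sup>2, z))"] by (cases "\<sigma> K = j") auto
  then show ?thesis
  proof (rule Lim_transform_eventually)
    have "exp (V K j (\<rho>\<^sup>2, z)) * (if \<sigma> K = j then \<rho>\<^sup>2 else 1) = exp (u j \<rho> z)" if "\<rho> > 0" for \<rho>
      using that potU_rod[of "\<rho>\<^sup>2" \<kappa> j z K] by (simp add: soliton_u_potU exp_add)
    then show "\<forall>\<^sub>F \<rho> in at_right 0. exp (V K j (\<rho>\<^sup>2, z)) * (if \<sigma> K = j then \<rho>\<^sup>2 else 1) = exp (u j \<rho> z)"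
      by (auto simp: eventually_at_filter)
  qed
qed

lemma norm_limit:
  assumes z: "c K < z" "z < c (K + 1)" and v: "v $ Rho = 0" "v $ Zc = 0"
  shows "axis_norm_limit (gm i) v z (\<Sum>j\<in>UNIV. (if j = i then - 1 else 1) * (v $ Phi j)\<^sup>2 * (if \<sigma> K = j then 0 else exp (V K j (0, z))))"
  unfolding axis_norm_limit_def
proof (intro allI impI)
  fix x :: "real ^ 'n coord" assume x: "x $ Zc = z"
  have "v \<bullet> (gm i (with_rho \<rho> x) *v v) = (\<Sum>j\<in>UNIV. (if j = i then - 1 else 1) * (v $ Phi j)\<^sup>2 * exp (u j \<rho> z))" for \<rho>
    unfolding inner_vec_def gm_mult sum_coord using v x
    by (auto simp: with_rho_def W.coef_def power2_eq_square intro!: sum.cong)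
  then show "((\<lambda>\<rho>. v \<bullet> (gm i (with_rho \<rho> x) *v v)) \<longlongrightarrow>
      (\<Sum>j\<in>UNIV. (if j = i then - 1 else 1) * (v $ Phi j)\<^sup>2 * (if \<sigma> K = j then 0 else exp (V K j (0, z))))) (at_right 0)"
    by (simp only:) (intro tendsto_sum tendsto_mult tendsto_const exp_u_limit z)
qed

lemma norm_limit_axis:
  assumes z: "c K < z" "z < c (K + 1)"
  shows "axis_norm_limit (gm i) (axis (Phi j) 1) z ((if j = i then - 1 else 1) * (if \<sigma> K = j then 0 else exp (V K j (0, z))))"
proof -
  have "(\<Sum>k\<in>UNIV. (if k = i then - 1 else 1) * (axis (Phi j) (1::real) $ Phi k)\<^sup>2 * (if \<sigma> K = k then 0 else exp (V K k (0, z))))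
    = (\<Sum>k\<in>UNIV. if k = j then (if j = i then - 1 else 1) * (if \<sigma> K = j then 0 else exp (V K j (0, z))) else 0)"
    by (intro sum.cong) (auto simp: axis_def)
  then show ?thesis
    using norm_limit[OF z, of "axis (Phi j) 1" i] by (simp add: axis_def)
qed

text \<open>A rotational vector has no component along \<open>Phi i\<close>, the only negative
  direction, so all terms of the limit are nonnegative; a component outside the collapsing direction
  contributes strictly.\<close>

lemma norm_limit_pos:
  assumes z: "c K < z" "z < c (K + 1)" and v: "rotational i v" and m: "m \<noteq> \<sigma> K" "v $ Phi m \<noteq> 0"
  shows "\<exists>l>0. axis_norm_limit (gm i) v z l"
proof -
  have "v $ Phi i = 0" using v by (simp add: rotational_def)
  then have "0 < (\<Sum>j\<in>UNIV. (if j = i then - 1 else 1) * (v $ Phi j)\<^sup>2 * (if \<sigma> K = j then 0 else exp (V K j (0, z))))"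
    using m by (intro sum_pos2[of _ m]) auto
  then show ?thesis using norm_limit[OF z, of v i] v by (auto simp: rotational_def)
qed

lemma black_hole_gm: "black_hole i (rod_end z0 L P) \<sigma> (gm i)"
  unfolding black_hole_def c_def[symmetric]
proof (intro conjI allI impI)
  have "i \<in> set P" using cover by simp
  then obtain k where "k < length P" "P ! k = i" by (auto simp: in_set_conv_nth)
  then show "\<exists>k. \<sigma> k = i" by (intro exI[of _ "int k"]) (simp add: rod_structure_def)
next
  fix k assume k: "\<sigma> k = i"
  show "horizon_rod i (c k) (c (k + 1)) (gm i)"
    unfolding horizon_rod_def
  proof (intro conjI ballI allI impI)
    show "c k < c (k + 1)" by (simp add: c_less)
    fix z assume "z \<in> {c k<..<c (k + 1)}"
    then have z: "c k < z" "z < c (k + 1)" by auto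
    show "axis_norm_limit (gm i) (axis (Phi i) 1) z 0"
      using norm_limit_axis[OF z, of i i] k by simp
    fix v :: "real ^ 'n coord" assume v: "rotational i v \<and> v \<noteq> 0"
    then obtain m where "v $ m \<noteq> 0" by (auto simp: vec_eq_iff)
    then obtain m where "v $ Phi m \<noteq> 0" "m \<noteq> i" using v by (cases m) (auto simp: rotational_def)
    then show "\<exists>l>0. axis_norm_limit (gm i) v z l" using norm_limit_pos[OF z, of i v m] v k by simp
  qed
next
  fix k assume k: "\<sigma> k \<noteq> i"
  show "axis_rod i (\<sigma> k) (c k) (c (k + 1)) (gm i)"
    unfolding axis_rod_def
  proof (intro conjI ballI allI impI)
    show "c k < c (k + 1)" by (simp add: c_less)
    fix z assume "z \<in> {c k<..<c (k + 1)}"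
    then have z: "c k < z" "z < c (k + 1)" by auto
    show "axis_norm_limit (gm i) (axis (Phi (\<sigma> k)) 1) z 0"
      using norm_limit_axis[OF z, of i "\<sigma> k"] k by simp
    show "\<exists>l<0. axis_norm_limit (gm i) (axis (Phi i) 1) z l"
      using norm_limit_axis[OF z, of i i] k by (intro exI[of _ "- exp (V k i (0, z))"]) simp
    fix v :: "real ^ 'n coord" assume v: "rotational i v \<and> v \<notin> span {axis (Phi (\<sigma> k)) 1}"
    have "\<exists>m. m \<noteq> \<sigma> k \<and> v $ Phi m \<noteq> 0"
    proof (rule ccontr)
      assume "\<not> ?thesis"
      then have "v = (v $ Phi (\<sigma> k)) *\<^sub>R axis (Phi (\<sigma> k)) 1"
        using v by (auto simp: vec_eq_iff axis_def rotational_def)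
      then have "v \<in> span {axis (Phi (\<sigma> k)) 1}" by (metis insertI1 span_base span_scale)
      then show False using v by simp
    qed
    then show "\<exists>l>0. axis_norm_limit (gm i) v z l" using norm_limit_pos[OF z] v by blast
  qed
qed

lemma no_conical_gm:
  assumes "\<sigma> k \<noteq> i"
  shows "no_conical_singularity (\<sigma> k) (c k) (c (k + 1)) (gm i)"
  unfolding no_conical_singularity_def
proof (intro allI impI)
  fix x :: "real ^ 'n coord" assume "x $ Zc \<in> {c k<..<c (k + 1)}"
  then have "((\<lambda>\<rho>. ln \<rho> + \<alpha> \<rho> (x $ Zc) - u (\<sigma> k) \<rho> (x $ Zc) / 2) \<longlongrightarrow> 0) (at_right 0)"
    using sol unfolding soliton_def c_def by auto
  then show "((\<lambda>\<rho>. ln \<rho> + ln (gm i (with_rho \<rho> x) $ Rho $ Rho) / 2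
      - ln (gm i (with_rho \<rho> x) $ Phi (\<sigma> k) $ Phi (\<sigma> k)) / 2) \<longlongrightarrow> 0) (at_right 0)"
    using assms by (simp add: gm_nth W.coef_def with_rho_def)
qed

end


section \<open>Smooth extension across the axis\<close>

lemma jacobian_eq:
  fixes F :: "real ^ 'm::finite \<Rightarrow> real ^ 'm"
  assumes "\<And>k. ((\<lambda>x. F x $ k) has_derivative D k) (at x)"
  shows "jacobian F (at x) $ k $ l = D k (axis l 1)"
proof -
  have "(F has_derivative (\<lambda>v. \<chi> k. D k v)) (at x)"
    unfolding has_derivative_componentwise_within[of F]
    using assms by (auto simp: Basis_vec_def inner_axis)
  then have "frechet_derivative F (at x) = (\<lambda>v. \<chi> k. D k v)"
    using frechet_derivative_at by metis
  then show ?thesis by (simp add: jacobian_def matrix_def)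
qed

text \<open>The extended metrics have this shape, with the one-forms \<open>x\<^sub>1 dx\<^sub>2 - x\<^sub>2 dx\<^sub>1\<close> of two coordinate
  planes in place of \<open>\<omega>\<close> and \<open>\<eta>\<close>.\<close>

definition rank_two :: "('m \<Rightarrow> real) \<Rightarrow> real \<Rightarrow> ('m \<Rightarrow> real) \<Rightarrow> real \<Rightarrow> ('m \<Rightarrow> real) \<Rightarrow> real ^ 'm ^ 'm"
  where "rank_two D p \<omega> q \<eta> = (\<chi> k l. (if k = l then D k else 0) + p * \<omega> k * \<omega> l + q * \<eta> k * \<eta> l)"

definition wedge :: "'m \<Rightarrow> 'm \<Rightarrow> real ^ 'm \<Rightarrow> 'm \<Rightarrow> real"
  where "wedge k l y m = (if m = l then y $ k else if m = k then - y $ l else 0)"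

lemma rank_two_congruent:
  fixes D \<omega> \<eta> :: "'m::finite \<Rightarrow> real"
  shows "(transpose J ** rank_two D p \<omega> q \<eta> ** J) $ k $ l =
    (\<Sum>m\<in>UNIV. D m * J $ m $ k * J $ m $ l)
    + p * (\<Sum>m\<in>UNIV. \<omega> m * J $ m $ k) * (\<Sum>m\<in>UNIV. \<omega> m * J $ m $ l)
    + q * (\<Sum>m\<in>UNIV. \<eta> m * J $ m $ k) * (\<Sum>m\<in>UNIV. \<eta> m * J $ m $ l)"
proof -
  have "(transpose J ** rank_two D p \<omega> q \<eta> ** J) $ k $ l =
      (\<Sum>n\<in>UNIV. (\<Sum>m\<in>UNIV. J $ m $ k * ((if m = n then D m else 0) + p * \<omega> m * \<omega> n + q * \<eta> m * \<eta> n)) * J $ n $ l)"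
    by (simp add: matrix_matrix_mult_def transpose_def rank_two_def)
  also have "\<dots> = (\<Sum>n\<in>UNIV. (J $ n $ k * D n) * J $ n $ l + (p * (\<Sum>m\<in>UNIV. \<omega> m * J $ m $ k)) * (\<omega> n * J $ n $ l)
      + (q * (\<Sum>m\<in>UNIV. \<eta> m * J $ m $ k)) * (\<eta> n * J $ n $ l))"
  proof (rule sum.cong[OF refl])
    fix n
    have "(\<Sum>m\<in>UNIV. J $ m $ k * ((if m = n then D m else 0) + p * \<omega> m * \<omega> n + q * \<eta> m * \<eta> n)) =
      (\<Sum>m\<in>UNIV. (if m = n then J $ m $ k * D m else 0) + (p * \<omega> n) * (\<omega> m * J $ m $ k) + (q * \<eta> n) * (\<eta> m * J $ m $ k))"
      by (rule sum.cong) (auto simp: algebra_simps)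
    also have "\<dots> = J $ n $ k * D n + (p * \<omega> n) * (\<Sum>m\<in>UNIV. \<omega> m * J $ m $ k) + (q * \<eta> n) * (\<Sum>m\<in>UNIV. \<eta> m * J $ m $ k)"
      by (simp add: sum.distrib sum_distrib_left)
    finally show "(\<Sum>m\<in>UNIV. J $ m $ k * ((if m = n then D m else 0) + p * \<omega> m * \<omega> n + q * \<eta> m * \<eta> n)) * J $ n $ l =
      (J $ n $ k * D n) * J $ n $ l + (p * (\<Sum>m\<in>UNIV. \<omega> m * J $ m $ k)) * (\<omega> n * J $ n $ l)
      + (q * (\<Sum>m\<in>UNIV. \<eta> m * J $ m $ k)) * (\<eta> n * J $ n $ l)"
      by (simp add: algebra_simps)
  qed
  also have "\<dots> = (\<Sum>m\<in>UNIV. D m * J $ m $ k * J $ m $ l)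
    + p * (\<Sum>m\<in>UNIV. \<omega> m * J $ m $ k) * (\<Sum>m\<in>UNIV. \<omega> m * J $ m $ l)
    + q * (\<Sum>m\<in>UNIV. \<eta> m * J $ m $ k) * (\<Sum>m\<in>UNIV. \<eta> m * J $ m $ l)"
    by (simp only: sum.distrib sum_distrib_left[symmetric] mult.commute[of "D _"] mult.assoc)
  finally show ?thesis .
qed

lemma sum_pair:
  fixes f :: "'m::finite \<Rightarrow> real"
  assumes "a \<noteq> b"
  shows "(\<Sum>m\<in>UNIV. f m) = f a + f b + (\<Sum>m\<in>UNIV - {a, b}. f m)"
proof -
  have "UNIV = insert a (insert b (UNIV - {a, b}))" by auto
  then have "(\<Sum>m\<in>UNIV. f m) = (\<Sum>m\<in>insert a (insert b (UNIV - {a, b})). f m)" by simp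
  then show ?thesis using assms by simp
qed

lemma transpose_rank_two: "transpose (rank_two D p \<omega> q \<eta>) = rank_two D p \<omega> q \<eta>"
  by (auto simp: rank_two_def transpose_def vec_eq_iff mult.commute mult.left_commute)

text \<open>Rotating the plane \<open>(a, b)\<close> diagonalizes its block, with eigenvalues \<open>D a\<close> and \<open>D a + p r\<^sup>2\<close>.\<close>

lemma lorentzian_rotate:
  fixes D \<eta> :: "'m::finite \<Rightarrow> real" and y :: "real ^ 'm"
  assumes ab: "a \<noteq> b" and D: "D a = D b" and \<eta>: "\<eta> a = 0" "\<eta> b = 0"
  defines "r \<equiv> (y $ a)\<^sup>2 + (y $ b)\<^sup>2"
  assumes lor: "\<And>t. 0 < t \<Longrightarrow> lorentzian (rank_two (D(a := t * D a, b := t * (D a + p * r))) 0 (\<lambda>_. 0) q \<eta>)"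
  shows "lorentzian (rank_two D p (wedge a b y) q \<eta>)"
proof -
  \<comment> \<open>At the origin of the plane every direction is an eigendirection, and (1, 0) is
    taken. The columns of \<open>Q\<close> in this plane have squared length \<open>t\<close> rather
    than 1, which is the origin of the factor in \<open>lor\<close>.\<close>
  define x1 where "x1 = (if r = 0 then 1 else y $ a)"
  define x2 where "x2 = (if r = 0 then 0 else y $ b)"
  define t where "t = x1\<^sup>2 + x2\<^sup>2"
  have r0: "r = 0 \<Longrightarrow> y $ a = 0 \<and> y $ b = 0" by (simp add: r_def sum_power2_eq_zero_iff)
  have t0: "t > 0" using r0 unfolding t_def x1_def x2_def by (auto simp: r_def sum_power2_gt_zero_iff)
  define Q :: "real ^ 'm ^ 'm" where "Q = (\<chi> k l. if k = a then (if l = a then x1 else if l = b then - x2 else 0)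
     else if k = b then (if l = a then x2 else if l = b then x1 else 0) else if k = l then 1 else 0)"
  define Q' :: "real ^ 'm ^ 'm" where "Q' = (\<chi> k l. if k = a then (if l = a then x1 / t else if l = b then x2 / t else 0)
     else if k = b then (if l = a then - x2 / t else if l = b then x1 / t else 0) else if k = l then 1 else 0)"
  have tt: "x1 * x1 / t + x2 * x2 / t = 1"
  proof -
    have "x1 * x1 + x2 * x2 = t" by (simp add: t_def power2_eq_square)
    then show ?thesis using t0 by (simp add: add_divide_distrib[symmetric])
  qed
  have "Q ** Q' = mat 1" "Q' ** Q = mat 1"
    using ab tt by (auto simp: vec_eq_iff matrix_matrix_mult_def mat_def sum_pair[OF ab] Q_def Q'_def
        if_distrib[of "\<lambda>x. x * _"] if_distrib[of "\<lambda>x. _ * x"] cong: if_cong)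
  then have inv: "invertible Q" unfolding invertible_def by blast
  define w0 where "w0 = x1 * y $ a + x2 * y $ b"
  have w: "(\<Sum>m\<in>UNIV. wedge a b y m * Q $ m $ k) = (if k = b then w0 else 0)" for k
  proof -
    have "x1 * y $ b = x2 * y $ a" using r0 by (auto simp: x1_def x2_def)
    then show ?thesis
      using ab by (auto simp: sum_pair[OF ab] wedge_def Q_def w0_def algebra_simps)
  qed
  have "w0 * w0 = t * r"
    using r0 by (auto simp: w0_def x1_def x2_def t_def r_def power2_eq_square algebra_simps)
  then have xr: "p * w0 * w0 = t * (p * r)" by simp
  have e: "(\<Sum>m\<in>UNIV. \<eta> m * Q $ m $ k) = \<eta> k" for k
    using ab \<eta> by (auto simp: sum_pair[OF ab] Q_def if_distrib[of "\<lambda>x. _ * x"] cong: if_cong)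
  have d: "(\<Sum>m\<in>UNIV. D m * Q $ m $ k * Q $ m $ l) = (if k = l then (D(a := t * D a, b := t * D a)) k else 0)" for k l
    using ab D by (auto simp: sum_pair[OF ab] Q_def t_def power2_eq_square algebra_simps
        if_distrib[of "\<lambda>x. x * _"] if_distrib[of "\<lambda>x. _ * x"] cong: if_cong)
  have "transpose Q ** rank_two D p (wedge a b y) q \<eta> ** Q = rank_two (D(a := t * D a, b := t * (D a + p * r))) 0 (\<lambda>_. 0) q \<eta>"
    unfolding vec_eq_iff rank_two_congruent w e d
    using ab by (auto simp: rank_two_def xr distrib_left)
  then show ?thesis
    using lorentzian_congruent[OF _ transpose_rank_two inv] lor[OF t0] by metis
qed

lemma rank_two_diag: "rank_two D 0 \<omega> q (\<lambda>_. 0) = diag D"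
  by (simp add: rank_two_def diag_def)

lemma rank_two_swap: "rank_two D p \<omega> q \<eta> = rank_two D q \<eta> p \<omega>"
  by (simp add: rank_two_def add.commute add.left_commute)

lemma Cinf_rank_two:
  assumes "open S" and "\<And>k. Cinf S (\<lambda>y. D y k)" and "Cinf S p" and "Cinf S q"
    and "\<And>k. Cinf S (\<lambda>y. \<omega> y k)" and "\<And>k. Cinf S (\<lambda>y. \<eta> y k)"
  shows "smooth_on S (\<lambda>y. rank_two (D y) (p y) (\<omega> y) (q y) (\<eta> y))"
proof (rule smooth_on_matrix[OF assms(1)])
  fix k l
  have "Cinf S (\<lambda>y. if k = l then D y k else 0)"
    using assms(2) Cinf_const[OF assms(1)] by (cases "k = l") simp_all
  then show "Cinf S (\<lambda>y. rank_two (D y) (p y) (\<omega> y) (q y) (\<eta> y) $ k $ l)"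
    by (simp add: rank_two_def) (intro Cinf_add Cinf_mult assms)
qed

lemma Cinf_wedge: "open S \<Longrightarrow> Cinf S (\<lambda>y. wedge a b y k)"
  by (cases "k = b"; cases "k = a") (auto simp: wedge_def intro: Cinf_nth Cinf_minus Cinf_const)

lemma has_derivative_nth: "((\<lambda>x :: real ^ 'm. x $ k) has_derivative (\<lambda>v. v $ k)) (at x)"
  by (rule bounded_linear_imp_has_derivative[OF bounded_linear_vec_nth])

lemma sum_Phi_delta:
  fixes f :: "'n::finite \<Rightarrow> real"
  shows "(\<Sum>m\<in>UNIV. if m = j then g m else f m) = g j + (\<Sum>m\<in>UNIV - {j}. f m)"
proof -
  have "(\<Sum>m\<in>UNIV. if m = j then g m else f m) = (\<Sum>m\<in>insert j (UNIV - {j}). if m = j then g m else f m)"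
    by (simp add: insert_absorb)
  also have "\<dots> = g j + (\<Sum>m\<in>UNIV - {j}. if m = j then g m else f m)" by (subst sum.insert) auto
  also have "(\<Sum>m\<in>UNIV - {j}. if m = j then g m else f m) = (\<Sum>m\<in>UNIV - {j}. f m)" by (rule sum.cong) auto
  finally show ?thesis .
qed

context soliton_array
begin

text \<open>In polar coordinates x1 dx2 - x2 dx1 is \<rho>^2 d\<phi>. Hence E (d\<rho>^2 + \<rho>^2
  d\<phi>^2) + q (\<rho>^2 d\<phi>)^2 has the angular coefficient \<rho>^2 (E + \<rho>^2 q), which
  is e^u by \<open>rod_extension\<close>.\<close>

lemma rod_extends:
  assumes j: "j = \<sigma> K" "j \<noteq> i"
  shows "extends_smoothly (rod_chart j) (rod_chart_axis j (c K) (c (K + 1))) (gm i)"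
proof -
  obtain a q w where ext: "Cinf (rod_dom K) a" "Cinf (rod_dom K) q" "\<And>i. Cinf (rod_dom K) (w i)"
    "\<And>s z. 0 < s \<Longrightarrow> c K < z \<Longrightarrow> z < c (K + 1) \<Longrightarrow> aS (s, z) = a (s, z)"
    "\<And>i s z. 0 < s \<Longrightarrow> U i (s, z) = w i (s, z) + (if \<sigma> K = i then ln s else 0)"
    "\<And>s z. (s, z) \<in> rod_dom K \<Longrightarrow> exp (w (\<sigma> K) (s, z)) = exp (2 * a (s, z)) + s * q (s, z)"
    using rod_extension[of K] by metis
  define V :: "(real ^ 'n coord) set" where "V = {y. c K < y $ Zc \<and> y $ Zc < c (K + 1)}"
  define pt where "pt y = ((y $ Rho)\<^sup>2 + (y $ Phi j)\<^sup>2, y $ Zc)" for y :: "real ^ 'n coord"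
  define D where "D y k = (case k of Rho \<Rightarrow> exp (2 * a (pt y)) | Zc \<Rightarrow> exp (2 * a (pt y))
     | Phi l \<Rightarrow> if l = j then exp (2 * a (pt y)) else (if l = i then - 1 else 1) * exp (w l (pt y)))" for y k
  define h where "h y = rank_two (D y) (q (pt y)) (wedge Rho (Phi j) y) 0 (\<lambda>_. 0)" for y
  have opV: "open V" unfolding V_def by (intro open_Collect_conj open_Collect_less continuous_intros)
  have ptV: "pt y \<in> rod_dom K" if "y \<in> V" for y
    using that unfolding pt_def by (intro rod_dom_axis) (auto simp: V_def)
  have Cpt: "Cinf V (\<lambda>y. F (pt y))" if "Cinf (rod_dom K) F" for F
    unfolding pt_def by (rule Cinf_compose2[OF that])
      (intro Cinf_add Cinf_power Cinf_nth opV | simp add: pt_def[symmetric] ptV)+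
  have "Cinf V (\<lambda>y. D y k)" for k
  proof (cases k)
    case (Phi l)
    have "Cinf V (\<lambda>y. (if l = i then - 1 else 1) * exp (w l (pt y)))"
      by (intro Cinf_mult Cinf_const Cinf_exp' Cpt ext opV) auto
    moreover have "Cinf V (\<lambda>y. exp (2 * a (pt y)))" by (intro Cinf_mult Cinf_const Cinf_exp' Cpt ext opV) auto
    ultimately show ?thesis using Phi by (cases "l = j") (simp_all add: D_def)
  qed (simp_all add: D_def, (intro Cinf_mult Cinf_const Cinf_exp' Cpt ext opV; simp)+)
  then have smooth: "smooth_on V h"
    unfolding h_def[abs_def] by (intro Cinf_rank_two opV Cpt ext Cinf_const Cinf_wedge)
  have lor: "lorentzian (h y)" if "y \<in> V" for y
    unfolding h_def
  proof (rule lorentzian_rotate)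
    fix t :: real assume t: "0 < t"
    \<comment> \<open>By \<open>rod_extension\<close> this second eigenvalue is an
      exponential.\<close>
    have pos: "0 < D y Rho + q (pt y) * ((y $ Rho)\<^sup>2 + (y $ Phi j)\<^sup>2)"
      using ext(6)[of "(y $ Rho)\<^sup>2 + (y $ Phi j)\<^sup>2" "y $ Zc"] ptV[OF that]
      by (simp add: D_def pt_def mult.commute) (metis exp_gt_zero)
    show "lorentzian (rank_two ((D y)(Rho := t * D y Rho, Phi j := t * (D y Rho + q (pt y) * ((y $ Rho)\<^sup>2 + (y $ Phi j)\<^sup>2)))) 0
       (\<lambda>_. 0) 0 (\<lambda>_. 0))"
      unfolding rank_two_diag
    proof (rule lorentzian_diag[of _ "Phi i"])
      show "0 < ((D y)(Rho := t * D y Rho, Phi j := t * (D y Rho + q (pt y) * ((y $ Rho)\<^sup>2 + (y $ Phi j)\<^sup>2)))) k" if "k \<noteq> Phi i" for k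
        using that pos t by (cases k) (auto simp: D_def)
    qed (use j in \<open>simp add: D_def\<close>)
  qed (simp_all add: D_def)
  have pb: "gm i x = pullback (rod_chart j) h x" if x: "x \<in> off_axis" and xV: "rod_chart j x \<in> V" for x
  proof -
    define \<rho> z \<phi> where "\<rho> = x $ Rho" and "z = x $ Zc" and "\<phi> = x $ Phi j"
    define C S where "C = cos \<phi>" and "S = sin \<phi>"
    have cs: "C * C + S * S = 1" by (simp add: C_def S_def power2_eq_square[symmetric])
    have \<rho>: "\<rho> > 0" using x by (simp add: off_axis_def \<rho>_def)
    have z: "c K < z" "z < c (K + 1)" using xV by (auto simp: V_def rod_chart_def z_def)
    have y: "rod_chart j x $ Rho = \<rho> * C" "rod_chart j x $ Phi j = \<rho> * S" "rod_chart j x $ Zc = z"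
      by (simp_all add: rod_chart_def \<rho>_def z_def \<phi>_def C_def S_def)
    have "(\<rho> * C)\<^sup>2 + (\<rho> * S)\<^sup>2 = \<rho>\<^sup>2 * (C * C + S * S)" by (simp add: power2_eq_square algebra_simps)
    then have pt: "pt (rod_chart j x) = (\<rho>\<^sup>2, z)" by (simp add: pt_def y cs)
    define J where "J = jacobian (rod_chart j) (at x)"
    define DF where "DF k = (if k = Rho then (\<lambda>v. C * v $ Rho - \<rho> * S * v $ Phi j)
       else if k = Phi j then (\<lambda>v. S * v $ Rho + \<rho> * C * v $ Phi j) else (\<lambda>v :: real ^ 'n coord. v $ k))" for k
    have J: "J $ k $ l = DF k (axis l 1)" for k l
      unfolding J_def
    proof (rule jacobian_eq)
      fix k
      have "((\<lambda>x :: real ^ 'n coord. x $ Rho * cos (x $ Phi j)) has_derivative (\<lambda>v. C * v $ Rho - \<rho> * S * v $ Phi j)) (at x)"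
        by (rule derivative_eq_intros has_derivative_nth refl)+ (simp add: C_def S_def \<rho>_def \<phi>_def algebra_simps)
      moreover have "((\<lambda>x :: real ^ 'n coord. x $ Rho * sin (x $ Phi j)) has_derivative (\<lambda>v. S * v $ Rho + \<rho> * C * v $ Phi j)) (at x)"
        by (rule derivative_eq_intros has_derivative_nth refl)+ (simp add: C_def S_def \<rho>_def \<phi>_def algebra_simps)
      ultimately show "((\<lambda>x. rod_chart j x $ k) has_derivative DF k) (at x)"
        using has_derivative_nth[of k x] by (simp add: rod_chart_def DF_def)
    qed
    have JR: "J $ Rho $ k = C * axis k 1 $ Rho - \<rho> * S * axis k 1 $ Phi j" and JZ: "J $ Zc $ k = axis k 1 $ Zc"
      and JP: "J $ Phi m $ k = (if m = j then S * axis k 1 $ Rho + \<rho> * C * axis k 1 $ Phi j else axis k 1 $ Phi m)" for k m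
      by (simp_all add: J DF_def)
    let ?y = "rod_chart j x"
    have w: "(\<Sum>m\<in>UNIV. wedge Rho (Phi j) ?y m * J $ m $ k) = \<rho>\<^sup>2 * axis k 1 $ Phi j" for k
    proof -
      have "(\<Sum>m\<in>UNIV. wedge Rho (Phi j) ?y m * J $ m $ k) = - (\<rho> * S) * J $ Rho $ k + \<rho> * C * J $ Phi j $ k"
        by (simp add: sum_coord wedge_def y if_distrib[of "\<lambda>x. x * _"] cong: if_cong)
      also have "\<dots> = \<rho>\<^sup>2 * (C * C + S * S) * axis k 1 $ Phi j"
        by (simp add: JR JP power2_eq_square algebra_simps)
      finally show ?thesis by (simp add: cs)
    qed
    define E where "E = exp (2 * a (\<rho>\<^sup>2, z))"
    have d: "(\<Sum>m\<in>UNIV. D ?y m * J $ m $ k * J $ m $ l) = E * (axis k 1 $ Rho * axis l 1 $ Rho + axis k 1 $ Zc * axis l 1 $ Zc)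
      + E * \<rho>\<^sup>2 * axis k 1 $ Phi j * axis l 1 $ Phi j
      + (\<Sum>m\<in>UNIV - {j}. (if m = i then - 1 else 1) * exp (w m (\<rho>\<^sup>2, z)) * axis k 1 $ Phi m * axis l 1 $ Phi m)" for k l
    proof -
      have "(\<Sum>m\<in>UNIV. D ?y (Phi m) * J $ Phi m $ k * J $ Phi m $ l) =
        E * J $ Phi j $ k * J $ Phi j $ l + (\<Sum>m\<in>UNIV - {j}. (if m = i then - 1 else 1) * exp (w m (\<rho>\<^sup>2, z)) * axis k 1 $ Phi m * axis l 1 $ Phi m)"
      proof -
        have "(\<Sum>m\<in>UNIV. D ?y (Phi m) * J $ Phi m $ k * J $ Phi m $ l) = (\<Sum>m\<in>UNIV. if m = j then E * J $ Phi j $ k * J $ Phi j $ l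
            else (if m = i then - 1 else 1) * exp (w m (\<rho>\<^sup>2, z)) * axis k 1 $ Phi m * axis l 1 $ Phi m)"
          by (rule sum.cong) (auto simp: D_def pt E_def JP)
        then show ?thesis by (simp only: sum_Phi_delta)
      qed
      moreover have "E * J $ Rho $ k * J $ Rho $ l + E * J $ Phi j $ k * J $ Phi j $ l =
        E * (C * C + S * S) * (axis k 1 $ Rho * axis l 1 $ Rho) + E * \<rho>\<^sup>2 * (C * C + S * S) * axis k 1 $ Phi j * axis l 1 $ Phi j"
        by (simp add: JR JP power2_eq_square algebra_simps)
      ultimately show ?thesis
        by (simp add: sum_coord D_def pt E_def[symmetric] JZ cs algebra_simps)
    qed
    have uj: "exp (u j \<rho> z) = \<rho>\<^sup>2 * (E + \<rho>\<^sup>2 * q (\<rho>\<^sup>2, z))"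
    proof -
      have "exp (u j \<rho> z) = \<rho>\<^sup>2 * exp (w j (\<rho>\<^sup>2, z))"
        using ext(5)[of "\<rho>\<^sup>2" j z] \<rho> j by (simp add: soliton_u_potU exp_add)
      then show ?thesis using ext(6)[OF rod_dom_axis[OF z, of "\<rho>\<^sup>2"]] j by (simp add: E_def)
    qed
    have um: "u m \<rho> z = w m (\<rho>\<^sup>2, z)" if "m \<noteq> j" for m
      using ext(5)[of "\<rho>\<^sup>2" m z] \<rho> j that by (simp add: soliton_u_potU)
    have al: "exp (2 * \<alpha> \<rho> z) = E"
      using ext(4)[of "\<rho>\<^sup>2" z] \<rho> z by (simp add: E_def aS_def)
    have "gm i x $ k $ l = pullback (rod_chart j) h x $ k $ l" for k l
    proof -
      have "pullback (rod_chart j) h x $ k $ l = E * (axis k 1 $ Rho * axis l 1 $ Rho + axis k 1 $ Zc * axis l 1 $ Zc)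
        + \<rho>\<^sup>2 * (E + \<rho>\<^sup>2 * q (\<rho>\<^sup>2, z)) * axis k 1 $ Phi j * axis l 1 $ Phi j
        + (\<Sum>m\<in>UNIV - {j}. (if m = i then - 1 else 1) * exp (w m (\<rho>\<^sup>2, z)) * axis k 1 $ Phi m * axis l 1 $ Phi m)"
        unfolding pullback_def J_def[symmetric] h_def rank_two_congruent w d pt
        by (simp add: algebra_simps power2_eq_square)
      also have "\<dots> = gm i x $ k $ l"
        using j uj al um
        by (cases k; cases l) (auto simp: gm_nth W.coef_def axis_def \<rho>_def[symmetric] z_def[symmetric]
            if_distrib[of "\<lambda>x. x * _"] if_distrib[of "\<lambda>x. _ * x"] cong: if_cong)
      finally show ?thesis ..
    qed
    then show ?thesis by (simp add: vec_eq_iff)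
  qed
  have "rod_chart_axis j (c K) (c (K + 1)) \<subseteq> V" by (auto simp: rod_chart_axis_def V_def)
  then show ?thesis
    unfolding extends_smoothly_def lorentzian_metric_on_def
    using smooth lor pb by blast
qed

text \<open>As over a rod, but in two planes with radii sqrt X and sqrt Y. There d\<rho>^2 + dz^2 is
  M = X + Y times the flat radial part, so the coefficient is e^(2 \<alpha>) M = e^\<Phi>, and the
  two angular coefficients are X (E + X p) and Y (E + Y q).\<close>

lemma corner_extends:
  assumes j: "j = \<sigma> K" "j \<noteq> i" and k: "k = \<sigma> (K + 1)" "k \<noteq> i"
  shows "extends_smoothly (corner_chart (c (K + 1)) j k) (corner_chart_axis j k) (gm i)"
proof -
  obtain \<Phi> p q w where ext: "Cinf box \<Phi>" "Cinf box p" "Cinf box q" "\<And>i. Cinf box (w i)"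
    "\<And>X Y. 0 < X \<Longrightarrow> 0 < Y \<Longrightarrow> (X, Y) \<in> box \<Longrightarrow> 2 * aS (corner_pt K (X, Y)) + ln (X + Y) = \<Phi> (X, Y)"
    "\<And>i X Y. 0 < X \<Longrightarrow> 0 < Y \<Longrightarrow> U i (corner_pt K (X, Y)) = w i (X, Y)
        + (if \<sigma> K = i then ln X else 0) + (if \<sigma> (K + 1) = i then ln Y else 0)"
    "\<And>X Y. (X, Y) \<in> box \<Longrightarrow> 0 \<le> X \<Longrightarrow> 0 \<le> Y \<Longrightarrow> exp (w (\<sigma> K) (X, Y)) = exp (\<Phi> (X, Y)) + X * p (X, Y)"
    "\<And>X Y. (X, Y) \<in> box \<Longrightarrow> 0 \<le> X \<Longrightarrow> 0 \<le> Y \<Longrightarrow> exp (w (\<sigma> (K + 1)) (X, Y)) = exp (\<Phi> (X, Y)) + Y * q (X, Y)"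
    by (rule corner_extension[of K]) (rule that)
  have jk: "j \<noteq> k" using alt[of K] j k by simp
  define X where "X y = (y $ Rho)\<^sup>2 + (y $ Phi j)\<^sup>2" for y :: "real ^ 'n coord"
  define Y where "Y y = (y $ Zc)\<^sup>2 + (y $ Phi k)\<^sup>2" for y :: "real ^ 'n coord"
  define V :: "(real ^ 'n coord) set" where "V = {y. X y < gap / 2 \<and> Y y < gap / 2}"
  define D where "D y d = (case d of Rho \<Rightarrow> exp (\<Phi> (X y, Y y)) | Zc \<Rightarrow> exp (\<Phi> (X y, Y y))
     | Phi l \<Rightarrow> if l = j then exp (\<Phi> (X y, Y y)) else if l = k then exp (\<Phi> (X y, Y y))
        else (if l = i then - 1 else 1) * exp (w l (X y, Y y)))" for y d
  define h where "h y = rank_two (D y) (p (X y, Y y)) (wedge Rho (Phi j) y) (q (X y, Y y)) (wedge Zc (Phi k) y)" for y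
  have opV: "open V"
    unfolding V_def X_def Y_def by (intro open_Collect_conj open_Collect_less continuous_intros)
  have XY0: "0 \<le> X y" "0 \<le> Y y" for y by (simp_all add: X_def Y_def)
  have inbox: "(X y, Y y) \<in> box" if "y \<in> V" for y
    using that XY0[of y] by (simp add: V_def box_def)
  have Cpt: "Cinf V (\<lambda>y. F (X y, Y y))" if "Cinf box F" for F
    by (rule Cinf_compose2[OF that]; (unfold X_def Y_def)?)
      (intro Cinf_add Cinf_power Cinf_nth opV | simp add: X_def[symmetric] Y_def[symmetric] inbox)+
  have "Cinf V (\<lambda>y. D y d)" for d
  proof (cases d)
    case (Phi l)
    have "Cinf V (\<lambda>y. (if l = i then - 1 else 1) * exp (w l (X y, Y y)))"
      by (intro Cinf_mult Cinf_const Cinf_exp' Cpt ext opV) auto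
    moreover have "Cinf V (\<lambda>y. exp (\<Phi> (X y, Y y)))" by (intro Cinf_exp' Cpt ext) auto
    ultimately show ?thesis using Phi by (cases "l = j"; cases "l = k") (simp_all add: D_def)
  qed (simp_all add: D_def, (intro Cinf_exp' Cpt ext; simp)+)
  then have smooth: "smooth_on V h"
    unfolding h_def[abs_def] by (intro Cinf_rank_two opV Cpt ext Cinf_wedge)
  have lor: "lorentzian (h y)" if "y \<in> V" for y
    unfolding h_def
  proof (rule lorentzian_rotate)
    fix t :: real assume t: "0 < t"
    define D' where "D' = (D y)(Rho := t * D y Rho, Phi j := t * (D y Rho + p (X y, Y y) * ((y $ Rho)\<^sup>2 + (y $ Phi j)\<^sup>2)))"
    have posX: "0 < D y Rho + p (X y, Y y) * ((y $ Rho)\<^sup>2 + (y $ Phi j)\<^sup>2)"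
      using ext(7)[OF inbox[OF that] XY0] by (simp add: D_def X_def[symmetric] mult.commute) (metis exp_gt_zero)
    have posY: "0 < D y Zc + q (X y, Y y) * ((y $ Zc)\<^sup>2 + (y $ Phi k)\<^sup>2)"
      using ext(8)[OF inbox[OF that] XY0] by (simp add: D_def Y_def[symmetric] mult.commute) (metis exp_gt_zero)
    \<comment> \<open>The two one-forms live in complementary planes, so the second block can be
      rotated after the first without disturbing it.\<close>
    have "lorentzian (rank_two D' (q (X y, Y y)) (wedge Zc (Phi k) y) 0 (\<lambda>_. 0))"
    proof (rule lorentzian_rotate)
      fix t' :: real assume t': "0 < t'"
      have Z: "D' Zc = D y Zc" by (simp add: D'_def)
      show "lorentzian (rank_two (D'(Zc := t' * D' Zc, Phi k := t' * (D' Zc + q (X y, Y y) * ((y $ Zc)\<^sup>2 + (y $ Phi k)\<^sup>2)))) 0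
         (\<lambda>_. 0) 0 (\<lambda>_. 0))"
        unfolding rank_two_diag Z
      proof (rule lorentzian_diag[of _ "Phi i"])
        show "0 < (D'(Zc := t' * D y Zc, Phi k := t' * (D y Zc + q (X y, Y y) * ((y $ Zc)\<^sup>2 + (y $ Phi k)\<^sup>2)))) d" if "d \<noteq> Phi i" for d
          using that posX posY t t' by (cases d) (auto simp: D'_def D_def)
      qed (use j k in \<open>simp add: D_def D'_def\<close>)
    qed (use jk in \<open>simp_all add: D_def D'_def\<close>)
    then show "lorentzian (rank_two ((D y)(Rho := t * D y Rho, Phi j := t * (D y Rho + p (X y, Y y) * ((y $ Rho)\<^sup>2 + (y $ Phi j)\<^sup>2)))) 0
       (\<lambda>_. 0) (q (X y, Y y)) (wedge Zc (Phi k) y))"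
      unfolding D'_def by (subst rank_two_swap) (simp add: rank_two_def)
  qed (use jk in \<open>simp_all add: D_def wedge_def\<close>)
  have pb: "gm i x = pullback (corner_chart (c (K + 1)) j k) h x"
    if x: "x \<in> off_axis" and xV: "corner_chart (c (K + 1)) j k x \<in> V" for x
  proof -
    let ?F = "corner_chart (c (K + 1)) j k"
    let ?y = "?F x"
    define R where "R x = sqrt ((x $ Rho)\<^sup>2 + (x $ Zc - c (K + 1))\<^sup>2)" for x :: "real ^ 'n coord"
    define \<rho> z where "\<rho> = x $ Rho" and "z = x $ Zc"
    define X0 Y0 where "X0 = R x + (z - c (K + 1))" and "Y0 = R x - (z - c (K + 1))"
    define r s where "r = sqrt X0" and "s = sqrt Y0"
    define C S C' S' where "C = cos (x $ Phi j)" and "S = sin (x $ Phi j)" and "C' = cos (x $ Phi k)" and "S' = sin (x $ Phi k)"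
    have cs: "C * C + S * S = 1" "C' * C' + S' * S' = 1"
      by (simp_all add: C_def S_def C'_def S'_def power2_eq_square[symmetric])
    have \<rho>: "\<rho> > 0" using x by (simp add: off_axis_def \<rho>_def)
    have "(z - c (K + 1))\<^sup>2 < \<rho>\<^sup>2 + (z - c (K + 1))\<^sup>2" using \<rho> by simp
    then have "sqrt ((z - c (K + 1))\<^sup>2) < R x" unfolding R_def \<rho>_def z_def by (rule real_sqrt_less_mono)
    then have XY: "0 < X0" "0 < Y0" by (auto simp: X0_def Y0_def abs_less_iff)
    have R2: "(R x)\<^sup>2 = \<rho>\<^sup>2 + (z - c (K + 1))\<^sup>2" by (simp add: R_def \<rho>_def z_def)
    then have prod: "X0 * Y0 = \<rho>\<^sup>2" by (simp add: X0_def Y0_def power2_eq_square algebra_simps)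
    have sum: "X0 + Y0 = 2 * R x" and diff: "c (K + 1) + (X0 - Y0) / 2 = z" by (simp_all add: X0_def Y0_def field_simps)
    have r: "0 < r" "r * r = X0" and s: "0 < s" "s * s = Y0" using XY by (simp_all add: r_def s_def)
    have rs: "r * s = \<rho>"
    proof -
      have "(r * s)\<^sup>2 = \<rho>\<^sup>2" using r s prod by (simp add: power2_eq_square) (metis mult.assoc mult.left_commute)
      then show ?thesis using r s \<rho> by (simp add: power2_eq_iff_nonneg)
    qed
    define M where "M = X0 + Y0"
    have M: "M > 0" using XY by (simp add: M_def)
    have y: "?y $ Rho = r * C" "?y $ Phi j = r * S" "?y $ Zc = s * C'" "?y $ Phi k = s * S'"
      using jk by (simp_all add: corner_chart_def Let_def r_def s_def X0_def Y0_def R_def z_def C_def S_def C'_def S'_def)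
    have Xy: "X ?y = X0" "Y ?y = Y0"
    proof -
      have "(r * C)\<^sup>2 + (r * S)\<^sup>2 = r * r * (C * C + S * S)" "(s * C')\<^sup>2 + (s * S')\<^sup>2 = s * s * (C' * C' + S' * S')"
        by (simp_all add: power2_eq_square algebra_simps)
      then show "X ?y = X0" "Y ?y = Y0" using r s by (simp_all add: X_def Y_def y cs)
    qed
    have b: "(X0, Y0) \<in> box" using inbox[OF xV] by (simp add: Xy)
    have pt: "corner_pt K (X0, Y0) = (\<rho>\<^sup>2, z)" by (simp add: corner_pt_def prod diff)
    have dR: "(R has_derivative (\<lambda>v. (\<rho> * v $ Rho + (z - c (K + 1)) * v $ Zc) / R x)) (at x)"
    proof -
      have p: "0 < (x $ Rho)\<^sup>2 + (x $ Zc - c (K + 1))\<^sup>2" using \<rho> by (simp add: \<rho>_def add_pos_nonneg)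
      have "((\<lambda>x :: real ^ 'n coord. (x $ Rho)\<^sup>2 + (x $ Zc - c (K + 1))\<^sup>2) has_derivative
         (\<lambda>v. 2 * (\<rho> * v $ Rho + (z - c (K + 1)) * v $ Zc))) (at x)"
        by (rule derivative_eq_intros has_derivative_nth refl)+ (simp add: \<rho>_def z_def algebra_simps)
      from has_derivative_compose[OF this DERIV_real_sqrt[OF p, unfolded has_field_derivative_def]]
      have "(R has_derivative (\<lambda>v. inverse (R x) / 2 * (2 * (\<rho> * v $ Rho + (z - c (K + 1)) * v $ Zc)))) (at x)"
        unfolding R_def[symmetric] by (simp only: R_def[abs_def])
      moreover have "inverse (R x) / 2 * (2 * a) = a / R x" for a by (simp add: inverse_eq_divide)
      ultimately show ?thesis by (simp only:)
    qed
    have dr: "((\<lambda>x. sqrt (R x + (x $ Zc - c (K + 1)))) has_derivative (\<lambda>v. (s * v $ Rho + r * v $ Zc) / M)) (at x)"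
    proof -
      have "((\<lambda>x. R x + (x $ Zc - c (K + 1))) has_derivative (\<lambda>v. (\<rho> * v $ Rho + (z - c (K + 1)) * v $ Zc) / R x + (v $ Zc - 0))) (at x)"
        by (intro has_derivative_add dR has_derivative_diff has_derivative_nth has_derivative_const)
      moreover have "(sqrt has_derivative (*) (inverse (sqrt X0) / 2)) (at (R x + (x $ Zc - c (K + 1))))"
        using DERIV_real_sqrt[OF XY(1)] unfolding has_field_derivative_def by (simp add: X0_def z_def)
      ultimately have "((\<lambda>x. sqrt (R x + (x $ Zc - c (K + 1)))) has_derivative
         (\<lambda>v. inverse (sqrt X0) / 2 * ((\<rho> * v $ Rho + (z - c (K + 1)) * v $ Zc) / R x + (v $ Zc - 0)))) (at x)"
        by (rule has_derivative_compose)
      moreover have "inverse (sqrt X0) / 2 * ((\<rho> * v $ Rho + (z - c (K + 1)) * v $ Zc) / R x + (v $ Zc - 0)) = (s * v $ Rho + r * v $ Zc) / M" for v :: "real ^ 'n coord"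
      proof -
        have Rx: "R x > 0" using M sum by (simp add: M_def)
        have "(\<rho> * v $ Rho + (z - c (K + 1)) * v $ Zc) / R x + (v $ Zc - 0) = (\<rho> * v $ Rho + X0 * v $ Zc) / R x"
          using Rx by (simp add: X0_def field_simps)
        also have "\<rho> * v $ Rho + X0 * v $ Zc = r * (s * v $ Rho + r * v $ Zc)"
          unfolding rs[symmetric] r(2)[symmetric] by (simp add: algebra_simps)
        finally have eq: "(\<rho> * v $ Rho + (z - c (K + 1)) * v $ Zc) / R x + (v $ Zc - 0) = r * (s * v $ Rho + r * v $ Zc) / R x" .
        show ?thesis
          unfolding eq using r Rx by (simp add: r_def[symmetric] M_def sum field_simps)
      qed
      ultimately show ?thesis by (simp only:)
    qed
    have ds: "((\<lambda>x. sqrt (R x - (x $ Zc - c (K + 1)))) has_derivative (\<lambda>v. (r * v $ Rho - s * v $ Zc) / M)) (at x)"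
    proof -
      have "((\<lambda>x. R x - (x $ Zc - c (K + 1))) has_derivative (\<lambda>v. (\<rho> * v $ Rho + (z - c (K + 1)) * v $ Zc) / R x - (v $ Zc - 0))) (at x)"
        by (intro has_derivative_add dR has_derivative_diff has_derivative_nth has_derivative_const)
      moreover have "(sqrt has_derivative (*) (inverse (sqrt Y0) / 2)) (at (R x - (x $ Zc - c (K + 1))))"
        using DERIV_real_sqrt[OF XY(2)] unfolding has_field_derivative_def by (simp add: Y0_def z_def)
      ultimately have "((\<lambda>x. sqrt (R x - (x $ Zc - c (K + 1)))) has_derivative
         (\<lambda>v. inverse (sqrt Y0) / 2 * ((\<rho> * v $ Rho + (z - c (K + 1)) * v $ Zc) / R x - (v $ Zc - 0)))) (at x)"
        by (rule has_derivative_compose)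
      moreover have "inverse (sqrt Y0) / 2 * ((\<rho> * v $ Rho + (z - c (K + 1)) * v $ Zc) / R x - (v $ Zc - 0)) = (r * v $ Rho - s * v $ Zc) / M" for v :: "real ^ 'n coord"
      proof -
        have Rx: "R x > 0" using M sum by (simp add: M_def)
        have "(\<rho> * v $ Rho + (z - c (K + 1)) * v $ Zc) / R x - (v $ Zc - 0) = (\<rho> * v $ Rho - Y0 * v $ Zc) / R x"
          using Rx by (simp add: Y0_def field_simps)
        also have "\<rho> * v $ Rho - Y0 * v $ Zc = s * (r * v $ Rho - s * v $ Zc)"
          unfolding rs[symmetric] s(2)[symmetric] by (simp add: algebra_simps)
        finally have eq: "(\<rho> * v $ Rho + (z - c (K + 1)) * v $ Zc) / R x - (v $ Zc - 0) = s * (r * v $ Rho - s * v $ Zc) / R x" .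
        show ?thesis
          unfolding eq using s Rx by (simp add: s_def[symmetric] M_def sum field_simps)
      qed
      ultimately show ?thesis by (simp only:)
    qed
    define dr' ds' where "dr' v = (s * v $ Rho + r * v $ Zc) / M" and "ds' v = (r * v $ Rho - s * v $ Zc) / M" for v :: "real ^ 'n coord"
    define J where "J = jacobian ?F (at x)"
    define DF where "DF d = (if d = Rho then (\<lambda>v. C * dr' v - r * S * v $ Phi j)
       else if d = Phi j then (\<lambda>v. S * dr' v + r * C * v $ Phi j)
       else if d = Zc then (\<lambda>v. C' * ds' v - s * S' * v $ Phi k)
       else if d = Phi k then (\<lambda>v. S' * ds' v + s * C' * v $ Phi k) else (\<lambda>v. v $ d))" for d
    have J: "J $ d $ l = DF d (axis l 1)" for d l
      unfolding J_def
    proof (rule jacobian_eq)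
      fix d
      have rx: "sqrt (R x + (x $ Zc - c (K + 1))) = r" "sqrt (R x - (x $ Zc - c (K + 1))) = s"
        by (simp_all add: r_def s_def X0_def Y0_def z_def)
      have cos: "((\<lambda>x :: real ^ 'n coord. cos (x $ m)) has_derivative (\<lambda>v. - sin (x $ m) * v $ m)) (at x)"
        and sin: "((\<lambda>x :: real ^ 'n coord. sin (x $ m)) has_derivative (\<lambda>v. cos (x $ m) * v $ m)) (at x)" for m
        by (rule derivative_eq_intros has_derivative_nth refl | simp add: mult.commute)+
      have "((\<lambda>x. sqrt (R x + (x $ Zc - c (K + 1))) * cos (x $ Phi j)) has_derivative (\<lambda>v. C * dr' v - r * S * v $ Phi j)) (at x)"
        by (rule has_derivative_eq_rhs[OF has_derivative_mult[OF dr cos]])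
          (simp add: C_def S_def dr'_def rx fun_eq_iff)
      moreover have "((\<lambda>x. sqrt (R x + (x $ Zc - c (K + 1))) * sin (x $ Phi j)) has_derivative (\<lambda>v. S * dr' v + r * C * v $ Phi j)) (at x)"
        by (rule has_derivative_eq_rhs[OF has_derivative_mult[OF dr sin]])
          (simp add: C_def S_def dr'_def rx fun_eq_iff)
      moreover have "((\<lambda>x. sqrt (R x - (x $ Zc - c (K + 1))) * cos (x $ Phi k)) has_derivative (\<lambda>v. C' * ds' v - s * S' * v $ Phi k)) (at x)"
        by (rule has_derivative_eq_rhs[OF has_derivative_mult[OF ds cos]])
          (simp add: C'_def S'_def ds'_def rx fun_eq_iff)
      moreover have "((\<lambda>x. sqrt (R x - (x $ Zc - c (K + 1))) * sin (x $ Phi k)) has_derivative (\<lambda>v. S' * ds' v + s * C' * v $ Phi k)) (at x)"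
        by (rule has_derivative_eq_rhs[OF has_derivative_mult[OF ds sin]])
          (simp add: C'_def S'_def ds'_def rx fun_eq_iff)
      ultimately show "((\<lambda>x. ?F x $ d) has_derivative DF d) (at x)"
        using has_derivative_nth[of d x] jk
        by (auto simp: corner_chart_def Let_def DF_def R_def[symmetric])
    qed
    have JR: "J $ Rho $ l = C * dr' (axis l 1) - r * S * axis l 1 $ Phi j"
      and JZ: "J $ Zc $ l = C' * ds' (axis l 1) - s * S' * axis l 1 $ Phi k"
      and Jj: "J $ Phi j $ l = S * dr' (axis l 1) + r * C * axis l 1 $ Phi j"
      and Jk: "J $ Phi k $ l = S' * ds' (axis l 1) + s * C' * axis l 1 $ Phi k"
      and Jm: "m \<noteq> j \<Longrightarrow> m \<noteq> k \<Longrightarrow> J $ Phi m $ l = axis l 1 $ Phi m" for l m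
      using jk by (simp_all add: J DF_def)
    have w1: "(\<Sum>m\<in>UNIV. wedge Rho (Phi j) ?y m * J $ m $ l) = X0 * axis l 1 $ Phi j" for l
    proof -
      have "(\<Sum>m\<in>UNIV. wedge Rho (Phi j) ?y m * J $ m $ l) = - (r * S) * J $ Rho $ l + r * C * J $ Phi j $ l"
        by (simp add: sum_coord wedge_def y if_distrib[of "\<lambda>x. x * _"] cong: if_cong)
      also have "\<dots> = r * r * (C * C + S * S) * axis l 1 $ Phi j"
        by (simp add: JR Jj algebra_simps)
      finally show ?thesis by (simp only: cs r mult_1_right)
    qed
    have w2: "(\<Sum>m\<in>UNIV. wedge Zc (Phi k) ?y m * J $ m $ l) = Y0 * axis l 1 $ Phi k" for l
    proof -
      have "(\<Sum>m\<in>UNIV. wedge Zc (Phi k) ?y m * J $ m $ l) = - (s * S') * J $ Zc $ l + s * C' * J $ Phi k $ l"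
        by (simp add: sum_coord wedge_def y if_distrib[of "\<lambda>x. x * _"] cong: if_cong)
      also have "\<dots> = s * s * (C' * C' + S' * S') * axis l 1 $ Phi k"
        by (simp add: JZ Jk algebra_simps)
      finally show ?thesis by (simp only: cs s mult_1_right)
    qed
    define E where "E = exp (\<Phi> (X0, Y0))"
    let ?rest = "\<lambda>d l. (\<Sum>m\<in>UNIV - {j, k}. (if m = i then - 1 else 1) * exp (w m (X0, Y0)) * axis d 1 $ Phi m * axis l 1 $ Phi m)"
    have d: "(\<Sum>m\<in>UNIV. D ?y m * J $ m $ d * J $ m $ l) = E / M * (axis d 1 $ Rho * axis l 1 $ Rho + axis d 1 $ Zc * axis l 1 $ Zc)
      + E * X0 * axis d 1 $ Phi j * axis l 1 $ Phi j + E * Y0 * axis d 1 $ Phi k * axis l 1 $ Phi k + ?rest d l" for d l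
    proof -
      have DE: "D ?y Rho = E" "D ?y Zc = E" by (simp_all add: D_def Xy E_def)
      have "(\<Sum>m\<in>UNIV. D ?y (Phi m) * J $ Phi m $ d * J $ Phi m $ l) =
        E * J $ Phi j $ d * J $ Phi j $ l + E * J $ Phi k $ d * J $ Phi k $ l
        + (\<Sum>m\<in>UNIV - {j, k}. D ?y (Phi m) * J $ Phi m $ d * J $ Phi m $ l)"
        using jk by (simp add: sum_pair[OF jk] D_def Xy E_def)
      also have "(\<Sum>m\<in>UNIV - {j, k}. D ?y (Phi m) * J $ Phi m $ d * J $ Phi m $ l) = ?rest d l"
        by (rule sum.cong) (auto simp: D_def Xy Jm)
      finally have "(\<Sum>m\<in>UNIV. D ?y m * J $ m $ d * J $ m $ l) =
        E * (J $ Rho $ d * J $ Rho $ l + J $ Phi j $ d * J $ Phi j $ l) + E * (J $ Zc $ d * J $ Zc $ l + J $ Phi k $ d * J $ Phi k $ l) + ?rest d l"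
        by (simp add: sum_coord DE distrib_left mult.assoc)
      also have "J $ Rho $ d * J $ Rho $ l + J $ Phi j $ d * J $ Phi j $ l =
          (C * C + S * S) * (dr' (axis d 1) * dr' (axis l 1)) + (C * C + S * S) * (r * r) * axis d 1 $ Phi j * axis l 1 $ Phi j"
        by (simp add: JR Jj algebra_simps)
      also have "J $ Zc $ d * J $ Zc $ l + J $ Phi k $ d * J $ Phi k $ l =
          (C' * C' + S' * S') * (ds' (axis d 1) * ds' (axis l 1)) + (C' * C' + S' * S') * (s * s) * axis d 1 $ Phi k * axis l 1 $ Phi k"
        by (simp add: JZ Jk algebra_simps)
      finally have 1: "(\<Sum>m\<in>UNIV. D ?y m * J $ m $ d * J $ m $ l) =
        E * (dr' (axis d 1) * dr' (axis l 1) + ds' (axis d 1) * ds' (axis l 1))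
        + E * X0 * axis d 1 $ Phi j * axis l 1 $ Phi j + E * Y0 * axis d 1 $ Phi k * axis l 1 $ Phi k + ?rest d l"
        by (simp add: cs r s distrib_left mult.assoc)
      \<comment> \<open>The change from (\<rho>, z) to the radii is conformal; this is its factor 1
        / M.\<close>
      have "dr' a * dr' b + ds' a * ds' b = (a $ Rho * b $ Rho + a $ Zc * b $ Zc) / M" for a b
      proof -
        have "dr' a * dr' b + ds' a * ds' b = (r * r + s * s) * (a $ Rho * b $ Rho + a $ Zc * b $ Zc) / (M * M)"
          by (simp add: dr'_def ds'_def add_divide_distrib[symmetric]) (simp add: algebra_simps)
        then show ?thesis using M by (simp add: r s M_def[symmetric])
      qed
      then show ?thesis unfolding 1 by simp
    qed
    have al: "exp (2 * \<alpha> \<rho> z) = E / M"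
    proof -
      have "2 * \<alpha> \<rho> z = \<Phi> (X0, Y0) - ln M"
        using ext(5)[OF XY b] pt \<rho> by (simp add: aS_def M_def)
      then show ?thesis using M by (simp add: E_def exp_diff)
    qed
    have um: "u m \<rho> z = w m (X0, Y0) + (if j = m then ln X0 else 0) + (if k = m then ln Y0 else 0)" for m
      using ext(6)[OF XY, of m] pt \<rho> j k by (simp add: soliton_u_potU)
    have uj: "exp (u j \<rho> z) = X0 * (E + X0 * p (X0, Y0))"
      using ext(7)[OF b] um[of j] j jk XY by (simp add: E_def exp_add)
    have uk: "exp (u k \<rho> z) = Y0 * (E + Y0 * q (X0, Y0))"
      using ext(8)[OF b] um[of k] k jk XY by (simp add: E_def exp_add)
    have "gm i x $ d $ l = pullback ?F h x $ d $ l" for d l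
    proof -
      have "pullback ?F h x $ d $ l = E / M * (axis d 1 $ Rho * axis l 1 $ Rho + axis d 1 $ Zc * axis l 1 $ Zc)
        + X0 * (E + X0 * p (X0, Y0)) * axis d 1 $ Phi j * axis l 1 $ Phi j
        + Y0 * (E + Y0 * q (X0, Y0)) * axis d 1 $ Phi k * axis l 1 $ Phi k + ?rest d l"
        unfolding pullback_def J_def[symmetric] h_def rank_two_congruent w1 w2 d Xy
        by (simp add: algebra_simps)
      also have "\<dots> = gm i x $ d $ l"
        using j k jk uj uk al um
        by (cases d; cases l) (auto simp: gm_nth W.coef_def axis_def \<rho>_def[symmetric] z_def[symmetric]
            if_distrib[of "\<lambda>x. x * _"] if_distrib[of "\<lambda>x. _ * x"] cong: if_cong)
      finally show ?thesis ..
    qed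
    then show ?thesis by (simp add: vec_eq_iff)
  qed
  have "corner_chart_axis j k \<subseteq> V" using gap by (auto simp: corner_chart_axis_def V_def X_def Y_def)
  then show ?thesis
    unfolding extends_smoothly_def lorentzian_metric_on_def
    using smooth lor pb by blast
qed

lemma regular_gm: "regular i (rod_end z0 L P) \<sigma> (gm i)"
  unfolding regular_def c_def[symmetric]
  using rod_extends corner_extends no_conical_gm by blast

end


section \<open>Decay of the oscillation in \<open>z\<close>\<close>

text \<open>Only the third \<open>z\<close>-derivatives of the series are bounded by summable terms that decay fast enough
  in \<open>\<rho>\<close>; periodicity in \<open>z\<close> then carries the bound over to the first derivative.
  Bounds at infinity are stated in powers of \<open>root4 s = s\<^sup>-\<^sup>1\<^sup>/\<^sup>4 = \<rho>\<^sup>-\<^sup>1\<^sup>/\<^sup>2\<close>.\<close>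

definition root4 :: "real \<Rightarrow> real"
  where "root4 s = 1 / sqrt (sqrt s)"

lemma root4_pos: "0 < s \<Longrightarrow> 0 < root4 s"
  by (simp add: root4_def)

lemma root4_le: "1 \<le> s \<Longrightarrow> root4 s \<le> 1"
  by (simp add: root4_def)

lemma root4_sq: "0 < s \<Longrightarrow> root4 s * root4 s = 1 / sqrt s"
  by (simp add: root4_def real_sqrt_mult_self)

lemma root4_4:
  assumes "0 < s"
  shows "root4 s ^ 4 = 1 / s"
proof -
  have "root4 s ^ 4 = (root4 s * root4 s) * (root4 s * root4 s)" by (simp add: power4_eq_xxxx)
  then show ?thesis using assms by (simp only: root4_sq) simp
qed

lemma root4_deriv: "0 < s \<Longrightarrow> (root4 has_real_derivative - (root4 s ^ 5) / 4) (at s)"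
proof -
  assume s: "0 < s"
  have "((\<lambda>s. 1 / sqrt (sqrt s)) has_real_derivative - (1 / 4) * ((1 / sqrt s) * (1 / sqrt s)) * (1 / sqrt (sqrt s))) (at s)"
    using s by (auto intro!: derivative_eq_intros simp: divide_simps)
  also have "- (1 / 4) * ((1 / sqrt s) * (1 / sqrt s)) * (1 / sqrt (sqrt s)) = - (root4 s ^ 5) / 4"
    unfolding root4_sq[OF s, symmetric] unfolding root4_def[symmetric] by (simp add: numeral_eq_Suc)
  finally show ?thesis unfolding root4_def[abs_def] .
qed

text \<open>The bound is uniform for \<open>s\<close> \<ge> 1 but only locally uniform in z, since a
  single half-line or array is not periodic. Once the pieces form a periodic function, one period
  determines a global bound.\<close>

definition decay :: "nat \<Rightarrow> (real \<times> real \<Rightarrow> real) \<Rightarrow> bool"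
  where "decay m F \<longleftrightarrow> (\<forall>B. \<exists>C. \<forall>s z. 1 \<le> s \<longrightarrow> \<bar>z\<bar> \<le> B \<longrightarrow> \<bar>F (s, z)\<bar> \<le> C * root4 s ^ m)"

definition zder :: "(real \<times> real \<Rightarrow> real) \<Rightarrow> (real \<times> real \<Rightarrow> real) \<Rightarrow> bool"
  where "zder F G \<longleftrightarrow> (\<forall>s z. 0 < s \<longrightarrow> ((\<lambda>z. F (s, z)) has_real_derivative G (s, z)) (at z))"

definition chain :: "nat \<Rightarrow> (real \<times> real \<Rightarrow> real) \<Rightarrow> bool"
  where "chain m F \<longleftrightarrow> (\<exists>F1 F2 F3. zder F F1 \<and> zder F1 F2 \<and> zder F2 F3 \<and> decay m F3)"

text \<open>\<open>D\<close> is the s-derivative of \<open>F\<close>. The exponents are chosen for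
  their use at infinity: root4^3 = \<rho>^(-3/2) tends to 0, and root4^5 = s^(-5/4) is integrable in
  \<open>s\<close>.\<close>

definition tame :: "(real \<times> real \<Rightarrow> real) \<Rightarrow> (real \<times> real \<Rightarrow> real) \<Rightarrow> bool"
  where "tame F D \<longleftrightarrow> (\<forall>y. 0 < fst y \<longrightarrow> (\<exists>b. has_grad F (D y) b y)) \<and> chain 3 F \<and> chain 5 D"

lemma decay_add: "decay m F \<Longrightarrow> decay m G \<Longrightarrow> decay m (\<lambda>y. F y + G y)"
  unfolding decay_def
proof
  fix B
  assume "\<forall>B. \<exists>C. \<forall>s z. 1 \<le> s \<longrightarrow> \<bar>z\<bar> \<le> B \<longrightarrow> \<bar>F (s, z)\<bar> \<le> C * root4 s ^ m"
    and "\<forall>B. \<exists>C. \<forall>s z. 1 \<le> s \<longrightarrow> \<bar>z\<bar> \<le> B \<longrightarrow> \<bar>G (s, z)\<bar> \<le> C * root4 s ^ m"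
  then obtain C C' where FG: "\<And>s z. 1 \<le> s \<Longrightarrow> \<bar>z\<bar> \<le> B \<Longrightarrow> \<bar>F (s, z)\<bar> \<le> C * root4 s ^ m"
    "\<And>s z. 1 \<le> s \<Longrightarrow> \<bar>z\<bar> \<le> B \<Longrightarrow> \<bar>G (s, z)\<bar> \<le> C' * root4 s ^ m" by metis
  have "\<bar>F (s, z) + G (s, z)\<bar> \<le> (C + C') * root4 s ^ m" if "1 \<le> s" "\<bar>z\<bar> \<le> B" for s z
    using add_mono[OF FG[OF that]] abs_triangle_ineq[of "F (s, z)" "G (s, z)"] by (simp add: distrib_right)
  then show "\<exists>C. \<forall>s z. 1 \<le> s \<longrightarrow> \<bar>z\<bar> \<le> B \<longrightarrow> \<bar>F (s, z) + G (s, z)\<bar> \<le> C * root4 s ^ m" by blast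
qed

lemma decay_cmult: "decay m F \<Longrightarrow> decay m (\<lambda>y. a * F y)"
  unfolding decay_def
proof
  fix B
  assume "\<forall>B. \<exists>C. \<forall>s z. 1 \<le> s \<longrightarrow> \<bar>z\<bar> \<le> B \<longrightarrow> \<bar>F (s, z)\<bar> \<le> C * root4 s ^ m"
  then obtain C where "\<And>s z. 1 \<le> s \<Longrightarrow> \<bar>z\<bar> \<le> B \<Longrightarrow> \<bar>F (s, z)\<bar> \<le> C * root4 s ^ m" by metis
  then have "\<bar>a * F (s, z)\<bar> \<le> (\<bar>a\<bar> * C) * root4 s ^ m" if "1 \<le> s" "\<bar>z\<bar> \<le> B" for s z
    using that by (simp add: abs_mult mult.assoc mult_left_mono)
  then show "\<exists>C. \<forall>s z. 1 \<le> s \<longrightarrow> \<bar>z\<bar> \<le> B \<longrightarrow> \<bar>a * F (s, z)\<bar> \<le> C * root4 s ^ m" by blast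
qed

lemma decay_reflect: "decay m F \<Longrightarrow> decay m (\<lambda>y. F (fst y, d + e * snd y))"
  unfolding decay_def
proof
  fix B
  assume "\<forall>B. \<exists>C. \<forall>s z. 1 \<le> s \<longrightarrow> \<bar>z\<bar> \<le> B \<longrightarrow> \<bar>F (s, z)\<bar> \<le> C * root4 s ^ m"
  then obtain C where C: "\<And>s z. 1 \<le> s \<Longrightarrow> \<bar>z\<bar> \<le> \<bar>d\<bar> + \<bar>e\<bar> * B \<Longrightarrow> \<bar>F (s, z)\<bar> \<le> C * root4 s ^ m" by metis
  have "\<bar>d + e * z\<bar> \<le> \<bar>d\<bar> + \<bar>e\<bar> * B" if "\<bar>z\<bar> \<le> B" for z
    using abs_triangle_ineq[of d "e * z"] mult_left_mono[OF that, of "\<bar>e\<bar>"] by (simp add: abs_mult)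
  then show "\<exists>C. \<forall>s z. 1 \<le> s \<longrightarrow> \<bar>z\<bar> \<le> B \<longrightarrow> \<bar>F (fst (s, z), d + e * snd (s, z))\<bar> \<le> C * root4 s ^ m"
    using C by auto
qed

lemma zder_add: "zder F F' \<Longrightarrow> zder G G' \<Longrightarrow> zder (\<lambda>y. F y + G y) (\<lambda>y. F' y + G' y)"
  unfolding zder_def by (auto intro: DERIV_add)

lemma zder_cmult: "zder F F' \<Longrightarrow> zder (\<lambda>y. a * F y) (\<lambda>y. a * F' y)"
  unfolding zder_def by (auto intro: DERIV_cmult)

lemma zder_reflect:
  assumes "zder F F'"
  shows "zder (\<lambda>y. F (fst y, d + e * snd y)) (\<lambda>y. e * F' (fst y, d + e * snd y))"
  unfolding zder_def
proof (intro allI impI)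
  fix s z :: real assume "0 < s"
  then have 1: "((\<lambda>z. F (s, z)) has_real_derivative F' (s, d + e * z)) (at (d + e * z))"
    using assms by (simp add: zder_def)
  have "((\<lambda>z. F (s, d + e * z)) has_real_derivative F' (s, d + e * z) * e) (at z)"
    by (rule DERIV_chain'[where f = "\<lambda>z. d + e * z" and g = "\<lambda>z. F (s, z)", OF _ 1])
      (auto intro!: derivative_eq_intros)
  then show "((\<lambda>z. F (fst (s, z), d + e * snd (s, z))) has_real_derivative e * F' (fst (s, z), d + e * snd (s, z))) (at z)"
    by (simp add: mult.commute)
qed

lemma zder_grad: "(\<And>y. 0 < fst y \<Longrightarrow> has_grad F (D y) (G y) y) \<Longrightarrow> zder F G"
  unfolding zder_def using has_grad_real_derivative2 by (metis fst_conv)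

lemma chainI: "zder F F1 \<Longrightarrow> zder F1 F2 \<Longrightarrow> zder F2 F3 \<Longrightarrow> decay m F3 \<Longrightarrow> chain m F"
  unfolding chain_def by blast

lemma chain_add: "chain m F \<Longrightarrow> chain m G \<Longrightarrow> chain m (\<lambda>y. F y + G y)"
  unfolding chain_def by (blast intro: zder_add decay_add)

lemma chain_cmult: "chain m F \<Longrightarrow> chain m (\<lambda>y. a * F y)"
  unfolding chain_def by (blast intro: zder_cmult decay_cmult)

lemma chain_reflect:
  assumes "chain m F"
  shows "chain m (\<lambda>y. F (fst y, d + e * snd y))"
proof -
  obtain F1 F2 F3 where F: "zder F F1" "zder F1 F2" "zder F2 F3" "decay m F3"
    using assms unfolding chain_def by blast
  show ?thesis
    by (rule chainI[OF zder_reflect[OF F(1)] zder_cmult[OF zder_reflect[OF F(2)]]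
          zder_cmult[OF zder_cmult[OF zder_reflect[OF F(3)]]]])
      (intro decay_cmult decay_reflect F(4))
qed

lemma chain_const: "chain m (\<lambda>_. a)"
proof -
  have "zder (\<lambda>_. b) (\<lambda>_. 0)" for b by (simp add: zder_def)
  moreover have "decay m (\<lambda>_. 0)" by (auto simp: decay_def intro!: exI[of _ 0])
  ultimately show ?thesis unfolding chain_def by blast
qed

lemma tame_add: "tame F D \<Longrightarrow> tame G E \<Longrightarrow> tame (\<lambda>y. F y + G y) (\<lambda>y. D y + E y)"
  unfolding tame_def by (blast intro: has_grad_add chain_add)

lemma tame_cmult: "tame F D \<Longrightarrow> tame (\<lambda>y. a * F y) (\<lambda>y. a * D y)"
  unfolding tame_def by (blast intro: has_grad_cmult chain_cmult)

lemma tame_diff: "tame F D \<Longrightarrow> tame G E \<Longrightarrow> tame (\<lambda>y. F y - G y) (\<lambda>y. D y - E y)"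
  using tame_add[of F D "\<lambda>y. (-1) * G y" "\<lambda>y. (-1) * E y"] tame_cmult[of G E "-1"] by simp

lemma tame_reflect:
  assumes "tame F D"
  shows "tame (\<lambda>y. F (fst y, d + e * snd y)) (\<lambda>y. D (fst y, d + e * snd y))"
proof -
  have "\<exists>b. has_grad (\<lambda>y. F (fst y, d + e * snd y)) (D (fst y, d + e * snd y)) b y" if "0 < fst y" for y
  proof -
    have "0 < fst (fst y, d + e * snd y)" using that by simp
    then obtain b where "has_grad F (D (fst y, d + e * snd y)) b (fst y, d + e * snd y)"
      using assms unfolding tame_def by blast
    then show ?thesis by (blast intro: has_grad_reflect)
  qed
  then show ?thesis using assms chain_reflect unfolding tame_def by blast
qed

lemma tame_const: "tame (\<lambda>_. a) (\<lambda>_. 0)"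
  unfolding tame_def using has_grad_const chain_const by blast

text \<open>The decay of 1 / r is divided evenly: up to a constant 1 / r is at most s^(-1/4) (1 +
  y)^(-1/2). All \<open>m\<close> powers of the first factor are kept for the decay in
  \<open>s\<close>; three powers of the second suffice to sum over y = L, 2 L, ....\<close>

lemma monom_bound:
  assumes s: "1 \<le> s" and y: "0 \<le> y" and x: "\<bar>x\<bar> \<le> B" and m: "3 \<le> m"
  shows "\<bar>monom3 a (a + m) 0 (s, y + x)\<bar> \<le> (2 * (1 + B)) ^ m * root4 s ^ m * (1 / sqrt (1 + y)) ^ 3"
proof -
  define X where "X = y + x"
  define r where "r = pole_dist (s, X)"
  have B: "0 \<le> B" using x by linarith
  have r: "0 < r" "r * r = s + X\<^sup>2" "\<bar>X\<bar> \<le> r"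
    using s by (auto simp: r_def pole_dist_def add_pos_nonneg intro: real_le_rsqrt)
  have ss: "1 \<le> sqrt s" "sqrt s * sqrt s = s" using s by auto
  \<comment> \<open>The inequality between the means: r^2 = s + X^2 dominates sqrt s (1 + |X|) up to
    the factor 2.\<close>
  have "0 \<le> (sqrt s - \<bar>X\<bar>)\<^sup>2" by simp
  then have "2 * (sqrt s * \<bar>X\<bar>) \<le> s + X\<^sup>2" using ss s by (simp add: power2_diff)
  moreover have "sqrt s \<le> s" using ss mult_right_mono[of 1 "sqrt s" "sqrt s"] by simp
  moreover have "0 \<le> X\<^sup>2" "0 \<le> sqrt s * \<bar>X\<bar>" using s by simp_all
  ultimately have 1: "sqrt s * (1 + \<bar>X\<bar>) \<le> 2 * (r * r)" unfolding r(2) distrib_left by linarith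
  have "y \<le> \<bar>X\<bar> + B" unfolding X_def using x by linarith
  then have "1 + y \<le> (1 + B) * (1 + \<bar>X\<bar>)" using mult_nonneg_nonneg[OF B abs_ge_zero[of X]] abs_ge_zero[of X] by (simp add: distrib_left distrib_right)
  then have "sqrt s * (1 + y) \<le> sqrt s * ((1 + B) * (1 + \<bar>X\<bar>))" using s by (intro mult_left_mono) auto
  also have "\<dots> \<le> (1 + B) * (2 * (r * r))" using mult_left_mono[OF 1, of "1 + B"] B by (simp add: ac_simps)
  finally have 2: "sqrt s * (1 + y) \<le> 2 * (1 + B) * (r * r)" by (simp only: ac_simps)
  define t where "t = sqrt (sqrt s) * sqrt (1 + y)"
  have t: "0 < t" "t * t = sqrt s * (1 + y)"
  proof -
    have "t * t = (sqrt (sqrt s) * sqrt (sqrt s)) * (sqrt (1 + y) * sqrt (1 + y))" by (simp add: t_def ac_simps)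
    then show "t * t = sqrt s * (1 + y)" using s y by simp
  qed (use s y in \<open>simp add: t_def\<close>)
  have "t\<^sup>2 \<le> (2 * (1 + B) * r)\<^sup>2"
  proof -
    have "2 * (1 + B) * (r * r) \<le> (2 * (1 + B)) * (2 * (1 + B)) * (r * r)"
      using B r(1) by (intro mult_right_mono) (auto simp: algebra_simps)
    then show ?thesis using 2 t(2) by (simp add: power2_eq_square ac_simps)
  qed
  then have "t \<le> 2 * (1 + B) * r" by (rule power2_le_imp_le) (use B r in simp)
  then have "1 / r \<le> 2 * (1 + B) / t" using r t by (simp add: field_simps)
  also have "\<dots> = 2 * (1 + B) * root4 s * (1 / sqrt (1 + y))" by (simp add: t_def root4_def)
  finally have "(1 / r) ^ m \<le> (2 * (1 + B) * root4 s * (1 / sqrt (1 + y))) ^ m"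
    using r by (intro power_mono) auto
  also have "\<dots> = (2 * (1 + B)) ^ m * root4 s ^ m * (1 / sqrt (1 + y)) ^ m" by (simp only: power_mult_distrib)
  also have "\<dots> \<le> (2 * (1 + B)) ^ m * root4 s ^ m * (1 / sqrt (1 + y)) ^ 3"
    using B y s m root4_pos[of s] by (intro mult_left_mono power_decreasing) auto
  finally have 3: "(1 / r) ^ m \<le> (2 * (1 + B)) ^ m * root4 s ^ m * (1 / sqrt (1 + y)) ^ 3" .
  have "\<bar>monom3 a (a + m) 0 (s, X)\<bar> = (\<bar>X\<bar> / r) ^ a * (1 / r) ^ m"
    using r by (simp add: monom3_def r_def[symmetric] abs_mult power_abs power_add power_divide inverse_eq_divide)
  also have "\<dots> \<le> 1 * (1 / r) ^ m"
    using r by (intro mult_right_mono power_le_one) auto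
  finally show ?thesis using 3 by (simp add: X_def)
qed

lemma decay_monom3: "3 \<le> m \<Longrightarrow> decay m (monom3 a (a + m) 0)"
  unfolding decay_def
proof (intro allI exI impI)
  fix B s z :: real assume "3 \<le> m" "1 \<le> s" "\<bar>z\<bar> \<le> B"
  then show "\<bar>monom3 a (a + m) 0 (s, z)\<bar> \<le> (2 * (1 + B)) ^ m * root4 s ^ m"
    using monom_bound[of s 0 z B m a] by simp
qed

lemma decay_monom_sum:
  assumes L: "L > 0" and m: "3 \<le> m"
  shows "decay m (monom_sum L a (a + m) 0)"
  unfolding decay_def
proof (intro allI exI impI)
  fix B s z :: real assume s: "1 \<le> s" and z: "\<bar>z\<bar> \<le> B"
  define g where "g n = (1 / sqrt (1 + real (Suc n) * L)) ^ 3" for n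
  have g: "summable g"
  proof (rule summable_comparison_test')
    have "summable (\<lambda>n. real n powr (- (3 / 2)))" by (simp add: summable_real_powr_iff)
    then have "summable (\<lambda>n. real (Suc n) powr (- (3 / 2)))" by (rule summable_Suc_iff[THEN iffD2])
    then show "summable (\<lambda>n. L powr (- (3 / 2)) * real (Suc n) powr (- (3 / 2)))" by (rule summable_mult)
    fix n :: nat
    define x where "x = real (Suc n) * L"
    have x: "x > 0" using L by (simp add: x_def)
    have "(1 / sqrt (1 + x)) ^ 3 \<le> (1 / sqrt x) ^ 3"
      using x by (intro power_mono divide_left_mono) auto
    also have "(1 / sqrt x) ^ 3 = x powr (- (3 / 2))"
      using x by (simp add: powr_half_sqrt[symmetric] powr_power powr_minus_divide power_divide)
    finally show "norm (g n) \<le> L powr (- (3 / 2)) * real (Suc n) powr (- (3 / 2))"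
      using x L by (simp add: g_def x_def powr_mult[symmetric] mult.commute)
  qed
  let ?K = "(2 * (1 + B)) ^ m * root4 s ^ m"
  have "norm (\<Sum>n. monom3 a (a + m) 0 (shift L n (s, z))) \<le> (\<Sum>n. ?K * g n)"
  proof (rule norm_suminf_le[OF _ summable_mult[OF g]])
    fix n
    show "norm (monom3 a (a + m) 0 (shift L n (s, z))) \<le> ?K * g n"
      using monom_bound[OF s _ z m, of "real (Suc n) * L" a] L by (simp add: shift_def[OF L] g_def)
  qed
  then show "\<bar>monom_sum L a (a + m) 0 (s, z)\<bar> \<le> ((2 * (1 + B)) ^ m * suminf (\<lambda>n. (1 / sqrt (1 + real (Suc n) * L)) ^ 3)) * root4 s ^ m"
    unfolding monom_sum_def[OF L] suminf_mult[OF g] g_def[symmetric] by (simp add: ac_simps)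
qed

text \<open>By this identity the z-derivative of 1 / (r (r + x)) is - 1 / r^3. The factor r + x,
  which \<open>monom_bound\<close> does not cover, has disappeared after one derivative.\<close>

lemma monom3_011:
  assumes "y \<in> half_dom"
  shows "monom3 1 3 1 y + monom3 0 2 1 y = monom3 0 3 0 y"
proof -
  note p = half_dom_pos(1,2)[OF assms]
  have "monom3 1 3 1 y + monom3 0 2 1 y = inverse (pole_dist y) ^ 3 * ((pole_dist y + snd y) * inverse (pole_dist y + snd y))"
    using p by (simp add: monom3_def power3_eq_cube power2_eq_square algebra_simps)
  then show ?thesis using p by (simp add: monom3_def)
qed

lemma half_dom_upper: "0 < fst y \<Longrightarrow> y \<in> half_dom"
  by (simp add: half_dom_def add_pos_nonneg)

lemma tame_half_line: "tame half_line (\<lambda>y. (1 / 2) * monom3 0 1 1 y)"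
proof -
  note g = has_grad_monom3[OF half_dom_upper]
  have "zder half_line (monom3 0 1 0)" by (rule zder_grad[OF has_grad_half_line[OF half_dom_upper]])
  moreover have "zder (monom3 0 1 0) (\<lambda>y. (-1) * monom3 1 3 0 y)"
    using zder_grad[OF g, of 0 1 0] by (simp add: monom3_d2_def[abs_def] numeral_3_eq_3)
  moreover have "zder (monom3 1 3 0) (\<lambda>y. monom3 0 3 0 y + (-3) * monom3 2 5 0 y)"
    using zder_grad[OF g, of 1 3 0] by (simp add: monom3_d2_def[abs_def] numeral_eq_Suc)
  moreover have "decay 3 (\<lambda>y. monom3 0 3 0 y + (-3) * monom3 2 5 0 y)"
    using decay_monom3[of 3 0] decay_monom3[of 3 2] by (intro decay_add decay_cmult) simp_all
  ultimately have 1: "chain 3 half_line" by (rule chainI[OF _ _ zder_cmult decay_cmult])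
  have "zder (monom3 0 1 1) (\<lambda>y. (-1) * monom3 0 3 0 y)"
  proof (rule zder_grad)
    fix y :: "real \<times> real" assume y: "0 < fst y"
    have e: "(-1) * monom3 0 3 0 y = - monom3 1 3 1 y - monom3 0 2 1 y"
      using monom3_011[OF half_dom_upper[OF y]] by simp
    show "has_grad (monom3 0 1 1) (monom3_d1 0 1 1 y) ((-1) * monom3 0 3 0 y) y"
      unfolding e using g[OF y, of 0 1 1] by (simp add: monom3_d2_def numeral_eq_Suc)
  qed
  moreover have "zder (monom3 0 3 0) (\<lambda>y. (-3) * monom3 1 5 0 y)"
    using zder_grad[OF g, of 0 3 0] by (simp add: monom3_d2_def[abs_def] numeral_eq_Suc)
  moreover have "zder (monom3 1 5 0) (\<lambda>y. monom3 0 5 0 y + (-5) * monom3 2 7 0 y)"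
    using zder_grad[OF g, of 1 5 0] by (simp add: monom3_d2_def[abs_def] numeral_eq_Suc)
  moreover have "decay 5 (\<lambda>y. monom3 0 5 0 y + (-5) * monom3 2 7 0 y)"
    using decay_monom3[of 5 0] decay_monom3[of 5 2] by (intro decay_add decay_cmult) simp_all
  ultimately have 2: "chain 5 (monom3 0 1 1)"
    by (rule chainI[OF _ zder_cmult zder_cmult[OF zder_cmult] decay_cmult[OF decay_cmult]])
  show ?thesis
    unfolding tame_def mult_1_left times_divide_eq_left
    using 1 chain_cmult[OF 2, of "1 / 2"] has_grad_half_line[OF half_dom_upper] by (simp only: mult_1_left times_divide_eq_left) blast
qed

lemma tame_array:
  assumes L: "L > 0"
  shows "tame (array L) (\<lambda>y. (1 / 2) * monom_sum L 0 1 1 y)"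
proof -
  have dom: "y \<in> array_dom L" if "0 < fst y" for y using that by (simp add: array_dom_def[OF L])
  note g = has_grad_monom_sum[OF L _ dom]
  have "zder (array L) (array_d2 L)" by (rule zder_grad[OF has_grad_array[OF L dom]])
  moreover have "zder (array_d2 L) (\<lambda>y. (-1) * monom_sum L 1 3 0 y)"
    using zder_grad[OF has_grad_array_d2[OF L dom]] by simp
  moreover have "zder (monom_sum L 1 3 0) (\<lambda>y. monom_sum L 0 3 0 y + (-3) * monom_sum L 2 5 0 y)"
    using zder_grad[OF g, of 1 3 0] by (simp add: numeral_eq_Suc)
  moreover have "decay 3 (\<lambda>y. monom_sum L 0 3 0 y + (-3) * monom_sum L 2 5 0 y)"
    using decay_monom_sum[OF L, of 3 0] decay_monom_sum[OF L, of 3 2] by (intro decay_add decay_cmult) simp_all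
  ultimately have 1: "chain 3 (array L)" by (rule chainI[OF _ _ zder_cmult decay_cmult])
  have "zder (monom_sum L 0 1 1) (\<lambda>y. (-1) * monom_sum L 0 3 0 y)"
  proof (rule zder_grad)
    fix y :: "real \<times> real" assume y: "0 < fst y"
    have "monom_sum L 0 3 0 y = monom_sum L 1 3 1 y + monom_sum L 0 2 1 y"
      unfolding monom_sum_def[OF L]
      unfolding monom3_011[OF shift_half_dom[OF L dom[OF y]], symmetric]
      by (rule suminf_add[symmetric]) (auto intro!: summable_monom[OF L])
    then have e: "(-1) * monom_sum L 0 3 0 y = - monom_sum L 1 3 1 y - monom_sum L 0 2 1 y" by simp
    show "has_grad (monom_sum L 0 1 1) (- (1 * monom_sum L 0 3 1 y + 1 * monom_sum L 0 2 2 y) / 2) ((-1) * monom_sum L 0 3 0 y) y"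
      unfolding e using g[of 0 1 1 y] y by (simp add: numeral_eq_Suc)
  qed
  moreover have "zder (monom_sum L 0 3 0) (\<lambda>y. (-3) * monom_sum L 1 5 0 y)"
    using zder_grad[OF g, of 0 3 0] by (simp add: numeral_eq_Suc)
  moreover have "zder (monom_sum L 1 5 0) (\<lambda>y. monom_sum L 0 5 0 y + (-5) * monom_sum L 2 7 0 y)"
    using zder_grad[OF g, of 1 5 0] by (simp add: numeral_eq_Suc)
  moreover have "decay 5 (\<lambda>y. monom_sum L 0 5 0 y + (-5) * monom_sum L 2 7 0 y)"
    using decay_monom_sum[OF L, of 5 0] decay_monom_sum[OF L, of 5 2] by (intro decay_add decay_cmult) simp_all
  ultimately have 2: "chain 5 (monom_sum L 0 1 1)"
    by (rule chainI[OF _ zder_cmult zder_cmult[OF zder_cmult] decay_cmult[OF decay_cmult]])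
  show ?thesis
    unfolding tame_def mult_1_left times_divide_eq_left
    using 1 chain_cmult[OF 2, of "1 / 2"] has_grad_array[OF L dom] by (simp only: mult_1_left times_divide_eq_left) blast
qed

lemma periodic_reduce:
  fixes f :: "real \<Rightarrow> real"
  assumes L: "L > 0" and per: "\<And>z. f (z + L) = f z"
  obtains z' where "0 \<le> z'" "z' \<le> L" "f z = f z'"
proof
  define m where "m = \<lfloor>z / L\<rfloor>"
  show "0 \<le> z - m * L" "z - m * L \<le> L"
    using L floor_divide_lower[OF L, of z] floor_divide_upper[OF L, of z] by (simp_all add: m_def algebra_simps)
  show "f z = f (z - m * L)" using periodic_int[of f L "z - m * L" m] per by simp
qed

text \<open>Rolle's theorem gives a zero of the first derivative in every period, and the mean value
  theorem bounds it elsewhere by the second.\<close>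

lemma periodic_deriv_bound:
  fixes f :: "real \<Rightarrow> real"
  assumes L: "L > 0" and per: "\<And>z. f (z + L) = f z"
    and f: "\<And>z. (f has_real_derivative g z) (at z)" and g: "\<And>z. (g has_real_derivative h z) (at z)"
    and h: "\<And>z. \<bar>h z\<bar> \<le> M"
  shows "\<bar>g z\<bar> \<le> L * M"
proof -
  have "\<exists>\<xi>. z < \<xi> \<and> \<xi> < z + L \<and> (f has_real_derivative 0) (at \<xi>)"
    by (rule Rolle) (use L per f in \<open>auto intro: DERIV_isCont continuous_at_imp_continuous_on simp: real_differentiable_def\<close>)
  then obtain \<xi> where \<xi>: "z < \<xi>" "\<xi> < z + L" "g \<xi> = 0" using f DERIV_unique by blast
  obtain w where "g \<xi> - g z = (\<xi> - z) * h w" using MVT2[OF \<xi>(1), of g h] g by blast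
  then have "\<bar>g z\<bar> = \<bar>(\<xi> - z) * h w\<bar>" using \<xi>(3) by (metis abs_minus_cancel diff_0)
  then have "\<bar>g z\<bar> = (\<xi> - z) * \<bar>h w\<bar>" using \<xi> by (simp add: abs_mult)
  also have "\<dots> \<le> L * M" using \<xi> h[of w] L by (intro mult_mono) auto
  finally show ?thesis .
qed

text \<open>Periodicity is inherited by z-derivatives, so the bound on the third one holds for all
  z; two applications of \<open>periodic_deriv_bound\<close> bring it down to the first, with the
  same power of \<open>root4\<close>.\<close>

lemma chain_bound:
  assumes L: "L > 0" and "chain m F" and per: "\<And>s z. 0 < s \<Longrightarrow> F (s, z + L) = F (s, z)"
  obtains G C where "zder F G" and "\<And>s z. 1 \<le> s \<Longrightarrow> \<bar>G (s, z)\<bar> \<le> C * root4 s ^ m"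
proof -
  obtain F1 F2 F3 where z: "zder F F1" "zder F1 F2" "zder F2 F3" and d: "decay m F3"
    using assms(2) unfolding chain_def by blast
  have pd: "G' (s, z + L) = G' (s, z)" if "zder G G'" "\<And>s z. 0 < s \<Longrightarrow> G (s, z + L) = G (s, z)" "0 < s" for G G' s z
  proof -
    have "((\<lambda>z. G (s, z)) has_real_derivative G' (s, z + L)) (at (z + L))" using that by (simp add: zder_def)
    then have "((\<lambda>z. G (s, z + L)) has_real_derivative G' (s, z + L)) (at z)" by (simp add: DERIV_shift)
    moreover have "((\<lambda>z. G (s, z)) has_real_derivative G' (s, z)) (at z)" using that by (simp add: zder_def)
    ultimately show ?thesis using that by (simp add: DERIV_unique)
  qed
  have p1: "F1 (s, z + L) = F1 (s, z)" if "0 < s" for s z using pd[OF z(1) per that] by blast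
  have p2: "F2 (s, z + L) = F2 (s, z)" if "0 < s" for s z using pd[OF z(2) p1 that] by blast
  have p3: "F3 (s, z + L) = F3 (s, z)" if "0 < s" for s z using pd[OF z(3) p2 that] by blast
  obtain C where C: "\<And>s z. 1 \<le> s \<Longrightarrow> \<bar>z\<bar> \<le> L \<Longrightarrow> \<bar>F3 (s, z)\<bar> \<le> C * root4 s ^ m"
    using d unfolding decay_def by metis
  have "\<bar>F1 (s, z)\<bar> \<le> (L * (L * C)) * root4 s ^ m" if s: "1 \<le> s" for s z
  proof -
    have s0: "0 < s" using s by simp
    have 3: "\<bar>F3 (s, z)\<bar> \<le> C * root4 s ^ m" for z
      using periodic_reduce[OF L, of "\<lambda>z. F3 (s, z)" z] p3[OF s0] C[OF s] by (metis abs_of_nonneg)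
    have 2: "\<bar>F2 (s, z)\<bar> \<le> L * (C * root4 s ^ m)" for z
      by (rule periodic_deriv_bound[OF L, of "\<lambda>z. F1 (s, z)" "\<lambda>z. F2 (s, z)" "\<lambda>z. F3 (s, z)"])
        (use z s0 p1 3 in \<open>auto simp: zder_def\<close>)
    have "\<bar>F1 (s, z)\<bar> \<le> L * (L * (C * root4 s ^ m))"
      by (rule periodic_deriv_bound[OF L, of "\<lambda>z. F (s, z)" "\<lambda>z. F1 (s, z)" "\<lambda>z. F2 (s, z)"])
        (use z s0 per 2 in \<open>auto simp: zder_def\<close>)
    then show ?thesis by (simp add: mult.assoc)
  qed
  then show ?thesis using that[OF z(1)] by blast
qed

text \<open>The derivative of \<open>root4\<close> is - root4^5 / 4, so g + 4 C root4 is
  nonincreasing and g - 4 C root4 is nondecreasing. This bounds the oscillation of \<open>g\<close>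
  beyond s, which gives both the limit and the rate.\<close>

lemma integrable_deriv_limit:
  fixes g :: "real \<Rightarrow> real"
  assumes d: "\<And>s. 1 \<le> s \<Longrightarrow> (g has_real_derivative h s) (at s)"
    and h: "\<And>s. 1 \<le> s \<Longrightarrow> \<bar>h s\<bar> \<le> C * root4 s ^ 5"
  obtains l where "\<And>s. 1 \<le> s \<Longrightarrow> \<bar>g s - l\<bar> \<le> 4 * C * root4 s"
proof -
  have C0: "0 \<le> C" using h[of 1] by (simp add: root4_def)
  have diff: "\<bar>g t - g s\<bar> \<le> 4 * C * root4 s" if "1 \<le> s" "s \<le> t" for s t
  proof -
    have der: "((\<lambda>s. g s + b * root4 s) has_real_derivative h x - b * root4 x ^ 5 / 4) (at x)" if "s \<le> x" for b x
      using DERIV_add[OF d DERIV_cmult[OF root4_deriv, of _ b]] that \<open>1 \<le> s\<close> by simp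
    have "g t + (4 * C) * root4 t \<le> g s + (4 * C) * root4 s"
    proof (rule DERIV_nonpos_imp_nonincreasing[OF that(2)])
      fix x assume x: "s \<le> x" "x \<le> t"
      have "h x - (4 * C) * root4 x ^ 5 / 4 \<le> 0" using h[of x] x that by (simp add: abs_le_iff)
      then show "\<exists>y. ((\<lambda>s. g s + (4 * C) * root4 s) has_real_derivative y) (at x) \<and> y \<le> 0"
        using der[OF x(1)] by blast
    qed
    moreover have "g s + (- 4 * C) * root4 s \<le> g t + (- 4 * C) * root4 t"
    proof (rule DERIV_nonneg_imp_nondecreasing[OF that(2)])
      fix x assume x: "s \<le> x" "x \<le> t"
      have "0 \<le> h x - (- 4 * C) * root4 x ^ 5 / 4" using h[of x] x that by (simp add: abs_le_iff)
      then show "\<exists>y. ((\<lambda>s. g s + (- 4 * C) * root4 s) has_real_derivative y) (at x) \<and> 0 \<le> y"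
        using der[OF x(1)] by blast
    qed
    moreover have "0 \<le> 4 * C * root4 t" using C0 that root4_pos[of t] by simp
    ultimately show ?thesis by (simp add: abs_le_iff)
  qed
  have r0: "(\<lambda>n. root4 (real (Suc n))) \<longlonglongrightarrow> 0" unfolding root4_def by real_asymp
  have "Cauchy (\<lambda>n. g (real (Suc n)))"
    unfolding Cauchy_iff real_norm_def
  proof (intro allI impI)
    fix e :: real assume e: "0 < e"
    have "(\<lambda>n. 4 * C * root4 (real (Suc n))) \<longlonglongrightarrow> 4 * C * 0" by (intro tendsto_mult tendsto_const r0)
    then have "\<forall>\<^sub>F n in sequentially. 4 * C * root4 (real (Suc n)) < e / 2" using e by (intro order_tendstoD(2)) auto
    then obtain k where k: "4 * C * root4 (real (Suc k)) < e / 2" by (auto simp: eventually_sequentially)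
    have "\<bar>g (real (Suc m)) - g (real (Suc n))\<bar> < e" if "k \<le> m" "k \<le> n" for m n
      using diff[of "real (Suc k)" "real (Suc m)"] diff[of "real (Suc k)" "real (Suc n)"] that k by simp
    then show "\<exists>M. \<forall>m\<ge>M. \<forall>n\<ge>M. \<bar>g (real (Suc m)) - g (real (Suc n))\<bar> < e" by blast
  qed
  then obtain l where l: "(\<lambda>n. g (real (Suc n))) \<longlonglongrightarrow> l" using Cauchy_convergent convergent_def by blast
  have "\<bar>g s - l\<bar> \<le> 4 * C * root4 s" if s: "1 \<le> s" for s
  proof -
    have "(\<lambda>n. \<bar>g (real (Suc n)) - g s\<bar>) \<longlonglongrightarrow> \<bar>l - g s\<bar>" by (intro tendsto_intros l)
    then have "\<bar>l - g s\<bar> \<le> 4 * C * root4 s"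
    proof (rule tendsto_upperbound)
      show "\<forall>\<^sub>F n in sequentially. \<bar>g (real (Suc n)) - g s\<bar> \<le> 4 * C * root4 s"
        using eventually_ge_at_top[of "nat \<lceil>s\<rceil>"] by eventually_elim (rule diff[OF s], linarith)
    qed simp
    then show ?thesis by (simp add: abs_minus_commute)
  qed
  then show ?thesis by (rule that)
qed

lemma uniform_limit_exp:
  fixes F :: "real \<Rightarrow> 'a \<Rightarrow> real"
  assumes "\<And>\<rho> x. 1 \<le> \<rho> \<Longrightarrow> \<bar>F \<rho> x - l\<bar> \<le> e \<rho>" and "(e \<longlongrightarrow> 0) at_top"
  shows "uniform_limit UNIV (\<lambda>\<rho> x. exp (F \<rho> x)) (\<lambda>_. exp l) at_top"
proof (rule uniform_limitI)
  fix d :: real assume d: "0 < d"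
  have "((\<lambda>\<rho>. exp l * (exp (e \<rho>) - 1)) \<longlongrightarrow> exp l * (exp 0 - 1)) at_top" by (intro tendsto_intros assms)
  then have "\<forall>\<^sub>F \<rho> in at_top. exp l * (exp (e \<rho>) - 1) < d" using d by (intro order_tendstoD(2)) auto
  then show "\<forall>\<^sub>F \<rho> in at_top. \<forall>x\<in>UNIV. dist (exp (F \<rho> x)) (exp l) < d"
    using eventually_ge_at_top[of 1]
  proof eventually_elim
    fix \<rho> :: real assume \<rho>: "exp l * (exp (e \<rho>) - 1) < d" "1 \<le> \<rho>"
    show "\<forall>x\<in>UNIV. dist (exp (F \<rho> x)) (exp l) < d"
    proof
      fix x
      define t where "t = F \<rho> x - l"
      have t: "\<bar>t\<bar> \<le> e \<rho>" using assms(1)[OF \<rho>(2)] by (simp add: t_def)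
      have "1 + \<bar>t\<bar> \<le> exp \<bar>t\<bar>" "1 + t \<le> exp t" using exp_ge_add_one_self by blast+
      then have "\<bar>exp t - 1\<bar> \<le> exp \<bar>t\<bar> - 1"
      proof (cases "t \<ge> 0")
        case False
        then have "\<bar>exp t - 1\<bar> = 1 - exp t" "\<bar>t\<bar> = - t" by simp_all
        then show ?thesis using \<open>1 + \<bar>t\<bar> \<le> exp \<bar>t\<bar>\<close> \<open>1 + t \<le> exp t\<close> by linarith
      qed simp
      also have "\<dots> \<le> exp (e \<rho>) - 1" using t by simp
      finally have "exp l * \<bar>exp t - 1\<bar> \<le> exp l * (exp (e \<rho>) - 1)" by (intro mult_left_mono) auto
      moreover have "dist (exp (F \<rho> x)) (exp l) = exp l * \<bar>exp t - 1\<bar>"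
      proof -
        have "exp (F \<rho> x) = exp l * exp t" by (simp add: t_def exp_diff)
        then have "exp (F \<rho> x) - exp l = exp l * (exp t - 1)" by (simp add: algebra_simps)
        then show ?thesis by (simp add: dist_real_def abs_mult)
      qed
      ultimately show "dist (exp (F \<rho> x)) (exp l) < d" using \<rho>(1) by linarith
    qed
  qed
qed

section \<open>Asymptotics of the potentials and of \<alpha>, and the Kasner exponents\<close>

context soliton_array
begin

lemma tame_rodW:
  obtains D where "tame (rodW k) D"
proof -
  note h = tame_reflect[OF tame_half_line]
  have "\<exists>D. tame pairs D"
    unfolding pairs_def[abs_def]
    by (rule exI) (rule tame_diff[OF tame_array[OF L] tame_reflect[OF tame_array[OF L]]])
  then obtain E where E: "tame pairs E" by blast
  show ?thesis
    by (rule that, unfold rodW_def[abs_def] rodU_def rod_pairs_def)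
      (rule tame_add[OF tame_diff[OF h h] tame_diff[OF tame_add[OF tame_reflect[OF E] tame_reflect[OF E]] tame_const]])
qed

text \<open>All \<open>N\<close> sample points lie within one period of \<open>z\<close>, so each
  value differs from f z by at most L times the bound on the derivative, and so does their
  average.\<close>

lemma average_bound:
  fixes f :: "real \<Rightarrow> real"
  assumes f: "\<And>z. (f has_real_derivative g z) (at z)" and g: "\<And>z. \<bar>g z\<bar> \<le> M"
    and T: "(\<Sum>j\<in>{0..<N}. f (z - j * gap)) = T"
  shows "\<bar>f z - T / N\<bar> \<le> L * M"
proof -
  have M: "0 \<le> M" using g[of 0] by linarith
  have "\<bar>f z - f (z - j * gap)\<bar> \<le> L * M" if j: "j \<in> {0..<N}" for j
  proof (cases "j = 0")
    case False
    then have "z - j * gap < z" using gap j by simp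
    from MVT2[OF this, of f g] f obtain w where "f z - f (z - j * gap) = j * gap * g w" by auto
    then have "\<bar>f z - f (z - j * gap)\<bar> = j * gap * \<bar>g w\<bar>" using gap j by (simp add: abs_mult)
    also have "\<dots> \<le> (N * gap) * M" using g[of w] gap j N by (intro mult_mono) auto
    finally show ?thesis by (simp only: N_gap)
  qed (use L M in simp)
  then have "\<bar>\<Sum>j\<in>{0..<N}. f z - f (z - j * gap)\<bar> \<le> (\<Sum>j\<in>{0..<N}. L * M)"
    by (intro order_trans[OF sum_abs] sum_mono) blast
  moreover have "(\<Sum>j\<in>{0..<N}. f z - f (z - j * gap)) = N * f z - T" using N T by (simp add: sum_subtractf)
  ultimately have "\<bar>N * f z - T\<bar> \<le> N * (L * M)" using N by simp
  moreover have "N * f z - T = N * (f z - T / N)" using N by (simp add: field_simps)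
  ultimately have "N * \<bar>f z - T / N\<bar> \<le> N * (L * M)" using N by (simp add: abs_mult)
  then show ?thesis using N by simp
qed

lemma rodW_shift: "rodW j (s, z) = rodW 0 (s, z - j * gap)"
  using rodW_translate[of 0 j s "z - j * gap"] by simp

text \<open>The potentials of the \<open>N\<close> rods of a period, each with its periodic
  translates, are shifts of \<open>rodW 0\<close> by multiples of \<open>gap\<close>, and
  \<open>sum_rodW\<close> gives their sum. So the average of \<open>rodW 0\<close> over these shifts
  is explicit, and the same holds for its s-derivative; \<open>average_bound\<close> controls the
  deviation.\<close>

lemma rodW_asymptotics:
  obtains D E C where "\<And>y. 0 < fst y \<Longrightarrow> has_grad (rodW 0) (D y) (E y) y"
    and "\<And>s z. 1 \<le> s \<Longrightarrow> \<bar>E (s, z)\<bar> \<le> C * root4 s ^ 3"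
    and "\<And>s z. 1 \<le> s \<Longrightarrow> \<bar>rodW 0 (s, z) - (ln s - 2 * ln (2 * L)) / N\<bar> \<le> C * root4 s ^ 3"
    and "\<And>s z. 1 \<le> s \<Longrightarrow> \<bar>D (s, z) - 1 / s / N\<bar> \<le> C * root4 s ^ 5"
proof -
  obtain D where D: "tame (rodW 0) D" by (rule tame_rodW)
  have D1: "((\<lambda>s. rodW 0 (s, z)) has_real_derivative D (s, z)) (at s)" if "0 < s" for s z
    using D that has_grad_real_derivative1 unfolding tame_def by (metis fst_conv)
  have per: "rodW 0 (s, z + L) = rodW 0 (s, z)" if "0 < s" for s z
    using rodW_translate[of "- N" N s z] rodW_period[OF that, of "- N" z] N_gap by simp
  have sum: "(\<Sum>j\<in>{0..<N}. rodW 0 (s, z - j * gap)) = ln s - 2 * ln (2 * L)" if "0 < s" for s z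
    using sum_rodW[OF that, where K = "N - 1" and z = z] unfolding window_eq rodW_shift[of _ s z] .
  have sumD: "(\<Sum>j\<in>{0..<N}. D (s, z - j * gap)) = 1 / s" if "0 < s" for s z
  proof -
    have "((\<lambda>s. \<Sum>j\<in>{0..<N}. rodW 0 (s, z - j * gap)) has_real_derivative (\<Sum>j\<in>{0..<N}. D (s, z - j * gap))) (at s)"
      by (intro DERIV_sum D1 that)
    moreover have "((\<lambda>s. \<Sum>j\<in>{0..<N}. rodW 0 (s, z - j * gap)) has_real_derivative 1 / s) (at s)"
      by (rule has_field_derivative_transform_within_open[where S = "{0<..}" and f = "\<lambda>s. ln s - 2 * ln (2 * L)"])
        (use that in \<open>auto simp: sum intro!: derivative_eq_intros\<close>)
    ultimately show ?thesis by (rule DERIV_unique)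
  qed
  have perD: "D (s, z + L) = D (s, z)" if "0 < s" for s z
  proof -
    have "((\<lambda>s. rodW 0 (s, z)) has_real_derivative D (s, z + L)) (at s)"
      by (rule has_field_derivative_transform_within_open[where S = "{0<..}", OF D1[OF that, of "z + L"]])
        (use that per in auto)
    then show ?thesis using D1[OF that] by (rule DERIV_unique)
  qed
  obtain E C1 where E: "zder (rodW 0) E" "\<And>s z. 1 \<le> s \<Longrightarrow> \<bar>E (s, z)\<bar> \<le> C1 * root4 s ^ 3"
    using chain_bound[OF L _ per, of 3] D unfolding tame_def by metis
  obtain E' C2 where E': "zder D E'" "\<And>s z. 1 \<le> s \<Longrightarrow> \<bar>E' (s, z)\<bar> \<le> C2 * root4 s ^ 5"
    using chain_bound[OF L _ perD, of 5] D unfolding tame_def by metis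
  define C where "C = max C1 (max (L * C1) (L * C2))"
  have C: "a * root4 s ^ m \<le> C * root4 s ^ m" if "a \<in> {C1, L * C1, L * C2}" "1 \<le> s" for a s m
    using that root4_pos[of s] by (intro mult_right_mono) (auto simp: C_def)
  show ?thesis
  proof
    fix y :: "real \<times> real" assume y: "0 < fst y"
    then obtain b where b: "has_grad (rodW 0) (D y) b y" using D unfolding tame_def by blast
    obtain s z where sz: "y = (s, z)" by fastforce
    have "b = E y"
      unfolding sz by (rule DERIV_unique[OF has_grad_real_derivative2[OF b[unfolded sz]]])
        (use E(1) y sz in \<open>simp add: zder_def\<close>)
    then show "has_grad (rodW 0) (D y) (E y) y" using b by simp
  next
    fix s z :: real assume s: "1 \<le> s"
    then have s0: "0 < s" by simp
    show "\<bar>E (s, z)\<bar> \<le> C * root4 s ^ 3" using E(2)[OF s] C[of C1 s 3] s by (force intro: order_trans)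
    have "\<bar>rodW 0 (s, z) - (ln s - 2 * ln (2 * L)) / N\<bar> \<le> L * (C1 * root4 s ^ 3)"
      by (rule average_bound[of "\<lambda>z. rodW 0 (s, z)" "\<lambda>z. E (s, z)"])
        (use E s s0 sum in \<open>auto simp: zder_def\<close>)
    then show "\<bar>rodW 0 (s, z) - (ln s - 2 * ln (2 * L)) / N\<bar> \<le> C * root4 s ^ 3"
      using C[of "L * C1" s 3] s by (simp add: mult.assoc)
    have "\<bar>D (s, z) - 1 / s / N\<bar> \<le> L * (C2 * root4 s ^ 5)"
      by (rule average_bound[of "\<lambda>z. D (s, z)" "\<lambda>z. E' (s, z)"])
        (use E' s s0 sumD in \<open>auto simp: zder_def\<close>)
    then show "\<bar>D (s, z) - 1 / s / N\<bar> \<le> C * root4 s ^ 5"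
      using C[of "L * C2" s 5] s by (simp add: mult.assoc)
  qed
qed

definition share :: "'n \<Rightarrow> real"
  where "share i = count_list P i / N"

lemma share: "0 \<le> share i" "share i \<le> 1" "(\<Sum>i\<in>UNIV. share i) = 1"
proof -
  show "0 \<le> share i" "share i \<le> 1" using N count_le_length[of P i] by (simp_all add: share_def N_def divide_le_eq_1)
  have "(\<Sum>i\<in>UNIV. count_list P i) = length P" using sum_count_set[of P UNIV] by simp
  then have "(\<Sum>i\<in>UNIV. real (count_list P i)) = N" unfolding N_def of_nat_sum[symmetric] by simp
  then show "(\<Sum>i\<in>UNIV. share i) = 1" using N by (simp add: share_def sum_divide_distrib[symmetric])
qed

lemma sum_if_share: "(\<Sum>j\<in>{0..<N}. if \<sigma> j = i then x / N else 0) = share i * x"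
proof -
  have "(\<Sum>j\<in>{0..<N}. if \<sigma> j = i then x / N else 0) = (\<Sum>j\<in>{0..<N}. x / N * (if \<sigma> j = i then 1 else 0))"
    by (rule sum.cong) auto
  also have "\<dots> = x / N * count_list P i" by (simp only: count_eq sum_distrib_left)
  finally show ?thesis by (simp add: share_def)
qed

lemma sum_if_bound:
  fixes f :: "int \<Rightarrow> real" and x M :: real
  assumes "\<And>j. \<bar>f j - x / N\<bar> \<le> M"
  shows "\<bar>(\<Sum>j\<in>{0..<N}. if \<sigma> j = i then f j else 0) - share i * x\<bar> \<le> N * M"
proof -
  have M: "0 \<le> M" using assms[of 0] by linarith
  have "(\<Sum>j\<in>{0..<N}. if \<sigma> j = i then f j else 0) - share i * x = (\<Sum>j\<in>{0..<N}. if \<sigma> j = i then f j - x / N else 0)"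
    unfolding sum_if_share[symmetric] sum_subtractf[symmetric] by (rule sum.cong) auto
  also have "\<bar>\<dots>\<bar> \<le> (\<Sum>j\<in>{0..<N}. M)" using assms M by (intro order_trans[OF sum_abs] sum_mono) auto
  finally show ?thesis using N by simp
qed

lemma U_asymptotics:
  obtains C k where "\<And>i s z. 1 \<le> s \<Longrightarrow> \<bar>U i (s, z) - (share i * ln s + k i)\<bar> \<le> C * root4 s ^ 3"
    and "\<And>i s z. 1 \<le> s \<Longrightarrow> \<bar>pdir1 (U i) (s, z) - share i / s\<bar> \<le> C * root4 s ^ 5"
    and "\<And>i s z. 1 \<le> s \<Longrightarrow> \<bar>pdir2 (U i) (s, z)\<bar> \<le> C * root4 s ^ 3"
proof -
  obtain D E C where g: "\<And>y. 0 < fst y \<Longrightarrow> has_grad (rodW 0) (D y) (E y) y"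
    and E: "\<And>s z. 1 \<le> s \<Longrightarrow> \<bar>E (s, z)\<bar> \<le> C * root4 s ^ 3"
    and W: "\<And>s z. 1 \<le> s \<Longrightarrow> \<bar>rodW 0 (s, z) - (ln s - 2 * ln (2 * L)) / N\<bar> \<le> C * root4 s ^ 3"
    and D: "\<And>s z. 1 \<le> s \<Longrightarrow> \<bar>D (s, z) - 1 / s / N\<bar> \<le> C * root4 s ^ 5"
    by (rule rodW_asymptotics) (rule that)
  have U: "U i (s, z) = (\<Sum>j\<in>{0..<N}. if \<sigma> j = i then rodW 0 (s, z - j * gap) else 0) + \<kappa> i" if "0 < s" for i s z
    using potU_window[OF that, of \<kappa> i z, where K = "N - 1"] unfolding window_eq rodW_shift[of _ s z] .
  have d1: "pdir1 (U i) (s, z) = (\<Sum>j\<in>{0..<N}. if \<sigma> j = i then D (s, z - j * gap) else 0)" if "0 < s" for i s z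
  proof (rule DERIV_unique)
    show "((\<lambda>s. U i (s, z)) has_real_derivative pdir1 (U i) (s, z)) (at s)"
      using has_grad_real_derivative1[OF has_grad_U[of "(s, z)" i]] that by simp
    have "((\<lambda>s. if \<sigma> j = i then rodW 0 (s, z - j * gap) else 0) has_real_derivative (if \<sigma> j = i then D (s, z - j * gap) else 0)) (at s)" for j
      using has_grad_real_derivative1[OF g[of "(s, z - j * gap)"]] that by simp
    then have "((\<lambda>s. (\<Sum>j\<in>{0..<N}. if \<sigma> j = i then rodW 0 (s, z - j * gap) else 0) + \<kappa> i) has_real_derivative
        (\<Sum>j\<in>{0..<N}. if \<sigma> j = i then D (s, z - j * gap) else 0) + 0) (at s)"
      by (intro DERIV_add DERIV_sum DERIV_const)
    then show "((\<lambda>s. U i (s, z)) has_real_derivative (\<Sum>j\<in>{0..<N}. if \<sigma> j = i then D (s, z - j * gap) else 0)) (at s)"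
      unfolding add_0_right
      by (rule has_field_derivative_transform_within_open[where S = "{0<..}"]) (use that in \<open>auto simp: U\<close>)
  qed
  have d2: "pdir2 (U i) (s, z) = (\<Sum>j\<in>{0..<N}. if \<sigma> j = i then E (s, z - j * gap) else 0)" if "0 < s" for i s z
  proof (rule DERIV_unique)
    show "((\<lambda>z. U i (s, z)) has_real_derivative pdir2 (U i) (s, z)) (at z)"
      using has_grad_real_derivative2[OF has_grad_U[of "(s, z)" i]] that by simp
    have "((\<lambda>z. rodW 0 (s, z - j * gap)) has_real_derivative E (s, z - j * gap)) (at z)" for j :: int
      using DERIV_shift[of "\<lambda>z. rodW 0 (s, z)" "E (s, z - j * gap)" z "- (j * gap)"]
        has_grad_real_derivative2[OF g[of "(s, z - j * gap)"]] that by simp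
    then have "((\<lambda>z. if \<sigma> j = i then rodW 0 (s, z - j * gap) else 0) has_real_derivative (if \<sigma> j = i then E (s, z - j * gap) else 0)) (at z)" for j
      by simp
    then have "((\<lambda>z. (\<Sum>j\<in>{0..<N}. if \<sigma> j = i then rodW 0 (s, z - j * gap) else 0) + \<kappa> i) has_real_derivative
        (\<Sum>j\<in>{0..<N}. if \<sigma> j = i then E (s, z - j * gap) else 0) + 0) (at z)"
      by (intro DERIV_add DERIV_sum DERIV_const)
    then show "((\<lambda>z. U i (s, z)) has_real_derivative (\<Sum>j\<in>{0..<N}. if \<sigma> j = i then E (s, z - j * gap) else 0)) (at z)"
      by (simp add: U[OF that])
  qed
  show ?thesis
  proof
    fix i and s z :: real assume s: "1 \<le> s"
    then have s0: "0 < s" by simp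
    show "\<bar>U i (s, z) - (share i * ln s + (\<kappa> i - share i * (2 * ln (2 * L))))\<bar> \<le> (N * C) * root4 s ^ 3"
      using sum_if_bound[of "\<lambda>j. rodW 0 (s, z - j * gap)", OF W[OF s], of i] by (simp add: U[OF s0] algebra_simps)
    show "\<bar>pdir1 (U i) (s, z) - share i / s\<bar> \<le> (N * C) * root4 s ^ 5"
      using sum_if_bound[of "\<lambda>j. D (s, z - j * gap)", OF D[OF s], of i] by (simp add: d1[OF s0] mult.assoc)
    show "\<bar>pdir2 (U i) (s, z)\<bar> \<le> (N * C) * root4 s ^ 3"
      using sum_if_bound[of "\<lambda>j. E (s, z - j * gap)" 0 "C * root4 s ^ 3" i] E[OF s] by (simp add: d2[OF s0] mult.assoc)
  qed
qed

text \<open>Inserting pdir1 U = \<open>share\<close> / s and pdir2 U = 0 into \<open>A1\<close>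
  gives \<open>kasner_a\<close> / (2 s), that is, \<alpha> grows like \<open>kasner_a\<close> times
  ln \<rho>.\<close>

definition kasner_a :: real
  where "kasner_a = ((\<Sum>i\<in>UNIV. (share i)\<^sup>2) - 1) / 2"

lemma kasner_a: "0 < kasner_a + 1"
proof -
  have "0 \<le> (\<Sum>i\<in>UNIV. (share i)\<^sup>2)" by (intro sum_nonneg) simp
  then show ?thesis by (simp add: kasner_a_def field_simps)
qed

lemma aS_asymptotics:
  obtains C l where "\<And>s z. 1 \<le> s \<Longrightarrow> \<bar>aS (s, z) - (kasner_a / 2 * ln s + l)\<bar> \<le> C * root4 s"
proof -
  obtain C k where U: "\<And>i s z. 1 \<le> s \<Longrightarrow> \<bar>U i (s, z) - (share i * ln s + k i)\<bar> \<le> C * root4 s ^ 3"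
    and D: "\<And>i s z. 1 \<le> s \<Longrightarrow> \<bar>pdir1 (U i) (s, z) - share i / s\<bar> \<le> C * root4 s ^ 5"
    and E: "\<And>i s z. 1 \<le> s \<Longrightarrow> \<bar>pdir2 (U i) (s, z)\<bar> \<le> C * root4 s ^ 3"
    by (rule U_asymptotics) (rule that)
  have C: "0 \<le> C" using E[of 1] by (force simp: root4_def intro: order_trans[OF abs_ge_zero])
  define n where "n = real CARD('n)"
  have A1: "\<bar>A1 (s, z) - kasner_a / (2 * s)\<bar> \<le> (n * (8 * C + 5 * C\<^sup>2)) * root4 s ^ 5" if s: "1 \<le> s" for s z
  proof -
    have s0: "0 < s" using s by simp
    define e where "e = root4 s"
    \<comment> \<open>The relation e^4 s = 1 absorbs the factor \<open>s\<close> of the quadratic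
      terms: s d^2 is of order s e^10 = e^6, hence bounded by e^5.\<close>
    have e: "0 < e" "e \<le> 1" "e ^ 4 * s = 1" using root4_pos[OF s0] root4_le[OF s] root4_4[OF s0] s0 by (auto simp: e_def)
    have "\<bar>4 * s * (pdir1 (U i) (s, z))\<^sup>2 - (pdir2 (U i) (s, z))\<^sup>2 - 4 * (share i)\<^sup>2 / s\<bar> \<le> (8 * C + 5 * C\<^sup>2) * e ^ 5" for i
    proof -
      define d where "d = pdir1 (U i) (s, z) - share i / s"
      define v where "v = pdir2 (U i) (s, z)"
      have d: "\<bar>d\<bar> \<le> C * e ^ 5" and v: "\<bar>v\<bar> \<le> C * e ^ 3" using D[OF s] E[OF s] by (auto simp: d_def v_def e_def)
      have "4 * s * (pdir1 (U i) (s, z))\<^sup>2 - v\<^sup>2 - 4 * (share i)\<^sup>2 / s = 8 * share i * d + 4 * (s * d\<^sup>2) - v\<^sup>2"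
        using s0 by (simp add: d_def field_simps power2_eq_square)
      moreover have "\<bar>8 * share i * d\<bar> \<le> 8 * (C * e ^ 5)"
      proof -
        have "share i * \<bar>d\<bar> \<le> 1 * (C * e ^ 5)" using share(2)[of i] d C e by (intro mult_mono) auto
        then show ?thesis using share(1)[of i] by (simp add: abs_mult)
      qed
      moreover have "s * d\<^sup>2 \<le> C\<^sup>2 * e ^ 5"
      proof -
        have "d\<^sup>2 \<le> (C * e ^ 5)\<^sup>2" using d by (rule power2_le_iff_abs_le[THEN iffD2, rotated]) (use C e in simp)
        then have "s * d\<^sup>2 \<le> s * (C * e ^ 5)\<^sup>2" using s0 by simp
        also have "\<dots> = C\<^sup>2 * ((e ^ 4 * s) * (e * e ^ 5))" by (simp add: power2_eq_square eval_nat_numeral ac_simps)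
        also have "\<dots> \<le> C\<^sup>2 * e ^ 5" using e by (simp add: mult_left_mono mult_left_le_one_le)
        finally show ?thesis .
      qed
      moreover have "v\<^sup>2 \<le> C\<^sup>2 * e ^ 5"
      proof -
        have "v\<^sup>2 \<le> (C * e ^ 3)\<^sup>2" using v by (rule power2_le_iff_abs_le[THEN iffD2, rotated]) (use C e in simp)
        also have "\<dots> = C\<^sup>2 * (e * e ^ 5)" by (simp add: power2_eq_square eval_nat_numeral ac_simps)
        also have "\<dots> \<le> C\<^sup>2 * e ^ 5" using e by (simp add: mult_left_mono mult_left_le_one_le)
        finally show ?thesis .
      qed
      moreover have "0 \<le> s * d\<^sup>2" "0 \<le> v\<^sup>2" using s0 by simp_all
      ultimately have "\<bar>4 * s * (pdir1 (U i) (s, z))\<^sup>2 - v\<^sup>2 - 4 * (share i)\<^sup>2 / s\<bar> \<le> 8 * (C * e ^ 5) + 5 * (C\<^sup>2 * e ^ 5)"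
        unfolding abs_le_iff by linarith
      then show ?thesis unfolding v_def[symmetric] distrib_right by (simp only: mult.assoc)
    qed
    then have "\<bar>\<Sum>i\<in>UNIV. 4 * s * (pdir1 (U i) (s, z))\<^sup>2 - (pdir2 (U i) (s, z))\<^sup>2 - 4 * (share i)\<^sup>2 / s\<bar>
        \<le> (\<Sum>i\<in>(UNIV::'n set). (8 * C + 5 * C\<^sup>2) * e ^ 5)"
      by (intro order_trans[OF sum_abs] sum_mono) blast
    moreover have "(\<Sum>i\<in>UNIV. 4 * s * (pdir1 (U i) (s, z))\<^sup>2 - (pdir2 (U i) (s, z))\<^sup>2 - 4 * (share i)\<^sup>2 / s)
        = 16 * (A1 (s, z) - kasner_a / (2 * s))"
      by (simp add: A1_def kasner_a_def sum_subtractf sum_divide_distrib[symmetric] sum_distrib_left[symmetric]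
          diff_divide_distrib)
    ultimately have "16 * \<bar>A1 (s, z) - kasner_a / (2 * s)\<bar> \<le> n * ((8 * C + 5 * C\<^sup>2) * e ^ 5)"
      by (simp only: n_def abs_mult abs_numeral sum_constant)
    moreover have "x \<le> y" if "16 * x \<le> y" "0 \<le> x" for x y :: real using that by linarith
    ultimately have "\<bar>A1 (s, z) - kasner_a / (2 * s)\<bar> \<le> n * ((8 * C + 5 * C\<^sup>2) * e ^ 5)"
      using abs_ge_zero by blast
    then show ?thesis by (simp only: e_def mult.assoc)
  qed
  have A2: "\<bar>A2 (s, z)\<bar> \<le> (n * ((1 + C) * C)) * root4 s" if s: "1 \<le> s" for s z
  proof -
    have s0: "0 < s" using s by simp
    define e where "e = root4 s"
    have e: "0 < e" "e \<le> 1" "e ^ 4 * s = 1" "e ^ 4 = 1 / s"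
      using root4_pos[OF s0] root4_le[OF s] root4_4[OF s0] s0 by (auto simp: e_def)
    have "\<bar>pdir1 (U i) (s, z) * pdir2 (U i) (s, z)\<bar> \<le> ((1 + C) * e ^ 4) * (C * e ^ 3)" for i
    proof -
      have "\<bar>pdir1 (U i) (s, z)\<bar> \<le> share i / s + C * e ^ 5"
        using D[OF s, of i z] share(1)[of i] s0
          abs_triangle_ineq[of "pdir1 (U i) (s, z) - share i / s" "share i / s"] by (simp add: e_def)
      also have "\<dots> \<le> e ^ 4 + C * e ^ 4"
        using share(2)[of i] C e s0 by (intro add_mono mult_left_mono power_decreasing) (auto simp: divide_right_mono)
      finally have "\<bar>pdir1 (U i) (s, z)\<bar> \<le> (1 + C) * e ^ 4" by (simp add: distrib_right)
      then show ?thesis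
        unfolding abs_mult using E[OF s, of i z] C e by (intro mult_mono) (auto simp: e_def)
    qed
    then have "\<bar>\<Sum>i\<in>UNIV. pdir1 (U i) (s, z) * pdir2 (U i) (s, z)\<bar> \<le> (\<Sum>i\<in>(UNIV::'n set). ((1 + C) * e ^ 4) * (C * e ^ 3))"
      by (intro order_trans[OF sum_abs] sum_mono) blast
    then have "s / 2 * \<bar>\<Sum>i\<in>UNIV. pdir1 (U i) (s, z) * pdir2 (U i) (s, z)\<bar> \<le> s * (n * (((1 + C) * e ^ 4) * (C * e ^ 3)))"
      using s0 by (intro mult_mono) (auto simp: n_def)
    also have "\<dots> = n * ((1 + C) * C) * e ^ 3 * (e ^ 4 * s)" by (simp only: ac_simps)
    also have "\<dots> = n * ((1 + C) * C) * e ^ 3" by (simp only: e(3) mult_1_right)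
    also have "\<dots> \<le> n * ((1 + C) * C) * e"
      using power_decreasing[of 1 3 e] e(1,2) C by (intro mult_left_mono) (simp_all add: n_def)
    finally show ?thesis using s0 by (simp add: A2_def abs_mult e_def)
  qed
  define K where "K = n * (8 * C + 5 * C\<^sup>2)"
  define K' where "K' = n * ((1 + C) * C)"
  \<comment> \<open>The limit is taken along the line z = 0; any other z is compared with it inside
    one period, where \<open>A2\<close> bounds the variation.\<close>
  have "((\<lambda>s. aS (s, 0) - kasner_a / 2 * ln s) has_real_derivative A1 (s, 0) - kasner_a / (2 * s)) (at s)" if "1 \<le> s" for s
  proof -
    have "((\<lambda>s. aS (s, 0) - kasner_a / 2 * ln s) has_real_derivative A1 (s, 0) - kasner_a / 2 * (1 / s)) (at s)"
      using that by (intro DERIV_diff DERIV_cmult DERIV_ln_divide has_grad_real_derivative1[OF has_grad_aS]) simp_all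
    then show ?thesis by simp
  qed
  from integrable_deriv_limit[OF this, of K] A1
  obtain l where l: "\<And>s. 1 \<le> s \<Longrightarrow> \<bar>aS (s, 0) - kasner_a / 2 * ln s - l\<bar> \<le> 4 * K * root4 s"
    unfolding K_def by metis
  have var: "\<bar>aS (s, z) - aS (s, 0)\<bar> \<le> L * K' * root4 s" if s: "1 \<le> s" for s z
  proof -
    have "aS (s, z + L) = aS (s, z)" for z using alpha_period[of "sqrt s"] s by (simp add: aS_def)
    from periodic_reduce[OF L, of "\<lambda>z. aS (s, z)" z, OF this]
    obtain z' where z': "0 \<le> z'" "z' \<le> L" "aS (s, z) = aS (s, z')" by metis
    have K'0: "0 \<le> K' * root4 s" using A2[OF s, of 0] unfolding K'_def by linarith
    show ?thesis
    proof (cases "z' = 0")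
      case True
      then show ?thesis using z' L K'0 by (simp add: mult.assoc)
    next
      case False
      then have "0 < z'" using z' by simp
      from MVT2[OF this, of "\<lambda>z. aS (s, z)" "\<lambda>z. A2 (s, z)"] obtain w
        where "aS (s, z') - aS (s, 0) = (z' - 0) * A2 (s, w)"
        using has_grad_real_derivative2[OF has_grad_aS] s by force
      then have "\<bar>aS (s, z) - aS (s, 0)\<bar> = z' * \<bar>A2 (s, w)\<bar>" using z' by (simp add: abs_mult)
      also have "\<dots> \<le> L * (K' * root4 s)" using z' A2[OF s] L by (intro mult_mono) (auto simp: K'_def)
      finally show ?thesis by (simp add: mult.assoc)
    qed
  qed
  have "\<bar>aS (s, z) - (kasner_a / 2 * ln s + l)\<bar> \<le> (4 * K + L * K') * root4 s" if "1 \<le> s" for s z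
    using l[OF that] var[OF that, of z] by (simp add: distrib_right abs_le_iff)
  then show ?thesis by (rule that)
qed

text \<open>The derivative \<rho>^a matches the growth of e^\<alpha>, so that the coefficient of
  d\<tau>^2 tends to a constant.\<close>

definition kasner_time :: "real \<Rightarrow> real"
  where "kasner_time \<rho> = \<rho> powr (kasner_a + 1) / (kasner_a + 1)"

lemma kasner_time_deriv: "0 < \<rho> \<Longrightarrow> deriv kasner_time \<rho> = \<rho> powr kasner_a"
  unfolding kasner_time_def[abs_def] using kasner_a
  by (intro DERIV_imp_deriv) (auto intro!: derivative_eq_intros)

lemma kasner_time_smooth:
  assumes "0 < \<rho>"
  shows "(deriv ^^ m) kasner_time field_differentiable at \<rho>"
proof -
  have d: "((\<lambda>\<rho>. C * \<rho> powr b) has_real_derivative C * b * \<rho> powr (b - 1)) (at \<rho>)" if "0 < \<rho>" for C b \<rho>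
    using that by (auto intro!: derivative_eq_intros)
  have t: "(f has_real_derivative C * b * \<rho> powr (b - 1)) (at \<rho>)"
    if "\<And>\<rho>. 0 < \<rho> \<Longrightarrow> f \<rho> = C * \<rho> powr b" "0 < \<rho>" for f C b \<rho>
    by (rule has_field_derivative_transform_within_open[OF d[OF that(2), of C b], where S = "{0<..}"]) (use that in auto)
  have "\<exists>C b. \<forall>\<rho>>0. (deriv ^^ m) kasner_time \<rho> = C * \<rho> powr b"
  proof (induction m)
    case 0
    show ?case
      by (intro exI[of _ "1 / (kasner_a + 1)"] exI[of _ "kasner_a + 1"]) (simp add: kasner_time_def)
  next
    case (Suc m)
    then obtain C b where "\<And>\<rho>. 0 < \<rho> \<Longrightarrow> (deriv ^^ m) kasner_time \<rho> = C * \<rho> powr b" by blast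
    from DERIV_imp_deriv[OF t[OF this]] show ?case by auto
  qed
  then obtain C b where "\<And>\<rho>. 0 < \<rho> \<Longrightarrow> (deriv ^^ m) kasner_time \<rho> = C * \<rho> powr b" by blast
  from t[OF this assms] show ?thesis by (auto simp: field_differentiable_def)
qed

lemma kasner_time_at_top: "filterlim kasner_time at_top at_top"
proof -
  have "filterlim (\<lambda>\<rho>. \<rho> powr (kasner_a + 1)) at_top at_top"
    using kasner_a by real_asymp
  then show ?thesis
    unfolding kasner_time_def[abs_def] divide_inverse
    by (intro filterlim_at_top_mult_tendsto_pos[OF tendsto_const _, of "inverse (kasner_a + 1)"])
      (use kasner_a in simp_all)
qed

lemma kasner_time_powr:
  assumes "0 < \<rho>"
  shows "kasner_time \<rho> powr p = exp (p * ((kasner_a + 1) * ln \<rho> - ln (kasner_a + 1)))"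
  using assms kasner_a by (simp add: kasner_time_def powr_def ln_div)

lemma kasner_gm: "kasner_asymptotics i (gm i)"
proof -
  obtain C l where aS: "\<And>s z. 1 \<le> s \<Longrightarrow> \<bar>aS (s, z) - (kasner_a / 2 * ln s + l)\<bar> \<le> C * root4 s"
    by (rule aS_asymptotics) (rule that)
  obtain C' k where U: "\<And>i s z. 1 \<le> s \<Longrightarrow> \<bar>U i (s, z) - (share i * ln s + k i)\<bar> \<le> C' * root4 s ^ 3"
    by (rule U_asymptotics) (rule that)
  let ?b = "kasner_a + 1"
  define p where "p j = share j / ?b" for j
  define p0 where "p0 = kasner_a / ?b"
  have pb: "p j * ?b = share j" "p0 * ?b = kasner_a" for j using kasner_a by (simp_all add: p_def p0_def)
  have r0: "((\<lambda>\<rho>. root4 (\<rho>\<^sup>2)) \<longlongrightarrow> 0) at_top" unfolding root4_def by real_asymp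
  have al: "\<bar>(2 * \<alpha> \<rho> z - 2 * kasner_a * ln \<rho> + x) - (2 * l + x)\<bar> \<le> 2 * C * root4 (\<rho>\<^sup>2)" if "1 \<le> \<rho>" for \<rho> z x
  proof -
    have "1 \<le> \<rho>\<^sup>2" using that by simp
    from aS[OF this, of z] have "\<bar>\<alpha> \<rho> z - (kasner_a * ln \<rho> + l)\<bar> \<le> C * root4 (\<rho>\<^sup>2)"
      using that by (simp add: aS_def ln_realpow)
    then show ?thesis by (simp add: abs_le_iff)
  qed
  have ul: "\<bar>(u j \<rho> z - 2 * share j * ln \<rho> + x) - (k j + x)\<bar> \<le> C' * root4 (\<rho>\<^sup>2) ^ 3" if "1 \<le> \<rho>" for j \<rho> z x
  proof -
    have "1 \<le> \<rho>\<^sup>2" using that by simp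
    from U[OF this, of j z] show ?thesis
      using that by (simp add: soliton_u_potU ln_realpow abs_le_iff)
  qed
  \<comment> \<open>The terms with ln (a + 1) undo the normalization of \<tau>, since \<tau>^(2 p)
    is \<rho>^(2 p (a + 1)) divided by (a + 1)^(2 p).\<close>
  define C0 where "C0 c = (case c of Rho \<Rightarrow> exp (2 * l) | Zc \<Rightarrow> exp (2 * l + 2 * p0 * ln ?b)
     | Phi j \<Rightarrow> exp (k j + 2 * p j * ln ?b))" for c
  have eR: "gm i (with_rho \<rho> x) $ Rho $ Rho / (deriv kasner_time \<rho>)\<^sup>2 = exp (2 * \<alpha> \<rho> (x $ Zc) - 2 * kasner_a * ln \<rho> + 0)"
    if "1 \<le> \<rho>" for \<rho> x
    using that by (simp add: gm_nth W.coef_def with_rho_def kasner_time_deriv powr_def exp_diff exp_double mult.assoc)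
  have eZ: "gm i (with_rho \<rho> x) $ Zc $ Zc / kasner_time \<rho> powr (2 * p0) = exp (2 * \<alpha> \<rho> (x $ Zc) - 2 * kasner_a * ln \<rho> + 2 * p0 * ln ?b)"
    if "1 \<le> \<rho>" for \<rho> x
  proof -
    have "2 * p0 * (?b * ln \<rho> - ln ?b) = 2 * (p0 * ?b) * ln \<rho> - 2 * p0 * ln ?b" by (simp add: algebra_simps)
    then show ?thesis
      using that by (simp only: kasner_time_powr pb) (simp add: gm_nth W.coef_def with_rho_def exp_diff[symmetric] algebra_simps)
  qed
  have eP: "(if j = i then - 1 else 1) * gm i (with_rho \<rho> x) $ Phi j $ Phi j / kasner_time \<rho> powr (2 * p j) =
      exp (u j \<rho> (x $ Zc) - 2 * share j * ln \<rho> + 2 * p j * ln ?b)"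
    if "1 \<le> \<rho>" for \<rho> x j
  proof -
    have "2 * p j * (?b * ln \<rho> - ln ?b) = 2 * (p j * ?b) * ln \<rho> - 2 * p j * ln ?b" by (simp add: algebra_simps)
    then show ?thesis
      using that by (simp only: kasner_time_powr pb) (simp add: gm_nth W.coef_def with_rho_def exp_diff[symmetric] algebra_simps)
  qed
  have ev: "uniform_limit UNIV f h at_top" if "\<And>\<rho> x. 1 \<le> \<rho> \<Longrightarrow> f \<rho> x = g \<rho> x" "uniform_limit UNIV g h at_top"
    for f g :: "real \<Rightarrow> real ^ 'n coord \<Rightarrow> real" and h
    using that(2) by (rule uniform_limit_cong[THEN iffD1, rotated 2])
      (use that(1) in \<open>auto intro: eventually_mono[OF eventually_ge_at_top[of 1]]\<close>)
  have lim: "((\<lambda>\<rho>. 2 * C * root4 (\<rho>\<^sup>2)) \<longlongrightarrow> 0) at_top" "((\<lambda>\<rho>. C' * root4 (\<rho>\<^sup>2) ^ 3) \<longlongrightarrow> 0) at_top"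
    using tendsto_mult[OF tendsto_const r0, of "2 * C"] tendsto_mult[OF tendsto_const tendsto_power[OF r0, of 3], of C'] by simp_all
  have 1: "uniform_limit UNIV (\<lambda>\<rho> x. gm i (with_rho \<rho> x) $ Rho $ Rho / (deriv kasner_time \<rho>)\<^sup>2) (\<lambda>_. C0 Rho) at_top"
    by (rule ev[OF eR]) (use uniform_limit_exp[OF al[where x = 0] lim(1)] in \<open>simp_all add: C0_def\<close>)
  have 2: "uniform_limit UNIV (\<lambda>\<rho> x. gm i (with_rho \<rho> x) $ Zc $ Zc / kasner_time \<rho> powr (2 * p0)) (\<lambda>_. C0 Zc) at_top"
    by (rule ev[OF eZ]) (use uniform_limit_exp[OF al lim(1)] in \<open>simp_all add: C0_def\<close>)
  have 3: "uniform_limit UNIV (\<lambda>\<rho> x. (if j = i then - 1 else 1) * gm i (with_rho \<rho> x) $ Phi j $ Phi j / kasner_time \<rho> powr (2 * p j))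
      (\<lambda>_. C0 (Phi j)) at_top" for j
    by (rule ev[OF eP]) (use uniform_limit_exp[OF ul lim(2)] in \<open>simp_all add: C0_def\<close>)
  have s1: "p0 + (\<Sum>j\<in>UNIV. p j) = 1"
    using kasner_a share(3) by (simp add: p0_def p_def sum_divide_distrib[symmetric] add_divide_distrib[symmetric])
  have s2: "p0\<^sup>2 + (\<Sum>j\<in>UNIV. (p j)\<^sup>2) = 1"
  proof -
    have "p0\<^sup>2 + (\<Sum>j\<in>UNIV. (p j)\<^sup>2) = (kasner_a\<^sup>2 + (\<Sum>j\<in>UNIV. (share j)\<^sup>2)) / ?b\<^sup>2"
      by (simp add: p0_def p_def power_divide sum_divide_distrib add_divide_distrib)
    \<comment> \<open>The definition of \<open>kasner_a\<close> is what makes the numerator the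
      square of a + 1.\<close>
    also have "(\<Sum>j\<in>UNIV. (share j)\<^sup>2) = 2 * kasner_a + 1" by (simp add: kasner_a_def field_simps)
    also have "kasner_a\<^sup>2 + (2 * kasner_a + 1) = ?b\<^sup>2" by (simp add: power2_eq_square algebra_simps)
    finally show ?thesis using kasner_a by simp
  qed
  show ?thesis
    unfolding kasner_asymptotics_def
  proof (intro exI conjI allI impI ballI)
    show "0 < deriv kasner_time \<rho>" if "0 < \<rho>" for \<rho> using kasner_time_deriv[OF that] that by simp
    show "(deriv ^^ m) kasner_time field_differentiable at \<rho>" if "0 < \<rho>" for \<rho> m by (rule kasner_time_smooth[OF that])
    show "0 < C0 c" for c by (cases c) (simp_all add: C0_def)
    show "uniform_limit UNIV (\<lambda>\<rho> x. - gm i (with_rho \<rho> x) $ Phi i $ Phi i / kasner_time \<rho> powr (2 * p i)) (\<lambda>_. C0 (Phi i)) at_top"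
      using 3[of i] by simp
    show "uniform_limit UNIV (\<lambda>\<rho> x. gm i (with_rho \<rho> x) $ Phi j $ Phi j / kasner_time \<rho> powr (2 * p j)) (\<lambda>_. C0 (Phi j)) at_top"
      if "j \<noteq> i" for j using 3[of j] that by simp
    show "gm i x $ k $ l = 0" if "k \<noteq> l" for x k l using that by (simp add: gm_nth)
  qed (rule kasner_time_at_top s1 s2 1 2)+
qed

end

section \<open>Combinatorics of the allowed periods, and conclusion\<close>

lemma rod_structure_alternates:
  assumes P: "\<And>m. m < length P \<Longrightarrow> P ! m \<noteq> P ! (Suc m mod length P)" and l: "P \<noteq> []"
  shows "rod_structure P k \<noteq> rod_structure P (k + 1)"
proof -
  define m where "m = nat (k mod int (length P))"
  have m: "k mod int (length P) = int m" "m < length P" using l by (simp_all add: m_def nat_less_iff)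
  have "(k + 1) mod int (length P) = int (Suc m mod length P)"
    using m(1) by (metis mod_add_left_eq of_nat_Suc of_nat_mod add.commute)
  then show ?thesis using P[OF m(2)] m by (simp add: rod_structure_def)
qed

lemma allowed_period_properties:
  fixes P :: "'n::finite list"
  assumes n: "n \<ge> 2" and e: "bij_betw e {1..n} UNIV" and P: "allowed_period n e P"
  shows "2 \<le> length P" and "set P = UNIV" and "rod_structure P k \<noteq> rod_structure P (k + 1)"
proof -
  have inj: "e a = e b \<longleftrightarrow> a = b" if "a \<in> {1..n}" "b \<in> {1..n}" for a b
    using e that by (auto simp: bij_betw_def inj_on_eq_iff)
  have surj: "UNIV = e ` {1..n}" using e by (simp add: bij_betw_def)
  have "2 \<le> length P \<and> set P = UNIV \<and> (\<forall>m<length P. P ! m \<noteq> P ! (Suc m mod length P))"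
    using P unfolding allowed_period_def
  proof (elim disjE conjE)
    assume P: "P = basic_period n e"
    have "P ! m = e (Suc m)" if "m < n" for m using that by (simp add: P basic_period_def del: upt_Suc)
    moreover have "length P = n" "set P = e ` {1..n}"
      by (simp_all add: P basic_period_def atLeastLessThanSuc_atLeastAtMost del: upt_Suc)
    moreover have "e (Suc m) \<noteq> e (Suc (Suc m mod n))" if "m < n" for m
      using that n inj[of "Suc m" "Suc (Suc m mod n)"] by (cases "Suc m = n") auto
    ultimately show ?thesis using n surj by auto
  next
    assume P: "n = 2" "P = [e 1, e 2, e 1, e 2]"
    then have "{1..n} = {1, 2}" "e 1 \<noteq> e 2" using inj[of 1 2] by auto
    then show ?thesis unfolding surj P(2) by (auto simp: All_less_Suc)
  next
    assume P: "n = 3" "P = [e 1, e 2, e 1, e 3]"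
    then have "{1..n} = {1, 2, 3}" "e 1 \<noteq> e 2" "e 1 \<noteq> e 3" using inj[of 1 2] inj[of 1 3] by auto
    then show ?thesis unfolding surj P(2) by (auto simp: All_less_Suc)
  next
    assume P: "n = 4" "P = [e 1, e 2, e 1, e 3, e 4]"
    then have "{1..n} = {1, 2, 3, 4}" "e 1 \<noteq> e 2" "e 1 \<noteq> e 3" "e 3 \<noteq> e 4" "e 1 \<noteq> e 4"
      using inj[of 1 2] inj[of 1 3] inj[of 1 4] inj[of 3 4] by auto
    then show ?thesis unfolding surj P(2) by (auto simp: All_less_Suc)
  qed
  then show "2 \<le> length P" "set P = UNIV" "rod_structure P k \<noteq> rod_structure P (k + 1)"
    using rod_structure_alternates[of P k] by fastforce+
qed

theorem theorem3:
  fixes n :: nat and e :: "nat \<Rightarrow> 'n::finite" and i :: 'n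
    and L z0 :: real and P :: "'n list" and quot :: bool
    and \<kappa> :: "'n \<Rightarrow> real" and \<alpha> :: "real \<Rightarrow> real \<Rightarrow> real"
  assumes "n \<ge> 2" and "bij_betw e {1..n} UNIV" and "L > 0"
    and "(\<not> quot \<and> P = basic_period n e) \<or> (quot \<and> allowed_period n e P)"
    and "soliton z0 L P \<kappa> \<alpha>"
  shows "let g = wick_rotation i (slice_metric (soliton_u z0 L P \<kappa>) \<alpha>)
    in static_axisymmetric_vacuum i quot L g
    \<and> black_hole i (rod_end z0 L P) (rod_structure P) g
    \<and> regular i (rod_end z0 L P) (rod_structure P) g
    \<and> kasner_asymptotics i g"
proof -
  \<comment> \<open>The basic period is itself an allowed one, so the space-periodic and the
    quotient solitons are treated together; \<open>quot\<close> enters through the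
    identifications.\<close>
  have "allowed_period n e P" using assms(4) by (auto simp: allowed_period_def)
  from allowed_period_properties[OF assms(1,2) this] assms(3,5)
  interpret soliton_array z0 L P \<kappa> \<alpha> by unfold_locales
  show ?thesis
    using vacuum_gm black_hole_gm regular_gm kasner_gm unfolding gm_def Let_def by blast
qed

end
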